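(* Let $\mathcal{P}=\langle \Sigma \mid \mathcal{R}\rangle$ be a semigroup presentation and $w\in\Sigma^+$. Every simple subgroup of the braided diagram group $D_b(\mathcal{P},w)$ (resp. of the planar diagram group $D(\mathcal{P},w)$, of the annular diagram group $D_a(\mathcal{P},w)$) is isomorphic to a subgroup of Thompson's group $V$ (resp. $F$, $T$).
   Context: Thompson's groups. $V$ is the group of right-continuous bijections of $\mathbb{S}^1=[0,1]/(0\sim 1)$ which map dyadic rationals to dyadic rationals, are differentiable except at finitely many dyadic rationals, and which, on each maximal interval of differentiability, are affine with derivative a power of $2$. $T\subset V$ is the subgroup of those which are homeomorphisms of $\mathbb{S}^1$. $F$ is the group of piecewise linear homeomorphisms of $[0,1]$, differentiable except at finitely many dyadic rationals, whose derivatives on intervals of differentiability are powers of $2$ (homeomorphisms orientation-preserving). Semigroup presentations. $\mathcal{P}=\langle\Sigma\mid\mathcal{R}\rangle$ consists of an alphabet $\Sigma$ and a set $\mathcal{R}$ of relations $u=v$ with $u,v\in\Sigma^+$ (non-empty words), with the convention that if $u=v$ belongs to $\mathcal{R}$ then $v=u$ does not (so no relation $u=u$). Braided diagrams. A wire is a copy of $[0,1]$ with bottom $0$ and top $1$. A transistor is a copy of $[0,1]^2$ and a frame is a copy of $\partial[0,1]^2$; both have top, bottom, left and right sides, the top and bottom sides being ordered left-to-right. A braided diagram $\Delta$ over $\mathcal{P}$ is a labelled oriented quotient space obtained from a finite non-empty collection of wires labelled by letters of $\Sigma$, a finite (possibly empty) collection of transistors, and a frame, such that: each endpoint of each wire is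 attached to a transistor or to the frame; the bottom of a wire is attached to the top side of a transistor or to the bottom side of the frame; the top of a wire is attached to the bottom side of a transistor or to the top side of the frame; images of distinct wires are disjoint; for each transistor $T$, if $\mathrm{top}(T)$ (resp. $\mathrm{bot}(T)$) is the word read left-to-right from the labels of wires attached to its top (resp. bottom) side, then $\mathrm{top}(T)=\mathrm{bot}(T)$ or $\mathrm{bot}(T)=\mathrm{top}(T)$ belongs to $\mathcal{R}$; writing $T_1\prec T_2$ when some wire has its bottom on the top side of $T_1$ and its top on the bottom side of $T_2$, the transitive closure of $\prec$ is a strict partial order. Diagrams are considered up to homeomorphisms preserving labels and all left-right and top-bottom orientations of transistors and frame. $\mathrm{top}(\Delta)$ and $\mathrm{bot}(\Delta)$ are the words read along the top and bottom sides of the frame; a $(u,v)$-diagram has $\mathrm{top}(\Delta)=u$, $\mathrm{bot}(\Delta)=v$. If $\mathrm{bot}(\Delta_1)=\mathrm{top}(\Delta_2)$, the concatenation $\Delta_1\circ\Delta_2$ is obtained by gluing $\Delta_2$ below $\Delta_1$ (matching wires in left-to-right order). A dipole is a pair of transistors $T_1\prec T_2$ such that all wires $w_1,\dots,w_n$ attached to the top side of $T_1$ are attached to the bottom side of $T_2$ in the same left-to-right order, no other wire is attached to the bottom side of $T_2$, and $\mathrm{top}(T_2)=\mathrm{bot}(T_1)$. Reducing it means deleting $T_1,T_2,w_1,\dots,w_n$ and joining, in order, the wires on the top side of $T_2$ with those on the bottom side of $T_1$. Two diagrams are equal modulo dipoles if they have the same (unique) dipole-free reduction. $D_b(\mathcal{P},w)$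 is the group of braided $(w,w)$-diagrams modulo dipoles, under concatenation. A diagram is planar if it embeds into the plane preserving the left-to-right and top-bottom orientations of transistors and frame; $D(\mathcal{P},w)$ is the subgroup of $D_b(\mathcal{P},w)$ of planar diagrams. A diagram is annular if it can be drawn in an annulus with pairwise disjoint wires: the top (resp. bottom) side of the frame is replaced with the inner (resp. outer) boundary circle, oriented counterclockwise and with a basepoint disjoint from the wires from which labels are read, and the resulting object embeds in the plane preserving orientations of transistors. $D_a(\mathcal{P},w)$ is the group of annular $(w,w)$-diagrams modulo dipoles, under concatenation (basepoints are matched). *)

theory Defs
  imports "HOL-Algebra.Bij" "HOL-Algebra.Coset" "HOL-Complex_Analysis.Winding_Numbers"
begin

section \<open>Simple groups\<close>

text \<open>
  The library locale \<open>simple_group\<close> demands \<open>order G > 1\<close> with \<open>order G = card (carrier G)\<close>,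
  and \<open>card\<close> is \<open>0\<close> on infinite sets; it therefore excludes infinite simple groups.
\<close>

definition is_simple :: "('g, 'm) monoid_scheme \<Rightarrow> bool" where
  "is_simple G \<longleftrightarrow>
     group G \<and> carrier G \<noteq> {\<one>\<^bsub>G\<^esub>} \<and> (\<forall>H. H \<lhd> G \<longrightarrow> H = carrier G \<or> H = {\<one>\<^bsub>G\<^esub>})"


section \<open>Thompson's groups\<close>

definition dyadic :: "real set" where
  "dyadic = {of_int m / 2 ^ n | m n. True}"

text \<open>
  The circle \<open>[0,1]/(0\<sim>1)\<close> is the unit circle of the complex plane, through \<open>t \<mapsto> exp (2\<pi>it)\<close>.
  Maps of the circle are read in the coordinate \<open>t \<in> \<real>\<close>, which is only defined modulo \<open>1\<close>;
  intervals of \<open>\<real>\<close> are thus lifts of intervals of the circle, including those through the base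
  point.
\<close>

definition circle_pt :: "real \<Rightarrow> complex" where
  "circle_pt t = cis (2 * pi * t)"

definition circle_diff :: "(complex \<Rightarrow> complex) \<Rightarrow> real \<Rightarrow> bool" where
  "circle_diff g t \<longleftrightarrow> (\<lambda>s. g (circle_pt s)) differentiable (at t)"

definition V_maps :: "(complex \<Rightarrow> complex) set" where
  "V_maps = {g \<in> Bij (sphere 0 1).
     (\<forall>t. continuous (at_right t) (\<lambda>s. g (circle_pt s))) \<and>
     (\<forall>t\<in>dyadic. g (circle_pt t) \<in> circle_pt ` dyadic) \<and>
     finite (circle_pt ` {t. \<not> circle_diff g t}) \<and> {t. \<not> circle_diff g t} \<subseteq> dyadic \<and>
     (\<forall>a b. a < b \<and> (\<forall>t\<in>{a<..<b}. circle_diff g t) \<longrightarrow>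
        (\<exists>(k::int) c. \<forall>t\<in>{a<..<b}. g (circle_pt t) = circle_pt (2 powi k * t + c)))}"

definition T_maps :: "(complex \<Rightarrow> complex) set" where
  "T_maps = {g \<in> V_maps. \<exists>g'. homeomorphism (sphere 0 1) (sphere 0 1) g g'}"

definition F_maps :: "(real \<Rightarrow> real) set" where
  "F_maps = {f \<in> Bij {0..1}.
     (\<exists>f'. homeomorphism {0..1} {0..1} f f') \<and> strict_mono_on {0..1} f \<and>
     finite {t\<in>{0..1}. \<not> f differentiable (at t within {0..1})} \<and>
     {t\<in>{0..1}. \<not> f differentiable (at t within {0..1})} \<subseteq> dyadic \<and>
     (\<forall>a b. a < b \<and> {a<..<b} \<subseteq> {t\<in>{0..1}. f differentiable (at t within {0..1})} \<longrightarrow>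
        (\<exists>(k::int) c. \<forall>t\<in>{a<..<b}. f t = 2 powi k * t + c))}"

definition thompson_V :: "(complex \<Rightarrow> complex) monoid" where
  "thompson_V = (BijGroup (sphere 0 1))\<lparr>carrier := V_maps\<rparr>"

definition thompson_T :: "(complex \<Rightarrow> complex) monoid" where
  "thompson_T = (BijGroup (sphere 0 1))\<lparr>carrier := T_maps\<rparr>"

definition thompson_F :: "(real \<Rightarrow> real) monoid" where
  "thompson_F = (BijGroup {0..1})\<lparr>carrier := F_maps\<rparr>"


section \<open>Semigroup presentations and braided diagrams\<close>

definition semigroup_presentation :: "'a set \<Rightarrow> ('a list \<times> 'a list) set \<Rightarrow> bool" where
  "semigroup_presentation \<A> \<R> \<longleftrightarrow>
     \<R> \<subseteq> (lists \<A> - {[]}) \<times> (lists \<A> - {[]}) \<and> (\<forall>u v. (u, v) \<in> \<R> \<longrightarrow> (v, u) \<notin> \<R>)"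

text \<open>
  A braided diagram is determined, up to homeomorphism, by which wire ends are attached to which
  side, and in which left-to-right order. The fields \<open>ttop t\<close>, \<open>tbot t\<close> list the wires attached to
  the top and bottom sides of the transistor \<open>t\<close>, and \<open>ftop\<close>, \<open>fbot\<close> those attached to the top and
  bottom sides of the frame. Hence \<open>ttop\<close> and \<open>fbot\<close> record the bottom ends of the wires, \<open>tbot\<close> and
  \<open>ftop\<close> their top ends. Values of \<open>label\<close> outside \<open>wires\<close> and of \<open>ttop\<close>, \<open>tbot\<close> outside
  \<open>transistors\<close> are irrelevant.
\<close>

record 'a diagram =
  wires :: "nat set"
  label :: "nat \<Rightarrow> 'a"
  transistors :: "nat set"
  ttop :: "nat \<Rightarrow> nat list"
  tbot :: "nat \<Rightarrow> nat list"
  ftop :: "nat list"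
  fbot :: "nat list"

definition word_on :: "'a diagram \<Rightarrow> nat list \<Rightarrow> 'a list" where
  "word_on \<Delta> es = map (label \<Delta>) es"

text \<open>\<open>(t1, t2) \<in> below \<Delta>\<close> is \<open>t1 \<prec> t2\<close>.\<close>

definition below :: "'a diagram \<Rightarrow> (nat \<times> nat) set" where
  "below \<Delta> = {(t1, t2). t1 \<in> transistors \<Delta> \<and> t2 \<in> transistors \<Delta> \<and>
                         set (ttop \<Delta> t1) \<inter> set (tbot \<Delta> t2) \<noteq> {}}"

text \<open>
  The two multiset equations say that every wire has its bottom end, respectively its top end,
  attached at exactly one place.
\<close>

definition braided_diagram :: "'a set \<Rightarrow> ('a list \<times> 'a list) set \<Rightarrow> 'a diagram \<Rightarrow> bool" where
  "braided_diagram \<A> \<R> \<Delta> \<longleftrightarrow>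
     finite (wires \<Delta>) \<and> wires \<Delta> \<noteq> {} \<and> label \<Delta> ` wires \<Delta> \<subseteq> \<A> \<and> finite (transistors \<Delta>) \<and>
     mset (fbot \<Delta>) + (\<Sum>t\<in>transistors \<Delta>. mset (ttop \<Delta> t)) = mset_set (wires \<Delta>) \<and>
     mset (ftop \<Delta>) + (\<Sum>t\<in>transistors \<Delta>. mset (tbot \<Delta> t)) = mset_set (wires \<Delta>) \<and>
     (\<forall>t\<in>transistors \<Delta>. (word_on \<Delta> (ttop \<Delta> t), word_on \<Delta> (tbot \<Delta> t)) \<in> \<R> \<or>
                         (word_on \<Delta> (tbot \<Delta> t), word_on \<Delta> (ttop \<Delta> t)) \<in> \<R>) \<and>
     acyclic (below \<Delta>)"

definition diagrams ::
    "'a set \<Rightarrow> ('a list \<times> 'a list) set \<Rightarrow> 'a list \<Rightarrow> 'a list \<Rightarrow> 'a diagram set" where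
  "diagrams \<A> \<R> u v =
     {\<Delta>. braided_diagram \<A> \<R> \<Delta> \<and> word_on \<Delta> (ftop \<Delta>) = u \<and> word_on \<Delta> (fbot \<Delta>) = v}"

definition diagram_iso :: "'a diagram \<Rightarrow> 'a diagram \<Rightarrow> bool" where
  "diagram_iso \<Delta> \<Delta>' \<longleftrightarrow>
     (\<exists>p q. bij_betw p (wires \<Delta>) (wires \<Delta>') \<and> bij_betw q (transistors \<Delta>) (transistors \<Delta>') \<and>
        (\<forall>e\<in>wires \<Delta>. label \<Delta>' (p e) = label \<Delta> e) \<and>
        (\<forall>t\<in>transistors \<Delta>. ttop \<Delta>' (q t) = map p (ttop \<Delta> t) \<and> tbot \<Delta>' (q t) = map p (tbot \<Delta> t)) \<and>
        ftop \<Delta>' = map p (ftop \<Delta>) \<and> fbot \<Delta>' = map p (fbot \<Delta>))"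

definition trivial_diagram :: "'a list \<Rightarrow> 'a diagram" where
  "trivial_diagram w =
     \<lparr>wires = {..<length w}, label = (\<lambda>i. w ! i), transistors = {},
      ttop = (\<lambda>_. []), tbot = (\<lambda>_. []), ftop = [0..<length w], fbot = [0..<length w]\<rparr>"

text \<open>
  \<open>rename_along es es' f e\<close> is the entry of \<open>es'\<close> at the position of \<open>e\<close> in \<open>es\<close>, and \<open>f e\<close> if \<open>e\<close>
  does not occur in \<open>es\<close>.
\<close>

definition rename_along :: "nat list \<Rightarrow> nat list \<Rightarrow> (nat \<Rightarrow> nat) \<Rightarrow> nat \<Rightarrow> nat" where
  "rename_along es es' f e = (case map_of (zip es es') e of None \<Rightarrow> f e | Some e' \<Rightarrow> e')"

text \<open>
  In \<open>\<Delta>1 \<circ> \<Delta>2\<close> the names coming from \<open>\<Delta>1\<close> are made even and those coming from \<open>\<Delta>2\<close> odd. A wire at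
  the top of the frame of \<open>\<Delta>2\<close> is absorbed into the wire of \<open>\<Delta>1\<close> to which it is glued.
\<close>

definition concat_diagram :: "'a diagram \<Rightarrow> 'a diagram \<Rightarrow> 'a diagram" where
  "concat_diagram \<Delta>1 \<Delta>2 =
     (let l = (\<lambda>i. 2 * i);
          r = rename_along (ftop \<Delta>2) (map l (fbot \<Delta>1)) (\<lambda>i. 2 * i + 1)
      in \<lparr>wires = l ` wires \<Delta>1 \<union> (\<lambda>i. 2 * i + 1) ` (wires \<Delta>2 - set (ftop \<Delta>2)),
          label = (\<lambda>e. if even e then label \<Delta>1 (e div 2) else label \<Delta>2 (e div 2)),
          transistors = l ` transistors \<Delta>1 \<union> (\<lambda>i. 2 * i + 1) ` transistors \<Delta>2,
          ttop = (\<lambda>t. if even t then map l (ttop \<Delta>1 (t div 2)) else map r (ttop \<Delta>2 (t div 2))),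
          tbot = (\<lambda>t. if even t then map l (tbot \<Delta>1 (t div 2)) else map r (tbot \<Delta>2 (t div 2))),
          ftop = map l (ftop \<Delta>1),
          fbot = map r (fbot \<Delta>2)\<rparr>)"


section \<open>Dipoles\<close>

definition dipole :: "'a diagram \<Rightarrow> nat \<Rightarrow> nat \<Rightarrow> bool" where
  "dipole \<Delta> t1 t2 \<longleftrightarrow>
     (t1, t2) \<in> below \<Delta> \<and> ttop \<Delta> t1 = tbot \<Delta> t2 \<and>
     word_on \<Delta> (ttop \<Delta> t2) = word_on \<Delta> (tbot \<Delta> t1)"

text \<open>
  Joining a wire on the top side of \<open>t2\<close> with one on the bottom side of \<open>t1\<close> keeps the name of the
  former, which inherits the bottom end of the latter.
\<close>

definition reduce_dipole :: "'a diagram \<Rightarrow> nat \<Rightarrow> nat \<Rightarrow> 'a diagram" where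
  "reduce_dipole \<Delta> t1 t2 =
     (let r = rename_along (tbot \<Delta> t1) (ttop \<Delta> t2) (\<lambda>e. e)
      in \<Delta>\<lparr>wires := wires \<Delta> - set (ttop \<Delta> t1) - set (tbot \<Delta> t1),
           transistors := transistors \<Delta> - {t1, t2},
           ttop := (\<lambda>t. map r (ttop \<Delta> t)),
           fbot := map r (fbot \<Delta>)\<rparr>)"

definition dipole_step :: "'a diagram \<Rightarrow> 'a diagram \<Rightarrow> bool" where
  "dipole_step \<Delta> \<Delta>' \<longleftrightarrow> (\<exists>t1 t2. dipole \<Delta> t1 t2 \<and> \<Delta>' = reduce_dipole \<Delta> t1 t2)"

definition reduction_of :: "'a diagram \<Rightarrow> 'a diagram \<Rightarrow> bool" where
  "reduction_of \<Delta> \<Gamma> \<longleftrightarrow> dipole_step\<^sup>*\<^sup>* \<Delta> \<Gamma> \<and> (\<forall>t1 t2. \<not> dipole \<Gamma> t1 t2)"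

definition eq_mod_dipoles :: "'a diagram \<Rightarrow> 'a diagram \<Rightarrow> bool" where
  "eq_mod_dipoles \<Delta> \<Delta>' \<longleftrightarrow>
     (\<exists>\<Gamma> \<Gamma>'. reduction_of \<Delta> \<Gamma> \<and> reduction_of \<Delta>' \<Gamma>' \<and> diagram_iso \<Gamma> \<Gamma>')"


section \<open>Planar and annular diagrams\<close>

abbreviation unit_square :: "complex set" where
  "unit_square \<equiv> cbox 0 (Complex 1 1)"

text \<open>
  Abscissa of the \<open>k\<close>-th of \<open>n\<close> attaching points on a side; only their order matters.
\<close>

definition attach_pos :: "nat \<Rightarrow> nat \<Rightarrow> real" where
  "attach_pos n k = real (Suc k) / real (Suc n)"

text \<open>
  A topological embedding of a transistor that preserves its orientation: the image of the
  boundary, run through as bottom, right, top, left side, winds once counterclockwise around the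
  image of the centre.
\<close>

definition oriented_embedding :: "(complex \<Rightarrow> complex) \<Rightarrow> bool" where
  "oriented_embedding h \<longleftrightarrow>
     continuous_on unit_square h \<and> inj_on h unit_square \<and>
     winding_number (h \<circ> rectpath 0 (Complex 1 1)) (h (Complex (1/2) (1/2))) = 1"

text \<open>
  An embedding of the quotient space in the plane: \<open>h t\<close> is the image of the transistor \<open>t\<close>,
  \<open>g e\<close> that of the wire \<open>e\<close> (from its bottom \<open>0\<close> to its top \<open>1\<close>). The frame is embedded in a
  standard way as the boundary of the open set \<open>U\<close>, which contains the rest of the diagram;
  \<open>ptop n k\<close> and \<open>pbot n k\<close> are the \<open>k\<close>-th of \<open>n\<close> attaching points on its top and bottom sides.
\<close>

definition drawing ::
    "complex set \<Rightarrow> (nat \<Rightarrow> nat \<Rightarrow> complex) \<Rightarrow> (nat \<Rightarrow> nat \<Rightarrow> complex) \<Rightarrow> 'a diagram \<Rightarrow>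
     (nat \<Rightarrow> complex \<Rightarrow> complex) \<Rightarrow> (nat \<Rightarrow> real \<Rightarrow> complex) \<Rightarrow> bool" where
  "drawing U ptop pbot \<Delta> h g \<longleftrightarrow>
     (\<forall>t\<in>transistors \<Delta>. oriented_embedding (h t) \<and> h t ` unit_square \<subseteq> U) \<and>
     (\<forall>t\<in>transistors \<Delta>. \<forall>t'\<in>transistors \<Delta>. t \<noteq> t' \<longrightarrow>
        h t ` unit_square \<inter> h t' ` unit_square = {}) \<and>
     (\<forall>e\<in>wires \<Delta>. arc (g e) \<and>
        g e ` {0<..<1} \<subseteq> U - (\<Union>t\<in>transistors \<Delta>. h t ` unit_square)) \<and>
     (\<forall>e\<in>wires \<Delta>. \<forall>e'\<in>wires \<Delta>. e \<noteq> e' \<longrightarrow> path_image (g e) \<inter> path_image (g e') = {}) \<and>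
     (\<forall>t\<in>transistors \<Delta>. \<forall>k<length (ttop \<Delta> t).
        pathstart (g (ttop \<Delta> t ! k)) = h t (Complex (attach_pos (length (ttop \<Delta> t)) k) 1)) \<and>
     (\<forall>t\<in>transistors \<Delta>. \<forall>k<length (tbot \<Delta> t).
        pathfinish (g (tbot \<Delta> t ! k)) = h t (Complex (attach_pos (length (tbot \<Delta> t)) k) 0)) \<and>
     (\<forall>k<length (ftop \<Delta>). pathfinish (g (ftop \<Delta> ! k)) = ptop (length (ftop \<Delta>)) k) \<and>
     (\<forall>k<length (fbot \<Delta>). pathstart (g (fbot \<Delta> ! k)) = pbot (length (fbot \<Delta>)) k)"

definition planar :: "'a diagram \<Rightarrow> bool" where
  "planar \<Delta> \<longleftrightarrow>
     (\<exists>h g. drawing (box 0 (Complex 1 1))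
              (\<lambda>n k. Complex (attach_pos n k) 1) (\<lambda>n k. Complex (attach_pos n k) 0) \<Delta> h g)"

text \<open>
  The annulus has inner radius \<open>1\<close> and outer radius \<open>2\<close>. The basepoints are the points of
  argument \<open>0\<close>, and wires are attached counterclockwise from them.
\<close>

definition annular :: "'a diagram \<Rightarrow> bool" where
  "annular \<Delta> \<longleftrightarrow>
     (\<exists>h g. drawing {z. 1 < norm z \<and> norm z < 2}
              (\<lambda>n k. circle_pt (attach_pos n k)) (\<lambda>n k. 2 * circle_pt (attach_pos n k)) \<Delta> h g)"


section \<open>Diagram groups\<close>

definition dipole_rel ::
    "'a set \<Rightarrow> ('a list \<times> 'a list) set \<Rightarrow> 'a list \<Rightarrow> ('a diagram \<times> 'a diagram) set" where
  "dipole_rel \<A> \<R> w =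
     {(\<Delta>, \<Delta>'). \<Delta> \<in> diagrams \<A> \<R> w w \<and> \<Delta>' \<in> diagrams \<A> \<R> w w \<and> eq_mod_dipoles \<Delta> \<Delta>'}"

definition braided_diagram_group ::
    "'a set \<Rightarrow> ('a list \<times> 'a list) set \<Rightarrow> 'a list \<Rightarrow> 'a diagram set monoid" where
  "braided_diagram_group \<A> \<R> w =
     \<lparr>carrier = diagrams \<A> \<R> w w // dipole_rel \<A> \<R> w,
      monoid.mult = (\<lambda>X Y. \<Union>\<Delta>1\<in>X. \<Union>\<Delta>2\<in>Y. dipole_rel \<A> \<R> w `` {concat_diagram \<Delta>1 \<Delta>2}),
      one = dipole_rel \<A> \<R> w `` {trivial_diagram w}\<rparr>"

definition planar_diagram_group ::
    "'a set \<Rightarrow> ('a list \<times> 'a list) set \<Rightarrow> 'a list \<Rightarrow> 'a diagram set monoid" where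
  "planar_diagram_group \<A> \<R> w = (braided_diagram_group \<A> \<R> w)
     \<lparr>carrier := {X \<in> carrier (braided_diagram_group \<A> \<R> w). \<exists>\<Delta>\<in>X. planar \<Delta>}\<rparr>"

definition annular_diagram_group ::
    "'a set \<Rightarrow> ('a list \<times> 'a list) set \<Rightarrow> 'a list \<Rightarrow> 'a diagram set monoid" where
  "annular_diagram_group \<A> \<R> w = (braided_diagram_group \<A> \<R> w)
     \<lparr>carrier := {X \<in> carrier (braided_diagram_group \<A> \<R> w). \<exists>\<Delta>\<in>X. annular \<Delta>}\<rparr>"

end

theory Submission
  imports Defs
begin

text \<open>
  Replace every wire by a copy of \<open>[0,1)\<close> and let every transistor identify, through dyadic
  subdivisions, the copies on its bottom side with those on its top side. Flowing upwards, a
  \<open>(w,w)\<close>-diagram becomes a piecewise affine bijection of \<open>[0,1)\<close>, that is an element of \<open>V\<close>, which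
  does not change when a dipole is reduced. This action of the diagram group need not be faithful,
  but it is faithful on simple subgroups. Give each transistor a letter, recording its relation and
  the way in which its top side flows to the frame, and a sign, recording the direction in which the
  relation is applied. Counting with signs the descending chains of transistors with a given sequence
  of letters, consecutive ones being distinct and overlapping, yields integers which do not change
  when a dipole is reduced either. On diagrams acting trivially they behave like the coefficients of
  a Magnus expansion: concatenation multiplies the generating series. If a simple group acted
  trivially, then, by induction on their length, these counts would be homomorphisms to the integers
  and vanish. But a non-empty diagram without dipoles always has a non-zero count, at a chain of
  maximal length.

  It remains to see that planar and annular diagrams act by order-preserving maps. In the universal
  cover of the annulus, the trajectory of a point, drawn along the wires and straight across the
  transistors, is an arc separating the strip into a left and a right half, which are told apart by
  a winding number. Since transistors preserve the orientation, a trajectory starting on the right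
  of it stays there.
\<close>

section \<open>Simple groups and homomorphisms to the integers\<close>

text \<open>Two transistors with a common address lie on one trajectory, hence are comparable. This
  is why consecutive letters must overlap: their order is then forced, it survives the deletion of a
  dipole, and in a concatenation a transistor of the lower factor precedes every overlapping one of
  the upper factor. Consecutive letters must differ because the two members of a dipole share their
  letter and have opposite signs: the lower one has the successors of the upper one and the upper
  one itself, and this exception has to be hidden for the two to cancel. Placing a letter in the top
  side of the frame moves the letters of the lower factor by the flow of the upper one, so the
  product formula is stated for an upper factor acting trivially. The subdivisions halve towards 1
  instead of being uniform: lengths are then powers of 2 for any number of pieces, and that number
  can be read off the maps, so that equal letters force equal lists of wires. A word along a longest
  chain is of the required kind just because the diagram has no dipole: two equal consecutive
  letters would bound a dipole or leave room for a longer chain.\<close>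

lemma simple_no_int_hom:
  fixes G (structure) and \<nu> :: "'g \<Rightarrow> int"
  assumes G: "is_simple G"
    and \<nu>: "\<And>x y. x \<in> carrier G \<Longrightarrow> y \<in> carrier G \<Longrightarrow> \<nu> (x \<otimes>\<^bsub>G\<^esub> y) = \<nu> x + \<nu> y"
    and x: "x \<in> carrier G"
  shows "\<nu> x = 0"
proof (rule ccontr)
  assume nz: "\<nu> x \<noteq> 0"
  interpret group G using G by (simp add: is_simple_def)
  have one: "\<nu> \<one> = 0" using \<nu>[of \<one> \<one>] by simp
  have inv: "\<nu> (inv y) = - \<nu> y" if "y \<in> carrier G" for y
    using \<nu>[of y "inv y"] that one by simp
  \<comment> \<open>The preimage of the multiples of \<open>2 * \<nu> x\<close>. It misses
    \<open>x\<close> and contains \<open>x \<otimes> x\<close>, where \<open>\<nu>\<close> does not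
    vanish, so it is a proper non-trivial normal subgroup. The kernel of \<open>\<nu>\<close> alone
    would only embed the group in the integers.\<close>
  define H where "H = {y \<in> carrier G. 2 * \<nu> x dvd \<nu> y}"
  have "subgroup H G"
    by (rule subgroupI) (auto simp: H_def \<nu> inv one)
  moreover have "y \<otimes> h \<otimes> inv y \<in> H" if "y \<in> carrier G" "h \<in> H" for y h
    using that by (auto simp: H_def \<nu> inv)
  ultimately have "H \<lhd> G" by (simp add: normal_inv_iff)
  then have "H = carrier G \<or> H = {\<one>}" using G by (auto simp: is_simple_def)
  moreover have "x \<notin> H"
    using nz by (auto simp: H_def dest: zdvd_imp_le dvd_imp_le_int)
  moreover have "x \<otimes> x \<in> H" using x by (auto simp: H_def \<nu>)
  ultimately have "x \<otimes> x = \<one>" using x by auto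
  then show False using \<nu>[OF x x] nz one by simp
qed

lemma simple_hom_trivial_or_inj:
  assumes G: "is_simple G" and K: "group K" and h: "h \<in> hom G K"
  shows "(\<forall>x\<in>carrier G. h x = \<one>\<^bsub>K\<^esub>) \<or> inj_on h (carrier G)"
proof -
  have "group G" using G by (simp add: is_simple_def)
  then interpret group_hom G K h
    using K h by (simp add: group_hom_def group_hom_axioms_def)
  have "kernel G K h = carrier G \<or> kernel G K h = {\<one>\<^bsub>G\<^esub>}"
    using G normal_kernel by (auto simp: is_simple_def)
  then show ?thesis
    using inj_on_one_iff by (auto simp: kernel_def)
qed

section \<open>Signed chain counts in labelled posets\<close>

context
  fixes T :: "'t set" and R :: "('t \<times> 't) set" and l :: "'t \<Rightarrow> 'x" and \<epsilon> :: "'t \<Rightarrow> int"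
begin

text \<open>Counts the continuations of a chain beyond \<open>t\<close>. The sign of
  \<open>t\<close> itself is left out, so that elements with the same relevant successors get equal
  values.\<close>

fun chain_sum :: "'x list \<Rightarrow> 't \<Rightarrow> int" where
  "chain_sum [] t = 1"
| "chain_sum (x # xs) t = (\<Sum>s \<in> {s \<in> T. (t, s) \<in> R \<and> l s = x}. \<epsilon> s * chain_sum xs s)"

fun chain_coeff :: "'x list \<Rightarrow> int" where
  "chain_coeff [] = 1"
| "chain_coeff (x # xs) = (\<Sum>s \<in> {s \<in> T. l s = x}. \<epsilon> s * chain_sum xs s)"

end

lemma sum_restrict_image:
  assumes "finite T'" "inj_on \<rho> T'" "\<And>t. t \<in> T' \<Longrightarrow> P' t \<longleftrightarrow> P (\<rho> t)"
    "\<And>t. t \<in> T' \<Longrightarrow> P' t \<Longrightarrow> f' t = f (\<rho> t)"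
  shows "(\<Sum>s \<in> {s \<in> \<rho> ` T'. P s}. f s) = (\<Sum>t \<in> {t \<in> T'. P' t}. f' t)"
proof -
  have "{s \<in> \<rho> ` T'. P s} = \<rho> ` {t \<in> T'. P' t}" using assms(3) by auto
  moreover have "inj_on \<rho> {t \<in> T'. P' t}" using assms(2) by (rule inj_on_subset) auto
  ultimately show ?thesis using assms(4) by (simp add: sum.reindex)
qed

lemma sum_restrict_Un:
  assumes "finite A" "finite B" "A \<inter> B = {}"
  shows "(\<Sum>s \<in> {s \<in> A \<union> B. P s}. f s) = (\<Sum>s \<in> {s \<in> A. P s}. f s) + (\<Sum>s \<in> {s \<in> B. P s}. (f s :: int))"
proof -
  have "{s \<in> A \<union> B. P s} = {s \<in> A. P s} \<union> {s \<in> B. P s}" by auto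
  then show ?thesis
    using assms by (simp add: sum.union_disjoint disjoint_iff)
qed

context
  fixes ov :: "'x \<Rightarrow> 'x \<Rightarrow> bool"
begin

definition walk :: "'x list \<Rightarrow> bool" where
  "walk xs \<longleftrightarrow> successively (\<lambda>x y. x \<noteq> y \<and> ov x y) xs"

lemma walk_Cons: "walk (x # y # xs) \<longleftrightarrow> x \<noteq> y \<and> ov x y \<and> walk (y # xs)"
  by (auto simp: walk_def)

lemma walk_take: "walk xs \<Longrightarrow> walk (take k xs)"
  unfolding walk_def by (metis append_take_drop_id successively_append_iff)

text \<open>
  \<open>D\<close> is a set of elements whose contributions cancel; it is empty for an isomorphism, and a
  dipole for a reduction.
\<close>

lemma chain_transfer:
  assumes fin: "finite T'" "finite D" and T: "T = \<rho> ` T' \<union> D" "\<rho> ` T' \<inter> D = {}" and inj: "inj_on \<rho> T'"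
    and l: "\<And>t. t \<in> T' \<Longrightarrow> l' t = l (\<rho> t)" and e: "\<And>t. t \<in> T' \<Longrightarrow> \<epsilon>' t = \<epsilon> (\<rho> t)"
    and R: "\<And>t s. t \<in> T' \<Longrightarrow> s \<in> T' \<Longrightarrow> ov (l' t) (l' s) \<Longrightarrow> l' t \<noteq> l' s \<Longrightarrow>
              (t, s) \<in> R' \<longleftrightarrow> (\<rho> t, \<rho> s) \<in> R"
    and D: "\<And>t x xs. t \<in> T' \<Longrightarrow> walk (l' t # x # xs) \<Longrightarrow>
              (\<Sum>s \<in> {s \<in> D. (\<rho> t, s) \<in> R \<and> l s = x}. \<epsilon> s * chain_sum T R l \<epsilon> xs s) = 0"
    and D0: "\<And>x xs. walk (x # xs) \<Longrightarrow>
              (\<Sum>s \<in> {s \<in> D. l s = x}. \<epsilon> s * chain_sum T R l \<epsilon> xs s) = 0"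
    and w: "walk xs"
  shows "chain_coeff T' R' l' \<epsilon>' xs = chain_coeff T R l \<epsilon> xs"
proof -
  \<comment> \<open>The label of \<open>t\<close> is kept in front of the word: agreement of the
    orders and cancellation over \<open>D\<close> are available only between distinct overlapping
    labels.\<close>
  have cs: "chain_sum T' R' l' \<epsilon>' xs t = chain_sum T R l \<epsilon> xs (\<rho> t)"
    if "t \<in> T'" "walk (l' t # xs)" for t xs
    using that
  proof (induction xs arbitrary: t)
    case (Cons x xs)
    have w: "l' t \<noteq> x" "ov (l' t) x" "walk (x # xs)" using Cons.prems(2) by (auto simp: walk_Cons)
    have "chain_sum T R l \<epsilon> (x # xs) (\<rho> t)
        = (\<Sum>s \<in> {s \<in> \<rho> ` T' \<union> D. (\<rho> t, s) \<in> R \<and> l s = x}. \<epsilon> s * chain_sum T R l \<epsilon> xs s)"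
      by (simp add: T(1))
    also have "\<dots> = (\<Sum>s \<in> {s \<in> \<rho> ` T'. (\<rho> t, s) \<in> R \<and> l s = x}. \<epsilon> s * chain_sum T R l \<epsilon> xs s)"
      using fin T(2) D[OF Cons.prems] by (subst sum_restrict_Un) auto
    also have "\<dots> = (\<Sum>s \<in> {s \<in> T'. (t, s) \<in> R' \<and> l' s = x}. \<epsilon>' s * chain_sum T' R' l' \<epsilon>' xs s)"
    proof (rule sum_restrict_image[OF fin(1) inj])
      fix s assume s: "s \<in> T'"
      show "(t, s) \<in> R' \<and> l' s = x \<longleftrightarrow> (\<rho> t, \<rho> s) \<in> R \<and> l (\<rho> s) = x"
        using R[OF Cons.prems(1) s] w l[OF s] by auto
      assume "(t, s) \<in> R' \<and> l' s = x"
      then show "\<epsilon>' s * chain_sum T' R' l' \<epsilon>' xs s = \<epsilon> (\<rho> s) * chain_sum T R l \<epsilon> xs (\<rho> s)"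
        using Cons.IH[OF s] w e[OF s] by simp
    qed
    finally show ?case by simp
  qed simp
  show ?thesis
  proof (cases xs)
    case (Cons x ys)
    have "chain_coeff T R l \<epsilon> xs
        = (\<Sum>s \<in> {s \<in> \<rho> ` T' \<union> D. l s = x}. \<epsilon> s * chain_sum T R l \<epsilon> ys s)"
      by (simp add: T(1) Cons)
    also have "\<dots> = (\<Sum>s \<in> {s \<in> \<rho> ` T'. l s = x}. \<epsilon> s * chain_sum T R l \<epsilon> ys s)"
      using fin T(2) D0 w Cons by (subst sum_restrict_Un) auto
    also have "\<dots> = (\<Sum>s \<in> {s \<in> T'. l' s = x}. \<epsilon>' s * chain_sum T' R' l' \<epsilon>' ys s)"
      using w Cons by (intro sum_restrict_image[OF fin(1) inj]) (auto simp: l e cs)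
    finally show ?thesis using Cons by simp
  qed simp
qed

text \<open>No element of \<open>T2\<close> lies above one of \<open>T1\<close>, so a chain runs
  through \<open>T2\<close> first and then through \<open>T1\<close>. Conversely an element of
  \<open>T2\<close> lies below every element of \<open>T1\<close> that it overlaps, so any chain of
  \<open>T2\<close> can be prolonged by any chain of \<open>T1\<close> as soon as the joint word is
  a walk. The sum runs over the place of the passage.\<close>

lemma chain_coeff_union:
  assumes fin: "finite T1" "finite T2" and T: "T = \<rho>1 ` T1 \<union> \<rho>2 ` T2" "\<rho>1 ` T1 \<inter> \<rho>2 ` T2 = {}"
    and inj: "inj_on \<rho>1 T1" "inj_on \<rho>2 T2"
    and l: "\<And>t. t \<in> T1 \<Longrightarrow> l1 t = l (\<rho>1 t)" "\<And>t. t \<in> T2 \<Longrightarrow> l2 t = l (\<rho>2 t)"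
    and e: "\<And>t. t \<in> T1 \<Longrightarrow> \<epsilon>1 t = \<epsilon> (\<rho>1 t)" "\<And>t. t \<in> T2 \<Longrightarrow> \<epsilon>2 t = \<epsilon> (\<rho>2 t)"
    and R1: "\<And>t s. t \<in> T1 \<Longrightarrow> s \<in> T1 \<Longrightarrow> ov (l1 t) (l1 s) \<Longrightarrow> l1 t \<noteq> l1 s \<Longrightarrow>
              (t, s) \<in> R1 \<longleftrightarrow> (\<rho>1 t, \<rho>1 s) \<in> R"
    and R2: "\<And>t s. t \<in> T2 \<Longrightarrow> s \<in> T2 \<Longrightarrow> ov (l2 t) (l2 s) \<Longrightarrow> l2 t \<noteq> l2 s \<Longrightarrow>
              (t, s) \<in> R2 \<longleftrightarrow> (\<rho>2 t, \<rho>2 s) \<in> R"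
    and R12: "\<And>t s. t \<in> T1 \<Longrightarrow> s \<in> T2 \<Longrightarrow> (\<rho>1 t, \<rho>2 s) \<notin> R"
    and R21: "\<And>t s. t \<in> T2 \<Longrightarrow> s \<in> T1 \<Longrightarrow> ov (l2 t) (l1 s) \<Longrightarrow> (\<rho>2 t, \<rho>1 s) \<in> R"
    and w: "walk xs"
  shows "chain_coeff T R l \<epsilon> xs =
    (\<Sum>k\<le>length xs. chain_coeff T2 R2 l2 \<epsilon>2 (take k xs) * chain_coeff T1 R1 l1 \<epsilon>1 (drop k xs))"
proof -
  let ?c1 = "chain_coeff T1 R1 l1 \<epsilon>1" and ?s1 = "chain_sum T1 R1 l1 \<epsilon>1"
  let ?c2 = "chain_coeff T2 R2 l2 \<epsilon>2" and ?s2 = "chain_sum T2 R2 l2 \<epsilon>2"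
  let ?s = "chain_sum T R l \<epsilon>"
  have split: "(\<Sum>s \<in> {s \<in> T. P s}. f s) = (\<Sum>s \<in> {s \<in> \<rho>2 ` T2. P s}. f s) + (\<Sum>s \<in> {s \<in> \<rho>1 ` T1. P s}. f s)"
    for P and f :: "_ \<Rightarrow> int"
    using fin T by (subst T(1), subst sum_restrict_Un) auto
  have cs1: "?s xs (\<rho>1 t) = ?s1 xs t" if "t \<in> T1" "walk (l1 t # xs)" for t xs
    using that
  proof (induction xs arbitrary: t)
    case (Cons x xs)
    have w: "l1 t \<noteq> x" "ov (l1 t) x" "walk (x # xs)" using Cons.prems(2) by (auto simp: walk_Cons)
    have "{s \<in> \<rho>2 ` T2. (\<rho>1 t, s) \<in> R \<and> l s = x} = {}"
      using R12 Cons.prems by auto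
    then have "?s (x # xs) (\<rho>1 t) = (\<Sum>s \<in> {s \<in> \<rho>1 ` T1. (\<rho>1 t, s) \<in> R \<and> l s = x}. \<epsilon> s * ?s xs s)"
      by (simp only: chain_sum.simps split) simp
    also have "\<dots> = (\<Sum>s \<in> {s \<in> T1. (t, s) \<in> R1 \<and> l1 s = x}. \<epsilon>1 s * ?s1 xs s)"
      by (rule sum_restrict_image[OF fin(1) inj(1)]) (use R1 Cons w l e in auto)
    finally show ?case by simp
  qed simp
  have part1: "(\<Sum>s \<in> {s \<in> \<rho>1 ` T1. l s = x}. \<epsilon> s * ?s xs s) = ?c1 (x # xs)"
    if "walk (x # xs)" for x xs
    unfolding chain_coeff.simps
    by (rule sum_restrict_image[OF fin(1) inj(1)]) (use that cs1 l e in auto)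
  have cs2: "?s xs (\<rho>2 t) = (\<Sum>k\<le>length xs. ?s2 (take k xs) t * ?c1 (drop k xs))"
    if "t \<in> T2" "walk (l2 t # xs)" for t xs
    using that
  proof (induction xs arbitrary: t)
    case (Cons x xs)
    have w: "l2 t \<noteq> x" "ov (l2 t) x" "walk (x # xs)" using Cons.prems(2) by (auto simp: walk_Cons)
    \<comment> \<open>On passing to \<open>T1\<close> the condition of lying above \<open>t\<close>
      is automatic by overlap, which turns the remaining sum into a full coefficient of
      \<open>T1\<close>.\<close>
    have "{s \<in> \<rho>1 ` T1. (\<rho>2 t, s) \<in> R \<and> l s = x} = {s \<in> \<rho>1 ` T1. l s = x}"
      using R21 Cons.prems w l by auto
    then have "?s (x # xs) (\<rho>2 t) =
        (\<Sum>s \<in> {s \<in> \<rho>2 ` T2. (\<rho>2 t, s) \<in> R \<and> l s = x}. \<epsilon> s * ?s xs s) + ?c1 (x # xs)"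
      using part1[OF w(3)] by (simp only: chain_sum.simps split)
    also have "(\<Sum>s \<in> {s \<in> \<rho>2 ` T2. (\<rho>2 t, s) \<in> R \<and> l s = x}. \<epsilon> s * ?s xs s)
       = (\<Sum>s \<in> {s \<in> T2. (t, s) \<in> R2 \<and> l2 s = x}.
            \<epsilon>2 s * (\<Sum>k\<le>length xs. ?s2 (take k xs) s * ?c1 (drop k xs)))"
      by (rule sum_restrict_image[OF fin(2) inj(2)]) (use R2 Cons w l e in auto)
    \<comment> \<open>These are the passages after the first letter or later; the passage before it
      is the separate summand \<open>?c1 (x # xs)\<close>.\<close>
    also have "\<dots> = (\<Sum>k\<le>length xs. ?s2 (take (Suc k) (x # xs)) t * ?c1 (drop (Suc k) (x # xs)))"
      by (simp add: sum_distrib_left sum_distrib_right mult.assoc) (rule sum.swap)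
    also have "\<dots> + ?c1 (x # xs) = (\<Sum>k\<le>length (x # xs). ?s2 (take k (x # xs)) t * ?c1 (drop k (x # xs)))"
      by (simp only: length_Cons sum.atMost_Suc_shift) simp
    finally show ?case .
  qed simp
  show ?thesis
  proof (cases xs)
    case (Cons x ys)
    have "chain_coeff T R l \<epsilon> xs =
        (\<Sum>s \<in> {s \<in> \<rho>2 ` T2. l s = x}. \<epsilon> s * ?s ys s) + ?c1 xs"
      using part1[of x ys] w by (simp only: chain_coeff.simps split Cons)
    also have "(\<Sum>s \<in> {s \<in> \<rho>2 ` T2. l s = x}. \<epsilon> s * ?s ys s)
       = (\<Sum>s \<in> {s \<in> T2. l2 s = x}.
            \<epsilon>2 s * (\<Sum>k\<le>length ys. ?s2 (take k ys) s * ?c1 (drop k ys)))"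
      by (rule sum_restrict_image[OF fin(2) inj(2)]) (use Cons w l e cs2 in auto)
    also have "\<dots> = (\<Sum>k\<le>length ys. ?c2 (take (Suc k) xs) * ?c1 (drop (Suc k) xs))"
      by (simp add: sum_distrib_left sum_distrib_right mult.assoc Cons) (rule sum.swap)
    also have "\<dots> + ?c1 xs = (\<Sum>k\<le>length xs. ?c2 (take k xs) * ?c1 (drop k xs))"
      by (simp only: Cons length_Cons sum.atMost_Suc_shift) simp
    finally show ?thesis .
  qed simp
qed

end

text \<open>The first \<open>n\<close> vertices of the path are pairwise distinct by
  acyclicity.\<close>

lemma acyclic_relpow_bound:
  assumes "finite B" "acyclic B" "(a, b) \<in> B ^^ n"
  shows "n < card (Field B) + 1"
proof (cases "n = 0")
  case False
  obtain f where f: "\<And>i. i < n \<Longrightarrow> (f i, f (Suc i)) \<in> B"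
    using assms(3) by (auto simp: relpow_fun_conv)
  have tr: "(f i, f (i + Suc d)) \<in> B\<^sup>+" if "i + Suc d \<le> n" for i d
    using that
  proof (induction d)
    case (Suc d)
    then have "(f i, f (i + Suc d)) \<in> B\<^sup>+" "(f (i + Suc d), f (Suc (i + Suc d))) \<in> B"
      using f[of "i + Suc d"] by auto
    then show ?case by (auto intro: trancl_into_trancl)
  qed (use f in auto)
  have "inj_on f {..<n}"
  proof (rule linorder_inj_onI)
    fix i j assume "i < j" "i \<in> {..<n}" "j \<in> {..<n}"
    then have "(f i, f j) \<in> B\<^sup>+" using tr[of i "j - i - 1"] by auto
    then show "f i \<noteq> f j" using assms(2) by (auto simp: acyclic_def)
  qed auto
  moreover have "f ` {..<n} \<subseteq> Field B" using f by (auto simp: Field_def)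
  ultimately have "n \<le> card (Field B)"
    using assms(1) card_inj_on_le[of f "{..<n}" "Field B"] by (simp add: finite_Field)
  then show ?thesis by simp
qed simp

text \<open>
  Along a chain of maximal length every element sits at the largest possible height, so that no
  other chain carries the same labels.
\<close>

lemma longest_chain_coeff_nonzero:
  assumes fin: "finite T" and ne: "T \<noteq> {}" and B: "B \<subseteq> T \<times> T" "acyclic B"
    and cmp: "\<And>t s. t \<in> T \<Longrightarrow> s \<in> T \<Longrightarrow> l t = l s \<Longrightarrow> t = s \<or> (t, s) \<in> B\<^sup>+ \<or> (s, t) \<in> B\<^sup>+"
    and e: "\<And>t. t \<in> T \<Longrightarrow> \<epsilon> t \<noteq> (0::int)"
  obtains f L where "\<And>i. i \<le> L \<Longrightarrow> f i \<in> T" "\<And>i. i < L \<Longrightarrow> (f i, f (Suc i)) \<in> B"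
    "\<And>a b. (a, b) \<notin> B ^^ Suc L"
    "chain_coeff T (B\<^sup>+) l \<epsilon> (map (\<lambda>i. l (f i)) [0..<Suc L]) \<noteq> 0"
proof -
  have finB: "finite B" using B(1) fin finite_subset by blast
  define P where "P n \<longleftrightarrow> (\<exists>a\<in>T. \<exists>b. (a, b) \<in> B ^^ n)" for n
  have "P 0" using ne by (auto simp: P_def)
  moreover have bound: "n < card (Field B) + 1" if "P n" for n
    using that acyclic_relpow_bound[OF finB B(2)] by (auto simp: P_def)
  ultimately obtain L where L: "P L" and Lmax: "\<And>n. P n \<Longrightarrow> n \<le> L"
    using GreatestI_nat[of P 0] Greatest_le_nat[of P] by (metis less_imp_le_nat)
  have none: "(a, b) \<notin> B ^^ Suc L" for a b
  proof
    assume ab: "(a, b) \<in> B ^^ Suc L"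
    have "a \<in> T" using relpow_Suc_D2[OF ab] B(1) by auto
    then show False using ab Lmax[of "Suc L"] by (auto simp: P_def)
  qed
  obtain a f where f0: "f 0 = a" "a \<in> T" and f: "\<And>i. i < L \<Longrightarrow> (f i, f (Suc i)) \<in> B"
    using L by (auto simp: P_def relpow_fun_conv)
  have fT: "f i \<in> T" if "i \<le> L" for i
  proof (cases i)
    case (Suc m)
    then show ?thesis using f[of m] that B(1) by auto
  qed (use f0 in simp)
  \<comment> \<open>\<open>D i t\<close> says that \<open>t\<close> has height at least
    \<open>i\<close>: some descending path of \<open>i\<close> steps starts at
    \<open>t\<close>.\<close>
  define D where "D i t \<longleftrightarrow> (\<exists>s. (s, t) \<in> B ^^ i)" for i t
  have D_tr: "D (Suc i) t" if s: "D i s" and st: "(s, t) \<in> B\<^sup>+" for i s t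
  proof -
    obtain n where "n > 0" "(s, t) \<in> B ^^ n" using st by (auto simp: trancl_power)
    then obtain m where "(s, t) \<in> B ^^ Suc m" using gr0_implies_Suc by blast
    moreover obtain u where "(u, s) \<in> B ^^ i" using s by (auto simp: D_def)
    ultimately have "(u, t) \<in> B ^^ (i + Suc m)" by (auto simp: relpow_add)
    then have "(u, t) \<in> B ^^ (m + Suc i)" by (simp add: add.commute)
    then show ?thesis unfolding relpow_add D_def by blast
  qed
  have Df: "D i (f i)" if "i \<le> L" for i
    using that f unfolding D_def relpow_fun_conv by (intro exI[of _ "f 0"] exI[of _ f]) auto
  have up: "(f i, f L) \<in> B ^^ (L - i)" if "i \<le> L" for i
    using that f unfolding relpow_fun_conv by (intro exI[of _ "\<lambda>j. f (i + j)"]) auto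
  \<comment> \<open>The height of \<open>f i\<close> is exactly \<open>i\<close>: a longer descent,
    prolonged along \<open>f\<close> up to \<open>f L\<close>, would have \<open>Suc L\<close>
    steps.\<close>
  have nD: "\<not> D (Suc i) (f i)" if "i \<le> L" for i
  proof
    assume "D (Suc i) (f i)"
    then obtain s where "(s, f i) \<in> B ^^ Suc i" by (auto simp: D_def)
    then have "(s, f L) \<in> B ^^ (Suc i + (L - i))" using up[OF that] by (subst relpow_add) blast
    then show False using none that by simp
  qed
  \<comment> \<open>Downward induction on \<open>i\<close>. Keeping track of heights singles out one
    non-zero term in each sum, so that no cancellation can happen.\<close>
  have main: "chain_sum T (B\<^sup>+) l \<epsilon> (map (\<lambda>i. l (f i)) [Suc i..<Suc L]) s \<noteq> 0 \<longleftrightarrow> s = f i"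
    if "i \<le> L" "s \<in> T" "l s = l (f i)" "D i s" for i s
    using that
  proof (induction "L - i" arbitrary: i s)
    case 0
    then have [simp]: "i = L" by simp
    have "\<not> (s, f i) \<in> B\<^sup>+" using D_tr[OF 0(5)] nD[of L] by auto
    moreover have "\<not> (f i, s) \<in> B\<^sup>+"
      using D_tr[OF Df] none unfolding D_def by (metis \<open>i = L\<close> order_refl)
    ultimately show ?case using cmp[OF 0(3) fT[OF 0(2)] 0(4)] by auto
  next
    case (Suc d)
    then have iL: "Suc i \<le> L" "i < L" "d = L - Suc i" by auto
    let ?s = "chain_sum T (B\<^sup>+) l \<epsilon> (map (\<lambda>i. l (f i)) [Suc (Suc i)..<Suc L])"
    let ?A = "{s' \<in> T. (s, s') \<in> B\<^sup>+ \<and> l s' = l (f (Suc i))}"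
    have IH: "?s s' \<noteq> 0 \<longleftrightarrow> s' = f (Suc i)" if "s' \<in> ?A" for s'
      using Suc.hyps(1)[OF iL(3) iL(1)] that D_tr[OF Suc.prems(4)] by auto
    have "[Suc i..<Suc L] = Suc i # [Suc (Suc i)..<Suc L]" using iL by (simp add: upt_conv_Cons)
    then have "chain_sum T (B\<^sup>+) l \<epsilon> (map (\<lambda>i. l (f i)) [Suc i..<Suc L]) s = (\<Sum>s' \<in> ?A. \<epsilon> s' * ?s s')"
      by simp
    also have "\<dots> = (\<Sum>s' \<in> ?A. if s' = f (Suc i) then \<epsilon> s' * ?s s' else 0)"
      using IH by (intro sum.cong) auto
    also have "\<dots> = (if f (Suc i) \<in> ?A then \<epsilon> (f (Suc i)) * ?s (f (Suc i)) else 0)"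
      using fin by (subst sum.delta) auto
    finally have eq: "chain_sum T (B\<^sup>+) l \<epsilon> (map (\<lambda>i. l (f i)) [Suc i..<Suc L]) s \<noteq> 0 \<longleftrightarrow>
        (s, f (Suc i)) \<in> B\<^sup>+"
      using IH e fT iL(1) by auto
    \<comment> \<open>Sharing a label, \<open>s\<close> and \<open>f i\<close> are comparable. If
      \<open>s\<close> were below, \<open>f i\<close> would be too high; if \<open>s\<close> were
      above, then \<open>f (Suc i)\<close>, lying above \<open>s\<close>, would be too high.\<close>
    have "s = f i" if "(s, f (Suc i)) \<in> B\<^sup>+"
    proof -
      have "\<not> (s, f i) \<in> B\<^sup>+" using D_tr[OF Suc.prems(4)] nD[of i] iL by auto
      moreover have "\<not> (f i, s) \<in> B\<^sup>+"
        using D_tr[OF D_tr[OF Df, of i s] that] nD[of "Suc i"] iL by auto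
      ultimately show ?thesis using cmp[OF Suc.prems(2) fT Suc.prems(3)] iL by auto
    qed
    then show ?case using eq f[OF iL(2)] by auto
  qed
  have "chain_coeff T (B\<^sup>+) l \<epsilon> (map (\<lambda>i. l (f i)) [0..<Suc L]) =
      (\<Sum>s \<in> {s \<in> T. l s = l (f 0)}. \<epsilon> s * chain_sum T (B\<^sup>+) l \<epsilon> (map (\<lambda>i. l (f i)) [Suc 0..<Suc L]) s)"
    by (subst upt_conv_Cons) simp_all
  also have "\<dots> = (\<Sum>s \<in> {s \<in> T. l s = l (f 0)}. if s = f 0
      then \<epsilon> s * chain_sum T (B\<^sup>+) l \<epsilon> (map (\<lambda>i. l (f i)) [Suc 0..<Suc L]) s else 0)"
    using main[of 0] by (intro sum.cong) (auto simp: D_def)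
  also have "\<dots> \<noteq> 0"
    using fin main[of 0 "f 0"] fT[of 0] e by (subst sum.delta) (auto simp: D_def)
  finally have nz: "chain_coeff T (B\<^sup>+) l \<epsilon> (map (\<lambda>i. l (f i)) [0..<Suc L]) \<noteq> 0" .
  show thesis using that[of L f] fT f none nz by blast
qed

section \<open>Subdividing the half-open unit interval\<close>

abbreviation unit_ivl :: "real set" where
  "unit_ivl \<equiv> {0..<1}"

text \<open>
  \<open>emb m k\<close> maps \<open>[0,1)\<close> onto the \<open>k\<close>-th interval of the subdivision of \<open>[0,1)\<close> with inner
  endpoints \<open>1/2, 3/4, \<dots>, 1 - 1/2^(m-1)\<close>.
\<close>

definition emb_len :: "nat \<Rightarrow> nat \<Rightarrow> real" where
  "emb_len m k = (if Suc k < m then 1 / 2 ^ Suc k else 1 / 2 ^ k)"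

definition emb :: "nat \<Rightarrow> nat \<Rightarrow> real \<Rightarrow> real" where
  "emb m k x = 1 - 1 / 2 ^ k + x * emb_len m k"

lemma emb_len_pos: "0 < emb_len m k"
  by (simp add: emb_len_def)

lemma emb_len_le: "emb_len m k \<le> 1 / 2 ^ k"
  by (simp add: emb_len_def field_simps)

lemma emb_ge: "x \<in> unit_ivl \<Longrightarrow> 1 - 1 / 2 ^ k \<le> emb m k x"
  using emb_len_pos[of m k] by (simp add: emb_def)

lemma emb_in:
  assumes "x \<in> unit_ivl" shows "emb m k x \<in> unit_ivl"
proof -
  have "x * emb_len m k < emb_len m k" using assms emb_len_pos[of m k] by simp
  then have "emb m k x < 1" using emb_len_le[of m k] by (simp add: emb_def)
  moreover have "(1::real) / 2 ^ k \<le> 1" by simp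
  then have "0 \<le> emb m k x" using emb_ge[OF assms, of k m] by linarith
  ultimately show ?thesis by simp
qed

lemma emb_lt:
  assumes "k < k'" "k' < m" "x \<in> unit_ivl"
  shows "emb m k x < 1 - 1 / 2 ^ k'"
proof -
  have "x * emb_len m k < 1 / 2 ^ Suc k"
    using assms by (simp add: emb_len_def field_simps)
  then have "emb m k x < 1 - 1 / 2 ^ Suc k" by (simp add: emb_def field_simps)
  moreover have "(1::real) / 2 ^ k' \<le> 1 / 2 ^ Suc k"
    using assms(1) by (intro divide_left_mono power_increasing) auto
  ultimately show ?thesis by linarith
qed

lemma emb_less_iff:
  assumes "k < m" "k' < m" "x \<in> unit_ivl" "x' \<in> unit_ivl"
  shows "emb m k x < emb m k' x' \<longleftrightarrow> k < k' \<or> k = k' \<and> x < x'"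
proof (cases k k' rule: linorder_cases)
  case less
  then show ?thesis using emb_lt[of k k' m x] emb_ge[of x' k' m] assms by auto
next
  case equal
  then show ?thesis using emb_len_pos[of m k] by (simp add: emb_def)
next
  case greater
  then show ?thesis using emb_lt[of k' k m x'] emb_ge[of x k m] assms by auto
qed

lemma emb_eq_iff:
  assumes "k < m" "k' < m" "x \<in> unit_ivl" "x' \<in> unit_ivl"
  shows "emb m k x = emb m k' x' \<longleftrightarrow> k = k' \<and> x = x'"
proof -
  have eq: "emb m k x = emb m k' x' \<longleftrightarrow> \<not> emb m k x < emb m k' x' \<and> \<not> emb m k' x' < emb m k x"
    by auto
  show ?thesis
    unfolding eq emb_less_iff[OF assms] emb_less_iff[OF assms(2,1,4,3)] by auto
qed

lemma emb_surj:
  assumes "0 < m" "y \<in> unit_ivl"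
  obtains k x where "k < m" "x \<in> unit_ivl" "y = emb m k x"
proof -
  let ?Q = "\<lambda>j. \<exists>k<m. \<exists>x\<in>unit_ivl. y = emb m k x"
  \<comment> \<open>Sweep from left to right: either \<open>y\<close> has been located in some
    piece, or it lies to the right of the left end of piece \<open>j\<close>.\<close>
  have step: "1 - 1 / 2 ^ j \<le> y \<or> ?Q j" if "j < m" for j
    using that
  proof (induction j)
    case (Suc j)
    show ?case
    proof (cases "?Q j \<or> 1 - 1 / 2 ^ Suc j \<le> y")
      case False
      then have le: "1 - 1 / 2 ^ j \<le> y" "y < 1 - 1 / 2 ^ Suc j" using Suc by auto
      define x where "x = (y - (1 - 1 / 2 ^ j)) * 2 ^ Suc j"
      define d where "d = y - (1 - 1 / 2 ^ j)"
      have "0 \<le> d" "d < 1 / 2 ^ Suc j" using le by (simp_all add: d_def)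
      then have "x \<in> unit_ivl" unfolding x_def d_def[symmetric] by (simp add: pos_less_divide_eq)
      moreover have "y = emb m j x" using Suc.prems by (simp add: x_def emb_def emb_len_def)
      moreover have "j < m" using Suc.prems by simp
      ultimately show ?thesis by blast
    qed blast
  qed (use assms in auto)
  show thesis
  proof (cases "\<exists>k<m. \<exists>x\<in>unit_ivl. y = emb m k x")
    case False
    then have le: "1 - 1 / 2 ^ (m - 1) \<le> y" using step[of "m - 1"] assms by auto
    define x where "x = (y - (1 - 1 / 2 ^ (m - 1))) * 2 ^ (m - 1)"
    define d where "d = y - (1 - 1 / 2 ^ (m - 1))"
    have "0 \<le> d" "d < 1 / 2 ^ (m - 1)" using le assms by (simp_all add: d_def)
    then have "x \<in> unit_ivl" unfolding x_def d_def[symmetric] by (simp add: pos_less_divide_eq)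
    moreover have "y = emb m (m - 1) x" using assms by (simp add: x_def emb_def emb_len_def)
    ultimately show ?thesis using that[of "m - 1" x] assms by auto
  qed (use that in auto)
qed

text \<open>The left end \<open>1 - 1 / 2 ^ k\<close> reveals the index of a piece, and only the
  last piece reaches up to 1, which reveals the number of pieces.\<close>

lemma emb_subdivision_eq:
  assumes "0 < m" and j: "\<And>k. k < m \<Longrightarrow> j k < n"
    and eq: "\<And>k x. k < m \<Longrightarrow> x \<in> unit_ivl \<Longrightarrow> emb m k x = emb n (j k) x"
  shows "m = n" "\<And>k. k < m \<Longrightarrow> j k = k"
proof -
  show jk: "j k = k" if "k < m" for k
    using eq[OF that, of 0] by (simp add: emb_def)
  have "emb_len m (m - 1) = emb_len n (m - 1)"
    using eq[of "m - 1" "1/2"] jk[of "m - 1"] assms(1) by (simp add: emb_def)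
  then have "\<not> Suc (m - 1) < n" using assms(1) by (auto simp: emb_len_def)
  then show "m = n" using j[of "m - 1"] jk[of "m - 1"] assms(1) by auto
qed

definition glue :: "nat \<Rightarrow> (nat \<Rightarrow> real \<Rightarrow> real) \<Rightarrow> real \<Rightarrow> real" where
  "glue m f y = (THE a. \<exists>k<m. \<exists>x\<in>unit_ivl. y = emb m k x \<and> a = f k x)"

lemma glue_emb: "k < m \<Longrightarrow> x \<in> unit_ivl \<Longrightarrow> glue m f (emb m k x) = f k x"
  unfolding glue_def by (rule the_equality) (auto simp: emb_eq_iff)

section \<open>Attachment of wires\<close>

lemma attachment_iff:
  assumes "finite T" "finite W"
  shows "mset xs + (\<Sum>t\<in>T. mset (f t)) = mset_set W \<longleftrightarrow>
     distinct xs \<and> (\<forall>t\<in>T. distinct (f t) \<and> set (f t) \<inter> set xs = {}) \<and>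
     (\<forall>t\<in>T. \<forall>s\<in>T. t \<noteq> s \<longrightarrow> set (f t) \<inter> set (f s) = {}) \<and> set xs \<union> (\<Union>t\<in>T. set (f t)) = W"
  using assms(1)
proof (induction T arbitrary: xs)
  case empty
  have "mset xs = mset_set W \<longleftrightarrow> distinct xs \<and> set xs = W"
    using assms(2) mset_set_set[of xs] finite_set_mset_mset_set[of W] set_mset_mset[of xs]
    by (metis count_mset_set(1,3) distinct_count_atmost_1)
  then show ?case by simp
next
  case (insert t T)
  have *: "mset xs + (\<Sum>t\<in>insert t T. mset (f t)) = mset (xs @ f t) + (\<Sum>t\<in>T. mset (f t))"
    using insert by simp
  then show ?case
    unfolding * insert.IH using insert.hyps by auto blast+
qed

locale diag =
  fixes \<A> :: "'a set" and \<R> :: "('a list \<times> 'a list) set" and \<Delta> :: "'a diagram"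
  assumes pres: "semigroup_presentation \<A> \<R>" and bd: "braided_diagram \<A> \<R> \<Delta>"
begin

abbreviation "W \<equiv> wires \<Delta>"
abbreviation "T \<equiv> transistors \<Delta>"
abbreviation "tt \<equiv> ttop \<Delta>"
abbreviation "tb \<equiv> tbot \<Delta>"
abbreviation "ft \<equiv> ftop \<Delta>"
abbreviation "fb \<equiv> fbot \<Delta>"

lemma fin: "finite W" "finite T"
  using bd by (auto simp: braided_diagram_def)

lemma acyc: "acyclic (below \<Delta>)"
  using bd by (auto simp: braided_diagram_def)

lemma fin_below: "finite (below \<Delta>)" and below_sub: "below \<Delta> \<subseteq> T \<times> T"
  using fin(2) finite_subset[of "below \<Delta>" "T \<times> T"] by (auto simp: below_def)

lemma bottoms:
  shows "distinct fb" "\<And>t. t \<in> T \<Longrightarrow> distinct (tt t)" "\<And>t. t \<in> T \<Longrightarrow> set (tt t) \<inter> set fb = {}"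
    "\<And>t s. t \<in> T \<Longrightarrow> s \<in> T \<Longrightarrow> t \<noteq> s \<Longrightarrow> set (tt t) \<inter> set (tt s) = {}"
    "set fb \<union> (\<Union>t\<in>T. set (tt t)) = W"
  using bd attachment_iff[OF fin(2,1), of fb tt] by (auto simp: braided_diagram_def)

lemma tops:
  shows "distinct ft" "\<And>t. t \<in> T \<Longrightarrow> distinct (tb t)" "\<And>t. t \<in> T \<Longrightarrow> set (tb t) \<inter> set ft = {}"
    "\<And>t s. t \<in> T \<Longrightarrow> s \<in> T \<Longrightarrow> t \<noteq> s \<Longrightarrow> set (tb t) \<inter> set (tb s) = {}"
    "set ft \<union> (\<Union>t\<in>T. set (tb t)) = W"
  using bd attachment_iff[OF fin(2,1), of ft tb] by (auto simp: braided_diagram_def)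

lemma relation: "t \<in> T \<Longrightarrow> (word_on \<Delta> (tt t), word_on \<Delta> (tb t)) \<in> \<R> \<or> (word_on \<Delta> (tb t), word_on \<Delta> (tt t)) \<in> \<R>"
  using bd by (auto simp: braided_diagram_def)

lemma nonempty: "t \<in> T \<Longrightarrow> tt t \<noteq> []" "t \<in> T \<Longrightarrow> tb t \<noteq> []"
  using relation[of t] pres by (auto simp: semigroup_presentation_def word_on_def)

lemma in_W: "t \<in> T \<Longrightarrow> j < length (tb t) \<Longrightarrow> tb t ! j \<in> W" "t \<in> T \<Longrightarrow> k < length (tt t) \<Longrightarrow> tt t ! k \<in> W"
  "k < length ft \<Longrightarrow> ft ! k \<in> W" "k < length fb \<Longrightarrow> fb ! k \<in> W"
  using bottoms(5) tops(5) nth_mem by blast+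

lemma top_cases:
  assumes "e \<in> W"
  obtains (frame) k where "k < length ft" "e = ft ! k"
    | (trans) t j where "t \<in> T" "j < length (tb t)" "e = tb t ! j"
proof -
  have "e \<in> set ft \<or> (\<exists>t\<in>T. e \<in> set (tb t))" using assms tops(5) by blast
  then show thesis using frame trans by (auto simp: in_set_conv_nth)
qed

lemma bottom_cases:
  assumes "e \<in> W"
  obtains (frame) k where "k < length fb" "e = fb ! k"
    | (trans) t k where "t \<in> T" "k < length (tt t)" "e = tt t ! k"
proof -
  have "e \<in> set fb \<or> (\<exists>t\<in>T. e \<in> set (tt t))" using assms bottoms(5) by blast
  then show thesis using frame trans by (auto simp: in_set_conv_nth)
qed

lemma tb_unique:
  assumes "t \<in> T" "s \<in> T" "j < length (tb t)" "i < length (tb s)" "tb t ! j = tb s ! i"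
  shows "t = s \<and> j = i"
proof -
  have "tb t ! j \<in> set (tb t) \<inter> set (tb s)" using assms by (metis IntI nth_mem)
  then have "t = s" using tops(4)[of t s] assms(1,2) by blast
  then show ?thesis using tops(2)[of s] assms by (simp add: nth_eq_iff_index_eq)
qed

lemma tt_unique:
  assumes "t \<in> T" "s \<in> T" "j < length (tt t)" "i < length (tt s)" "tt t ! j = tt s ! i"
  shows "t = s \<and> j = i"
proof -
  have "tt t ! j \<in> set (tt t) \<inter> set (tt s)" using assms by (metis IntI nth_mem)
  then have "t = s" using bottoms(4)[of t s] assms(1,2) by blast
  then show ?thesis using bottoms(2)[of s] assms by (simp add: nth_eq_iff_index_eq)
qed

lemma tb_not_ft: "t \<in> T \<Longrightarrow> j < length (tb t) \<Longrightarrow> k < length ft \<Longrightarrow> tb t ! j \<noteq> ft ! k"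
  by (metis IntI empty_iff nth_mem tops(3))

lemma tt_not_fb: "t \<in> T \<Longrightarrow> j < length (tt t) \<Longrightarrow> k < length fb \<Longrightarrow> tt t ! j \<noteq> fb ! k"
  by (metis IntI empty_iff nth_mem bottoms(3))

lemma belowI:
  "t \<in> T \<Longrightarrow> s \<in> T \<Longrightarrow> k < length (tt t) \<Longrightarrow> j < length (tb s) \<Longrightarrow> tt t ! k = tb s ! j \<Longrightarrow> (t, s) \<in> below \<Delta>"
  using nth_mem[of k "tt t"] nth_mem[of j "tb s"] by (auto simp: below_def)

text \<open>What remains of a step of the flow when sheet and coordinate are forgotten.
  Well-foundedness of the converse gives inductions from the top of the frame downwards, that of the
  relation itself inductions from the bottom upwards.\<close>

definition wire_up :: "(nat \<times> nat) set" where
  "wire_up = {(e, e'). \<exists>t\<in>T. e \<in> set (tb t) \<and> e' \<in> set (tt t)}"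

lemma wire_up_acyclic: "acyclic wire_up"
proof -
  have *: "\<exists>t\<in>T. \<exists>t'\<in>T. e \<in> set (tb t) \<and> e' \<in> set (tt t') \<and> (t, t') \<in> (below \<Delta>)\<^sup>*"
    if "(e, e') \<in> wire_up\<^sup>+" for e e'
    using that
  proof (induction rule: trancl_induct)
    case (step e' e'')
    then obtain t t' s where st: "t \<in> T" "t' \<in> T" "s \<in> T" "e \<in> set (tb t)" "e' \<in> set (tt t')"
      "(t, t') \<in> (below \<Delta>)\<^sup>*" "e' \<in> set (tb s)" "e'' \<in> set (tt s)"
      by (auto simp: wire_up_def)
    then have "(t', s) \<in> below \<Delta>" by (auto simp: below_def)
    then show ?case using st by (meson rtrancl.rtrancl_into_rtrancl)
  qed (auto simp: wire_up_def)
  have "False" if cyc: "(e, e) \<in> wire_up\<^sup>+" for e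
  proof -
    obtain t t' where "t \<in> T" "t' \<in> T" "e \<in> set (tb t)" "e \<in> set (tt t')" "(t, t') \<in> (below \<Delta>)\<^sup>*"
      using *[OF cyc] by blast
    moreover from this have "(t', t) \<in> below \<Delta>" by (auto simp: below_def)
    ultimately have "(t, t) \<in> (below \<Delta>)\<^sup>+" by (meson rtrancl_into_trancl1)
    then show False using acyc by (auto simp: acyclic_def)
  qed
  then show ?thesis by (auto simp: acyclic_def)
qed

lemma wf_wire_up: "wf wire_up" "wf (wire_up\<inverse>)"
proof -
  have "wire_up \<subseteq> W \<times> W" using bottoms(5) tops(5) by (auto simp: wire_up_def)
  then have "finite wire_up" using fin(1) finite_subset by blast
  then show "wf wire_up" "wf (wire_up\<inverse>)"
    using wire_up_acyclic by (auto intro: finite_acyclic_wf finite_acyclic_wf_converse)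
qed

end

section \<open>The upward flow\<close>

text \<open>
  A wire is a copy of \<open>[0,1)\<close>, and a transistor identifies the \<open>n\<close> copies on its bottom side with
  the \<open>m\<close> copies on its top side through the subdivisions of \<open>[0,1)\<close> into \<open>n\<close> and \<open>m\<close> intervals.
  Each point of a wire thus flows upwards to the top side of the frame. The integer records the sheet
  of a covering of the annulus: the shift \<open>sh e\<close> says that the bottom end of the lift
  \<open>n\<close> of the wire \<open>e\<close> is attached to the lift \<open>n + sh e\<close> of what it is attached to, whereas the top end
  stays in the same sheet.
\<close>

type_synonym state = "int \<times> nat \<times> real"

definition ustep_at :: "'a diagram \<Rightarrow> (nat \<Rightarrow> int) \<Rightarrow> nat \<Rightarrow> nat \<Rightarrow> nat \<Rightarrow> state \<Rightarrow> state \<Rightarrow> bool" where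
  "ustep_at \<Delta> sh t j k s s' \<longleftrightarrow> t \<in> transistors \<Delta> \<and> j < length (tbot \<Delta> t) \<and> k < length (ttop \<Delta> t) \<and>
     (\<exists>n. \<exists>x\<in>unit_ivl. \<exists>x'\<in>unit_ivl. s = (n, tbot \<Delta> t ! j, x) \<and>
        s' = (n - sh (ttop \<Delta> t ! k), ttop \<Delta> t ! k, x') \<and>
        emb (length (tbot \<Delta> t)) j x = emb (length (ttop \<Delta> t)) k x')"

definition ustep :: "'a diagram \<Rightarrow> (nat \<Rightarrow> int) \<Rightarrow> (state \<times> state) set" where
  "ustep \<Delta> sh = {(s, s'). \<exists>t j k. ustep_at \<Delta> sh t j k s s'}"

definition reaches :: "'a diagram \<Rightarrow> (nat \<Rightarrow> int) \<Rightarrow> state \<Rightarrow> real \<Rightarrow> bool" where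
  "reaches \<Delta> sh s a \<longleftrightarrow> (\<exists>n. \<exists>k<length (ftop \<Delta>). \<exists>y\<in>unit_ivl.
     (s, (n, ftop \<Delta> ! k, y)) \<in> (ustep \<Delta> sh)\<^sup>* \<and> a = of_int n + emb (length (ftop \<Delta>)) k y)"

definition waddr :: "'a diagram \<Rightarrow> (nat \<Rightarrow> int) \<Rightarrow> nat \<Rightarrow> real \<Rightarrow> real" where
  "waddr \<Delta> sh e x = (THE a. reaches \<Delta> sh (0, e, x) a)"

definition taddr :: "'a diagram \<Rightarrow> (nat \<Rightarrow> int) \<Rightarrow> nat \<Rightarrow> real \<Rightarrow> real" where
  "taddr \<Delta> sh t = glue (length (ttop \<Delta> t)) (\<lambda>k x. waddr \<Delta> sh (ttop \<Delta> t ! k) x - of_int (sh (ttop \<Delta> t ! k)))"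

definition flow :: "'a diagram \<Rightarrow> (nat \<Rightarrow> int) \<Rightarrow> real \<Rightarrow> real" where
  "flow \<Delta> sh = glue (length (fbot \<Delta>)) (\<lambda>k x. waddr \<Delta> sh (fbot \<Delta> ! k) x - of_int (sh (fbot \<Delta> ! k)))"

definition addressing :: "'a diagram \<Rightarrow> (nat \<Rightarrow> int) \<Rightarrow> (nat \<Rightarrow> real \<Rightarrow> real) \<Rightarrow> (nat \<Rightarrow> real \<Rightarrow> real) \<Rightarrow> bool" where
  "addressing \<Delta> sh A B \<longleftrightarrow>
     (\<forall>k<length (ftop \<Delta>). \<forall>x\<in>unit_ivl. A (ftop \<Delta> ! k) x = emb (length (ftop \<Delta>)) k x) \<and>
     (\<forall>t\<in>transistors \<Delta>. \<forall>j<length (tbot \<Delta> t). \<forall>x\<in>unit_ivl.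
        A (tbot \<Delta> t ! j) x = B t (emb (length (tbot \<Delta> t)) j x)) \<and>
     (\<forall>t\<in>transistors \<Delta>. \<forall>k<length (ttop \<Delta> t). \<forall>x\<in>unit_ivl.
        B t (emb (length (ttop \<Delta> t)) k x) = A (ttop \<Delta> t ! k) x - of_int (sh (ttop \<Delta> t ! k)))"

context diag
begin

lemma ustep_atE:
  assumes "ustep_at \<Delta> sh t j k s s'"
  obtains n x x' where "t \<in> T" "j < length (tb t)" "k < length (tt t)" "x \<in> unit_ivl" "x' \<in> unit_ivl"
    "s = (n, tb t ! j, x)" "s' = (n - sh (tt t ! k), tt t ! k, x')"
    "emb (length (tb t)) j x = emb (length (tt t)) k x'"
  using assms unfolding ustep_at_def by blast

lemma ustep_at_unique:
  assumes 1: "ustep_at \<Delta> sh t j k s s1" and 2: "ustep_at \<Delta> sh t' j' k' s s2"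
  shows "s1 = s2"
proof -
  obtain n x x1 where a: "t \<in> T" "j < length (tb t)" "k < length (tt t)" "x \<in> unit_ivl" "x1 \<in> unit_ivl"
    "s = (n, tb t ! j, x)" "s1 = (n - sh (tt t ! k), tt t ! k, x1)"
    "emb (length (tb t)) j x = emb (length (tt t)) k x1"
    using ustep_atE[OF 1] by metis
  obtain n' x' x2 where b: "t' \<in> T" "j' < length (tb t')" "k' < length (tt t')" "x' \<in> unit_ivl" "x2 \<in> unit_ivl"
    "s = (n', tb t' ! j', x')" "s2 = (n' - sh (tt t' ! k'), tt t' ! k', x2)"
    "emb (length (tb t')) j' x' = emb (length (tt t')) k' x2"
    using ustep_atE[OF 2] by metis
  have "t = t'" "j = j'" using tb_unique[OF a(1) b(1) a(2) b(2)] a(6) b(6) by auto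
  then have "k = k'" "x1 = x2" using a b emb_eq_iff[OF a(3) _ a(5) b(5), of k'] by auto
  then show ?thesis using a b \<open>t = t'\<close> by simp
qed

lemma ustep_at_unique_converse:
  assumes 1: "ustep_at \<Delta> sh t j k s1 s" and 2: "ustep_at \<Delta> sh t' j' k' s2 s"
  shows "s1 = s2"
proof -
  obtain n x x1 where a: "t \<in> T" "j < length (tb t)" "k < length (tt t)" "x1 \<in> unit_ivl" "x \<in> unit_ivl"
    "s1 = (n, tb t ! j, x1)" "s = (n - sh (tt t ! k), tt t ! k, x)"
    "emb (length (tb t)) j x1 = emb (length (tt t)) k x"
    using ustep_atE[OF 1] by metis
  obtain n' x' x2 where b: "t' \<in> T" "j' < length (tb t')" "k' < length (tt t')" "x2 \<in> unit_ivl" "x' \<in> unit_ivl"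
    "s2 = (n', tb t' ! j', x2)" "s = (n' - sh (tt t' ! k'), tt t' ! k', x')"
    "emb (length (tb t')) j' x2 = emb (length (tt t')) k' x'"
    using ustep_atE[OF 2] by metis
  have "t = t'" "k = k'" using tt_unique[OF a(1) b(1) a(3) b(3)] a(7) b(7) by auto
  then have "j = j'" "x1 = x2" using a b emb_eq_iff[OF a(2) _ a(4) b(4), of j'] by auto
  then show ?thesis using a b \<open>t = t'\<close> \<open>k = k'\<close> by simp
qed

lemma ustep_single_valued: "single_valued (ustep \<Delta> sh)"
proof (rule single_valuedI)
  fix s s1 s2 assume "(s, s1) \<in> ustep \<Delta> sh" "(s, s2) \<in> ustep \<Delta> sh"
  then show "s1 = s2"
    by (auto simp: ustep_def intro: ustep_at_unique)
qed

lemma ustep_single_valued_converse: "single_valued ((ustep \<Delta> sh)\<inverse>)"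
proof (rule single_valuedI)
  fix s s1 s2 assume "(s, s1) \<in> (ustep \<Delta> sh)\<inverse>" "(s, s2) \<in> (ustep \<Delta> sh)\<inverse>"
  then show "s1 = s2" by (auto simp: ustep_def intro: ustep_at_unique_converse)
qed

lemma no_ustep_from_top: "k < length ft \<Longrightarrow> ((n, ft ! k, x), s) \<notin> ustep \<Delta> sh"
  using tb_not_ft by (auto simp: ustep_def ustep_at_def) metis

lemma no_ustep_to_bottom: "k < length fb \<Longrightarrow> (s, (n, fb ! k, x)) \<notin> ustep \<Delta> sh"
  using tt_not_fb by (auto simp: ustep_def ustep_at_def) metis

lemma ustep_up:
  assumes "t \<in> T" "j < length (tb t)" "x \<in> unit_ivl"
  obtains k x' where "k < length (tt t)" "x' \<in> unit_ivl" "emb (length (tb t)) j x = emb (length (tt t)) k x'"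
    "ustep_at \<Delta> sh t j k (n, tb t ! j, x) (n - sh (tt t ! k), tt t ! k, x')"
proof -
  obtain k x' where "k < length (tt t)" "x' \<in> unit_ivl" "emb (length (tb t)) j x = emb (length (tt t)) k x'"
    using emb_surj[of "length (tt t)" "emb (length (tb t)) j x"] emb_in[OF assms(3)] nonempty[OF assms(1)] by auto
  then show thesis using that assms by (auto simp: ustep_at_def)
qed

lemma ustep_down:
  assumes "t \<in> T" "k < length (tt t)" "x' \<in> unit_ivl"
  obtains j x where "j < length (tb t)" "x \<in> unit_ivl" "emb (length (tb t)) j x = emb (length (tt t)) k x'"
    "ustep_at \<Delta> sh t j k (n + sh (tt t ! k), tb t ! j, x) (n, tt t ! k, x')"
proof -
  obtain j x where "j < length (tb t)" "x \<in> unit_ivl" "emb (length (tb t)) j x = emb (length (tt t)) k x'"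
    using emb_surj[of "length (tb t)" "emb (length (tt t)) k x'"] emb_in[OF assms(3)] nonempty[OF assms(1)]
    by (metis length_greater_0_conv)
  then show thesis using that assms by (auto simp: ustep_at_def)
qed

lemma ustep_wire_up: "ustep_at \<Delta> sh t j k (n, e, x) (n', e', x') \<Longrightarrow> (e, e') \<in> wire_up"
  by (auto simp: ustep_at_def wire_up_def intro!: bexI[of _ t])

lemma reaches_exists:
  assumes "e \<in> W" "x \<in> unit_ivl" shows "\<exists>a. reaches \<Delta> sh (n, e, x) a"
  using assms
proof (induction e arbitrary: n x rule: wf_induct_rule[OF wf_wire_up(2)])
  case (1 e)
  from \<open>e \<in> W\<close> show ?case
  proof (cases rule: top_cases)
    case (frame k)
    then show ?thesis using 1 unfolding reaches_def by blast
  next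
    case (trans t j)
    obtain k x' where k: "k < length (tt t)" "x' \<in> unit_ivl" and
      st: "ustep_at \<Delta> sh t j k (n, tb t ! j, x) (n - sh (tt t ! k), tt t ! k, x')"
      using ustep_up[OF trans(1,2) 1(3)] by metis
    have "(tt t ! k, e) \<in> wire_up\<inverse>" using ustep_wire_up[OF st] trans by simp
    then have "\<exists>a. reaches \<Delta> sh (n - sh (tt t ! k), tt t ! k, x') a"
      using 1(1) k trans in_W by blast
    moreover have "((n, e, x), (n - sh (tt t ! k), tt t ! k, x')) \<in> ustep \<Delta> sh"
      using st trans by (auto simp: ustep_def)
    ultimately show ?thesis unfolding reaches_def by (meson converse_rtrancl_into_rtrancl)
  qed
qed

lemma comes_from_bottom:
  assumes "e \<in> W" "x \<in> unit_ivl"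
  shows "\<exists>n'. \<exists>i<length fb. \<exists>y\<in>unit_ivl. ((n', fb ! i, y), (n, e, x)) \<in> (ustep \<Delta> sh)\<^sup>*"
  using assms
proof (induction e arbitrary: n x rule: wf_induct_rule[OF wf_wire_up(1)])
  case (1 e)
  from \<open>e \<in> W\<close> show ?case
  proof (cases rule: bottom_cases)
    case (frame k)
    then show ?thesis using 1 by blast
  next
    case (trans t k)
    obtain j x' where j: "j < length (tb t)" "x' \<in> unit_ivl" and
      st: "ustep_at \<Delta> sh t j k (n + sh (tt t ! k), tb t ! j, x') (n, tt t ! k, x)"
      using ustep_down[OF trans(1,2) 1(3)] by metis
    have "(tb t ! j, e) \<in> wire_up" using ustep_wire_up[OF st] trans by simp
    have "\<exists>n'. \<exists>i<length fb. \<exists>y\<in>unit_ivl. ((n', fb ! i, y), (n + sh (tt t ! k), tb t ! j, x')) \<in> (ustep \<Delta> sh)\<^sup>*"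
      by (rule 1(1)[OF \<open>(tb t ! j, e) \<in> wire_up\<close> in_W(1)[OF trans(1) j(1)] j(2)])
    moreover have "((n + sh (tt t ! k), tb t ! j, x'), (n, e, x)) \<in> ustep \<Delta> sh"
      using st trans by (auto simp: ustep_def)
    ultimately show ?thesis by (meson rtrancl.rtrancl_into_rtrancl)
  qed
qed

text \<open>The flow is deterministic and stops at the top side of the frame, so of two end points
  neither can be strictly beyond the other.\<close>

lemma reaches_unique:
  assumes "reaches \<Delta> sh s a" "reaches \<Delta> sh s b" shows "a = b"
proof -
  obtain n k y m i z where *: "k < length ft" "y \<in> unit_ivl" "(s, (n, ft ! k, y)) \<in> (ustep \<Delta> sh)\<^sup>*"
    "a = of_int n + emb (length ft) k y"
    "i < length ft" "z \<in> unit_ivl" "(s, (m, ft ! i, z)) \<in> (ustep \<Delta> sh)\<^sup>*" "b = of_int m + emb (length ft) i z"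
    using assms unfolding reaches_def by blast
  have "((n, ft ! k, y), (m, ft ! i, z)) \<in> (ustep \<Delta> sh)\<^sup>* \<or> ((m, ft ! i, z), (n, ft ! k, y)) \<in> (ustep \<Delta> sh)\<^sup>*"
    using single_valued_confluent[OF ustep_single_valued *(3,7)] .
  then have "(n, ft ! k, y) = (m, ft ! i, z)"
    using no_ustep_from_top[OF *(1)] no_ustep_from_top[OF *(5)] by (auto elim: converse_rtranclE)
  then show ?thesis using * tops(1) by (simp add: nth_eq_iff_index_eq)
qed

lemma waddr_eqI: "reaches \<Delta> sh (0, e, x) a \<Longrightarrow> waddr \<Delta> sh e x = a"
  unfolding waddr_def using reaches_unique by blast

lemma ustep_shift:
  "((n, e, x), (n', e', x')) \<in> (ustep \<Delta> sh)\<^sup>* \<Longrightarrow> ((n + m, e, x), (n' + m, e', x')) \<in> (ustep \<Delta> sh)\<^sup>*"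
proof (induction "(n', e', x')" arbitrary: n' e' x' rule: rtrancl_induct)
  case (step s)
  obtain n1 e1 x1 where s: "s = (n1, e1, x1)" by (cases s)
  have "((n1 + m, e1, x1), (n' + m, e', x')) \<in> ustep \<Delta> sh"
    using step(2) by (auto simp: s ustep_def ustep_at_def)
  then show ?case using step(3)[OF s] by (rule rtrancl_into_rtrancl[rotated])
qed simp

lemma reaches_shift: "reaches \<Delta> sh (n, e, x) a \<Longrightarrow> reaches \<Delta> sh (n + m, e, x) (a + of_int m)"
proof -
  assume "reaches \<Delta> sh (n, e, x) a"
  then obtain n' k y where k: "k < length ft" "y \<in> unit_ivl"
      "((n, e, x), (n', ft ! k, y)) \<in> (ustep \<Delta> sh)\<^sup>*" "a = of_int n' + emb (length ft) k y"
    unfolding reaches_def by blast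
  have "((n + m, e, x), (n' + m, ft ! k, y)) \<in> (ustep \<Delta> sh)\<^sup>*" by (rule ustep_shift[OF k(3)])
  moreover have "a + of_int m = of_int (n' + m) + emb (length ft) k y" using k(4) by simp
  ultimately show ?thesis unfolding reaches_def using k(1,2) by blast
qed

lemma reaches_waddr:
  assumes "e \<in> W" "x \<in> unit_ivl" shows "reaches \<Delta> sh (n, e, x) (of_int n + waddr \<Delta> sh e x)"
proof -
  obtain a where a: "reaches \<Delta> sh (0, e, x) a" using reaches_exists[OF assms] by blast
  then show ?thesis using reaches_shift[OF a, of n] waddr_eqI[OF a] by (simp add: add.commute)
qed

lemma waddr_ustep:
  assumes "((n, e, x), (n', e', x')) \<in> (ustep \<Delta> sh)\<^sup>*" "e' \<in> W" "x' \<in> unit_ivl" "e \<in> W" "x \<in> unit_ivl"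
  shows "of_int n + waddr \<Delta> sh e x = of_int n' + waddr \<Delta> sh e' x'"
proof -
  have "reaches \<Delta> sh (n, e, x) (of_int n' + waddr \<Delta> sh e' x')"
    using reaches_waddr[OF assms(2,3), of sh n'] assms(1) unfolding reaches_def by (meson rtrancl_trans)
  then show ?thesis using reaches_unique reaches_waddr assms by blast
qed

lemma addressing_addr: "addressing \<Delta> sh (waddr \<Delta> sh) (taddr \<Delta> sh)"
proof -
  have "waddr \<Delta> sh (ft ! k) x = emb (length ft) k x" if "k < length ft" "x \<in> unit_ivl" for k x
    using that by (intro waddr_eqI) (auto simp: reaches_def intro!: exI[of _ 0] exI[of _ k] bexI[of _ x])
  moreover have "taddr \<Delta> sh t (emb (length (tt t)) k x) = waddr \<Delta> sh (tt t ! k) x - of_int (sh (tt t ! k))"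
    if "k < length (tt t)" "x \<in> unit_ivl" for t k x
    using that by (simp add: taddr_def glue_emb)
  moreover have "waddr \<Delta> sh (tb t ! j) x = taddr \<Delta> sh t (emb (length (tb t)) j x)"
    if t: "t \<in> T" "j < length (tb t)" "x \<in> unit_ivl" for t j x
  proof -
    obtain k x' where k: "k < length (tt t)" "x' \<in> unit_ivl"
        "emb (length (tb t)) j x = emb (length (tt t)) k x'" and
        st: "ustep_at \<Delta> sh t j k (0, tb t ! j, x) (0 - sh (tt t ! k), tt t ! k, x')"
      using ustep_up[OF t] by metis
    have "((0, tb t ! j, x), (0 - sh (tt t ! k), tt t ! k, x')) \<in> (ustep \<Delta> sh)\<^sup>*"
      using st by (auto simp: ustep_def)
    then show ?thesis using waddr_ustep[of 0 "tb t ! j" x] k t in_W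
      by (simp add: taddr_def glue_emb)
  qed
  ultimately show ?thesis by (simp add: addressing_def)
qed

text \<open>The equations determine the addresses by induction from the top of the frame. The effect
  of an operation on diagrams is therefore computed by exhibiting functions that satisfy them,
  without following trajectories.\<close>

lemma addressing_unique:
  assumes A: "addressing \<Delta> sh A B"
  shows "e \<in> W \<Longrightarrow> x \<in> unit_ivl \<Longrightarrow> waddr \<Delta> sh e x = A e x"
    "t \<in> T \<Longrightarrow> y \<in> unit_ivl \<Longrightarrow> taddr \<Delta> sh t y = B t y"
proof -
  note AA = A[unfolded addressing_def] addressing_addr[of sh, unfolded addressing_def]
  show W: "waddr \<Delta> sh e x = A e x" if "e \<in> W" "x \<in> unit_ivl" for e x
    using that
  proof (induction e arbitrary: x rule: wf_induct_rule[OF wf_wire_up(2)])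
    case (1 e)
    from \<open>e \<in> W\<close> show ?case
    proof (cases rule: top_cases)
      case (frame k)
      then show ?thesis using AA 1 by simp
    next
      case (trans t j)
      obtain k x' where k: "k < length (tt t)" "x' \<in> unit_ivl"
          "emb (length (tb t)) j x = emb (length (tt t)) k x'"
        using ustep_up[OF trans(1,2) 1(3)] by metis
      have "(tt t ! k, e) \<in> wire_up\<inverse>" using trans k by (auto simp: wire_up_def intro!: bexI[of _ t])
      then have "waddr \<Delta> sh (tt t ! k) x' = A (tt t ! k) x'" using 1(1) k trans in_W by blast
      then show ?thesis using AA trans k 1(3) by simp
    qed
  qed
  show "taddr \<Delta> sh t y = B t y" if t: "t \<in> T" and y: "y \<in> unit_ivl"
  proof -
    obtain k x where "k < length (tt t)" "x \<in> unit_ivl" "y = emb (length (tt t)) k x"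
      using emb_surj[OF _ y, of "length (tt t)"] nonempty[OF t] by auto
    then show ?thesis using AA t W in_W by simp
  qed
qed

lemma flow_emb:
  "k < length fb \<Longrightarrow> x \<in> unit_ivl \<Longrightarrow>
    flow \<Delta> sh (emb (length fb) k x) = waddr \<Delta> sh (fb ! k) x - of_int (sh (fb ! k))"
  by (simp add: flow_def glue_emb)

lemma addr_simps:
  "k < length ft \<Longrightarrow> x \<in> unit_ivl \<Longrightarrow> waddr \<Delta> sh (ft ! k) x = emb (length ft) k x"
  "t \<in> T \<Longrightarrow> j < length (tb t) \<Longrightarrow> x \<in> unit_ivl \<Longrightarrow>
     waddr \<Delta> sh (tb t ! j) x = taddr \<Delta> sh t (emb (length (tb t)) j x)"
  "t \<in> T \<Longrightarrow> k < length (tt t) \<Longrightarrow> x \<in> unit_ivl \<Longrightarrow>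
     taddr \<Delta> sh t (emb (length (tt t)) k x) = waddr \<Delta> sh (tt t ! k) x - of_int (sh (tt t ! k))"
  using addressing_addr[of sh] by (auto simp: addressing_def)

lemma ustep_target: "((n, e, x), (n', e', x')) \<in> (ustep \<Delta> sh)\<^sup>* \<Longrightarrow> e \<in> W \<Longrightarrow> x \<in> unit_ivl \<Longrightarrow> e' \<in> W \<and> x' \<in> unit_ivl"
  by (erule rtranclE) (auto simp: ustep_def ustep_at_def in_W)

lemma ustep_no_shift: "((n, e, x), (n', e', x')) \<in> (ustep \<Delta> (\<lambda>_. 0))\<^sup>* \<Longrightarrow> n' = n"
  by (induction "(n', e', x')" arbitrary: n' e' x' rule: rtrancl_induct)
    (auto simp: ustep_def ustep_at_def)

text \<open>Both points flow to the same point of the top side. The flow is also deterministic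
  backwards, so the descent from that point is a single trajectory, on which both points
  lie.\<close>

lemma same_addr_comparable:
  assumes "e \<in> W" "x \<in> unit_ivl" "f \<in> W" "y \<in> unit_ivl"
    and eq: "waddr \<Delta> (\<lambda>_. 0) e x = waddr \<Delta> (\<lambda>_. 0) f y"
  shows "((0, e, x), (0, f, y)) \<in> (ustep \<Delta> (\<lambda>_. 0))\<^sup>* \<or> ((0, f, y), (0, e, x)) \<in> (ustep \<Delta> (\<lambda>_. 0))\<^sup>*"
proof -
  let ?U = "ustep \<Delta> (\<lambda>_. 0)"
  obtain n k u m i v where *: "k < length ft" "u \<in> unit_ivl" "((0, e, x), (n, ft ! k, u)) \<in> ?U\<^sup>*"
    "waddr \<Delta> (\<lambda>_. 0) e x = of_int n + emb (length ft) k u"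
    "i < length ft" "v \<in> unit_ivl" "((0, f, y), (m, ft ! i, v)) \<in> ?U\<^sup>*"
    "waddr \<Delta> (\<lambda>_. 0) f y = of_int m + emb (length ft) i v"
    using reaches_waddr[OF assms(1,2), of "\<lambda>_. 0" 0] reaches_waddr[OF assms(3,4), of "\<lambda>_. 0" 0]
    unfolding reaches_def by auto
  have "n = 0" "m = 0" using ustep_no_shift[OF *(3)] ustep_no_shift[OF *(7)] by auto
  then have "k = i" "u = v" using * eq by (auto simp: emb_eq_iff)
  then have "((n, ft ! k, u), (0, e, x)) \<in> (?U\<inverse>)\<^sup>*" "((n, ft ! k, u), (0, f, y)) \<in> (?U\<inverse>)\<^sup>*"
    using * \<open>n = 0\<close> \<open>m = 0\<close> by (auto simp: rtrancl_converse)
  from single_valued_confluent[OF ustep_single_valued_converse this] show ?thesis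
    by (auto simp: rtrancl_converse)
qed

end

abbreviation "flow0 \<Delta> \<equiv> flow \<Delta> (\<lambda>_. 0)"
abbreviation "waddr0 \<Delta> \<equiv> waddr \<Delta> (\<lambda>_. 0)"
abbreviation "taddr0 \<Delta> \<equiv> taddr \<Delta> (\<lambda>_. 0)"

context diag
begin

lemma waddr0_in:
  assumes "e \<in> W" "x \<in> unit_ivl" shows "waddr0 \<Delta> e x \<in> unit_ivl"
proof -
  have "reaches \<Delta> (\<lambda>_. 0) (0, e, x) (waddr0 \<Delta> e x)"
    using reaches_waddr[OF assms, of "\<lambda>_. 0" 0] by simp
  then show ?thesis by (auto simp: reaches_def dest!: ustep_no_shift dest: emb_in)
qed

lemma taddr0_in:
  assumes "t \<in> T" "y \<in> unit_ivl" shows "taddr0 \<Delta> t y \<in> unit_ivl"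
proof -
  obtain k x where "k < length (tt t)" "x \<in> unit_ivl" "y = emb (length (tt t)) k x"
    using emb_surj[OF _ assms(2), of "length (tt t)"] nonempty[OF assms(1)] by auto
  then show ?thesis using waddr0_in[OF in_W(2)] assms(1) by (auto simp: addr_simps)
qed

lemma flow0_emb:
  "k < length fb \<Longrightarrow> x \<in> unit_ivl \<Longrightarrow> flow0 \<Delta> (emb (length fb) k x) = waddr0 \<Delta> (fb ! k) x"
  by (simp add: flow_emb)

lemma waddr0_eq_trace:
  assumes "((0, e, x), (0, f, y)) \<in> (ustep \<Delta> (\<lambda>_. 0))\<^sup>*" "e \<in> W" "x \<in> unit_ivl"
  shows "waddr0 \<Delta> e x = waddr0 \<Delta> f y"
  using waddr_ustep[OF assms(1)] ustep_target[OF assms] assms by auto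

lemma flow0_bij:
  assumes "fb \<noteq> []" shows "bij_betw (flow0 \<Delta>) unit_ivl unit_ivl"
proof (rule bij_betw_imageI)
  show "inj_on (flow0 \<Delta>) unit_ivl"
  proof (rule inj_onI)
    fix y y' assume "y \<in> unit_ivl" "y' \<in> unit_ivl" and eq: "flow0 \<Delta> y = flow0 \<Delta> y'"
    then obtain k x k' x' where *: "k < length fb" "x \<in> unit_ivl" "y = emb (length fb) k x"
        "k' < length fb" "x' \<in> unit_ivl" "y' = emb (length fb) k' x'"
      using emb_surj[of "length fb"] assms by (metis length_greater_0_conv)
    then have "waddr0 \<Delta> (fb ! k) x = waddr0 \<Delta> (fb ! k') x'" using eq by (simp add: flow0_emb)
    \<comment> \<open>The points are on one trajectory, and nothing flows into a point of the bottom
      side; so they coincide.\<close>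
    from same_addr_comparable[OF _ _ _ _ this] have "(0::int, fb ! k, x) = (0, fb ! k', x')"
      using * in_W no_ustep_to_bottom by (auto elim: rtranclE)
    then show "y = y'" using * bottoms(1) by (simp add: nth_eq_iff_index_eq)
  qed
  show "flow0 \<Delta> ` unit_ivl = unit_ivl"
  proof (intro equalityI subsetI)
    fix z assume "z \<in> flow0 \<Delta> ` unit_ivl"
    then obtain y where "y \<in> unit_ivl" "z = flow0 \<Delta> y" by auto
    moreover obtain k x where "k < length fb" "x \<in> unit_ivl" "y = emb (length fb) k x"
      using emb_surj[OF _ \<open>y \<in> unit_ivl\<close>, of "length fb"] assms by auto
    ultimately show "z \<in> unit_ivl" using waddr0_in in_W by (simp add: flow0_emb)
  next
    fix a :: real assume a: "a \<in> unit_ivl"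
    \<comment> \<open>A point entering at the bottom has to arrive somewhere.\<close>
    have "ft \<noteq> []"
    proof
      assume "ft = []"
      then have "\<nexists>a. reaches \<Delta> (\<lambda>_. 0) (0, fb ! 0, 0) a" by (auto simp: reaches_def)
      then show False using reaches_exists[of "fb ! 0" 0] in_W(4)[of 0] assms by auto
    qed
    then obtain k x where k: "k < length ft" "x \<in> unit_ivl" "a = emb (length ft) k x"
      using emb_surj[OF _ a, of "length ft"] by auto
    obtain n i y where i: "i < length fb" "y \<in> unit_ivl"
      "((n, fb ! i, y), (0, ft ! k, x)) \<in> (ustep \<Delta> (\<lambda>_. 0))\<^sup>*"
      using comes_from_bottom[OF in_W(3)[OF k(1)] k(2), of 0 "\<lambda>_. 0"] by blast
    then have "n = 0" using ustep_no_shift by blast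
    then have "waddr0 \<Delta> (fb ! i) y = a"
      using waddr0_eq_trace[of "fb ! i" y] i k in_W by (simp add: addr_simps)
    then have "a = flow0 \<Delta> (emb (length fb) i y)" using i by (simp add: flow0_emb)
    then show "a \<in> flow0 \<Delta> ` unit_ivl" using emb_in i by blast
  qed
qed

end

section \<open>Invariants of braided diagrams\<close>

definition positive :: "('a list \<times> 'a list) set \<Rightarrow> 'a diagram \<Rightarrow> nat \<Rightarrow> bool" where
  "positive \<R> \<Delta> t \<longleftrightarrow> (word_on \<Delta> (ttop \<Delta> t), word_on \<Delta> (tbot \<Delta> t)) \<in> \<R>"

definition tsign :: "('a list \<times> 'a list) set \<Rightarrow> 'a diagram \<Rightarrow> nat \<Rightarrow> int" where
  "tsign \<R> \<Delta> t = (if positive \<R> \<Delta> t then 1 else - 1)"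

type_synonym 'a letter = "('a list \<times> 'a list) \<times> (real \<Rightarrow> real)"

text \<open>
  The letter of a transistor consists of its relation and of the place it occupies in the top side
  of the frame.
\<close>

definition tletter :: "('a list \<times> 'a list) set \<Rightarrow> 'a diagram \<Rightarrow> nat \<Rightarrow> 'a letter" where
  "tletter \<R> \<Delta> t =
     (if positive \<R> \<Delta> t then (word_on \<Delta> (ttop \<Delta> t), word_on \<Delta> (tbot \<Delta> t))
      else (word_on \<Delta> (tbot \<Delta> t), word_on \<Delta> (ttop \<Delta> t)), restrict (taddr0 \<Delta> t) unit_ivl)"

definition overlap :: "'a letter \<Rightarrow> 'a letter \<Rightarrow> bool" where
  "overlap x y \<longleftrightarrow> (\<exists>u\<in>unit_ivl. \<exists>v\<in>unit_ivl. snd x u = snd y v)"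

definition coeff :: "('a list \<times> 'a list) set \<Rightarrow> 'a diagram \<Rightarrow> 'a letter list \<Rightarrow> int" where
  "coeff \<R> \<Delta> = chain_coeff (transistors \<Delta>) ((below \<Delta>)\<^sup>+) (tletter \<R> \<Delta>) (tsign \<R> \<Delta>)"

lemma snd_tletter: "u \<in> unit_ivl \<Longrightarrow> snd (tletter \<R> \<Delta> t) u = taddr0 \<Delta> t u"
  by (simp add: tletter_def)

context diag
begin

lemma ustep_trancl_below:
  assumes "((n, tb t ! j, x), (m, e, y)) \<in> (ustep \<Delta> sh)\<^sup>+" "t \<in> T" "j < length (tb t)"
  shows "\<exists>t'\<in>T. e \<in> set (tt t') \<and> (t, t') \<in> (below \<Delta>)\<^sup>*"
  using assms(1)
proof (induction "(m, e, y)" arbitrary: m e y rule: trancl_induct)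
  case base
  then obtain t' j' k' where "ustep_at \<Delta> sh t' j' k' (n, tb t ! j, x) (m, e, y)" by (auto simp: ustep_def)
  then obtain u where u: "t' \<in> T" "j' < length (tb t')" "k' < length (tt t')" "tb t ! j = tb t' ! j'" "e = tt t' ! k'"
    by (auto elim: ustep_atE)
  then have "t' = t" using tb_unique[OF u(1) assms(2) u(2) assms(3)] by simp
  then show ?case using u by (intro bexI[of _ t]) auto
next
  case (step s)
  obtain n1 e1 x1 where s: "s = (n1, e1, x1)" by (cases s)
  obtain t' j' k' where "ustep_at \<Delta> sh t' j' k' (n1, e1, x1) (m, e, y)" using step(2) s by (auto simp: ustep_def)
  then have u: "t' \<in> T" "e1 \<in> set (tb t')" "e \<in> set (tt t')"
    by (auto elim!: ustep_atE)
  obtain t'' where "t'' \<in> T" "e1 \<in> set (tt t'')" "(t, t'') \<in> (below \<Delta>)\<^sup>*" using step(3)[OF s] by blast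
  then have "(t, t') \<in> (below \<Delta>)\<^sup>*" using u by (auto simp: below_def intro: rtrancl_into_rtrancl)
  then show ?case using u by blast
qed

text \<open>A trajectory crosses transistors in increasing order for \<open>below\<close>. Overlap
  of letters, a condition on functions alone, thereby becomes comparability inside the
  diagram.\<close>

lemma same_taddr_comparable:
  assumes t: "t \<in> T" "u \<in> unit_ivl" and s: "s \<in> T" "v \<in> unit_ivl"
    and eq: "taddr0 \<Delta> t u = taddr0 \<Delta> s v"
  shows "t = s \<and> u = v \<or> (t, s) \<in> (below \<Delta>)\<^sup>+ \<or> (s, t) \<in> (below \<Delta>)\<^sup>+"
proof -
  have aux: "(t, s) \<in> (below \<Delta>)\<^sup>+"
    if a: "((0, tb t ! j, x), (0, tb s ! i, y)) \<in> (ustep \<Delta> (\<lambda>_. 0))\<^sup>+" "t \<in> T" "s \<in> T" "j < length (tb t)" "i < length (tb s)"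
    for t s j i x y
  proof -
    obtain t' where "t' \<in> T" "tb s ! i \<in> set (tt t')" "(t, t') \<in> (below \<Delta>)\<^sup>*"
      using ustep_trancl_below[OF a(1,2,4)] by blast
    moreover from this a have "(t', s) \<in> below \<Delta>" by (auto simp: below_def)
    ultimately show ?thesis by (meson rtrancl_into_trancl1)
  qed
  obtain j x where j: "j < length (tb t)" "x \<in> unit_ivl" "u = emb (length (tb t)) j x"
    using emb_surj[OF _ t(2), of "length (tb t)"] nonempty[OF t(1)] by auto
  obtain i y where i: "i < length (tb s)" "y \<in> unit_ivl" "v = emb (length (tb s)) i y"
    using emb_surj[OF _ s(2), of "length (tb s)"] nonempty[OF s(1)] by auto
  have "waddr0 \<Delta> (tb t ! j) x = waddr0 \<Delta> (tb s ! i) y"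
    using eq t s i j by (simp add: addr_simps)
  from same_addr_comparable[OF in_W(1)[OF t(1) j(1)] j(2) in_W(1)[OF s(1) i(1)] i(2) this]
  consider "(0::int, tb t ! j, x) = (0, tb s ! i, y)"
    | "((0, tb t ! j, x), (0, tb s ! i, y)) \<in> (ustep \<Delta> (\<lambda>_. 0))\<^sup>+"
    | "((0, tb s ! i, y), (0, tb t ! j, x)) \<in> (ustep \<Delta> (\<lambda>_. 0))\<^sup>+"
    by (metis rtranclD)
  then show ?thesis
  proof cases
    case 1
    then show ?thesis using tb_unique[OF t(1) s(1) j(1) i(1)] i j by auto
  qed (use aux t s i j in blast)+
qed

lemma in_set_W: "e \<in> set ft \<Longrightarrow> e \<in> W" "e \<in> set fb \<Longrightarrow> e \<in> W"
  "t \<in> T \<Longrightarrow> e \<in> set (tt t) \<Longrightarrow> e \<in> W" "t \<in> T \<Longrightarrow> e \<in> set (tb t) \<Longrightarrow> e \<in> W"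
  using tops(5) bottoms(5) by blast+

lemma below_tr_irrefl: "(t, t) \<notin> (below \<Delta>)\<^sup>+"
  using acyc by (auto simp: acyclic_def)

text \<open>Here the convention on presentations enters: no relation is listed in both directions,
  so the direction in which a transistor applies its relation is well defined.\<close>

lemma tsign_cases: "t \<in> T \<Longrightarrow>
    positive \<R> \<Delta> t \<and> (word_on \<Delta> (tb t), word_on \<Delta> (tt t)) \<notin> \<R> \<or>
    \<not> positive \<R> \<Delta> t \<and> (word_on \<Delta> (tb t), word_on \<Delta> (tt t)) \<in> \<R>"
  using relation[of t] pres by (auto simp: positive_def semigroup_presentation_def)

end

text \<open>Overlap makes \<open>t\<close> and \<open>s\<close> comparable already in
  \<open>\<Delta>'\<close>. Since \<open>\<rho>\<close> preserves the order, the wrong order in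
  \<open>\<Delta>'\<close> would create a cycle in \<open>\<Delta>\<close>; so preservation in one
  direction gives the equivalence.\<close>

lemma order_transfer:
  assumes "diag \<A> \<R> \<Delta>'" "diag \<A> \<R> \<Delta>"
    and pres: "\<And>t s. t \<in> transistors \<Delta>' \<Longrightarrow> s \<in> transistors \<Delta>' \<Longrightarrow> (t, s) \<in> below \<Delta>' \<Longrightarrow> (\<rho> t, \<rho> s) \<in> (below \<Delta>)\<^sup>+"
    and ts: "t \<in> transistors \<Delta>'" "s \<in> transistors \<Delta>'" and ov: "overlap (tletter \<R> \<Delta>' t) (tletter \<R> \<Delta>' s)"
    and ne: "tletter \<R> \<Delta>' t \<noteq> tletter \<R> \<Delta>' s"
  shows "(t, s) \<in> (below \<Delta>')\<^sup>+ \<longleftrightarrow> (\<rho> t, \<rho> s) \<in> (below \<Delta>)\<^sup>+"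
proof -
  interpret D': diag \<A> \<R> \<Delta>' by fact
  interpret D: diag \<A> \<R> \<Delta> by fact
  have up: "(\<rho> t, \<rho> s) \<in> (below \<Delta>)\<^sup>+" if "(t, s) \<in> (below \<Delta>')\<^sup>+" for t s
    using that
  proof (induction rule: trancl_induct)
    case (step s s')
    moreover have "(\<rho> s, \<rho> s') \<in> (below \<Delta>)\<^sup>+" using pres step D'.below_sub by auto
    ultimately show ?case by (meson trancl_trans)
  qed (use pres D'.below_sub in auto)
  obtain u v where uv: "u \<in> unit_ivl" "v \<in> unit_ivl" "taddr0 \<Delta>' t u = taddr0 \<Delta>' s v"
    using ov by (metis overlap_def snd_tletter)
  have "(t, s) \<in> (below \<Delta>')\<^sup>+ \<or> (s, t) \<in> (below \<Delta>')\<^sup>+"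
    using D'.same_taddr_comparable[OF ts(1) uv(1) ts(2) uv(2,3)] ne by auto
  then show ?thesis using up D.below_tr_irrefl by (meson trancl_trans)
qed

lemma rename_along_nth:
  assumes "distinct es" "length es = length es'" "i < length es"
  shows "rename_along es es' f (es ! i) = es' ! i"
  using assms by (simp add: rename_along_def map_of_zip_nth)

lemma rename_along_other:
  assumes "length es = length es'" "e \<notin> set es"
  shows "rename_along es es' f e = f e"
proof -
  have "map_of (zip es es') e = None" using assms by (simp add: map_of_zip_is_None)
  then show ?thesis by (simp add: rename_along_def)
qed

definition same_invariants :: "('a list \<times> 'a list) set \<Rightarrow> 'a diagram \<Rightarrow> 'a diagram \<Rightarrow> bool" where
  "same_invariants \<R> \<Delta> \<Delta>' \<longleftrightarrow> (\<forall>y\<in>unit_ivl. flow0 \<Delta> y = flow0 \<Delta>' y) \<and>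
     (\<forall>xs. walk overlap xs \<longrightarrow> coeff \<R> \<Delta> xs = coeff \<R> \<Delta>' xs)"

section \<open>Invariance under the deletion of a dipole\<close>

locale dipole_diag = diag +
  fixes t1 t2 assumes dip: "dipole \<Delta> t1 t2"
begin

definition "\<Delta>' = reduce_dipole \<Delta> t1 t2"

definition r :: "nat \<Rightarrow> nat" where
  "r = rename_along (tb t1) (tt t2) (\<lambda>e. e)"

lemma t12: "t1 \<in> T" "t2 \<in> T" "(t1, t2) \<in> below \<Delta>" "tt t1 = tb t2" "word_on \<Delta> (tt t2) = word_on \<Delta> (tb t1)"
  using dip by (auto simp: dipole_def below_def)

lemma t12_ne: "t1 \<noteq> t2"
  using t12(3) below_tr_irrefl by auto

lemma len: "length (tb t1) = length (tt t2)"
  using t12(5) by (metis length_map word_on_def)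

lemma r_nth: "j < length (tb t1) \<Longrightarrow> r (tb t1 ! j) = tt t2 ! j"
  unfolding r_def using tops(2)[OF t12(1)] len by (simp add: rename_along_nth)

lemma r_other: "e \<notin> set (tb t1) \<Longrightarrow> r e = e"
  unfolding r_def using len by (simp add: rename_along_other)

lemma r_image: "r ` set (tb t1) = set (tt t2)"
proof -
  have "map r (tb t1) = tt t2" by (rule nth_equalityI) (auto simp: len r_nth)
  then show ?thesis by (metis set_map)
qed

lemma label_r: "label \<Delta> (r e) = label \<Delta> e"
proof (cases "e \<in> set (tb t1)")
  case True
  then obtain j where j: "j < length (tb t1)" "e = tb t1 ! j" by (auto simp: in_set_conv_nth)
  then show ?thesis using t12(5) len by (auto simp: r_nth word_on_def list_eq_iff_nth_eq)
qed (simp add: r_other)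

lemma \<Delta>'_simps:
  "wires \<Delta>' = W - set (tt t1) - set (tb t1)" "label \<Delta>' = label \<Delta>" "transistors \<Delta>' = T - {t1, t2}"
  "ttop \<Delta>' = (\<lambda>t. map r (tt t))" "tbot \<Delta>' = tb" "ftop \<Delta>' = ft" "fbot \<Delta>' = map r fb"
  by (simp_all add: \<Delta>'_def reduce_dipole_def r_def Let_def)

lemma word_r: "word_on \<Delta> (map r es) = word_on \<Delta> es" "word_on \<Delta>' es = word_on \<Delta> es"
  by (simp_all add: word_on_def \<Delta>'_simps label_r)

lemma tb1_tt2: "set (tb t1) \<inter> set (tt t2) = {}"
proof (rule ccontr)
  assume "\<not> ?thesis"
  then have "(t2, t1) \<in> below \<Delta>" using t12 by (auto simp: below_def)
  then show False using t12(3) below_tr_irrefl by (meson r_into_trancl' trancl_trans)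
qed

lemma tb1_tt1: "set (tb t1) \<inter> set (tt t1) = {}"
  using tops(4)[OF t12(1,2) t12_ne] t12(4) by simp

text \<open>\<open>r\<close> moves the wires below \<open>t1\<close> onto those above
  \<open>t2\<close>, so it becomes injective once the latter are removed from its domain.\<close>

lemma r_inj: "inj_on r (W - set (tt t2))"
proof (rule inj_onI)
  fix e e' assume *: "e \<in> W - set (tt t2)" "e' \<in> W - set (tt t2)" "r e = r e'"
  consider "e \<in> set (tb t1)" "e' \<in> set (tb t1)" | "e \<in> set (tb t1)" "e' \<notin> set (tb t1)"
    | "e \<notin> set (tb t1)" "e' \<in> set (tb t1)" | "e \<notin> set (tb t1)" "e' \<notin> set (tb t1)" by blast
  then show "e = e'"
  proof cases
    case 1
    then obtain i j where "i < length (tb t1)" "e = tb t1 ! i" "j < length (tb t1)" "e' = tb t1 ! j"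
      by (metis in_set_conv_nth)
    then show ?thesis using *(3) bottoms(2)[OF t12(2)] len by (simp add: r_nth nth_eq_iff_index_eq)
  next
    case 2
    then show ?thesis using * r_image r_other[of e'] by auto
  next
    case 3
    then show ?thesis using * r_image r_other[of e] by (metis DiffD2 image_eqI)
  qed (use * r_other in auto)
qed

lemma bottoms_sub:
  "set fb \<subseteq> W - set (tt t2)" "set fb \<inter> set (tt t1) = {}"
  "t \<in> T - {t1, t2} \<Longrightarrow> set (tt t) \<subseteq> W - set (tt t2)" "t \<in> T - {t1, t2} \<Longrightarrow> set (tt t) \<inter> set (tt t1) = {}"
proof -
  show "set fb \<subseteq> W - set (tt t2)" "set fb \<inter> set (tt t1) = {}"
    using bottoms(3)[OF t12(2)] bottoms(3)[OF t12(1)] bottoms(5) by blast+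
  assume t: "t \<in> T - {t1, t2}"
  then have "t \<in> T" "t \<noteq> t1" "t \<noteq> t2" by auto
  then show "set (tt t) \<subseteq> W - set (tt t2)" "set (tt t) \<inter> set (tt t1) = {}"
    using bottoms(4)[of t t1] bottoms(4)[of t t2] t12 bottoms(5) by blast+
qed

lemma r_disjoint:
  assumes "X \<subseteq> W - set (tt t2)" "Y \<subseteq> W - set (tt t2)" "X \<inter> Y = {}" shows "r ` X \<inter> r ` Y = {}"
  using inj_on_image_Int[OF r_inj assms(1,2)] assms(3) by simp

lemma r_cover: "r ` (W - set (tt t2) - set (tt t1)) = W - set (tt t1) - set (tb t1)"
proof -
  have sub: "set (tb t1) \<subseteq> W" "set (tt t2) \<subseteq> W" using tops(5) bottoms(5) t12 by blast+
  have "set (tt t2) \<inter> set (tt t1) = {}" using bottoms(4)[OF t12(2,1)] t12_ne by auto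
  have "W - set (tt t2) - set (tt t1) = set (tb t1) \<union> (W - set (tt t2) - set (tt t1) - set (tb t1))"
    using sub tb1_tt2 tb1_tt1 by blast
  then have "r ` (W - set (tt t2) - set (tt t1)) = r ` set (tb t1) \<union> r ` (W - set (tt t2) - set (tt t1) - set (tb t1))"
    by (metis image_Un)
  also have "r ` (W - set (tt t2) - set (tt t1) - set (tb t1)) = W - set (tt t2) - set (tt t1) - set (tb t1)"
    by (rule image_cong[OF refl r_other, THEN trans]) auto
  finally have eq: "r ` (W - set (tt t2) - set (tt t1)) =
      set (tt t2) \<union> (W - set (tt t2) - set (tt t1) - set (tb t1))" by (simp only: r_image)
  have "x \<in> set (tt t2) \<union> (W - set (tt t2) - set (tt t1) - set (tb t1)) \<longleftrightarrow> x \<in> W - set (tt t1) - set (tb t1)" for x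
    using sub tb1_tt2 \<open>set (tt t2) \<inter> set (tt t1) = {}\<close> by auto
  then show ?thesis unfolding eq by blast
qed

text \<open>A joined wire replaces a passage through the dipole: in \<open>\<Delta>\<close> it was
  the path from \<open>t\<close> to \<open>t1\<close>, \<open>t2\<close> and \<open>s\<close>. Hence
  the transitive closure.\<close>

lemma below': "(t, s) \<in> below \<Delta>' \<Longrightarrow> (t, s) \<in> (below \<Delta>)\<^sup>+"
proof -
  assume "(t, s) \<in> below \<Delta>'"
  then obtain e where e: "t \<in> T" "s \<in> T" "e \<in> set (tt t)" "r e \<in> set (tb s)"
    by (auto simp: below_def \<Delta>'_simps)
  show ?thesis
  proof (cases "e \<in> set (tb t1)")
    case True
    then have "(t, t1) \<in> below \<Delta>" using e t12 by (auto simp: below_def)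
    moreover have "r e \<in> set (tt t2)" using True r_image by blast
    then have "(t2, s) \<in> below \<Delta>" using e t12 by (auto simp: below_def)
    ultimately show ?thesis using t12(3) by (meson trancl.intros)
  next
    case False
    then have "(t, s) \<in> below \<Delta>" using e r_other by (auto simp: below_def)
    then show ?thesis by auto
  qed
qed

lemma diag': "diag \<A> \<R> \<Delta>'"
proof
  show "semigroup_presentation \<A> \<R>" by (rule pres)
  have T': "t \<in> T" "t \<noteq> t1" "t \<noteq> t2" if "t \<in> transistors \<Delta>'" for t using that by (auto simp: \<Delta>'_simps)
  have fin': "finite (transistors \<Delta>')" "finite (wires \<Delta>')" using fin by (auto simp: \<Delta>'_simps)
  have "set fb \<union> (\<Union>t\<in>T - {t1, t2}. set (tt t)) = W - set (tt t2) - set (tt t1)"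
  proof -
    have "set fb \<union> (\<Union>t\<in>T - {t1, t2}. set (tt t)) \<union> set (tt t1) \<union> set (tt t2) = W"
      using bottoms(5) t12 by blast
    moreover have "(set fb \<union> (\<Union>t\<in>T - {t1, t2}. set (tt t))) \<inter> (set (tt t1) \<union> set (tt t2)) = {}"
      using bottoms_sub by fast
    ultimately show ?thesis by auto
  qed
  then have cover: "set (fbot \<Delta>') \<union> (\<Union>t\<in>transistors \<Delta>'. set (ttop \<Delta>' t)) = wires \<Delta>'"
    using r_cover by (simp add: \<Delta>'_simps image_Un[symmetric] image_UN[symmetric])
  have bot: "mset (fbot \<Delta>') + (\<Sum>t\<in>transistors \<Delta>'. mset (ttop \<Delta>' t)) = mset_set (wires \<Delta>')"
  proof (subst attachment_iff[OF fin'], intro conjI ballI impI cover)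
    show "distinct (fbot \<Delta>')"
      using bottoms(1) inj_on_subset[OF r_inj bottoms_sub(1)] by (simp add: \<Delta>'_simps distinct_map)
    fix t assume t: "t \<in> transistors \<Delta>'"
    then have sub: "set (tt t) \<subseteq> W - set (tt t2)" using bottoms_sub(3) by (simp add: \<Delta>'_simps)
    show "distinct (ttop \<Delta>' t)"
      using bottoms(2)[of t] T'[OF t] inj_on_subset[OF r_inj sub] by (simp add: \<Delta>'_simps distinct_map)
    show "set (ttop \<Delta>' t) \<inter> set (fbot \<Delta>') = {}"
      using r_disjoint[OF sub bottoms_sub(1)] bottoms(3)[of t] T'[OF t] by (simp add: \<Delta>'_simps)
    fix s assume s: "s \<in> transistors \<Delta>'" "t \<noteq> s"
    then have sub': "set (tt s) \<subseteq> W - set (tt t2)" using bottoms_sub(3) by (simp add: \<Delta>'_simps)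
    show "set (ttop \<Delta>' t) \<inter> set (ttop \<Delta>' s) = {}"
      using r_disjoint[OF sub sub'] bottoms(4)[of t s] T'[OF t] T'[OF s(1)] s by (simp add: \<Delta>'_simps)
  qed
  have top: "mset (ftop \<Delta>') + (\<Sum>t\<in>transistors \<Delta>'. mset (tbot \<Delta>' t)) = mset_set (wires \<Delta>')"
  proof (subst attachment_iff[OF fin'], intro conjI ballI impI)
    show "distinct (ftop \<Delta>')" using tops(1) by (simp add: \<Delta>'_simps)
    fix t assume t: "t \<in> transistors \<Delta>'"
    show "distinct (tbot \<Delta>' t)" "set (tbot \<Delta>' t) \<inter> set (ftop \<Delta>') = {}"
      using tops(2,3)[of t] T'[OF t] by (simp_all add: \<Delta>'_simps)
    fix s assume s: "s \<in> transistors \<Delta>'" "t \<noteq> s"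
    show "set (tbot \<Delta>' t) \<inter> set (tbot \<Delta>' s) = {}"
      using tops(4)[of t s] T'[OF t] T'[OF s(1)] s by (simp add: \<Delta>'_simps)
  next
    have "set ft \<union> (\<Union>t\<in>T - {t1, t2}. set (tb t)) \<union> set (tb t1) \<union> set (tb t2) = W"
      using tops(5) t12 by blast
    moreover have "set ft \<inter> (set (tb t1) \<union> set (tb t2)) = {}" using tops(3) t12 by blast
    moreover have "set (tb t) \<inter> (set (tb t1) \<union> set (tb t2)) = {}" if "t \<in> T - {t1, t2}" for t
      using tops(4)[of t t1] tops(4)[of t t2] that t12 by blast
    ultimately show "set (ftop \<Delta>') \<union> (\<Union>t\<in>transistors \<Delta>'. set (tbot \<Delta>' t)) = wires \<Delta>'"
      unfolding \<Delta>'_simps t12(4) by blast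
  qed
  \<comment> \<open>A diagram must keep at least one wire; those above \<open>t2\<close> survive the
    deletion.\<close>
  have "tt t2 ! 0 \<in> set (tt t2)" using nonempty(1)[OF t12(2)] by simp
  moreover have "set (tt t2) \<inter> set (tt t1) = {}" "set (tt t2) \<subseteq> W"
    using bottoms(4)[OF t12(2,1)] t12_ne bottoms(5) t12 by blast+
  ultimately have "wires \<Delta>' \<noteq> {}" using tb1_tt2 unfolding \<Delta>'_simps by blast
  moreover have "acyclic (below \<Delta>')"
  proof (rule acyclic_subset)
    show "acyclic ((below \<Delta>)\<^sup>+)" using acyc by (simp add: acyclic_def)
  qed (use below' in auto)
  moreover have "label \<Delta>' ` wires \<Delta>' \<subseteq> \<A>"
    using bd by (auto simp: \<Delta>'_simps braided_diagram_def)
  moreover have "(word_on \<Delta>' (ttop \<Delta>' t), word_on \<Delta>' (tbot \<Delta>' t)) \<in> \<R> \<or>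
      (word_on \<Delta>' (tbot \<Delta>' t), word_on \<Delta>' (ttop \<Delta>' t)) \<in> \<R>" if "t \<in> transistors \<Delta>'" for t
    using relation[OF T'(1)[OF that]] by (simp add: \<Delta>'_simps word_r)
  ultimately show "braided_diagram \<A> \<R> \<Delta>'"
    unfolding braided_diagram_def using bot top fin' by blast
qed

text \<open>The top side of \<open>t1\<close> and the bottom side of \<open>t2\<close> carry the
  same list of wires, hence the same subdivision, and the flow between the two transistors is the
  identity.\<close>

lemma taddr_t12: "y \<in> unit_ivl \<Longrightarrow> taddr0 \<Delta> t1 y = taddr0 \<Delta> t2 y"
proof -
  assume y: "y \<in> unit_ivl"
  obtain k x where "k < length (tt t1)" "x \<in> unit_ivl" "y = emb (length (tt t1)) k x"
    using emb_surj[OF _ y, of "length (tt t1)"] nonempty[OF t12(1)] by auto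
  then show ?thesis
    using t12(4) addr_simps(3)[OF t12(1), of k x "\<lambda>_. 0"] addr_simps(2)[OF t12(2), of k x "\<lambda>_. 0"] by simp
qed

lemma waddr_r: "x \<in> unit_ivl \<Longrightarrow> waddr0 \<Delta> (r e) x = waddr0 \<Delta> e x"
proof (cases "e \<in> set (tb t1)")
  case True
  assume x: "x \<in> unit_ivl"
  obtain j where j: "j < length (tb t1)" "e = tb t1 ! j" using True by (auto simp: in_set_conv_nth)
  then show ?thesis
    using x t12 len addr_simps(2)[OF t12(1) j(1) x, of "\<lambda>_. 0"] addr_simps(3)[OF t12(2), of j x "\<lambda>_. 0"]
      taddr_t12[OF emb_in[OF x]] by (simp add: r_nth)
qed (simp add: r_other)

text \<open>The addresses of \<open>\<Delta>\<close> still satisfy the equations of the smaller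
  diagram, which by uniqueness has the same addresses.\<close>

lemma addressing': "addressing \<Delta>' (\<lambda>_. 0) (waddr0 \<Delta>) (taddr0 \<Delta>)"
  by (simp add: addressing_def \<Delta>'_simps addr_simps waddr_r)

lemma taddr': "t \<in> transistors \<Delta>' \<Longrightarrow> y \<in> unit_ivl \<Longrightarrow> taddr0 \<Delta>' t y = taddr0 \<Delta> t y"
  using diag.addressing_unique(2)[OF diag' addressing'] by blast

lemma flow': "y \<in> unit_ivl \<Longrightarrow> flow0 \<Delta>' y = flow0 \<Delta> y"
proof (cases "fb = []")
  case False
  assume y: "y \<in> unit_ivl"
  interpret D': diag \<A> \<R> \<Delta>' by (rule diag')
  obtain k x where k: "k < length fb" "x \<in> unit_ivl" "y = emb (length fb) k x"
    using emb_surj[OF _ y, of "length fb"] False by auto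
  have "waddr0 \<Delta>' (fbot \<Delta>' ! k) x = waddr0 \<Delta> (fbot \<Delta>' ! k) x"
    using D'.addressing_unique(1)[OF addressing'] D'.in_W(4)[of k] k by (simp add: \<Delta>'_simps)
  then show ?thesis
    using k D'.flow0_emb[of k x] flow0_emb[of k x] by (simp add: \<Delta>'_simps waddr_r)
qed (simp add: flow_def glue_def \<Delta>'_simps)

lemma tletter': "t \<in> transistors \<Delta>' \<Longrightarrow> tletter \<R> \<Delta>' t = tletter \<R> \<Delta> t"
    and tsign': "tsign \<R> \<Delta>' t = tsign \<R> \<Delta> t"
  by (auto simp: tletter_def tsign_def positive_def \<Delta>'_simps(4,5) word_r taddr' restrict_def)

lemma tletter_t12: "tletter \<R> \<Delta> t1 = tletter \<R> \<Delta> t2" and tsign_t12: "tsign \<R> \<Delta> t2 = - tsign \<R> \<Delta> t1"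
  using tsign_cases[OF t12(1)] t12(4,5) taddr_t12
  by (auto simp: tletter_def tsign_def positive_def restrict_def)

text \<open>All wires above \<open>t1\<close> end on \<open>t2\<close>, which is therefore its only
  immediate successor.\<close>

lemma below_t1: "(t1, s) \<in> (below \<Delta>)\<^sup>+ \<longleftrightarrow> s = t2 \<or> (t2, s) \<in> (below \<Delta>)\<^sup>+"
proof -
  have "u = t2" if "(t1, u) \<in> below \<Delta>" for u
    using that t12 tops(4)[of t2 u] by (auto simp: below_def)
  then show ?thesis using t12(3)
    by (metis converse_tranclE r_into_trancl' trancl_into_trancl2)
qed

lemma coeff': assumes "walk overlap xs" shows "coeff \<R> \<Delta>' xs = coeff \<R> \<Delta> xs"
  unfolding coeff_def
proof (rule chain_transfer[where \<rho> = "\<lambda>t. t" and D = "{t1, t2}" and ov = overlap])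
  let ?cs = "chain_sum T ((below \<Delta>)\<^sup>+) (tletter \<R> \<Delta>) (tsign \<R> \<Delta>)"
  \<comment> \<open>The one successor of \<open>t1\<close> that does not succeed \<open>t2\<close>
    is \<open>t2\<close> itself. It carries the letter of \<open>t1\<close>, which the next letter
    of a walk avoids.\<close>
  have cs: "?cs xs t1 = ?cs xs t2" if w: "walk overlap (tletter \<R> \<Delta> t1 # xs)" for xs
  proof (cases xs)
    case (Cons y ys)
    then have "tletter \<R> \<Delta> t2 \<noteq> y" using w tletter_t12 by (auto simp: walk_Cons)
    then have "{s \<in> T. (t1, s) \<in> (below \<Delta>)\<^sup>+ \<and> tletter \<R> \<Delta> s = y} =
        {s \<in> T. (t2, s) \<in> (below \<Delta>)\<^sup>+ \<and> tletter \<R> \<Delta> s = y}"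
      using below_t1 by auto
    then show ?thesis using Cons by simp
  qed simp
  show "finite (transistors \<Delta>')" "T = (\<lambda>t. t) ` transistors \<Delta>' \<union> {t1, t2}"
    "(\<lambda>t. t) ` transistors \<Delta>' \<inter> {t1, t2} = {}"
    using fin t12 by (auto simp: \<Delta>'_simps)
  show "(t, s) \<in> (below \<Delta>')\<^sup>+ \<longleftrightarrow> (t, s) \<in> (below \<Delta>)\<^sup>+"
    if "t \<in> transistors \<Delta>'" "s \<in> transistors \<Delta>'" "overlap (tletter \<R> \<Delta>' t) (tletter \<R> \<Delta>' s)"
      "tletter \<R> \<Delta>' t \<noteq> tletter \<R> \<Delta>' s" for t s
    using order_transfer[OF diag' diag_axioms, of "\<lambda>t. t"] below' that by blast
  show "(\<Sum>s \<in> {s \<in> {t1, t2}. tletter \<R> \<Delta> s = x}. tsign \<R> \<Delta> s * ?cs xs s) = 0"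
    if "walk overlap (x # xs)" for x xs
  proof (cases "x = tletter \<R> \<Delta> t1")
    case True
    then have "{s \<in> {t1, t2}. tletter \<R> \<Delta> s = x} = {t1, t2}" using tletter_t12 by auto
    then show ?thesis using t12_ne tsign_t12 cs[of xs] that True by simp
  next
    case False
    then have "{s \<in> {t1, t2}. tletter \<R> \<Delta> s = x} = {}" using tletter_t12 by auto
    then show ?thesis by (simp only: sum.empty)
  qed
  show "(\<Sum>s \<in> {s \<in> {t1, t2}. (t, s) \<in> (below \<Delta>)\<^sup>+ \<and> tletter \<R> \<Delta> s = x}. tsign \<R> \<Delta> s * ?cs xs s) = 0"
    if t: "t \<in> transistors \<Delta>'" and w: "walk overlap (tletter \<R> \<Delta>' t # x # xs)" for t x xs
  proof (cases "x = tletter \<R> \<Delta> t1")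
    case True
    have ov: "overlap (tletter \<R> \<Delta> t) (tletter \<R> \<Delta> t1)" and wx: "walk overlap (x # xs)"
      using w True tletter'[OF t] by (auto simp: walk_Cons)
    have tT: "t \<in> T" "t \<noteq> t1" "t \<noteq> t2" using t by (auto simp: \<Delta>'_simps)
    obtain u v where uv: "u \<in> unit_ivl" "v \<in> unit_ivl" "taddr0 \<Delta> t u = taddr0 \<Delta> t1 v"
      using ov by (metis overlap_def snd_tletter)
    have "(t, t1) \<in> (below \<Delta>)\<^sup>+ \<or> (t1, t) \<in> (below \<Delta>)\<^sup>+"
      using same_taddr_comparable[OF tT(1) uv(1) t12(1) uv(2,3)] tT by auto
    \<comment> \<open>A transistor comparable with \<open>t1\<close> is below both members of the
      dipole or above both. They therefore enter the sum together, with opposite signs.\<close>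
    then have "(t, t1) \<in> (below \<Delta>)\<^sup>+ \<longleftrightarrow> (t, t2) \<in> (below \<Delta>)\<^sup>+"
      using t12(3) below_t1[of t] tT below_tr_irrefl by (meson trancl_into_trancl trancl_trans)
    then have "{s \<in> {t1, t2}. (t, s) \<in> (below \<Delta>)\<^sup>+ \<and> tletter \<R> \<Delta> s = x} =
        (if (t, t1) \<in> (below \<Delta>)\<^sup>+ then {t1, t2} else {})" using tletter_t12 True by auto
    then show ?thesis using t12_ne tsign_t12 cs[of xs] wx True by simp
  next
    case False
    then have "{s \<in> {t1, t2}. (t, s) \<in> (below \<Delta>)\<^sup>+ \<and> tletter \<R> \<Delta> s = x} = {}" using tletter_t12 by auto
    then show ?thesis by (simp only: sum.empty)
  qed
qed (use assms tletter' tsign' in auto)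

lemma same_invariants': "same_invariants \<R> \<Delta> \<Delta>'"
  by (simp add: same_invariants_def flow' coeff')

end

section \<open>Invariance under isomorphism\<close>

lemma diagram_iso_same_invariants:
  assumes "diag \<A> \<R> \<Delta>" "diag \<A> \<R> \<Delta>'" "diagram_iso \<Delta> \<Delta>'"
  shows "same_invariants \<R> \<Delta> \<Delta>'"
proof -
  interpret D: diag \<A> \<R> \<Delta> by fact
  interpret D': diag \<A> \<R> \<Delta>' by fact
  obtain p q where p: "bij_betw p (wires \<Delta>) (wires \<Delta>')" and q: "bij_betw q (transistors \<Delta>) (transistors \<Delta>')"
    and lab: "\<And>e. e \<in> wires \<Delta> \<Longrightarrow> label \<Delta>' (p e) = label \<Delta> e"
    and tr: "\<And>t. t \<in> transistors \<Delta> \<Longrightarrow> ttop \<Delta>' (q t) = map p (ttop \<Delta> t)"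
      "\<And>t. t \<in> transistors \<Delta> \<Longrightarrow> tbot \<Delta>' (q t) = map p (tbot \<Delta> t)"
    and fr: "ftop \<Delta>' = map p (ftop \<Delta>)" "fbot \<Delta>' = map p (fbot \<Delta>)"
    using assms(3) by (auto simp: diagram_iso_def)
  have qT: "q t \<in> transistors \<Delta>'" if "t \<in> transistors \<Delta>" for t using q that by (auto simp: bij_betw_def)
  \<comment> \<open>The addresses of \<open>\<Delta>'\<close>, pulled back along the isomorphism,
    solve the equations of \<open>\<Delta>\<close>.\<close>
  have addr: "addressing \<Delta> (\<lambda>_. 0) (\<lambda>e. waddr0 \<Delta>' (p e)) (\<lambda>t. taddr0 \<Delta>' (q t))"
    unfolding addressing_def
  proof (intro conjI allI ballI impI)
    fix k x assume "k < length (ftop \<Delta>)" "x \<in> unit_ivl"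
    then show "waddr0 \<Delta>' (p (ftop \<Delta> ! k)) x = emb (length (ftop \<Delta>)) k x"
      using D'.addr_simps(1)[of k x] by (simp add: fr)
  next
    fix t j x assume "t \<in> transistors \<Delta>" "j < length (tbot \<Delta> t)" "x \<in> unit_ivl"
    then show "waddr0 \<Delta>' (p (tbot \<Delta> t ! j)) x = taddr0 \<Delta>' (q t) (emb (length (tbot \<Delta> t)) j x)"
      using D'.addr_simps(2)[OF qT, of t j x] by (simp add: tr)
  next
    fix t k x assume "t \<in> transistors \<Delta>" "k < length (ttop \<Delta> t)" "x \<in> unit_ivl"
    then show "taddr0 \<Delta>' (q t) (emb (length (ttop \<Delta> t)) k x) = waddr0 \<Delta>' (p (ttop \<Delta> t ! k)) x - of_int 0"
      using D'.addr_simps(3)[OF qT, of t k x] by (simp add: tr)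
  qed
  have flow: "flow0 \<Delta> y = flow0 \<Delta>' y" if y: "y \<in> unit_ivl" for y
  proof (cases "fbot \<Delta> = []")
    case False
    obtain k x where k: "k < length (fbot \<Delta>)" "x \<in> unit_ivl" "y = emb (length (fbot \<Delta>)) k x"
      using emb_surj[OF _ y, of "length (fbot \<Delta>)"] False by auto
    then show ?thesis
      using D'.flow0_emb[of k x] D.flow0_emb[of k x] D.addressing_unique(1)[OF addr D.in_W(4)]
      by (simp add: fr)
  qed (simp add: flow_def glue_def fr)
  have words: "word_on \<Delta>' (ttop \<Delta>' (q t)) = word_on \<Delta> (ttop \<Delta> t)"
    "word_on \<Delta>' (tbot \<Delta>' (q t)) = word_on \<Delta> (tbot \<Delta> t)" if "t \<in> transistors \<Delta>" for t
    using lab D.in_set_W(3,4)[OF that] by (auto simp: tr[OF that] word_on_def)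
  have let_eq: "tletter \<R> \<Delta> t = tletter \<R> \<Delta>' (q t)" "tsign \<R> \<Delta> t = tsign \<R> \<Delta>' (q t)"
    if "t \<in> transistors \<Delta>" for t
    using words[OF that] D.addressing_unique(2)[OF addr that]
    by (auto simp: tletter_def tsign_def positive_def restrict_def)
  have bel: "(q t, q s) \<in> below \<Delta>'" if "(t, s) \<in> below \<Delta>" for t s
    using that qT by (fastforce simp: below_def tr)
  have "coeff \<R> \<Delta> xs = coeff \<R> \<Delta>' xs" if "walk overlap xs" for xs
    unfolding coeff_def
  proof (rule chain_transfer[where \<rho> = q and D = "{}" and ov = overlap])
    show "transistors \<Delta>' = q ` transistors \<Delta> \<union> {}" "inj_on q (transistors \<Delta>)"
      using q by (auto simp: bij_betw_def)
    show "(t, s) \<in> (below \<Delta>)\<^sup>+ \<longleftrightarrow> (q t, q s) \<in> (below \<Delta>')\<^sup>+"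
      if "t \<in> transistors \<Delta>" "s \<in> transistors \<Delta>" "overlap (tletter \<R> \<Delta> t) (tletter \<R> \<Delta> s)"
        "tletter \<R> \<Delta> t \<noteq> tletter \<R> \<Delta> s" for t s
      using order_transfer[OF assms(1,2), of q] bel that by blast
  qed (use D.fin let_eq that in auto)
  then show ?thesis using flow by (simp add: same_invariants_def)
qed

section \<open>Concatenation\<close>

locale concat_diag = D1: diag \<A> \<R> \<Delta>1 + D2: diag \<A> \<R> \<Delta>2 + D: diag \<A> \<R> "concat_diagram \<Delta>1 \<Delta>2"
  for \<A> \<R> \<Delta>1 \<Delta>2 +
  assumes glue_words: "word_on \<Delta>1 (fbot \<Delta>1) = word_on \<Delta>2 (ftop \<Delta>2)"
begin

abbreviation "\<Delta> \<equiv> concat_diagram \<Delta>1 \<Delta>2"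

definition r :: "nat \<Rightarrow> nat" where
  "r = rename_along (ftop \<Delta>2) (map (\<lambda>i. 2 * i) (fbot \<Delta>1)) (\<lambda>i. 2 * i + 1)"

lemma len: "length (fbot \<Delta>1) = length (ftop \<Delta>2)"
  using glue_words by (metis length_map word_on_def)

lemma r_nth: "k < length (ftop \<Delta>2) \<Longrightarrow> r (ftop \<Delta>2 ! k) = 2 * (fbot \<Delta>1 ! k)"
  unfolding r_def using D2.tops(1) len by (simp add: rename_along_nth)

lemma r_other: "e \<notin> set (ftop \<Delta>2) \<Longrightarrow> r e = 2 * e + 1"
  unfolding r_def using len by (simp add: rename_along_other)

lemma \<Delta>_simps:
  "transistors \<Delta> = (\<lambda>i. 2 * i) ` transistors \<Delta>1 \<union> (\<lambda>i. 2 * i + 1) ` transistors \<Delta>2"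
  "ttop \<Delta> (2 * t) = map (\<lambda>i. 2 * i) (ttop \<Delta>1 t)" "ttop \<Delta> (2 * t + 1) = map r (ttop \<Delta>2 t)"
  "tbot \<Delta> (2 * t) = map (\<lambda>i. 2 * i) (tbot \<Delta>1 t)" "tbot \<Delta> (2 * t + 1) = map r (tbot \<Delta>2 t)"
  "ftop \<Delta> = map (\<lambda>i. 2 * i) (ftop \<Delta>1)" "fbot \<Delta> = map r (fbot \<Delta>2)"
  "label \<Delta> (2 * e) = label \<Delta>1 e" "label \<Delta> (2 * e + 1) = label \<Delta>2 e"
  by (simp_all add: concat_diagram_def Let_def r_def)

lemma label_r: "label \<Delta> (r e) = label \<Delta>2 e"
proof (cases "e \<in> set (ftop \<Delta>2)")
  case True
  then obtain k where k: "k < length (ftop \<Delta>2)" "e = ftop \<Delta>2 ! k" by (auto simp: in_set_conv_nth)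
  then show ?thesis using glue_words len by (auto simp: r_nth \<Delta>_simps word_on_def list_eq_iff_nth_eq)
next
  case False
  show ?thesis unfolding r_other[OF False] \<Delta>_simps ..
qed

text \<open>Points of the lower factor first flow to its own top side, from where the flow of
  \<open>\<Delta>1\<close> takes over. Parity tells the factors apart, as in
  \<open>concat_diagram\<close>.\<close>

definition A :: "nat \<Rightarrow> real \<Rightarrow> real" where
  "A e x = (if even e then waddr0 \<Delta>1 (e div 2) x else flow0 \<Delta>1 (waddr0 \<Delta>2 (e div 2) x))"

definition B :: "nat \<Rightarrow> real \<Rightarrow> real" where
  "B t y = (if even t then taddr0 \<Delta>1 (t div 2) y else flow0 \<Delta>1 (taddr0 \<Delta>2 (t div 2) y))"

lemma A_r: "x \<in> unit_ivl \<Longrightarrow> A (r e) x = flow0 \<Delta>1 (waddr0 \<Delta>2 e x)"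
proof (cases "e \<in> set (ftop \<Delta>2)")
  case True
  assume x: "x \<in> unit_ivl"
  from True obtain k where k: "k < length (ftop \<Delta>2)" "e = ftop \<Delta>2 ! k" by (auto simp: in_set_conv_nth)
  then show ?thesis
    using x len D1.flow0_emb[of k x] D2.addr_simps(1)[of k x] by (simp add: r_nth A_def)
qed (simp add: r_other A_def)

lemma A_even: "A (2 * e) x = waddr0 \<Delta>1 e x" and B_even: "B (2 * t) x = taddr0 \<Delta>1 t x"
  and B_odd: "B (2 * t + 1) x = flow0 \<Delta>1 (taddr0 \<Delta>2 t x)"
  by (simp_all add: A_def B_def)

lemma addressing_AB: "addressing \<Delta> (\<lambda>_. 0) A B"
  unfolding addressing_def
proof (intro conjI allI ballI impI)
  fix k x assume "k < length (ftop \<Delta>)" "x \<in> unit_ivl"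
  then show "A (ftop \<Delta> ! k) x = emb (length (ftop \<Delta>)) k x"
    using D1.addr_simps(1)[of k x] by (simp add: \<Delta>_simps A_even)
next
  fix t j x assume t: "t \<in> transistors \<Delta>" "j < length (tbot \<Delta> t)" "x \<in> unit_ivl"
  show "A (tbot \<Delta> t ! j) x = B t (emb (length (tbot \<Delta> t)) j x)"
  proof -
    from t(1) consider s where "s \<in> transistors \<Delta>1" "t = 2 * s" | s where "s \<in> transistors \<Delta>2" "t = 2 * s + 1"
      by (auto simp: \<Delta>_simps)
    then show ?thesis
    proof cases
      case 1
      then show ?thesis using t(2,3) D1.addr_simps(2)[OF 1(1), of j x "\<lambda>_. 0"] by (simp add: \<Delta>_simps A_even B_even)
    next
      case 2
      then show ?thesis using t(2,3) D2.addr_simps(2)[OF 2(1), of j x "\<lambda>_. 0"]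
        by (simp only: 2 \<Delta>_simps length_map nth_map A_r B_odd)
    qed
  qed
next
  fix t k x assume t: "t \<in> transistors \<Delta>" "k < length (ttop \<Delta> t)" "x \<in> unit_ivl"
  show "B t (emb (length (ttop \<Delta> t)) k x) = A (ttop \<Delta> t ! k) x - of_int 0"
  proof -
    from t(1) consider s where "s \<in> transistors \<Delta>1" "t = 2 * s" | s where "s \<in> transistors \<Delta>2" "t = 2 * s + 1"
      by (auto simp: \<Delta>_simps)
    then show ?thesis
    proof cases
      case 1
      then show ?thesis using t(2,3) D1.addr_simps(3)[OF 1(1), of k x "\<lambda>_. 0"] by (simp add: \<Delta>_simps A_even B_even)
    next
      case 2
      have k: "k < length (ttop \<Delta>2 s)" using t(2) by (simp only: 2 \<Delta>_simps length_map)
      then show ?thesis using t(3) D2.addr_simps(3)[OF 2(1) k t(3), of "\<lambda>_. 0"]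
        by (simp only: 2 \<Delta>_simps length_map nth_map A_r B_odd) simp
    qed
  qed
qed

lemma flow_concat: assumes y: "y \<in> unit_ivl" and ne: "fbot \<Delta>2 \<noteq> []"
  shows "flow0 \<Delta> y = flow0 \<Delta>1 (flow0 \<Delta>2 y)"
proof -
  obtain k x where k: "k < length (fbot \<Delta>2)" "x \<in> unit_ivl" "y = emb (length (fbot \<Delta>2)) k x"
    using emb_surj[OF _ y, of "length (fbot \<Delta>2)"] ne by auto
  then have "flow0 \<Delta> y = A (fbot \<Delta> ! k) x"
    using D.flow0_emb[of k x] D.addressing_unique(1)[OF addressing_AB D.in_W(4)] by (simp add: \<Delta>_simps)
  also have "\<dots> = flow0 \<Delta>1 (flow0 \<Delta>2 y)" using k D2.flow0_emb[of k x] by (simp add: \<Delta>_simps A_r)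
  finally show ?thesis .
qed

lemma inT: "t \<in> transistors \<Delta>1 \<Longrightarrow> 2 * t \<in> transistors \<Delta>" "t \<in> transistors \<Delta>2 \<Longrightarrow> 2 * t + 1 \<in> transistors \<Delta>"
  unfolding \<Delta>_simps by blast+

lemma word_even: "word_on \<Delta> (map (\<lambda>i. 2 * i) es) = word_on \<Delta>1 es" and word_r: "word_on \<Delta> (map r es) = word_on \<Delta>2 es"
  by (simp_all add: word_on_def \<Delta>_simps label_r)

lemma letter_even: "t \<in> transistors \<Delta>1 \<Longrightarrow> tletter \<R> \<Delta> (2 * t) = tletter \<R> \<Delta>1 t"
    and sign_even: "tsign \<R> \<Delta> (2 * t) = tsign \<R> \<Delta>1 t"
  using D.addressing_unique(2)[OF addressing_AB inT(1)]
  by (auto simp: tletter_def tsign_def positive_def \<Delta>_simps(2,4) word_even B_even restrict_def)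

text \<open>The letters of the lower factor are moved by the flow of the upper one; when this is the
  identity they are unchanged.\<close>

lemma letter_odd:
  assumes "\<And>y. y \<in> unit_ivl \<Longrightarrow> flow0 \<Delta>1 y = y" "t \<in> transistors \<Delta>2"
  shows "tletter \<R> \<Delta> (2 * t + 1) = tletter \<R> \<Delta>2 t"
proof -
  have "taddr0 \<Delta> (2 * t + 1) y = taddr0 \<Delta>2 t y" if "y \<in> unit_ivl" for y
    using D.addressing_unique(2)[OF addressing_AB inT(2)[OF assms(2)] that] assms(1) D2.taddr0_in[OF assms(2) that]
    by (simp only: B_odd)
  then show ?thesis
    unfolding tletter_def positive_def \<Delta>_simps(3,5) word_r by (auto simp: restrict_def simp del: add_2_eq_Suc')
qed

lemma sign_odd: "tsign \<R> \<Delta> (2 * t + 1) = tsign \<R> \<Delta>2 t"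
  unfolding tsign_def positive_def \<Delta>_simps(3,5) word_r by simp

lemma below_even: "(t, s) \<in> below \<Delta>1 \<Longrightarrow> (2 * t, 2 * s) \<in> below \<Delta>"
proof -
  assume "(t, s) \<in> below \<Delta>1"
  then obtain e where e: "t \<in> transistors \<Delta>1" "s \<in> transistors \<Delta>1" "e \<in> set (ttop \<Delta>1 t)" "e \<in> set (tbot \<Delta>1 s)"
    by (auto simp: below_def)
  then have "2 * e \<in> set (ttop \<Delta> (2 * t)) \<inter> set (tbot \<Delta> (2 * s))" by (simp add: \<Delta>_simps)
  then show ?thesis using inT(1) e unfolding below_def by blast
qed

lemma below_odd: "(t, s) \<in> below \<Delta>2 \<Longrightarrow> (2 * t + 1, 2 * s + 1) \<in> below \<Delta>"
proof -
  assume "(t, s) \<in> below \<Delta>2"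
  then obtain e where e: "t \<in> transistors \<Delta>2" "s \<in> transistors \<Delta>2" "e \<in> set (ttop \<Delta>2 t)" "e \<in> set (tbot \<Delta>2 s)"
    by (auto simp: below_def)
  then have "r e \<in> set (ttop \<Delta> (2 * t + 1)) \<inter> set (tbot \<Delta> (2 * s + 1))" unfolding \<Delta>_simps by simp
  then show ?thesis using inT(2) e unfolding below_def by blast
qed

text \<open>The upper factor is closed under going up: a wire on the bottom side of a transistor of
  \<open>\<Delta>2\<close> is never one of the glued wires, so it cannot start on a transistor of
  \<open>\<Delta>1\<close>.\<close>

lemma below_from_even: "(t, s) \<in> (below \<Delta>)\<^sup>+ \<Longrightarrow> even t \<Longrightarrow> even s"
proof -
  have st: "even s" if ts: "(t, s) \<in> below \<Delta>" "even t" for t s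
  proof (rule ccontr)
    assume "odd s"
    then obtain s' where s: "s = 2 * s' + 1" by (elim oddE)
    then have s': "s' \<in> transistors \<Delta>2" using ts by (auto simp: below_def \<Delta>_simps) presburger+
    obtain t' where t: "t = 2 * t'" using ts(2) by (metis evenE)
    obtain e where e: "e \<in> set (ttop \<Delta> (2 * t'))" "e \<in> set (tbot \<Delta> (2 * s' + 1))"
      using ts unfolding below_def s t by blast
    from e(2) obtain f where f: "e = r f" "f \<in> set (tbot \<Delta>2 s')" unfolding \<Delta>_simps by auto
    then have "f \<notin> set (ftop \<Delta>2)" using D2.tops(3)[OF s'] by blast
    then have "odd e" using f r_other by simp
    then show False using e(1) by (auto simp: \<Delta>_simps)
  qed
  assume "(t, s) \<in> (below \<Delta>)\<^sup>+" "even t"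
  then show "even s" by (induction rule: trancl_induct) (use st in blast)+
qed

lemma coeff_concat:
  assumes id: "\<And>y. y \<in> unit_ivl \<Longrightarrow> flow0 \<Delta>1 y = y" and w: "walk overlap xs"
  shows "coeff \<R> \<Delta> xs = (\<Sum>k\<le>length xs. coeff \<R> \<Delta>2 (take k xs) * coeff \<R> \<Delta>1 (drop k xs))"
  unfolding coeff_def
proof (rule chain_coeff_union[where ?\<rho>1.0 = "\<lambda>i. 2 * i" and ?\<rho>2.0 = "\<lambda>i. 2 * i + 1" and ov = overlap])
  show "(\<lambda>i. 2 * i) ` transistors \<Delta>1 \<inter> (\<lambda>i. 2 * i + 1) ` transistors \<Delta>2 = {}"
    by auto presburger
  show "tletter \<R> \<Delta>1 t = tletter \<R> \<Delta> (2 * t)" if "t \<in> transistors \<Delta>1" for t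
    using letter_even[OF that] by simp
  show "tletter \<R> \<Delta>2 t = tletter \<R> \<Delta> (2 * t + 1)" if "t \<in> transistors \<Delta>2" for t
    using letter_odd[OF id that] by simp
  show "tsign \<R> \<Delta>1 t = tsign \<R> \<Delta> (2 * t)" "tsign \<R> \<Delta>2 t = tsign \<R> \<Delta> (2 * t + 1)" for t
    using sign_even sign_odd by auto
  show "(t, s) \<in> (below \<Delta>1)\<^sup>+ \<longleftrightarrow> (2 * t, 2 * s) \<in> (below \<Delta>)\<^sup>+"
    if "t \<in> transistors \<Delta>1" "s \<in> transistors \<Delta>1" "overlap (tletter \<R> \<Delta>1 t) (tletter \<R> \<Delta>1 s)"
      "tletter \<R> \<Delta>1 t \<noteq> tletter \<R> \<Delta>1 s" for t s
    using order_transfer[OF D1.diag_axioms D.diag_axioms, of "\<lambda>i. 2 * i"] below_even that by blast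
  show "(t, s) \<in> (below \<Delta>2)\<^sup>+ \<longleftrightarrow> (2 * t + 1, 2 * s + 1) \<in> (below \<Delta>)\<^sup>+"
    if "t \<in> transistors \<Delta>2" "s \<in> transistors \<Delta>2" "overlap (tletter \<R> \<Delta>2 t) (tletter \<R> \<Delta>2 s)"
      "tletter \<R> \<Delta>2 t \<noteq> tletter \<R> \<Delta>2 s" for t s
    using order_transfer[OF D2.diag_axioms D.diag_axioms, of "\<lambda>i. 2 * i + 1"] below_odd that by blast
  show no: "(2 * t, 2 * s + 1) \<notin> (below \<Delta>)\<^sup>+" for t s
    using below_from_even[of "2 * t" "2 * s + 1"] by auto
  show "(2 * t + 1, 2 * s) \<in> (below \<Delta>)\<^sup>+"
    if ts: "t \<in> transistors \<Delta>2" "s \<in> transistors \<Delta>1" and ov: "overlap (tletter \<R> \<Delta>2 t) (tletter \<R> \<Delta>1 s)" for t s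
  proof -
    \<comment> \<open>Overlap makes the pair comparable, and no transistor of
      \<open>\<Delta>1\<close> precedes one of \<open>\<Delta>2\<close>; one order remains.\<close>
    have "overlap (tletter \<R> \<Delta> (2 * t + 1)) (tletter \<R> \<Delta> (2 * s))"
      using ov letter_even[OF ts(2)] letter_odd[OF id ts(1)] by simp
    then obtain u v where uv: "u \<in> unit_ivl" "v \<in> unit_ivl" "taddr0 \<Delta> (2 * t + 1) u = taddr0 \<Delta> (2 * s) v"
      by (metis overlap_def snd_tletter)
    have "2 * t + 1 \<noteq> 2 * s" by presburger
    then show ?thesis
      using D.same_taddr_comparable[OF inT(2)[OF ts(1)] uv(1) inT(1)[OF ts(2)] uv(2,3)] no by blast
  qed
qed (use D1.fin D2.fin \<Delta>_simps(1) w in \<open>auto simp: inj_on_def\<close>)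

end

section \<open>Reduction\<close>

lemma same_invariants_refl: "same_invariants \<R> \<Delta> \<Delta>"
  and same_invariants_sym: "same_invariants \<R> \<Delta> \<Delta>' \<Longrightarrow> same_invariants \<R> \<Delta>' \<Delta>"
  and same_invariants_trans: "same_invariants \<R> \<Delta> \<Delta>' \<Longrightarrow> same_invariants \<R> \<Delta>' \<Delta>'' \<Longrightarrow> same_invariants \<R> \<Delta> \<Delta>''"
  by (auto simp: same_invariants_def)

lemma dipole_steps:
  assumes "dipole_step\<^sup>*\<^sup>* \<Delta> \<Gamma>" "diag \<A> \<R> \<Delta>"
  shows "diag \<A> \<R> \<Gamma> \<and> same_invariants \<R> \<Delta> \<Gamma> \<and> word_on \<Gamma> (ftop \<Gamma>) = word_on \<Delta> (ftop \<Delta>) \<and>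
    word_on \<Gamma> (fbot \<Gamma>) = word_on \<Delta> (fbot \<Delta>)"
  using assms
proof (induction rule: rtranclp_induct)
  case (step \<Gamma> \<Gamma>')
  obtain t1 t2 where t: "dipole \<Gamma> t1 t2" "\<Gamma>' = reduce_dipole \<Gamma> t1 t2"
    using step(2) by (auto simp: dipole_step_def)
  interpret dipole_diag \<A> \<R> \<Gamma> t1 t2
    using step t by (simp add: dipole_diag_def dipole_diag_axioms_def)
  show ?case
    using step diag' same_invariants' same_invariants_trans[of \<R> \<Delta> \<Gamma> \<Gamma>']
    by (simp add: t(2) \<Delta>'_def[symmetric] \<Delta>'_simps(6,7) word_r)
qed (simp add: same_invariants_refl)

lemma reduction_exists:
  assumes "diag \<A> \<R> \<Delta>" shows "\<exists>\<Gamma>. reduction_of \<Delta> \<Gamma>"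
  using assms
proof (induction "card (transistors \<Delta>)" arbitrary: \<Delta> rule: less_induct)
  case less
  show ?case
  proof (cases "\<exists>t1 t2. dipole \<Delta> t1 t2")
    case True
    then obtain t1 t2 where d: "dipole \<Delta> t1 t2" by blast
    interpret dipole_diag \<A> \<R> \<Delta> t1 t2
      using less d by (simp add: dipole_diag_def dipole_diag_axioms_def)
    have "card (transistors \<Delta>') < card (transistors \<Delta>)"
      using fin t12 by (intro psubset_card_mono) (auto simp: \<Delta>'_simps)
    then obtain \<Gamma> where "reduction_of \<Delta>' \<Gamma>" using less(1) diag' by blast
    moreover have "dipole_step \<Delta> \<Delta>'" using d by (auto simp: dipole_step_def \<Delta>'_def)
    ultimately show ?thesis
      unfolding reduction_of_def by (meson converse_rtranclp_into_rtranclp)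
  qed (auto simp: reduction_of_def)
qed

lemma diagram_iso_refl: "diagram_iso \<Delta> \<Delta>"
  unfolding diagram_iso_def by (intro exI[of _ "\<lambda>x. x"]) (auto simp: bij_betw_def)

lemma eq_mod_dipoles_same_invariants:
  assumes "diag \<A> \<R> \<Delta>" "diag \<A> \<R> \<Delta>'" "eq_mod_dipoles \<Delta> \<Delta>'"
  shows "same_invariants \<R> \<Delta> \<Delta>'"
proof -
  obtain \<Gamma> \<Gamma>' where "dipole_step\<^sup>*\<^sup>* \<Delta> \<Gamma>" "dipole_step\<^sup>*\<^sup>* \<Delta>' \<Gamma>'" and iso: "diagram_iso \<Gamma> \<Gamma>'"
    using assms(3) by (auto simp: eq_mod_dipoles_def reduction_of_def)
  with assms dipole_steps have "diag \<A> \<R> \<Gamma>" "diag \<A> \<R> \<Gamma>'"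
    and s: "same_invariants \<R> \<Delta> \<Gamma>" "same_invariants \<R> \<Delta>' \<Gamma>'"
    by blast+
  then have "same_invariants \<R> \<Gamma> \<Gamma>'"
    using diagram_iso_same_invariants[OF _ _ iso] by blast
  then show ?thesis using s same_invariants_sym same_invariants_trans by metis
qed

text \<open>The empty word is excluded because its coefficient is always 1.\<close>

definition trivial_invariants :: "('a list \<times> 'a list) set \<Rightarrow> 'a diagram \<Rightarrow> bool" where
  "trivial_invariants \<R> \<Delta> \<longleftrightarrow> (\<forall>y\<in>unit_ivl. flow0 \<Delta> y = y) \<and>
     (\<forall>xs. walk overlap xs \<and> xs \<noteq> [] \<longrightarrow> coeff \<R> \<Delta> xs = 0)"

lemma same_trivial_invariants: "same_invariants \<R> \<Delta> \<Delta>' \<Longrightarrow> trivial_invariants \<R> \<Delta> \<Longrightarrow> trivial_invariants \<R> \<Delta>'"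
  by (auto simp: same_invariants_def trivial_invariants_def)

section \<open>Reduced diagrams with trivial invariants\<close>

context diag
begin

lemma taddr_inj: "t \<in> T \<Longrightarrow> u \<in> unit_ivl \<Longrightarrow> v \<in> unit_ivl \<Longrightarrow> taddr0 \<Delta> t u = taddr0 \<Delta> t v \<Longrightarrow> u = v"
  using same_taddr_comparable[of t u t v] below_tr_irrefl by blast

lemma tletter_eq_taddr: "tletter \<R> \<Delta> t = tletter \<R> \<Delta> s \<Longrightarrow> y \<in> unit_ivl \<Longrightarrow> taddr0 \<Delta> t y = taddr0 \<Delta> s y"
  by (metis snd_tletter)

lemma below_overlap: "(t, s) \<in> below \<Delta> \<Longrightarrow> overlap (tletter \<R> \<Delta> t) (tletter \<R> \<Delta> s)"
proof -
  assume ts: "(t, s) \<in> below \<Delta>"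
  then obtain k j where *: "t \<in> T" "s \<in> T" "k < length (tt t)" "j < length (tb s)" "tt t ! k = tb s ! j"
    unfolding below_def by (auto simp: disjoint_iff) (metis in_set_conv_nth)
  have "taddr0 \<Delta> t (emb (length (tt t)) k 0) = taddr0 \<Delta> s (emb (length (tb s)) j 0)"
    using * addr_simps(2)[OF *(2,4), of 0 "\<lambda>_. 0"] addr_simps(3)[OF *(1,3), of 0 "\<lambda>_. 0"] by simp
  moreover have emb0: "emb m k 0 \<in> unit_ivl" for m k by (rule emb_in) simp
  ultimately show ?thesis
    unfolding overlap_def by (intro bexI[OF _ emb0] bexI[OF _ emb0]) (simp add: snd_tletter emb0 del: atLeastLessThan_iff)
qed

text \<open>Equal letters place \<open>t\<close> and \<open>s\<close> in the same way in the top
  side of the frame. Since nothing lies between them, every wire above \<open>t\<close> runs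
  directly to \<open>s\<close>, and equality of the two subdivisions puts the wires in the same
  order.\<close>

lemma same_letter_dipole:
  assumes ts: "(t, s) \<in> below \<Delta>" and eq: "tletter \<R> \<Delta> t = tletter \<R> \<Delta> s"
    and btw: "\<And>u. (t, u) \<in> (below \<Delta>)\<^sup>+ \<Longrightarrow> (u, s) \<notin> (below \<Delta>)\<^sup>+"
  shows "dipole \<Delta> t s"
proof -
  let ?m = "length (tt t)" and ?n = "length (tb s)" and ?U = "(ustep \<Delta> (\<lambda>_. 0))\<^sup>+"
  have t: "t \<in> T" and s: "s \<in> T" using ts by (auto simp: below_def)
  have direct: "\<exists>j<?n. tt t ! k = tb s ! j" if k: "k < ?m" for k
  proof -
    let ?y = "emb ?m k 0"
    have y: "?y \<in> unit_ivl" by (rule emb_in) simp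
    obtain j x where j: "j < ?n" "x \<in> unit_ivl" "?y = emb ?n j x"
      using emb_surj[OF _ y, of ?n] nonempty(2)[OF s] by auto
    have "waddr0 \<Delta> (tt t ! k) 0 = waddr0 \<Delta> (tb s ! j) x"
      using addr_simps(3)[OF t k, of 0 "\<lambda>_. 0"] addr_simps(2)[OF s j(1,2), of "\<lambda>_. 0"] j(3)
        tletter_eq_taddr[OF eq y] by simp
    from same_addr_comparable[OF in_W(2)[OF t k] _ in_W(1)[OF s j(1)] j(2) this]
    consider "(0::int, tt t ! k, 0) = (0, tb s ! j, x)"
      | "((0, tt t ! k, 0), (0, tb s ! j, x)) \<in> ?U" | "((0, tb s ! j, x), (0, tt t ! k, 0)) \<in> ?U"
      by (metis atLeastLessThan_iff order_refl rtranclD zero_less_one)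
    then show ?thesis
    proof cases
      \<comment> \<open>The trajectory leaves the wire before reaching \<open>s\<close>, through a
        transistor \<open>u\<close> strictly between \<open>t\<close> and \<open>s\<close>.\<close>
      case 2
      then obtain u i k' s' where st: "ustep_at \<Delta> (\<lambda>_. 0) u i k' (0, tt t ! k, 0) s'"
        by (auto simp: ustep_def dest!: tranclD)
      then have u: "u \<in> T" "i < length (tb u)" "tt t ! k = tb u ! i" by (auto elim: ustep_atE)
      have "((0, tb u ! i, 0), (0, tb s ! j, x)) \<in> ?U" using 2 u by simp
      then obtain t' where t': "t' \<in> T" "tb s ! j \<in> set (tt t')" "(u, t') \<in> (below \<Delta>)\<^sup>*"
        using ustep_trancl_below[OF _ u(1,2)] by blast
      have "(t, u) \<in> below \<Delta>" using belowI[OF t u(1) k u(2,3)] .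
      moreover have "(t', s) \<in> below \<Delta>" using t' s j by (auto simp: below_def)
      then have "(u, s) \<in> (below \<Delta>)\<^sup>+" using t'(3) by (meson rtrancl_into_trancl1)
      ultimately show ?thesis using btw by blast
    next
      \<comment> \<open>The trajectory passes \<open>s\<close> and then leaves \<open>t\<close>
        upwards, which closes a cycle since \<open>t\<close> is below \<open>s\<close>.\<close>
      case 3
      obtain t' where t': "t' \<in> T" "tt t ! k \<in> set (tt t')" "(s, t') \<in> (below \<Delta>)\<^sup>*"
        using ustep_trancl_below[OF 3 s j(1)] by blast
      then have "t' = t" using bottoms(4)[of t t'] t k nth_mem[of k "tt t"] by blast
      then have "(t, t) \<in> (below \<Delta>)\<^sup>+" using t'(3) ts by (meson rtrancl_into_trancl2)
      then show ?thesis using below_tr_irrefl by blast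
    qed (use j in auto)
  qed
  then obtain j where j: "\<And>k. k < ?m \<Longrightarrow> j k < ?n" "\<And>k. k < ?m \<Longrightarrow> tt t ! k = tb s ! j k" by metis
  \<comment> \<open>A common wire gives both points the same address, equal letters allow the
    comparison inside \<open>t\<close>, and \<open>taddr0\<close> is injective on
    \<open>t\<close>.\<close>
  have emb: "emb ?m k x = emb ?n (j k) x" if "k < ?m" "x \<in> unit_ivl" for k x
  proof (rule taddr_inj[OF t emb_in[OF that(2)] emb_in[OF that(2)]])
    show "taddr0 \<Delta> t (emb ?m k x) = taddr0 \<Delta> t (emb ?n (j k) x)"
      using addr_simps(3)[OF t that, of "\<lambda>_. 0"] addr_simps(2)[OF s j(1)[OF that(1)] that(2), of "\<lambda>_. 0"]
        tletter_eq_taddr[OF eq emb_in[OF that(2), of ?n "j k"]] j(2)[OF that(1)] by simp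
  qed
  have "?m = ?n" "\<And>k. k < ?m \<Longrightarrow> j k = k"
    using emb_subdivision_eq[of ?m j ?n, OF _ j(1) emb] nonempty(1)[OF t] by blast+
  then have lists: "tt t = tb s" using j by (intro nth_equalityI) auto
  \<comment> \<open>As \<open>tt t = tb s\<close>, equal signs would make the words on both sides of
    \<open>t\<close> equal, which the presentation forbids. So the signs are opposite, and the equal
    relations give the remaining two words.\<close>
  have "word_on \<Delta> (tt s) = word_on \<Delta> (tb t)"
    using eq tsign_cases[OF t] tsign_cases[OF s] lists
    by (auto simp: tletter_def positive_def split: if_splits)
  then show ?thesis using ts lists by (simp add: dipole_def)
qed

text \<open>A longest chain for \<open>below\<close> spells a word with non-zero coefficient. The
  absence of dipoles is what makes its consecutive letters distinct, so that the word is one of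
  those on which the coefficients are assumed to vanish.\<close>

lemma reduced_trivial:
  assumes red: "\<And>t1 t2. \<not> dipole \<Delta> t1 t2" and triv: "trivial_invariants \<R> \<Delta>"
  shows "T = {}"
proof (rule ccontr)
  assume "T \<noteq> {}"
  have cmp: "t = s \<or> (t, s) \<in> (below \<Delta>)\<^sup>+ \<or> (s, t) \<in> (below \<Delta>)\<^sup>+"
    if "t \<in> T" "s \<in> T" "tletter \<R> \<Delta> t = tletter \<R> \<Delta> s" for t s
    using same_taddr_comparable[OF that(1) _ that(2) _ tletter_eq_taddr[OF that(3)], of 0] by auto
  have nz: "tsign \<R> \<Delta> t \<noteq> 0" for t by (simp add: tsign_def)
  obtain f L where f: "\<And>i. i \<le> L \<Longrightarrow> f i \<in> T" "\<And>i. i < L \<Longrightarrow> (f i, f (Suc i)) \<in> below \<Delta>"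
    "\<And>a b. (a, b) \<notin> below \<Delta> ^^ Suc L"
    "chain_coeff T ((below \<Delta>)\<^sup>+) (tletter \<R> \<Delta>) (tsign \<R> \<Delta>) (map (\<lambda>i. tletter \<R> \<Delta> (f i)) [0..<Suc L]) \<noteq> 0"
  proof (rule longest_chain_coeff_nonzero[where l = "tletter \<R> \<Delta>" and \<epsilon> = "tsign \<R> \<Delta>",
        OF fin(2) \<open>T \<noteq> {}\<close> below_sub acyc cmp nz])
    fix f L
    assume "\<And>i. i \<le> L \<Longrightarrow> f i \<in> T" "\<And>i. i < L \<Longrightarrow> (f i, f (Suc i)) \<in> below \<Delta>"
      "\<And>a b. (a, b) \<notin> below \<Delta> ^^ Suc L"
      "chain_coeff T ((below \<Delta>)\<^sup>+) (tletter \<R> \<Delta>) (tsign \<R> \<Delta>) (map (\<lambda>i. tletter \<R> \<Delta> (f i)) [0..<Suc L]) \<noteq> 0"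
    then show thesis by (rule that)
  qed
  \<comment> \<open>Without a dipole there is a transistor \<open>u\<close> strictly between
    \<open>f i\<close> and \<open>f (Suc i)\<close>. The detour through \<open>u\<close> takes
    \<open>a + b\<close> steps instead of one, with \<open>a\<close> and \<open>b\<close> positive,
    and makes the path too long.\<close>
  have ne: "tletter \<R> \<Delta> (f i) \<noteq> tletter \<R> \<Delta> (f (Suc i))" if i: "i < L" for i
  proof
    assume "tletter \<R> \<Delta> (f i) = tletter \<R> \<Delta> (f (Suc i))"
    then obtain u where u: "(f i, u) \<in> (below \<Delta>)\<^sup>+" "(u, f (Suc i)) \<in> (below \<Delta>)\<^sup>+"
      using same_letter_dipole[OF f(2)[OF i]] red by blast
    have "(f 0, f i) \<in> below \<Delta> ^^ i"
      unfolding relpow_fun_conv using f(2) i by (intro exI[of _ f]) auto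
    moreover obtain a where "a > 0" "(f i, u) \<in> below \<Delta> ^^ a" using u(1) by (auto simp: trancl_power)
    moreover obtain b where "b > 0" "(u, f (Suc i)) \<in> below \<Delta> ^^ b" using u(2) by (auto simp: trancl_power)
    moreover have "(f (Suc i), f L) \<in> below \<Delta> ^^ (L - Suc i)"
      unfolding relpow_fun_conv using f(2) i by (intro exI[of _ "\<lambda>j. f (Suc i + j)"]) auto
    ultimately have path: "(f 0, f L) \<in> below \<Delta> ^^ (i + (a + (b + (L - Suc i))))" and ab: "a > 0" "b > 0"
      by (auto simp: relpow_add relcomp.simps intro!: relcompI)
    have eq: "i + (a + (b + (L - Suc i))) = Suc L + (a + b - 2)" using ab i by simp
    show False using path f(3) unfolding eq relpow_add[of "Suc L"] by blast
  qed
  have "walk overlap (map (\<lambda>i. tletter \<R> \<Delta> (f i)) [0..<Suc L])"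
    unfolding walk_def successively_conv_nth
    using ne below_overlap f(2) by (auto simp del: upt_Suc)
  then show False using triv f(4) by (auto simp: trivial_invariants_def coeff_def)
qed

text \<open>Without transistors the flow permutes the pieces of the subdivision as the wires permute
  the ends; comparing left ends shows that a trivial flow means a trivial permutation.\<close>

lemma no_transistors_frames:
  assumes "T = {}" and triv: "trivial_invariants \<R> \<Delta>"
  shows "fb = ft" "W = set fb" "distinct fb"
proof -
  have W: "set ft = W" "set fb = W" using tops(5) bottoms(5) assms(1) by auto
  have len: "length ft = length fb" using W tops(1) bottoms(1) by (metis distinct_card)
  have "fb ! k = ft ! k" if k: "k < length fb" for k
  proof -
    have "fb ! k \<in> set ft" using W k nth_mem by blast
    then obtain i where i: "i < length ft" "fb ! k = ft ! i" by (metis in_set_conv_nth)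
    have "emb (length ft) i 0 = flow0 \<Delta> (emb (length fb) k 0)"
      using flow0_emb[OF k, of 0] i addr_simps(1)[OF i(1), of 0] by simp
    also have "\<dots> = emb (length fb) k 0"
      using triv emb_in[of 0] by (auto simp: trivial_invariants_def)
    finally have "i = k" using i k len by (simp add: emb_eq_iff)
    then show ?thesis using i by simp
  qed
  then show "fb = ft" using len by (intro nth_equalityI) auto
  show "W = set fb" "distinct fb" using W bottoms(1) by auto
qed

end

lemma trivial_invariants_iso:
  assumes "diag \<A> \<R> \<Delta>" "diag \<A> \<R> \<Delta>'" "transistors \<Delta> = {}" "transistors \<Delta>' = {}"
    "trivial_invariants \<R> \<Delta>" "trivial_invariants \<R> \<Delta>'"
    and word: "word_on \<Delta> (fbot \<Delta>) = word_on \<Delta>' (fbot \<Delta>')"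
  shows "diagram_iso \<Delta> \<Delta>'"
proof -
  note 1 = diag.no_transistors_frames[OF assms(1,3,5)] and 2 = diag.no_transistors_frames[OF assms(2,4,6)]
  have len: "length (fbot \<Delta>) = length (fbot \<Delta>')" using word by (metis length_map word_on_def)
  define p where "p = rename_along (fbot \<Delta>) (fbot \<Delta>') (\<lambda>e. e)"
  have p: "p (fbot \<Delta> ! k) = fbot \<Delta>' ! k" if "k < length (fbot \<Delta>)" for k
    unfolding p_def using rename_along_nth[OF 1(3) len that] .
  have mp: "map p (fbot \<Delta>) = fbot \<Delta>'" by (rule nth_equalityI) (auto simp: len p)
  have "inj_on p (set (fbot \<Delta>))" using mp 2(3) by (metis distinct_map)
  then have "bij_betw p (wires \<Delta>) (wires \<Delta>')"
    unfolding bij_betw_def 1(2) 2(2) using mp by (metis set_map)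
  moreover have "label \<Delta>' (p e) = label \<Delta> e" if e: "e \<in> wires \<Delta>" for e
  proof -
    obtain k where "k < length (fbot \<Delta>)" "e = fbot \<Delta> ! k" using e 1(2) by (metis in_set_conv_nth)
    then show ?thesis using word len p by (auto simp: word_on_def list_eq_iff_nth_eq)
  qed
  moreover have "ftop \<Delta>' = map p (ftop \<Delta>)" using mp 1(1) 2(1) by metis
  ultimately show ?thesis
    unfolding diagram_iso_def using assms(3,4) mp
    by (intro exI[of _ p] exI[of _ "\<lambda>t. t"]) (auto simp: bij_betw_def)
qed

lemma trivial_invariants_eq_mod_dipoles:
  assumes "diag \<A> \<R> \<Delta>" "diag \<A> \<R> \<Delta>'" "trivial_invariants \<R> \<Delta>" "trivial_invariants \<R> \<Delta>'"
    and word: "word_on \<Delta> (fbot \<Delta>) = word_on \<Delta>' (fbot \<Delta>')"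
  shows "eq_mod_dipoles \<Delta> \<Delta>'"
proof -
  obtain \<Gamma> \<Gamma>' where \<Gamma>: "reduction_of \<Delta> \<Gamma>" "reduction_of \<Delta>' \<Gamma>'"
    using reduction_exists assms(1,2) by blast
  have g: "diag \<A> \<R> \<Gamma>" "trivial_invariants \<R> \<Gamma>" "word_on \<Gamma> (fbot \<Gamma>) = word_on \<Delta> (fbot \<Delta>)"
    "diag \<A> \<R> \<Gamma>'" "trivial_invariants \<R> \<Gamma>'" "word_on \<Gamma>' (fbot \<Gamma>') = word_on \<Delta>' (fbot \<Delta>')"
    using dipole_steps[of \<Delta> \<Gamma> \<A> \<R>] dipole_steps[of \<Delta>' \<Gamma>' \<A> \<R>] \<Gamma> assms same_trivial_invariants
    unfolding reduction_of_def by blast+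
  have "transistors \<Gamma> = {}" "transistors \<Gamma>' = {}"
    using diag.reduced_trivial[OF g(1) _ g(2)] diag.reduced_trivial[OF g(4) _ g(5)] \<Gamma>
    unfolding reduction_of_def by blast+
  then show ?thesis
    unfolding eq_mod_dipoles_def using \<Gamma> trivial_invariants_iso g word by metis
qed

section \<open>Simple groups of diagrams act faithfully\<close>

locale diagram_group =
  fixes \<A> :: "'a set" and \<R> :: "('a list \<times> 'a list) set" and w :: "'a list"
  assumes pres: "semigroup_presentation \<A> \<R>" and w: "w \<in> lists \<A>" "w \<noteq> []"
begin

abbreviation "rel \<equiv> dipole_rel \<A> \<R> w"
abbreviation "DG \<equiv> braided_diagram_group \<A> \<R> w"

lemma diagrams_diag: "\<Delta> \<in> diagrams \<A> \<R> u v \<Longrightarrow> diag \<A> \<R> \<Delta>"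
  using pres by (simp add: diagrams_def diag_def)

lemma diagrams_fbot: "\<Delta> \<in> diagrams \<A> \<R> w w \<Longrightarrow> fbot \<Delta> \<noteq> []"
  using w(2) by (auto simp: diagrams_def word_on_def)

lemma rel_same_invariants: "(\<Delta>, \<Delta>') \<in> rel \<Longrightarrow> same_invariants \<R> \<Delta> \<Delta>'"
  using eq_mod_dipoles_same_invariants diagrams_diag by (fastforce simp: dipole_rel_def)

lemma rel_refl: "\<Delta> \<in> diagrams \<A> \<R> w w \<Longrightarrow> (\<Delta>, \<Delta>) \<in> rel"
  using reduction_exists[OF diagrams_diag] diagram_iso_refl by (fastforce simp: dipole_rel_def eq_mod_dipoles_def)

lemma class_same_invariants:
  assumes "X \<in> carrier DG" "\<Delta> \<in> X" "\<Delta>' \<in> X" shows "same_invariants \<R> \<Delta> \<Delta>'"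
proof -
  obtain \<Delta>0 where "(\<Delta>0, \<Delta>) \<in> rel" "(\<Delta>0, \<Delta>') \<in> rel"
    using assms by (auto simp: braided_diagram_group_def quotient_def)
  then show ?thesis
    using rel_same_invariants same_invariants_sym same_invariants_trans by metis
qed

lemma class_nonempty: "X \<in> carrier DG \<Longrightarrow> X \<noteq> {}"
  using rel_refl by (auto simp: braided_diagram_group_def quotient_def)

lemma class_diagrams: "X \<in> carrier DG \<Longrightarrow> \<Delta> \<in> X \<Longrightarrow> \<Delta> \<in> diagrams \<A> \<R> w w"
  by (auto simp: braided_diagram_group_def quotient_def dipole_rel_def)

definition rep :: "'a diagram set \<Rightarrow> 'a diagram" where
  "rep X = (SOME \<Delta>. \<Delta> \<in> X)"

lemma rep_in: "X \<in> carrier DG \<Longrightarrow> rep X \<in> X"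
  using class_nonempty by (simp add: rep_def some_in_eq)

lemma rep_diagrams: "X \<in> carrier DG \<Longrightarrow> rep X \<in> diagrams \<A> \<R> w w"
  using rep_in class_diagrams by blast

lemma rep_diag: "X \<in> carrier DG \<Longrightarrow> diag \<A> \<R> (rep X)"
  using rep_diagrams diagrams_diag by blast

definition act :: "'a diagram set \<Rightarrow> real \<Rightarrow> real" where
  "act X = restrict (flow0 (rep X)) unit_ivl"

lemma act_eq: "X \<in> carrier DG \<Longrightarrow> \<Delta> \<in> X \<Longrightarrow> y \<in> unit_ivl \<Longrightarrow> act X y = flow0 \<Delta> y"
  using class_same_invariants[OF _ rep_in] by (auto simp: act_def same_invariants_def)

lemma act_Bij: "X \<in> carrier DG \<Longrightarrow> act X \<in> Bij unit_ivl"
proof -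
  assume X: "X \<in> carrier DG"
  have "bij_betw (flow0 (rep X)) unit_ivl unit_ivl"
    using diag.flow0_bij[OF rep_diag[OF X]] diagrams_fbot[OF rep_diagrams[OF X]] by blast
  then have "bij_betw (restrict (flow0 (rep X)) unit_ivl) unit_ivl unit_ivl"
    by (subst bij_betw_cong[where g = "flow0 (rep X)"]) auto
  then show ?thesis by (simp add: Bij_def act_def)
qed

text \<open>The product is a union of classes over all pairs of representatives. Once it is known to
  be a class, a member of it is related to one particular concatenation, on which the invariants can
  be computed.\<close>

lemma mult_concat:
  assumes "X \<in> carrier DG" "Y \<in> carrier DG" "X \<otimes>\<^bsub>DG\<^esub> Y \<in> carrier DG"
  obtains \<Delta>1 \<Delta>2 where "\<Delta>1 \<in> X" "\<Delta>2 \<in> Y" "concat_diag \<A> \<R> \<Delta>1 \<Delta>2"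
    "same_invariants \<R> (concat_diagram \<Delta>1 \<Delta>2) (rep (X \<otimes>\<^bsub>DG\<^esub> Y))"
proof -
  have "rep (X \<otimes>\<^bsub>DG\<^esub> Y) \<in> X \<otimes>\<^bsub>DG\<^esub> Y" using rep_in[OF assms(3)] .
  then obtain \<Delta>1 \<Delta>2 where *: "\<Delta>1 \<in> X" "\<Delta>2 \<in> Y" "(concat_diagram \<Delta>1 \<Delta>2, rep (X \<otimes>\<^bsub>DG\<^esub> Y)) \<in> rel"
    by (auto simp: braided_diagram_group_def)
  \<comment> \<open>\<open>dipole_rel\<close> relates diagrams only, so the concatenation is seen to
    be a braided diagram from its being related to the chosen representative.\<close>
  have d: "\<Delta>1 \<in> diagrams \<A> \<R> w w" "\<Delta>2 \<in> diagrams \<A> \<R> w w" "concat_diagram \<Delta>1 \<Delta>2 \<in> diagrams \<A> \<R> w w"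
    using * class_diagrams assms by (auto simp: dipole_rel_def)
  then have "concat_diag \<A> \<R> \<Delta>1 \<Delta>2"
    using diagrams_diag by (auto simp: concat_diag_def concat_diag_axioms_def diagrams_def)
  then show thesis using that * rel_same_invariants by blast
qed

lemma act_mult:
  assumes "X \<in> carrier DG" "Y \<in> carrier DG" "X \<otimes>\<^bsub>DG\<^esub> Y \<in> carrier DG"
  shows "act (X \<otimes>\<^bsub>DG\<^esub> Y) = compose unit_ivl (act X) (act Y)"
proof
  fix y
  obtain \<Delta>1 \<Delta>2 where *: "\<Delta>1 \<in> X" "\<Delta>2 \<in> Y" "concat_diag \<A> \<R> \<Delta>1 \<Delta>2"
    "same_invariants \<R> (concat_diagram \<Delta>1 \<Delta>2) (rep (X \<otimes>\<^bsub>DG\<^esub> Y))"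
    using mult_concat[OF assms] .
  interpret concat_diag \<A> \<R> \<Delta>1 \<Delta>2 by fact
  show "act (X \<otimes>\<^bsub>DG\<^esub> Y) y = compose unit_ivl (act X) (act Y) y"
  proof (cases "y \<in> unit_ivl")
    case True
    have "act Y y \<in> unit_ivl" using act_Bij[OF assms(2)] True by (auto simp: Bij_def bij_betw_def)
    have "act (X \<otimes>\<^bsub>DG\<^esub> Y) y = flow0 (concat_diagram \<Delta>1 \<Delta>2) y"
      using *(4) True by (auto simp: act_def same_invariants_def)
    also have "\<dots> = flow0 \<Delta>1 (flow0 \<Delta>2 y)"
      using flow_concat[OF True diagrams_fbot] class_diagrams assms * by blast
    also have "\<dots> = act X (act Y y)"
      using act_eq assms * True \<open>act Y y \<in> unit_ivl\<close> by metis
    finally show ?thesis using True by (simp add: compose_def)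
  qed (simp add: act_def compose_def del: atLeastLessThan_iff)
qed

lemma trivial_diagram: "trivial_diagram w \<in> diagrams \<A> \<R> w w" "trivial_invariants \<R> (trivial_diagram w)"
proof -
  let ?T = "trivial_diagram w"
  have "mset [0..<length w] = mset_set {..<length w}"
    by (metis atLeast0LessThan atLeast_upt distinct_upt mset_set_set)
  then have "braided_diagram \<A> \<R> ?T"
    using w by (auto simp: braided_diagram_def trivial_diagram_def below_def acyclic_def in_lists_conv_set)
  then show d: "?T \<in> diagrams \<A> \<R> w w"
    by (auto simp: diagrams_def word_on_def trivial_diagram_def map_nth)
  interpret diag \<A> \<R> ?T using diagrams_diag[OF d] .
  have s: "fbot ?T = [0..<length w]" "ftop ?T = [0..<length w]" "transistors ?T = {}"
    by (auto simp: trivial_diagram_def)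
  have "flow0 ?T y = y" if y: "y \<in> unit_ivl" for y
  proof -
    obtain k x where k: "k < length w" "x \<in> unit_ivl" "y = emb (length w) k x"
      using emb_surj[OF _ y, of "length w"] w by auto
    then show ?thesis using flow0_emb[of k x] addr_simps(1)[of k x "\<lambda>_. 0"] by (simp add: s)
  qed
  moreover have "coeff \<R> ?T xs = 0" if "xs \<noteq> []" for xs
    using that by (cases xs) (auto simp: coeff_def s)
  ultimately show "trivial_invariants \<R> ?T" by (simp add: trivial_invariants_def)
qed

text \<open>Any two diagrams with trivial invariants are related, and invariants are constant along
  \<open>rel\<close>; this yields both inclusions between the class and the unit.\<close>

lemma class_one:
  assumes X: "X \<in> carrier DG" and triv: "trivial_invariants \<R> (rep X)" shows "X = \<one>\<^bsub>DG\<^esub>"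
proof -
  have one: "\<one>\<^bsub>DG\<^esub> = rel `` {trivial_diagram w}" by (simp add: braided_diagram_group_def)
  obtain \<Delta>0 where X0: "X = rel `` {\<Delta>0}" "\<Delta>0 \<in> diagrams \<A> \<R> w w"
    using X by (auto simp: braided_diagram_group_def quotient_def)
  have eq: "(\<Delta>, \<Delta>') \<in> rel" if "\<Delta> \<in> diagrams \<A> \<R> w w" "\<Delta>' \<in> diagrams \<A> \<R> w w"
    "trivial_invariants \<R> \<Delta>" "trivial_invariants \<R> \<Delta>'" for \<Delta> \<Delta>'
    using that trivial_invariants_eq_mod_dipoles[OF diagrams_diag diagrams_diag, of \<Delta> w w \<Delta>' w w]
    by (auto simp: dipole_rel_def diagrams_def)
  have triv0: "trivial_invariants \<R> \<Delta>" if "\<Delta> \<in> X" for \<Delta>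
    using class_same_invariants[OF X rep_in[OF X] that] triv same_trivial_invariants by blast
  have "\<Delta>0 \<in> X" using X0 rel_refl by blast
  show ?thesis
  proof (intro equalityI subsetI)
    fix \<Delta> assume "\<Delta> \<in> X"
    then show "\<Delta> \<in> \<one>\<^bsub>DG\<^esub>" unfolding one
      using eq trivial_diagram triv0 class_diagrams[OF X] by blast
  next
    fix \<Delta> assume "\<Delta> \<in> \<one>\<^bsub>DG\<^esub>"
    then have "(trivial_diagram w, \<Delta>) \<in> rel" by (simp add: one)
    then have "\<Delta> \<in> diagrams \<A> \<R> w w" "trivial_invariants \<R> \<Delta>"
      using rel_same_invariants same_trivial_invariants trivial_diagram by (auto simp: dipole_rel_def) blast
    then show "\<Delta> \<in> X" unfolding X0 using eq X0(2) triv0[OF \<open>\<Delta>0 \<in> X\<close>] by blast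
  qed
qed

theorem simple_act_hom_inj:
  assumes S: "S \<subseteq> carrier DG" and simple: "is_simple (DG\<lparr>carrier := S\<rparr>)"
  shows "act \<in> hom (DG\<lparr>carrier := S\<rparr>) (BijGroup unit_ivl)" "inj_on act S"
proof -
  let ?G = "DG\<lparr>carrier := S\<rparr>"
  interpret group ?G using simple by (simp add: is_simple_def)
  have closed: "X \<otimes>\<^bsub>DG\<^esub> Y \<in> S" if "X \<in> S" "Y \<in> S" for X Y using m_closed that by simp
  show hom: "act \<in> hom ?G (BijGroup unit_ivl)"
  proof (rule homI)
    fix X Y assume "X \<in> carrier ?G" "Y \<in> carrier ?G"
    then have "X \<in> S" "Y \<in> S" by auto
    then show "act (X \<otimes>\<^bsub>?G\<^esub> Y) = act X \<otimes>\<^bsub>BijGroup unit_ivl\<^esub> act Y"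
      using act_mult[of X Y] act_Bij[of X] act_Bij[of Y] closed[of X Y] S by (auto simp: BijGroup_def)
  qed (use act_Bij S in \<open>auto simp: BijGroup_def\<close>)
  from simple_hom_trivial_or_inj[OF simple group_BijGroup hom]
  show "inj_on act S"
  proof
    assume "\<forall>X\<in>carrier ?G. act X = \<one>\<^bsub>BijGroup unit_ivl\<^esub>"
    then have id: "act X y = y" if "X \<in> S" "y \<in> unit_ivl" for X y
      using that by (auto simp: BijGroup_def)
    \<comment> \<open>Strong induction on the length, for all of \<open>S\<close> at once:
      additivity for \<open>xs\<close> rests on the vanishing of its proper prefixes on the second
      factor.\<close>
    have zero: "coeff \<R> (rep X) xs = 0" if "X \<in> S" "walk overlap xs" "xs \<noteq> []" for X xs
      using that
    proof (induction "length xs" arbitrary: X xs rule: less_induct)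
      case less
      show ?case
      proof (rule simple_no_int_hom[OF simple, of "\<lambda>X. coeff \<R> (rep X) xs"])
        fix X Y assume "X \<in> carrier ?G" "Y \<in> carrier ?G"
        then have XY: "X \<in> S" "Y \<in> S" "X \<in> carrier DG" "Y \<in> carrier DG" "X \<otimes>\<^bsub>DG\<^esub> Y \<in> carrier DG"
          using S closed by auto
        obtain \<Delta>1 \<Delta>2 where *: "\<Delta>1 \<in> X" "\<Delta>2 \<in> Y" "concat_diag \<A> \<R> \<Delta>1 \<Delta>2"
          "same_invariants \<R> (concat_diagram \<Delta>1 \<Delta>2) (rep (X \<otimes>\<^bsub>DG\<^esub> Y))"
          using mult_concat[OF XY(3-5)] .
        interpret concat_diag \<A> \<R> \<Delta>1 \<Delta>2 by fact
        have same: "same_invariants \<R> \<Delta>1 (rep X)" "same_invariants \<R> \<Delta>2 (rep Y)"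
          using class_same_invariants rep_in XY * by blast+
        have id1: "flow0 \<Delta>1 y = y" if "y \<in> unit_ivl" for y
          using act_eq[OF XY(3) *(1) that] id[OF XY(1) that] by simp
        have c: "coeff \<R> \<Delta>1 ys = coeff \<R> (rep X) ys" "coeff \<R> \<Delta>2 ys = coeff \<R> (rep Y) ys"
          if "walk overlap ys" for ys using same that by (auto simp: same_invariants_def)
        have "coeff \<R> (rep (X \<otimes>\<^bsub>?G\<^esub> Y)) xs = coeff \<R> (concat_diagram \<Delta>1 \<Delta>2) xs"
          using *(4) less.prems(2) by (simp add: same_invariants_def)
        also have "\<dots> = (\<Sum>k\<le>length xs. coeff \<R> \<Delta>2 (take k xs) * coeff \<R> \<Delta>1 (drop k xs))"
          by (rule coeff_concat[OF id1 less.prems(2)])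
        \<comment> \<open>An inner term contains the coefficient of a non-empty proper prefix, which
          vanishes by induction. In the two extreme terms one factor is the coefficient 1 of the
          empty word.\<close>
        also have "\<dots> = (\<Sum>k\<in>{0, length xs}. coeff \<R> \<Delta>2 (take k xs) * coeff \<R> \<Delta>1 (drop k xs))"
        proof (rule sum.mono_neutral_right)
          show "\<forall>k\<in>{..length xs} - {0, length xs}. coeff \<R> \<Delta>2 (take k xs) * coeff \<R> \<Delta>1 (drop k xs) = 0"
          proof
            fix k assume "k \<in> {..length xs} - {0, length xs}"
            then have k: "0 < k" "k < length xs" by auto
            have "coeff \<R> (rep Y) (take k xs) = 0"
              using k less.prems XY walk_take by (intro less.hyps) auto
            then show "coeff \<R> \<Delta>2 (take k xs) * coeff \<R> \<Delta>1 (drop k xs) = 0"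
              using c(2)[OF walk_take[OF less.prems(2)]] by simp
          qed
        qed auto
        also have "\<dots> = coeff \<R> (rep X) xs + coeff \<R> (rep Y) xs"
          using c[OF less.prems(2)] less.prems(3) by (simp add: coeff_def)
        finally show "coeff \<R> (rep (X \<otimes>\<^bsub>?G\<^esub> Y)) xs = coeff \<R> (rep X) xs + coeff \<R> (rep Y) xs" .
      qed (use less.prems in auto)
    qed
    have "X = \<one>\<^bsub>DG\<^esub>" if X: "X \<in> S" for X
    proof (rule class_one)
      show "X \<in> carrier DG" using S X by blast
      show "trivial_invariants \<R> (rep X)"
        unfolding trivial_invariants_def
      proof (intro conjI ballI allI impI)
        fix y :: real assume "y \<in> unit_ivl"
        then show "flow0 (rep X) y = y" using id[OF X, of y] by (simp add: act_def)
      qed (use zero[OF X] in blast)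
    qed
    moreover have "S \<noteq> {\<one>\<^bsub>DG\<^esub>}" using simple by (simp add: is_simple_def)
    moreover have "\<one>\<^bsub>DG\<^esub> \<in> S" using one_closed by simp
    ultimately show ?thesis by blast
  qed simp
qed

end

section \<open>Dyadic piecewise affine maps\<close>

lemma dyadic_of_int: "of_int n \<in> dyadic" and dyadic_0: "0 \<in> dyadic" and dyadic_1: "1 \<in> dyadic"
proof -
  show "of_int n \<in> dyadic" for n unfolding dyadic_def by (intro CollectI exI[of _ n] exI[of _ 0]) simp
  from this[of 0] this[of 1] show "0 \<in> dyadic" "1 \<in> dyadic" by auto
qed

lemma dyadic_add: "x \<in> dyadic \<Longrightarrow> y \<in> dyadic \<Longrightarrow> x + y \<in> dyadic"
proof -
  assume "x \<in> dyadic" "y \<in> dyadic"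
  then obtain m n m' n' where x: "x = of_int m / 2 ^ n" "y = of_int m' / 2 ^ n'" by (auto simp: dyadic_def)
  have "x + y = of_int (m * 2 ^ n' + m' * 2 ^ n) / 2 ^ (n + n')"
    unfolding x by (simp add: power_add field_simps)
  then show ?thesis unfolding dyadic_def by blast
qed

lemma dyadic_mult: "x \<in> dyadic \<Longrightarrow> y \<in> dyadic \<Longrightarrow> x * y \<in> dyadic"
proof -
  assume "x \<in> dyadic" "y \<in> dyadic"
  then obtain m n m' n' where x: "x = of_int m / 2 ^ n" "y = of_int m' / 2 ^ n'" by (auto simp: dyadic_def)
  have "x * y = of_int (m * m') / 2 ^ (n + n')" unfolding x by (simp add: power_add)
  then show ?thesis unfolding dyadic_def by blast
qed

lemma dyadic_powi: "2 powi k \<in> dyadic"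
proof (cases "k \<ge> 0")
  case True
  then have "(2::real) powi k = of_int (2 ^ nat k) / 2 ^ 0" by (simp add: power_int_def)
  then show ?thesis unfolding dyadic_def by blast
next
  case False
  then have "(2::real) powi k = of_int 1 / 2 ^ nat (- k)" by (simp add: power_int_def field_simps)
  then show ?thesis unfolding dyadic_def by blast
qed

lemma dyadic_diff: "x \<in> dyadic \<Longrightarrow> y \<in> dyadic \<Longrightarrow> x - y \<in> dyadic"
  using dyadic_add[of x "of_int (-1) * y"] dyadic_mult[OF dyadic_of_int, of y "-1"] by simp

lemma dyadic_affine: "x \<in> dyadic \<Longrightarrow> c \<in> dyadic \<Longrightarrow> 2 powi k * x + c \<in> dyadic"
  by (intro dyadic_add dyadic_mult dyadic_powi)

text \<open>The formula holds on the half-open interval, so \<open>f\<close> may jump at a break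
  point but is continuous from the right there. Quantifying over all intervals whose interior avoids
  \<open>D\<close>, instead of listing pieces, lets \<open>D\<close> be enlarged freely.\<close>

definition affine_off :: "real set \<Rightarrow> (real \<Rightarrow> real) \<Rightarrow> bool" where
  "affine_off D f \<longleftrightarrow> (\<forall>a b. 0 \<le> a \<and> a < b \<and> b \<le> 1 \<and> D \<inter> {a<..<b} = {} \<longrightarrow>
     (\<exists>(k::int). \<exists>c\<in>dyadic. \<forall>t\<in>{a..<b}. f t = 2 powi k * t + c))"

definition dyadic_pl :: "(real \<Rightarrow> real) \<Rightarrow> bool" where
  "dyadic_pl f \<longleftrightarrow> (\<exists>D. finite D \<and> D \<subseteq> dyadic \<and> affine_off D f)"

lemma affine_offD:
  "affine_off D f \<Longrightarrow> 0 \<le> a \<Longrightarrow> a < b \<Longrightarrow> b \<le> 1 \<Longrightarrow> D \<inter> {a<..<b} = {} \<Longrightarrow>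
    \<exists>(k::int). \<exists>c\<in>dyadic. \<forall>t\<in>{a..<b}. f t = 2 powi k * t + c"
  unfolding affine_off_def by blast

lemma affine_offI:
  "(\<And>a b. 0 \<le> a \<Longrightarrow> a < b \<Longrightarrow> b \<le> 1 \<Longrightarrow> D \<inter> {a<..<b} = {} \<Longrightarrow>
    \<exists>(k::int). \<exists>c\<in>dyadic. \<forall>t\<in>{a..<b}. f t = 2 powi k * t + c) \<Longrightarrow> affine_off D f"
  unfolding affine_off_def by blast

lemma emb_affine: "\<exists>p::int. emb_len m k = 2 powi p" "1 - 1 / 2 ^ k \<in> dyadic"
proof -
  have "emb_len m k = 2 powi (- int (if Suc k < m then Suc k else k))"
    by (simp add: emb_len_def power_int_minus field_simps del: power_Suc)
  then show "\<exists>p::int. emb_len m k = 2 powi p" by blast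
  have "(1::real) / 2 ^ k = 2 powi (- int k)" by (simp add: power_int_minus field_simps)
  then show "1 - 1 / 2 ^ k \<in> dyadic" using dyadic_diff[OF dyadic_1 dyadic_powi] by metis
qed

lemma dyadic_pl_cong: "(\<And>t. t \<in> unit_ivl \<Longrightarrow> f t = g t) \<Longrightarrow> dyadic_pl f \<longleftrightarrow> dyadic_pl g"
proof -
  have "dyadic_pl g" if eq: "\<And>t. t \<in> unit_ivl \<Longrightarrow> f t = g t" and f: "dyadic_pl f" for f g
  proof -
    obtain D where D: "finite D" "D \<subseteq> dyadic" "affine_off D f"
      using f unfolding dyadic_pl_def by blast
    note fD = affine_offD[OF D(3)]
    have "affine_off D g"
    proof (rule affine_offI)
      fix a b :: real assume ab: "0 \<le> a" "a < b" "b \<le> 1" "D \<inter> {a<..<b} = {}"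
      obtain k :: int and c where c: "c \<in> dyadic" "\<forall>t\<in>{a..<b}. f t = 2 powi k * t + c" using fD[OF ab] by blast
      have "g t = 2 powi k * t + c" if "t \<in> {a..<b}" for t
      proof -
        have "t \<in> unit_ivl" using that \<open>0 \<le> a\<close> \<open>b \<le> 1\<close> by auto
        then show ?thesis using c(2) eq that by metis
      qed
      then show "\<exists>(k::int). \<exists>c\<in>dyadic. \<forall>t\<in>{a..<b}. g t = 2 powi k * t + c" using c(1) by blast
    qed
    then show ?thesis unfolding dyadic_pl_def using D by blast
  qed
  then show "(\<And>t. t \<in> unit_ivl \<Longrightarrow> f t = g t) \<Longrightarrow> dyadic_pl f \<longleftrightarrow> dyadic_pl g" by metis
qed

lemma dyadic_pl_id: "dyadic_pl (\<lambda>x. x)"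
  unfolding dyadic_pl_def affine_off_def using dyadic_0
  by (intro exI[of _ "{}"]) (auto intro!: exI[of _ 0] bexI[of _ 0])

lemma dyadic_pl_comp_emb:
  assumes f: "dyadic_pl f" shows "dyadic_pl (\<lambda>x. f (emb m k x))"
proof -
  obtain D where D: "finite D" "D \<subseteq> dyadic" "affine_off D f"
    using f unfolding dyadic_pl_def by blast
  note fD = affine_offD[OF D(3)]
  obtain p :: int where p: "emb_len m k = 2 powi p" using emb_affine(1) by blast
  define l where "l = emb_len m k"
  define s :: real where "s = 1 - 1 / 2 ^ k"
  have l: "l > 0" "s + l \<le> 1" "s \<ge> 0" using emb_len_pos[of m k] emb_len_le[of m k] by (auto simp: l_def s_def)
  have e: "emb m k x = s + x * l" for x by (simp add: emb_def s_def l_def)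
  define D' where "D' = (\<lambda>d. (d - s) / l) ` D"
  have "D' \<subseteq> dyadic"
  proof
    fix x assume "x \<in> D'"
    then obtain d where d: "d \<in> D" "x = (d - s) / l" by (auto simp: D'_def)
    have "x = 2 powi (- p) * (d - s) + 0" using d p by (simp add: l_def power_int_minus field_simps)
    also have "\<dots> \<in> dyadic"
      using d D emb_affine(2)[of k] by (intro dyadic_affine dyadic_diff dyadic_0) (auto simp: s_def)
    finally show "x \<in> dyadic" .
  qed
  moreover have "finite D'" using D by (simp add: D'_def)
  moreover have "affine_off D' (\<lambda>x. f (emb m k x))"
  proof (rule affine_offI)
    fix a b :: real assume ab: "0 \<le> a" "a < b" "b \<le> 1" "D' \<inter> {a<..<b} = {}"
    have "0 \<le> a * l" "b * l \<le> l" "a * l < b * l"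
      using ab l mult_right_mono[of b 1 l] by auto
    then have le: "0 \<le> s + a * l" "s + a * l < s + b * l" "s + b * l \<le> 1" using l by linarith+
    have "D \<inter> {s + a * l<..<s + b * l} = {}"
    proof (rule ccontr)
      assume "D \<inter> {s + a * l<..<s + b * l} \<noteq> {}"
      then obtain d where d: "d \<in> D" "s + a * l < d" "d < s + b * l" by auto
      have "(d - s) / l \<in> D' \<inter> {a<..<b}" using d l by (auto simp: D'_def field_simps)
      then show False using ab by blast
    qed
    then obtain j :: int and c where c: "c \<in> dyadic" "\<forall>t\<in>{s + a * l..<s + b * l}. f t = 2 powi j * t + c"
      using fD[OF le] by blast
    have "f (emb m k t) = 2 powi (j + p) * t + (2 powi j * s + c)" if "t \<in> {a..<b}" for t
    proof -
      have "emb m k t \<in> {s + a * l..<s + b * l}" using that l by (simp add: e mult_right_mono)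
      then have "f (emb m k t) = 2 powi j * emb m k t + c" using c by blast
      then show ?thesis using p by (simp add: e l_def power_int_add algebra_simps)
    qed
    moreover have "2 powi j * s + c \<in> dyadic" using emb_affine(2)[of k] c by (auto simp: s_def intro: dyadic_affine)
    ultimately show "\<exists>(j::int). \<exists>c\<in>dyadic. \<forall>t\<in>{a..<b}. f (emb m k t) = 2 powi j * t + c" by blast
  qed
  ultimately show ?thesis unfolding dyadic_pl_def by blast
qed

lemma dyadic_pl_glue:
  assumes "0 < m" and f: "\<And>k. k < m \<Longrightarrow> dyadic_pl (\<lambda>x. f (emb m k x))"
  shows "dyadic_pl f"
proof -
  have "\<forall>k<m. \<exists>D. finite D \<and> D \<subseteq> dyadic \<and> affine_off D (\<lambda>x. f (emb m k x))"
    using f unfolding dyadic_pl_def by blast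
  then obtain D where D: "\<And>k. k < m \<Longrightarrow> finite (D k)" "\<And>k. k < m \<Longrightarrow> D k \<subseteq> dyadic"
    "\<And>k. k < m \<Longrightarrow> affine_off (D k) (\<lambda>x. f (emb m k x))"
    by metis
  note fD = affine_offD[OF D(3)]
  \<comment> \<open>The left ends of the pieces are added to the transported break points; an
    interval whose interior avoids \<open>E\<close> then stays within one piece.\<close>
  define E where "E = (\<Union>k<m. emb m k ` D k) \<union> (\<lambda>k. 1 - 1 / 2 ^ k) ` {..<m}"
  have "finite E" using D by (auto simp: E_def)
  moreover have "E \<subseteq> dyadic"
  proof -
    have "emb m k d \<in> dyadic" if "k < m" "d \<in> D k" for k d
    proof -
      obtain p :: int where p: "emb_len m k = 2 powi p" using emb_affine(1) by blast
      have "emb m k d = 2 powi p * d + (1 - 1 / 2 ^ k)" by (simp add: emb_def p)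
      then show ?thesis using D(2)[OF that(1)] that emb_affine(2)[of k] by (auto intro: dyadic_affine)
    qed
    then show ?thesis using emb_affine(2) by (auto simp: E_def)
  qed
  moreover have "affine_off E f"
  proof (rule affine_offI)
    fix a b :: real assume ab: "0 \<le> a" "a < b" "b \<le> 1" "E \<inter> {a<..<b} = {}"
    obtain k x where k: "k < m" "x \<in> unit_ivl" "a = emb m k x"
      using emb_surj[OF assms(1), of a] ab by auto
    define l where "l = emb_len m k"
    define s :: real where "s = 1 - 1 / 2 ^ k"
    have l: "l > 0" using emb_len_pos[of m k] by (simp add: l_def)
    have e: "emb m k x = s + x * l" for x by (simp add: emb_def s_def l_def)
    have "b \<le> s + l"
    proof (cases "Suc k < m")
      case True
      then have "s + l = 1 - 1 / 2 ^ Suc k" by (simp add: s_def l_def emb_len_def field_simps)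
      then have "s + l \<in> E" using True unfolding E_def by blast
      moreover have "a < s + l" using k l by (simp add: e)
      ultimately show ?thesis using ab by fastforce
    next
      case False
      then show ?thesis using ab k by (simp add: s_def l_def emb_len_def)
    qed
    define y where "y = (b - s) / l"
    have y: "y \<le> 1" "x < y" "s + y * l = b"
      using \<open>b \<le> s + l\<close> l ab k by (auto simp: y_def e field_simps)
    have "D k \<inter> {x<..<y} = {}"
    proof (rule ccontr)
      assume "D k \<inter> {x<..<y} \<noteq> {}"
      then obtain d where d: "d \<in> D k" "x < d" "d < y" by auto
      have "x * l < d * l" "d * l < y * l" using d l by auto
      then have "emb m k d \<in> {a<..<b}" using y k by (auto simp: e)
      moreover have "emb m k d \<in> E" using d k by (auto simp: E_def)
      ultimately show False using ab by blast
    qed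
    then obtain j :: int and c where c: "c \<in> dyadic" "\<forall>t\<in>{x..<y}. f (emb m k t) = 2 powi j * t + c"
      using fD[OF k(1) _ y(2,1)] k by auto
    obtain p :: int where p: "emb_len m k = 2 powi p" using emb_affine(1) by blast
    have "f t = 2 powi (j - p) * t + (c - 2 powi (j - p) * s)" if t: "t \<in> {a..<b}" for t
    proof -
      define u where "u = (t - s) / l"
      have "t = s + u * l" using l by (simp add: u_def)
      moreover have "u \<in> {x..<y}"
        using t l y k by (auto simp: u_def y_def e field_simps)
      ultimately have "f t = 2 powi j * u + c" using c e by metis
      also have "2 powi j * u = 2 powi (j - p) * (t - s)"
        using p by (simp add: u_def l_def power_int_diff)
      finally show ?thesis by (simp add: algebra_simps)
    qed
    moreover have "c - 2 powi (j - p) * s \<in> dyadic"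
      using c(1) emb_affine(2)[of k, folded s_def] by (intro dyadic_diff dyadic_mult dyadic_powi)
    ultimately show "\<exists>(j::int). \<exists>c\<in>dyadic. \<forall>t\<in>{a..<b}. f t = 2 powi j * t + c" by blast
  qed
  ultimately show ?thesis unfolding dyadic_pl_def by blast
qed

context diag
begin

lemma taddr0_pl:
  assumes t: "t \<in> T" and "\<And>k. k < length (tt t) \<Longrightarrow> dyadic_pl (waddr0 \<Delta> (tt t ! k))"
  shows "dyadic_pl (taddr0 \<Delta> t)"
proof (rule dyadic_pl_glue)
  show "0 < length (tt t)" using nonempty(1)[OF t] by simp
  fix k assume k: "k < length (tt t)"
  show "dyadic_pl (\<lambda>x. taddr0 \<Delta> t (emb (length (tt t)) k x))"
    using addr_simps(3)[OF t k, of _ "\<lambda>_. 0"] assms(2)[OF k]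
    by (subst dyadic_pl_cong[where g = "waddr0 \<Delta> (tt t ! k)"]) auto
qed

lemma waddr0_pl: "e \<in> W \<Longrightarrow> dyadic_pl (waddr0 \<Delta> e)"
proof (induction e rule: wf_induct_rule[OF wf_wire_up(2)])
  case (1 e)
  from \<open>e \<in> W\<close> show ?case
  proof (cases rule: top_cases)
    case (frame k)
    then show ?thesis
      using addr_simps(1)[OF frame(1), of _ "\<lambda>_. 0"] dyadic_pl_comp_emb[OF dyadic_pl_id]
      by (subst dyadic_pl_cong[where g = "emb (length ft) k"]) auto
  next
    case (trans t j)
    have "dyadic_pl (waddr0 \<Delta> (tt t ! k))" if "k < length (tt t)" for k
    proof (rule 1(1))
      show "(tt t ! k, e) \<in> wire_up\<inverse>" using that trans by (auto simp: wire_up_def intro!: bexI[of _ t])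
      show "tt t ! k \<in> W" using in_W that trans by blast
    qed
    from dyadic_pl_comp_emb[OF taddr0_pl[OF trans(1) this]]
    show ?thesis
      using addr_simps(2)[OF trans(1,2), of _ "\<lambda>_. 0"] trans
      by (subst dyadic_pl_cong[where g = "\<lambda>x. taddr0 \<Delta> t (emb (length (tb t)) j x)"]) auto
  qed
qed

lemma flow0_pl: "fb \<noteq> [] \<Longrightarrow> dyadic_pl (flow0 \<Delta>)"
proof (rule dyadic_pl_glue[of "length fb"])
  fix k assume k: "k < length fb"
  show "dyadic_pl (\<lambda>x. flow0 \<Delta> (emb (length fb) k x))"
    using flow0_emb[OF k] waddr0_pl[OF in_W(4)[OF k]]
    by (subst dyadic_pl_cong[where g = "waddr0 \<Delta> (fb ! k)"]) auto
qed simp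

end

section \<open>Realization in Thompson's groups\<close>

text \<open>The set \<open>D\<close> may contain points at which the map is differentiable after
  all, and the definitions of Thompson's groups ask for a single affine formula across them.
  Differentiability forces the values and the slopes on the two sides to agree.\<close>

lemma one_sided_derivatives_match:
  fixes G G1 G2 :: "real \<Rightarrow> 'b::real_normed_vector"
  assumes G: "G differentiable (at p)" and \<epsilon>: "\<epsilon> > 0"
    and right: "\<And>s. p \<le> s \<Longrightarrow> s < p + \<epsilon> \<Longrightarrow> G s = G1 s"
    and left: "\<And>s. p - \<epsilon> < s \<Longrightarrow> s < p \<Longrightarrow> G s = G2 s"
    and d1: "(G1 has_vector_derivative d1) (at p)" and d2: "(G2 has_vector_derivative d2) (at p)"
  shows "G2 p = G p" "d1 = d2" "vector_derivative G (at p) = d1"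
proof -
  have ev: "\<forall>\<^sub>F s in at_left p. G2 s = G s"
    using eventually_at_left_real[of "p - \<epsilon>" p] by (rule eventually_mono) (use left \<epsilon> in auto)
  have "(G \<longlongrightarrow> G p) (at_left p)"
    using differentiable_imp_continuous_within[OF G] by (simp add: continuous_at filterlim_at_split)
  moreover have "continuous (at p) G2" using d2 by (rule has_vector_derivative_continuous)
  then have "(G2 \<longlongrightarrow> G2 p) (at_left p)" by (simp add: continuous_at filterlim_at_split)
  then have "(G \<longlongrightarrow> G2 p) (at_left p)" by (rule Lim_transform_eventually[OF _ ev])
  ultimately show eq: "G2 p = G p" using tendsto_unique[OF trivial_limit_at_left_real] by blast
  have D: "(G has_vector_derivative vector_derivative G (at p)) (at p)"
    using G by (simp add: vector_derivative_works)
  have "(G has_vector_derivative d1) (at p within cbox p (p + \<epsilon> / 2))"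
    by (rule has_vector_derivative_transform_within[OF has_vector_derivative_at_within[OF d1], of \<epsilon>])
      (use \<epsilon> right in auto)
  moreover have "(G has_vector_derivative d2) (at p within cbox (p - \<epsilon> / 2) p)"
  proof (rule has_vector_derivative_transform_within[OF has_vector_derivative_at_within[OF d2], of \<epsilon>])
    fix s assume "s \<in> cbox (p - \<epsilon> / 2) p"
    then show "G2 s = G s" using \<epsilon> left[of s] eq by (cases "s = p") auto
  qed (use \<epsilon> in auto)
  ultimately show "d1 = d2" "vector_derivative G (at p) = d1"
    using vector_derivative_unique_within_closed_interval[of p "p + \<epsilon> / 2" p G]
      vector_derivative_unique_within_closed_interval[of "p - \<epsilon> / 2" p p G]
      has_vector_derivative_at_within[OF D] \<epsilon> by (auto, metis)
qed

section \<open>Maps of the circle\<close>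

lemma circle_pt_add: "circle_pt (s + t) = circle_pt s * circle_pt t"
  by (simp add: circle_pt_def cis_mult algebra_simps)

lemma circle_pt_of_int: "circle_pt (of_int n) = 1"
proof -
  have "2 * pi * of_int n = of_int n * (2 * pi)" by simp
  then show ?thesis by (simp add: circle_pt_def cis_multiple_2pi)
qed

lemma circle_pt_add_int: "circle_pt (t + of_int n) = circle_pt t"
  by (simp add: circle_pt_add circle_pt_of_int)

lemma circle_pt_frac: "circle_pt (frac t) = circle_pt t"
  using circle_pt_add_int[of "frac t" "\<lfloor>t\<rfloor>"] by (simp add: frac_def)

lemma circle_pt_norm: "norm (circle_pt t) = 1" and circle_pt_nz: "circle_pt t \<noteq> 0"
  by (simp_all add: circle_pt_def)

lemma Arg2pi_circle_pt: "Arg2pi (circle_pt t) / (2 * pi) = frac t"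
proof -
  have "0 \<le> frac t" "frac t < 1" by (auto simp: frac_ge_0 frac_lt_1)
  then have "Arg2pi (circle_pt (frac t)) = 2 * pi * frac t"
    by (intro Arg2pi_unique[of 1]) (auto simp: circle_pt_def cis_conv_exp)
  then show ?thesis by (simp add: circle_pt_frac)
qed

lemma circle_pt_Arg2pi: "norm z = 1 \<Longrightarrow> circle_pt (Arg2pi z / (2 * pi)) = z"
  using Arg2pi_eq[of z] by (simp add: circle_pt_def cis_conv_exp)

lemma bij_Arg2pi: "bij_betw (\<lambda>z. Arg2pi z / (2 * pi)) (sphere 0 1) unit_ivl"
proof (rule bij_betw_byWitness[where f' = circle_pt])
  show "(\<lambda>z. Arg2pi z / (2 * pi)) ` sphere 0 1 \<subseteq> unit_ivl"
    using Arg2pi_ge_0 Arg2pi_lt_2pi by (auto simp: field_simps)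
qed (auto simp: circle_pt_Arg2pi Arg2pi_circle_pt frac_eq circle_pt_norm)

lemma bij_circle_pt: "bij_betw circle_pt unit_ivl (sphere 0 1)"
proof (rule bij_betw_byWitness[where f' = "\<lambda>z. Arg2pi z / (2 * pi)"])
  show "(\<lambda>z. Arg2pi z / (2 * pi)) ` sphere 0 1 \<subseteq> unit_ivl"
    using Arg2pi_ge_0 Arg2pi_lt_2pi by (auto simp: field_simps)
qed (auto simp: circle_pt_Arg2pi Arg2pi_circle_pt frac_eq circle_pt_norm)

definition circ :: "(real \<Rightarrow> real) \<Rightarrow> complex \<Rightarrow> complex" where
  "circ F = restrict (\<lambda>z. circle_pt (F (Arg2pi z / (2 * pi)))) (sphere 0 1)"

lemma circ_circle_pt: "circ F (circle_pt t) = circle_pt (F (frac t))"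
  by (simp add: circ_def circle_pt_norm Arg2pi_circle_pt)

lemma circ_Bij: assumes "bij_betw F unit_ivl unit_ivl" shows "circ F \<in> Bij (sphere 0 1)"
proof -
  have "bij_betw (circle_pt \<circ> F \<circ> (\<lambda>z. Arg2pi z / (2 * pi))) (sphere 0 1) (sphere 0 1)"
    using bij_betw_trans[OF bij_Arg2pi bij_betw_trans[OF assms bij_circle_pt]] by (simp add: comp_assoc)
  then have "bij_betw (circ F) (sphere 0 1) (sphere 0 1)"
    by (subst bij_betw_cong[where g = "circle_pt \<circ> F \<circ> (\<lambda>z. Arg2pi z / (2 * pi))"]) (auto simp: circ_def)
  then show ?thesis by (simp add: Bij_def circ_def)
qed

lemma circ_compose:
  assumes "G ` unit_ivl \<subseteq> unit_ivl"
  shows "circ (compose unit_ivl F G) = compose (sphere 0 1) (circ F) (circ G)"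
proof
  fix z
  show "circ (compose unit_ivl F G) z = compose (sphere 0 1) (circ F) (circ G) z"
  proof (cases "z \<in> sphere 0 1")
    case True
    define t where "t = Arg2pi z / (2 * pi)"
    have t: "t \<in> unit_ivl" using bij_betwE[OF bij_Arg2pi] True by (auto simp: t_def)
    then have z: "z = circle_pt t" "frac t = t" using True by (auto simp: t_def circle_pt_Arg2pi frac_eq)
    have "G t \<in> unit_ivl" using assms t by blast
    then have "frac (G t) = G t" by (simp add: frac_eq)
    then show ?thesis using True t z by (simp add: compose_def circ_circle_pt)
  qed (simp add: circ_def compose_def)
qed

lemma circ_inj: "inj_on circ (Bij unit_ivl)"
proof (rule inj_onI)
  fix F G assume F: "F \<in> Bij unit_ivl" and G: "G \<in> Bij unit_ivl" and eq: "circ F = circ G"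
  show "F = G"
  proof
    fix t
    show "F t = G t"
    proof (cases "t \<in> unit_ivl")
      case True
      then have "circle_pt (F t) = circle_pt (G t)"
        using fun_cong[OF eq, of "circle_pt t"] by (simp add: circ_circle_pt frac_eq)
      moreover have "F t \<in> unit_ivl" "G t \<in> unit_ivl"
        using F G True by (auto simp: Bij_def dest: bij_betwE)
      ultimately show ?thesis using bij_circle_pt by (auto simp: bij_betw_def inj_on_def)
    next
      case False
      then show ?thesis using F G by (metis Bij_imp_extensional extensional_arb)
    qed
  qed
qed

lemma circle_pt_deriv: "((\<lambda>s. circle_pt (m * s + c)) has_vector_derivative (of_real (2 * pi * m) * \<i> * circle_pt (m * p + c))) (at p within S)"
proof -
  have e: "circle_pt (m * s + c) = exp (of_real (2 * pi * m) * \<i> * of_real s + of_real (2 * pi * c) * \<i>)" for s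
    by (simp add: circle_pt_def cis_conv_exp algebra_simps)
  have "((\<lambda>z. exp (of_real (2 * pi * m) * \<i> * z + of_real (2 * pi * c) * \<i>)) has_field_derivative
      (of_real (2 * pi * m) * \<i> * exp (of_real (2 * pi * m) * \<i> * of_real p + of_real (2 * pi * c) * \<i>))) (at (of_real p))"
    by (auto intro!: derivative_eq_intros)
  from has_vector_derivative_real_field[OF this] show ?thesis
    unfolding e by (rule has_vector_derivative_at_within)
qed

text \<open>The coordinate jumps at the base point, which is therefore always a break point. An
  interval of the line avoiding the lifted break points \<open>Br\<close> then lies over a single
  period.\<close>

locale circle_pl =
  fixes F :: "real \<Rightarrow> real" and D :: "real set"
  assumes bij: "bij_betw F unit_ivl unit_ivl" and D: "finite D" "D \<subseteq> dyadic" "0 \<in> D"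
    and affine: "affine_off D F"
begin

definition Br :: "real set" where
  "Br = {t. frac t \<in> D}"

definition G :: "real \<Rightarrow> complex" where
  "G s = circ F (circle_pt s)"

lemma seg:
  assumes "a < b" "Br \<inter> {a<..<b} = {}"
  shows "\<exists>(k::int). \<exists>c\<in>dyadic. \<forall>s\<in>{a..<b}. G s = circle_pt (2 powi k * s + c)"
proof -
  define n where "n = \<lfloor>a\<rfloor>"
  have "of_int n + 1 \<in> Br" using D by (simp add: Br_def frac_def)
  moreover have n: "of_int n \<le> a" "a < of_int n + 1" by (auto simp: n_def)
  ultimately have bn: "b \<le> of_int n + 1" using assms(2) by (meson disjoint_iff greaterThanLessThan_iff not_le)
  have fr: "frac s = s - of_int n" if "s \<in> {a..<b}" for s
  proof -
    have "\<lfloor>s\<rfloor> = n" using that n bn by (intro floor_unique) auto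
    then show ?thesis by (simp add: frac_def)
  qed
  have "D \<inter> {a - of_int n<..<b - of_int n} = {}"
  proof (rule ccontr)
    assume "D \<inter> {a - of_int n<..<b - of_int n} \<noteq> {}"
    then obtain d where d: "d \<in> D" "a < d + of_int n" "d + of_int n < b" by (auto simp: field_simps)
    have "frac (d + of_int n) = d" using fr[of "d + of_int n"] d by simp
    then have "d + of_int n \<in> Br \<inter> {a<..<b}" using d by (simp add: Br_def)
    then show False using assms by blast
  qed
  then obtain k :: int and c where c: "c \<in> dyadic" "\<forall>t\<in>{a - of_int n..<b - of_int n}. F t = 2 powi k * t + c"
    using affine_offD[OF affine, of "a - of_int n" "b - of_int n"] assms(1) n bn by auto
  define c' where "c' = c - 2 powi k * of_int n"
  have F: "F (frac s) = 2 powi k * s + c'" if "s \<in> {a..<b}" for s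
  proof -
    have "s - of_int n \<in> {a - of_int n..<b - of_int n}" using that by auto
    then have "F (s - of_int n) = 2 powi k * (s - of_int n) + c" using c(2) by blast
    then show ?thesis unfolding fr[OF that] c'_def by (simp add: algebra_simps)
  qed
  have "c' \<in> dyadic" unfolding c'_def using c by (intro dyadic_diff dyadic_mult dyadic_powi dyadic_of_int)
  moreover have "\<forall>s\<in>{a..<b}. G s = circle_pt (2 powi k * s + c')" using F by (simp add: G_def circ_circle_pt)
  ultimately show ?thesis by blast
qed

lemma gap: obtains \<epsilon> where "\<epsilon> > 0" "Br \<inter> {t<..<t + \<epsilon>} = {}" "Br \<inter> {t - \<epsilon><..<t} = {}"
proof -
  \<comment> \<open>Lifts of \<open>D\<close> in the five periods around \<open>t\<close>, enough to
    contain every break point at distance less than 1.\<close>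
  define S where "S = (\<lambda>(d, i). d + of_int i) ` (D \<times> {\<lfloor>t\<rfloor> - 2..\<lfloor>t\<rfloor> + 2})"
  have "finite S" using D by (simp add: S_def)
  then obtain \<delta> where \<delta>: "\<delta> > 0" "\<And>s. s \<in> S \<Longrightarrow> s \<noteq> t \<Longrightarrow> \<delta> \<le> dist t s" using finite_set_avoid by metis
  define \<epsilon> where "\<epsilon> = min \<delta> 1"
  have "s \<notin> Br" if "dist t s < \<epsilon>" "s \<noteq> t" for s
  proof
    assume "s \<in> Br"
    have "\<lfloor>s\<rfloor> \<in> {\<lfloor>t\<rfloor> - 2..\<lfloor>t\<rfloor> + 2}" using that(1) by (simp add: \<epsilon>_def dist_real_def) linarith
    moreover have "s = frac s + of_int \<lfloor>s\<rfloor>" by (simp add: frac_def)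
    ultimately have "s \<in> S" using \<open>s \<in> Br\<close> unfolding S_def Br_def by (auto intro!: image_eqI[of _ _ "(frac s, \<lfloor>s\<rfloor>)"])
    then show False using \<delta>(2)[of s] that by (simp add: \<epsilon>_def)
  qed
  then have "Br \<inter> {t<..<t + \<epsilon>} = {}" "Br \<inter> {t - \<epsilon><..<t} = {}"
    by (auto simp: dist_real_def disjoint_iff)
  moreover have "\<epsilon> > 0" using \<delta>(1) by (simp add: \<epsilon>_def)
  ultimately show thesis using that by blast
qed

lemma Br_dyadic: "Br \<subseteq> dyadic"
proof
  fix t assume "t \<in> Br"
  then have "frac t + of_int \<lfloor>t\<rfloor> \<in> dyadic" using D dyadic_of_int by (auto simp: Br_def intro!: dyadic_add)
  then show "t \<in> dyadic" by (simp add: frac_def)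
qed

lemma diff_off_Br: "t \<notin> Br \<Longrightarrow> circle_diff (circ F) t"
proof -
  assume t: "t \<notin> Br"
  obtain \<epsilon> where \<epsilon>: "\<epsilon> > 0" "Br \<inter> {t<..<t + \<epsilon>} = {}" "Br \<inter> {t - \<epsilon><..<t} = {}" using gap .
  have "Br \<inter> {t - \<epsilon><..<t + \<epsilon>} = {}"
  proof -
    have "{t - \<epsilon><..<t + \<epsilon>} \<subseteq> {t - \<epsilon><..<t} \<union> {t} \<union> {t<..<t + \<epsilon>}" by auto
    then show ?thesis using t \<epsilon> by blast
  qed
  moreover have "t - \<epsilon> < t + \<epsilon>" using \<epsilon>(1) by simp
  ultimately obtain k :: int and c where c: "\<forall>s\<in>{t - \<epsilon>..<t + \<epsilon>}. G s = circle_pt (2 powi k * s + c)"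
    using seg[of "t - \<epsilon>" "t + \<epsilon>"] by blast
  have "(G has_vector_derivative (of_real (2 * pi * 2 powi k) * \<i> * circle_pt (2 powi k * t + c))) (at t)"
  proof (rule has_vector_derivative_transform_within[OF circle_pt_deriv \<epsilon>(1)])
    fix s assume "dist s t < \<epsilon>"
    then have "s \<in> {t - \<epsilon>..<t + \<epsilon>}" by (auto simp: dist_real_def)
    then show "circle_pt (2 powi k * s + c) = G s" using c by simp
  qed simp
  then show ?thesis by (auto simp: circle_diff_def G_def[abs_def] intro: differentiableI_vector)
qed

text \<open>At a point of differentiability the formulas on the left and on the right have the same
  value and the same slope, hence merge into one.\<close>

lemma local_form:
  assumes "circle_diff (circ F) p"
  obtains k :: int and \<epsilon> where "\<epsilon> > 0" "\<And>s. \<bar>s - p\<bar> < \<epsilon> \<Longrightarrow> G s = G p * circle_pt (2 powi k * (s - p))"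
proof -
  obtain \<epsilon> where \<epsilon>: "\<epsilon> > 0" "Br \<inter> {p<..<p + \<epsilon>} = {}" "Br \<inter> {p - \<epsilon><..<p} = {}" using gap .
  have lt: "p < p + \<epsilon>" "p - \<epsilon> < p" using \<epsilon>(1) by auto
  obtain k1 :: int and c1 where 1: "\<forall>s\<in>{p..<p + \<epsilon>}. G s = circle_pt (2 powi k1 * s + c1)"
    using seg[OF lt(1) \<epsilon>(2)] by blast
  obtain k2 :: int and c2 where 2: "\<forall>s\<in>{p - \<epsilon>..<p}. G s = circle_pt (2 powi k2 * s + c2)"
    using seg[OF lt(2) \<epsilon>(3)] by blast
  have G: "G differentiable at p" using assms by (simp add: circle_diff_def G_def[abs_def])
  have f1: "G s = circle_pt (2 powi k1 * s + c1)" if "p \<le> s" "s < p + \<epsilon>" for s using 1 that by auto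
  have f2: "G s = circle_pt (2 powi k2 * s + c2)" if "p - \<epsilon> < s" "s < p" for s using 2 that by auto
  note m = one_sided_derivatives_match[OF G \<epsilon>(1) f1 f2 circle_pt_deriv circle_pt_deriv]
  have Gp: "G p = circle_pt (2 powi k1 * p + c1)" using 1 \<epsilon> by simp
  have eq: "circle_pt (2 powi k2 * p + c2) = G p" by (rule m(1))
  have "of_real (2 * pi * 2 powi k1) * \<i> * circle_pt (2 powi k1 * p + c1) =
      of_real (2 * pi * 2 powi k2) * \<i> * circle_pt (2 powi k2 * p + c2)"
    by (rule m(2))
  then have "complex_of_real (2 * pi * 2 powi k1) = of_real (2 * pi * 2 powi k2)"
    using eq Gp circle_pt_nz[of "2 powi k1 * p + c1"] by simp
  then have k: "(2::real) powi k1 = 2 powi k2" by (simp only: of_real_eq_iff) simp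
  have "G s = G p * circle_pt (2 powi k1 * (s - p))" if s: "\<bar>s - p\<bar> < \<epsilon>" for s
  proof (cases "p \<le> s")
    case True
    then have "G s = circle_pt ((2 powi k1 * p + c1) + 2 powi k1 * (s - p))"
      using 1 s by (simp add: algebra_simps)
    then show ?thesis using Gp by (simp add: circle_pt_add)
  next
    case False
    then have "G s = circle_pt ((2 powi k2 * p + c2) + 2 powi k2 * (s - p))"
      using 2 s by (simp add: algebra_simps)
    then show ?thesis using eq k by (simp add: circle_pt_add)
  qed
  then show thesis using that[OF \<epsilon>(1), of k1] by blast
qed

lemma global_form:
  assumes ab: "a < b" and diff: "\<forall>t\<in>{a<..<b}. circle_diff (circ F) t"
  shows "\<exists>(k::int) c. \<forall>t\<in>{a<..<b}. G t = circle_pt (2 powi k * t + c)"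
proof -
  \<comment> \<open>The logarithmic derivative: locally the constant
    \<open>2 * pi * 2 powi k * \<i>\<close>, it makes the exponent \<open>k\<close> visible.\<close>
  define v where "v p = vector_derivative G (at p) / G p" for p
  have Gnz: "G p \<noteq> 0" for p by (simp add: G_def circ_circle_pt circle_pt_nz)
  have loc: "\<exists>\<epsilon>>0. \<forall>s. \<bar>s - p\<bar> < \<epsilon> \<longrightarrow> v s = of_real (2 * pi * 2 powi k) * \<i> \<and> G s = G p * circle_pt (2 powi k * (s - p))"
    if "\<epsilon> > 0" "\<And>s. \<bar>s - p\<bar> < \<epsilon> \<Longrightarrow> G s = G p * circle_pt (2 powi k * (s - p))" for p \<epsilon> and k :: int
  proof (intro exI[of _ \<epsilon>] conjI that(1) allI impI)
    fix s assume s: "\<bar>s - p\<bar> < \<epsilon>"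
    show Gs: "G s = G p * circle_pt (2 powi k * (s - p))" by (rule that(2)[OF s])
    have "((\<lambda>u. G p * circle_pt (2 powi k * u + - (2 powi k * p))) has_vector_derivative
       (G p * (of_real (2 * pi * 2 powi k) * \<i> * circle_pt (2 powi k * s + - (2 powi k * p))))) (at s)"
      by (intro has_vector_derivative_mult_right circle_pt_deriv)
    then have "(G has_vector_derivative (G p * (of_real (2 * pi * 2 powi k) * \<i> * circle_pt (2 powi k * s + - (2 powi k * p))))) (at s)"
    proof (rule has_vector_derivative_transform_within[where d = "\<epsilon> - \<bar>s - p\<bar>"])
      fix u assume "dist u s < \<epsilon> - \<bar>s - p\<bar>"
      then have "\<bar>u - p\<bar> < \<epsilon>" unfolding dist_real_def by linarith
      from that(2)[OF this] show "G p * circle_pt (2 powi k * u + - (2 powi k * p)) = G u"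
        by (simp add: right_diff_distrib)
    qed (use s in auto)
    then have "vector_derivative G (at s) = G p * (of_real (2 * pi * 2 powi k) * \<i> * circle_pt (2 powi k * s + - (2 powi k * p)))"
      by (rule vector_derivative_at)
    then show "v s = of_real (2 * pi * 2 powi k) * \<i>"
      using Gs Gnz[of s] by (simp add: v_def algebra_simps)
  qed
  have exp_cancel: "exp (m * x - m * y) * exp (- m * x) = exp (- m * y)" for m x y :: complex
    unfolding exp_add[symmetric] by simp
  \<comment> \<open>Slope and phase of the local formula. Both are locally constant, hence constant
    on the interval, and together they determine \<open>G\<close> there.\<close>
  define \<Phi> where "\<Phi> p = (v p, G p * exp (- v p * of_real p))" for p
  have "\<Phi> constant_on {a<..<b}"
  proof (rule locally_constant_imp_constant)
    fix p assume p: "p \<in> {a<..<b}"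
    obtain k :: int and \<epsilon> where "\<epsilon> > 0" "\<And>s. \<bar>s - p\<bar> < \<epsilon> \<Longrightarrow> G s = G p * circle_pt (2 powi k * (s - p))"
      using local_form[of p] diff p by metis
    from loc[OF this] obtain \<epsilon> where \<epsilon>: "\<epsilon> > 0"
      "\<And>s. \<bar>s - p\<bar> < \<epsilon> \<Longrightarrow> v s = of_real (2 * pi * 2 powi k) * \<i>"
      "\<And>s. \<bar>s - p\<bar> < \<epsilon> \<Longrightarrow> G s = G p * circle_pt (2 powi k * (s - p))" by blast
    have near: "\<Phi> s = \<Phi> p" if s: "\<bar>s - p\<bar> < \<epsilon>" for s
    proof -
      define m where "m = complex_of_real (2 * pi * 2 powi k) * \<i>"
      have v: "v s = m" "v p = m" using \<epsilon> s by (auto simp: m_def)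
      have "circle_pt (2 powi k * (s - p)) = exp (m * of_real s - m * of_real p)"
        by (simp add: m_def circle_pt_def cis_conv_exp algebra_simps)
      then have "G s * exp (- m * of_real s) = G p * exp (- m * of_real p)"
        unfolding \<epsilon>(3)[OF s] by (simp only: mult.assoc exp_cancel)
      then show ?thesis by (simp only: \<Phi>_def v)
    qed
    show "\<exists>U. openin (top_of_set {a<..<b}) U \<and> p \<in> U \<and> (\<forall>x\<in>U. \<Phi> x = \<Phi> p)"
    proof (intro exI[of _ "{a<..<b} \<inter> ball p \<epsilon>"] conjI ballI)
      show "openin (top_of_set {a<..<b}) ({a<..<b} \<inter> ball p \<epsilon>)" by (rule openin_open_Int) simp
      show "\<Phi> x = \<Phi> p" if "x \<in> {a<..<b} \<inter> ball p \<epsilon>" for x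
        using near[of x] that by (simp add: dist_real_def abs_minus_commute)
    qed (use p \<epsilon>(1) in auto)
  qed simp
  then obtain v0 g0 where const: "\<forall>t\<in>{a<..<b}. v t = v0 \<and> G t * exp (- v t * of_real t) = g0"
    unfolding constant_on_def \<Phi>_def prod_eq_iff by auto
  define p where "p = (a + b) / 2"
  have p: "p \<in> {a<..<b}" using ab by (auto simp: p_def)
  obtain k :: int and \<epsilon> where "\<epsilon> > 0" "\<And>s. \<bar>s - p\<bar> < \<epsilon> \<Longrightarrow> G s = G p * circle_pt (2 powi k * (s - p))"
    using local_form[of p] diff p by metis
  from loc[OF this] have "v p = of_real (2 * pi * 2 powi k) * \<i>" by auto
  then have v0: "v0 = of_real (2 * pi * 2 powi k) * \<i>" using const p by simp
  have e: "exp (v0 * of_real t) = circle_pt (2 powi k * t)" for t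
    by (simp add: v0 circle_pt_def cis_conv_exp algebra_simps)
  have Gt: "G t = g0 * circle_pt (2 powi k * t)" if "t \<in> {a<..<b}" for t
  proof -
    have "G t * exp (- v0 * of_real t) = g0" using const that by metis
    then have "G t * (exp (- v0 * of_real t) * exp (v0 * of_real t)) = g0 * exp (v0 * of_real t)"
      by (simp only: mult.assoc[symmetric])
    moreover have "exp (- v0 * of_real t) * exp (v0 * of_real t) = 1" unfolding exp_add[symmetric] by simp
    ultimately show ?thesis by (simp only: e mult_1_right)
  qed
  have "norm g0 = 1"
  proof -
    have "norm (G p) = norm g0 * norm (circle_pt (2 powi k * p))" using Gt[OF p] by (simp add: norm_mult)
    then show ?thesis by (simp add: circle_pt_norm G_def circ_circle_pt)
  qed
  then obtain c where "g0 = circle_pt c" using circle_pt_Arg2pi by metis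
  then have "\<forall>t\<in>{a<..<b}. G t = circle_pt (2 powi k * t + c)" using Gt by (simp add: circle_pt_add)
  then show ?thesis by blast
qed

lemma circ_V: "circ F \<in> V_maps"
  unfolding V_maps_def
proof (intro CollectI conjI allI ballI impI)
  show "circ F \<in> Bij (sphere 0 1)" by (rule circ_Bij[OF bij])
  show "continuous (at_right t) (\<lambda>s. circ F (circle_pt s))" for t
  proof -
    obtain \<epsilon> where \<epsilon>: "\<epsilon> > 0" "Br \<inter> {t<..<t + \<epsilon>} = {}" using gap .
    then have "t < t + \<epsilon>" by simp
    then obtain k :: int and c where c: "\<forall>s\<in>{t..<t + \<epsilon>}. G s = circle_pt (2 powi k * s + c)"
      using seg[of t "t + \<epsilon>"] \<epsilon>(2) by blast
    have "((\<lambda>s. circle_pt (2 powi k * s + c)) \<longlongrightarrow> circle_pt (2 powi k * t + c)) (at_right t)"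
      using has_vector_derivative_continuous[OF circle_pt_deriv] by (simp add: continuous_within)
    then have "((\<lambda>s. circle_pt (2 powi k * s + c)) \<longlongrightarrow> G t) (at_right t)" using c \<epsilon> by simp
    moreover have "\<forall>\<^sub>F s in at_right t. circle_pt (2 powi k * s + c) = G s"
      using eventually_at_right_real[OF \<open>t < t + \<epsilon>\<close>] by (rule eventually_mono) (use c in auto)
    ultimately have "(G \<longlongrightarrow> G t) (at_right t)" by (rule Lim_transform_eventually)
    then show ?thesis by (simp add: continuous_within G_def[abs_def])
  qed
  show "circ F (circle_pt t) \<in> circle_pt ` dyadic" if t: "t \<in> dyadic" for t
  proof -
    obtain \<epsilon> where \<epsilon>: "\<epsilon> > 0" "Br \<inter> {t<..<t + \<epsilon>} = {}" using gap .
    then have "t < t + \<epsilon>" by simp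
    then obtain k :: int and c where "c \<in> dyadic" "\<forall>s\<in>{t..<t + \<epsilon>}. G s = circle_pt (2 powi k * s + c)"
      using seg[of t "t + \<epsilon>"] \<epsilon>(2) by blast
    then show ?thesis using \<epsilon>(1) t dyadic_affine[of t c k] by (auto simp: G_def)
  qed
  have sub: "{t. \<not> circle_diff (circ F) t} \<subseteq> Br" using diff_off_Br by blast
  then show "{t. \<not> circle_diff (circ F) t} \<subseteq> dyadic" using Br_dyadic by blast
  have "circle_pt ` Br \<subseteq> circle_pt ` D"
  proof
    fix z assume "z \<in> circle_pt ` Br"
    then obtain t where "frac t \<in> D" "z = circle_pt (frac t)" by (auto simp: Br_def circle_pt_frac)
    then show "z \<in> circle_pt ` D" by blast
  qed
  then show "finite (circle_pt ` {t. \<not> circle_diff (circ F) t})"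
    using sub D(1) by (meson finite_imageI finite_subset image_mono subset_trans)
  show "\<exists>(k::int) c. \<forall>t\<in>{a<..<b}. circ F (circle_pt t) = circle_pt (2 powi k * t + c)"
    if "a < b \<and> (\<forall>t\<in>{a<..<b}. circle_diff (circ F) t)" for a b
    using global_form[of a b] that by (simp add: G_def)
qed

end

lemma dyadic_pl_obtain:
  assumes "dyadic_pl F" "finite D0" "D0 \<subseteq> dyadic"
  obtains D where "finite D" "D \<subseteq> dyadic" "D0 \<subseteq> D" "affine_off D F"
proof -
  obtain D where D: "finite D" "D \<subseteq> dyadic" "affine_off D F"
    using assms(1) unfolding dyadic_pl_def by blast
  have "affine_off (D \<union> D0) F"
    unfolding affine_off_def using affine_offD[OF D(3)] by (auto simp: Int_Un_distrib2)
  then show thesis using that[of "D \<union> D0"] D assms by blast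
qed

lemma circ_in_V:
  assumes "bij_betw F unit_ivl unit_ivl" "dyadic_pl F" shows "circ F \<in> V_maps"
proof -
  obtain D where D: "finite D" "D \<subseteq> dyadic" "{0} \<subseteq> D" "affine_off D F"
    using dyadic_pl_obtain[OF assms(2), of "{0}"] dyadic_0 by auto
  interpret circle_pl F D using assms D by unfold_locales auto
  show ?thesis by (rule circ_V)
qed

lemma circ_in_T:
  assumes F: "bij_betw F unit_ivl unit_ivl" "dyadic_pl F"
    and L: "strict_mono L" "\<And>t. circ F (circle_pt t) = circle_pt (L t)" "\<And>t. L (t + 1) = L t + 1"
  shows "circ F \<in> T_maps"
proof -
  have V: "circ F \<in> V_maps" by (rule circ_in_V[OF F])
  have Bij: "bij_betw (circ F) (sphere 0 1) (sphere 0 1)" using circ_Bij[OF F(1)] by (simp add: Bij_def)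
  have Ln: "L (t + of_nat n) = L t + of_nat n" for t n
  proof (induction n)
    case (Suc n)
    have "L (t + of_nat (Suc n)) = L ((t + of_nat n) + 1)" by (simp add: algebra_simps)
    then show ?case using Suc L(3) by simp
  qed simp
  have Li: "L (t + of_int i) = L t + of_int i" for t i
  proof (cases "i \<ge> 0")
    case True
    then show ?thesis using Ln[of t "nat i"] by simp
  next
    case False
    then show ?thesis using Ln[of "t + of_int i" "nat (- i)"] by simp
  qed
  \<comment> \<open>An increasing function without gaps in its range is continuous. Surjectivity of
    \<open>circ F\<close> gives the values modulo 1, and translation by integers gives all of
    them.\<close>
  have "range L = UNIV"
  proof (intro equalityI subsetI UNIV_I)
    fix y :: real
    have "circle_pt y \<in> circ F ` sphere 0 1" using Bij by (auto simp: bij_betw_def circle_pt_norm)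
    then obtain z where z: "z \<in> sphere 0 1" "circle_pt y = circ F z" by blast
    then obtain t where "z = circle_pt t" by (metis bij_betw_imp_surj_on bij_circle_pt imageE)
    then have "circle_pt (L t) = circle_pt y" using L(2) z by simp
    then have "frac (L t) = frac y" by (metis Arg2pi_circle_pt)
    then have "y = L t + of_int (\<lfloor>y\<rfloor> - \<lfloor>L t\<rfloor>)" by (simp add: frac_def)
    then have "y = L (t + of_int (\<lfloor>y\<rfloor> - \<lfloor>L t\<rfloor>))" by (simp only: Li)
    then show "y \<in> range L" by blast
  qed
  then have contL: "continuous_on UNIV L"
    using strict_mono_mono[OF L(1)] by (intro continuous_onI_mono) (auto simp: mono_def)
  have contc: "continuous_on UNIV circle_pt" unfolding circle_pt_def by (intro continuous_intros)
  have "continuous_on (sphere 0 1) (circ F)"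
    unfolding continuous_on_closed
  proof (intro allI impI)
    fix C assume "closedin (top_of_set (circ F ` sphere 0 1)) C"
    then have C: "closed C" using Bij by (auto simp: bij_betw_def intro: closedin_closed_trans)
    \<comment> \<open>Continuity descends from the line to the circle: the preimage of a closed set
      is the image of a compact part of one period.\<close>
    have "sphere 0 1 \<inter> circ F -` C = circle_pt ` ({0..1} \<inter> (\<lambda>t. circle_pt (L t)) -` C)"
    proof (intro equalityI subsetI)
      fix z assume "z \<in> sphere 0 1 \<inter> circ F -` C"
      moreover from this have "z \<in> circle_pt ` unit_ivl" using bij_circle_pt by (auto simp: bij_betw_def)
      then obtain t where "t \<in> unit_ivl" "z = circle_pt t" by blast
      ultimately show "z \<in> circle_pt ` ({0..1} \<inter> (\<lambda>t. circle_pt (L t)) -` C)"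
        using L(2) by (intro image_eqI[of _ _ t]) auto
    qed (auto simp: L(2) circle_pt_norm)
    moreover have "continuous_on UNIV (\<lambda>t. circle_pt (L t))"
      using continuous_on_compose2[OF contc contL] by simp
    then have "closed ((\<lambda>t. circle_pt (L t)) -` C)" by (rule closed_vimage[OF C])
    then have "compact ({0..1} \<inter> (\<lambda>t. circle_pt (L t)) -` C)" by (intro compact_Int_closed) auto
    then have "compact (circle_pt ` ({0..1} \<inter> (\<lambda>t. circle_pt (L t)) -` C))"
      using contc continuous_on_subset by (intro compact_continuous_image) blast+
    ultimately have "closed (sphere 0 1 \<inter> circ F -` C)" by (simp add: compact_imp_closed)
    then show "closedin (top_of_set (sphere 0 1)) (sphere 0 1 \<inter> circ F -` C)"
      by (rule closed_subset[rotated]) auto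
  qed
  then have "\<exists>g'. homeomorphism (sphere 0 1) (sphere 0 1) (circ F) g'"
    using Bij by (intro homeomorphism_compact) (auto simp: bij_betw_def)
  then show ?thesis using V by (simp add: T_maps_def)
qed

section \<open>Maps of the closed interval\<close>

definition closed_lift :: "(real \<Rightarrow> real) \<Rightarrow> real \<Rightarrow> real" where
  "closed_lift F = restrict (\<lambda>t. if t = 1 then 1 else F t) {0..1}"

lemma closed_lift_in_F:
  assumes bij: "bij_betw F unit_ivl unit_ivl" and pl: "dyadic_pl F" and mono: "strict_mono_on unit_ivl F"
  shows "closed_lift F \<in> F_maps"
proof -
  \<comment> \<open>Extended by the identity outside \<open>[0,1)\<close>, the map is strictly
    increasing and onto the line, hence continuous; this covers the end point 1 as well.\<close>
  define G where "G t = (if t \<in> unit_ivl then F t else t)" for t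
  have FI: "F t \<in> unit_ivl" if "t \<in> unit_ivl" for t using bij that by (auto dest: bij_betwE)
  have G: "G t = closed_lift F t" if "t \<in> {0..1}" for t using that by (auto simp: G_def closed_lift_def)
  have Gmono: "strict_mono G"
  proof (rule strict_monoI)
    fix x y :: real assume "x < y"
    then show "G x < G y"
      using FI[of x] FI[of y] mono by (auto simp: G_def strict_mono_on_def)
  qed
  have "range G = UNIV"
  proof (intro equalityI subsetI UNIV_I)
    fix y :: real
    show "y \<in> range G"
    proof (cases "y \<in> unit_ivl")
      case True
      then obtain x where "x \<in> unit_ivl" "y = F x" by (metis bij bij_betw_imp_surj_on imageE)
      then show ?thesis by (intro image_eqI[of _ _ x]) (auto simp: G_def)
    qed (auto simp: G_def intro!: image_eqI[of _ _ y])
  qed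
  then have contG: "continuous_on UNIV G"
    using strict_mono_mono[OF Gmono] by (intro continuous_onI_mono) (auto simp: mono_def)
  let ?f = "closed_lift F"
  have f1: "?f 1 = 1" and fF: "\<And>t. t \<in> unit_ivl \<Longrightarrow> ?f t = F t" by (auto simp: closed_lift_def)
  have cont: "continuous_on {0..1} ?f"
    using continuous_on_subset[OF contG subset_UNIV] by (rule continuous_on_eq) (rule G)
  have smono: "strict_mono_on {0..1} ?f"
  proof (rule strict_mono_onI)
    fix x y :: real assume "x \<in> {0..1}" "y \<in> {0..1}" "x < y"
    then show "?f x < ?f y" using strict_monoD[OF Gmono, of x y] G by metis
  qed
  have un: "{0..1} = insert 1 unit_ivl" by auto
  have img: "?f ` {0..1} = {0..1}"
  proof -
    have "?f ` unit_ivl = F ` unit_ivl" by (rule image_cong[OF refl fF])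
    then have "?f ` unit_ivl = unit_ivl" using bij by (simp add: bij_betw_def)
    then show ?thesis unfolding un by (simp add: f1)
  qed
  have inj: "inj_on ?f {0..1}" using smono by (rule strict_mono_on_imp_inj_on)
  \<comment> \<open>With 0 and 1 among the break points, the gaps around other points stay inside
    the unit interval and no differentiability at the end points has to be examined.\<close>
  obtain D where D: "finite D" "D \<subseteq> dyadic" "{0, 1} \<subseteq> D" "affine_off D F"
    using dyadic_pl_obtain[OF pl, of "{0, 1}"] dyadic_0 dyadic_1 by auto
  note FD = affine_offD[OF D(4)]
  have aff: "((\<lambda>s. m * s + c) has_vector_derivative m) (at p within S)" for m c p :: real and S
    by (auto intro!: derivative_eq_intros simp: has_real_derivative_iff_has_vector_derivative[symmetric])
  have gap: "\<exists>\<epsilon>>0. \<epsilon> \<le> p \<and> p + \<epsilon> \<le> 1 \<and> D \<inter> {p<..<p + \<epsilon>} = {} \<and> D \<inter> {p - \<epsilon><..<p} = {}"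
    if p: "p \<in> {0<..<1}" for p
  proof -
    obtain \<delta> where \<delta>: "\<delta> > 0" "\<And>s. s \<in> D \<Longrightarrow> s \<noteq> p \<Longrightarrow> \<delta> \<le> dist p s" using finite_set_avoid[OF D(1)] by metis
    have "\<delta> \<le> p" "p + \<delta> \<le> 1" using \<delta>(2)[of 0] \<delta>(2)[of 1] D(3) p by (auto simp: dist_real_def)
    moreover have "s \<notin> D" if "dist p s < \<delta>" "s \<noteq> p" for s using \<delta>(2)[of s] that by auto
    ultimately show ?thesis using \<delta>(1) by (intro exI[of _ \<delta>]) (fastforce simp: dist_real_def)
  qed
  have diff_within: "?f differentiable (at t within {0..1}) \<longleftrightarrow> ?f differentiable (at t)" if "t \<in> {0<..<1}" for t
  proof -
    have "at t within {0..1} = at t" using that at_within_interior[of t "{0..1}"] by simp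
    then show ?thesis by simp
  qed
  have nd: "{t \<in> {0..1}. \<not> ?f differentiable (at t within {0..1})} \<subseteq> D"
  proof (rule ccontr)
    assume "\<not> ?thesis"
    then obtain t where t: "t \<in> {0..1}" "\<not> ?f differentiable (at t within {0..1})" "t \<notin> D" by blast
    then have t01: "t \<in> {0<..<1}" using D(3) by (auto simp: less_le)
    obtain \<epsilon> where \<epsilon>: "\<epsilon> > 0" "\<epsilon> \<le> t" "t + \<epsilon> \<le> 1" "D \<inter> {t<..<t + \<epsilon>} = {}" "D \<inter> {t - \<epsilon><..<t} = {}"
      using gap[OF t01] by blast
    have "{t - \<epsilon><..<t + \<epsilon>} \<subseteq> {t - \<epsilon><..<t} \<union> {t} \<union> {t<..<t + \<epsilon>}" by auto
    then have "D \<inter> {t - \<epsilon><..<t + \<epsilon>} = {}" using \<epsilon> t(3) by blast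
    then obtain k :: int and c where c: "\<forall>s\<in>{t - \<epsilon>..<t + \<epsilon>}. F s = 2 powi k * s + c"
      using FD[of "t - \<epsilon>" "t + \<epsilon>"] \<epsilon> by auto
    have "(?f has_vector_derivative (2 powi k)) (at t)"
    proof (rule has_vector_derivative_transform_within[OF aff \<epsilon>(1)])
      fix s assume "dist s t < \<epsilon>"
      then have "s \<in> {t - \<epsilon>..<t + \<epsilon>}" "s \<in> unit_ivl" using \<epsilon> by (auto simp: dist_real_def)
      then show "2 powi k * s + c = ?f s" using c fF by simp
    qed simp
    then show False using t(2) diff_within[OF t01] by (auto intro: differentiableI_vector)
  qed
  have glob: "\<exists>(k::int) c. \<forall>t\<in>{a<..<b}. ?f t = 2 powi k * t + c"
    if ab: "a < b" "{a<..<b} \<subseteq> {t \<in> {0..1}. ?f differentiable (at t within {0..1})}" for a b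
  proof -
    have "{a<..<b} \<subseteq> {0..1}" using ab by blast
    then have ab01: "0 \<le> a" "b \<le> 1" using ab(1) greaterThanLessThan_subseteq_atLeastAtMost_iff[of a b 0 1] by auto
    have loc: "\<exists>(k::int) \<epsilon>. \<epsilon> > 0 \<and> (\<forall>s. \<bar>s - p\<bar> < \<epsilon> \<longrightarrow> ?f s = ?f p + 2 powi k * (s - p))" if p: "p \<in> {a<..<b}" for p
    proof -
      have p01: "p \<in> {0<..<1}" using p ab01 by auto
      have diff: "?f differentiable at p" using p ab diff_within[OF p01] by auto
      obtain \<epsilon> where \<epsilon>: "\<epsilon> > 0" "\<epsilon> \<le> p" "p + \<epsilon> \<le> 1" "D \<inter> {p<..<p + \<epsilon>} = {}" "D \<inter> {p - \<epsilon><..<p} = {}"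
        using gap[OF p01] by blast
      obtain k1 :: int and c1 where 1: "\<forall>s\<in>{p..<p + \<epsilon>}. F s = 2 powi k1 * s + c1"
        using FD[of p "p + \<epsilon>"] \<epsilon> p01 by auto
      obtain k2 :: int and c2 where 2: "\<forall>s\<in>{p - \<epsilon>..<p}. F s = 2 powi k2 * s + c2"
        using FD[of "p - \<epsilon>" p] \<epsilon> p01 by auto
      have f1: "?f s = 2 powi k1 * s + c1" if "p \<le> s" "s < p + \<epsilon>" for s using 1 fF[of s] that \<epsilon> p01 by auto
      have f2: "?f s = 2 powi k2 * s + c2" if "p - \<epsilon> < s" "s < p" for s using 2 fF[of s] that \<epsilon> p01 by auto
      note m = one_sided_derivatives_match[OF diff \<epsilon>(1) f1 f2 aff aff]
      have "?f s = ?f p + 2 powi k1 * (s - p)" if "\<bar>s - p\<bar> < \<epsilon>" for s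
        using that f1[of s] f1[of p] f2[of s] m(1,2) \<epsilon> by (cases "p \<le> s") (auto simp: algebra_simps)
      then show ?thesis using \<epsilon>(1) by blast
    qed
    define v where "v p = vector_derivative ?f (at p)" for p
    have v: "v s = 2 powi k" if "\<epsilon> > 0" "\<forall>s. \<bar>s - p\<bar> < \<epsilon> \<longrightarrow> ?f s = ?f p + 2 powi k * (s - p)" "\<bar>s - p\<bar> < \<epsilon>"
      for p \<epsilon> s and k :: int
    proof -
      have "(?f has_vector_derivative (2 powi k)) (at s)"
        by (rule has_vector_derivative_transform_within[OF aff[of "2 powi k" "?f p - 2 powi k * p"], where d = "\<epsilon> - \<bar>s - p\<bar>"])
          (use that in \<open>auto simp: dist_real_def algebra_simps\<close>)
      then show ?thesis by (simp add: v_def vector_derivative_at)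
    qed
    \<comment> \<open>Slope and intercept of the local affine formula, both locally
      constant.\<close>
    define \<Phi> where "\<Phi> p = (v p, ?f p - v p * p)" for p
    have "\<Phi> constant_on {a<..<b}"
    proof (rule locally_constant_imp_constant)
      fix p assume p: "p \<in> {a<..<b}"
      obtain k :: int and \<epsilon> where \<epsilon>: "\<epsilon> > 0" "\<forall>s. \<bar>s - p\<bar> < \<epsilon> \<longrightarrow> ?f s = ?f p + 2 powi k * (s - p)"
        using loc[OF p] by blast
      have near: "\<Phi> s = \<Phi> p" if s: "\<bar>s - p\<bar> < \<epsilon>" for s
        using v[OF \<epsilon>, of s] v[OF \<epsilon>, of p] s \<epsilon> by (simp add: \<Phi>_def algebra_simps)
      show "\<exists>U. openin (top_of_set {a<..<b}) U \<and> p \<in> U \<and> (\<forall>x\<in>U. \<Phi> x = \<Phi> p)"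
      proof (intro exI[of _ "{a<..<b} \<inter> ball p \<epsilon>"] conjI ballI)
        show "openin (top_of_set {a<..<b}) ({a<..<b} \<inter> ball p \<epsilon>)" by (rule openin_open_Int) simp
        show "\<Phi> x = \<Phi> p" if "x \<in> {a<..<b} \<inter> ball p \<epsilon>" for x
        using near[of x] that by (simp add: dist_real_def abs_minus_commute)
    qed (use p \<epsilon>(1) in auto)
    qed simp
    then obtain v0 c where const: "\<forall>t\<in>{a<..<b}. v t = v0 \<and> ?f t - v t * t = c"
      unfolding constant_on_def \<Phi>_def prod_eq_iff by auto
    define p where "p = (a + b) / 2"
    have p: "p \<in> {a<..<b}" using ab by (auto simp: p_def)
    obtain k :: int where "v p = 2 powi k" using loc[OF p] v[of _ p _ p] by auto
    then have "\<forall>t\<in>{a<..<b}. ?f t = 2 powi k * t + c" using const p by (auto simp: algebra_simps)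
    then show ?thesis by blast
  qed
  have "\<exists>f'. homeomorphism {0..1} {0..1} ?f f'"
    using cont img inj by (intro homeomorphism_compact) auto
  moreover have "?f \<in> Bij {0..1}"
    using img inj by (simp add: Bij_def bij_betw_def closed_lift_def)
  moreover have "finite {t \<in> {0..1}. \<not> ?f differentiable (at t within {0..1})}"
    using nd D(1) finite_subset by blast
  ultimately show ?thesis
    unfolding F_maps_def using smono nd D(2) glob by blast
qed

lemma closed_lift_compose:
  assumes "G ` unit_ivl \<subseteq> unit_ivl"
  shows "closed_lift (compose unit_ivl F G) = compose {0..1} (closed_lift F) (closed_lift G)"
proof
  fix t
  have "t \<in> unit_ivl \<Longrightarrow> G t \<in> unit_ivl" using assms by blast
  then show "closed_lift (compose unit_ivl F G) t = compose {0..1} (closed_lift F) (closed_lift G) t"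
    by (auto simp: closed_lift_def compose_def)
qed

lemma closed_lift_inj: "inj_on closed_lift (Bij unit_ivl)"
proof (rule inj_onI)
  fix F G assume F: "F \<in> Bij unit_ivl" and G: "G \<in> Bij unit_ivl" and eq: "closed_lift F = closed_lift G"
  show "F = G"
  proof
    fix t
    show "F t = G t"
    proof (cases "t \<in> unit_ivl")
      case True
      then show ?thesis using fun_cong[OF eq, of t] by (auto simp: closed_lift_def)
    next
      case False
      then show ?thesis using F G by (metis Bij_imp_extensional extensional_arb)
    qed
  qed
qed

section \<open>An arc crossing a strip\<close>

text \<open>A convex set is simply connected, so the triangle contracts inside \<open>Q\<close> and
  its image contracts away from \<open>z\<close>.\<close>

lemma winding_number_triangle_image:
  assumes h: "continuous_on Q h" and Q: "convex Q" "a \<in> Q" "b \<in> Q" "c \<in> Q" and z: "z \<notin> h ` Q"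
  shows "winding_number (h \<circ> linepath a b) z + winding_number (h \<circ> linepath b c) z +
    winding_number (h \<circ> linepath c a) z = 0"
proof -
  let ?l = "linepath a b +++ linepath b c +++ linepath c a"
  have sub: "path_image (linepath x y) \<subseteq> Q" if "x \<in> Q" "y \<in> Q" for x y
    using closed_segment_subset[OF that Q(1)] by simp
  have "path ?l" "path_image ?l \<subseteq> Q" "pathfinish ?l = pathstart ?l"
    using sub[OF Q(2,3)] sub[OF Q(3,4)] sub[OF Q(4,2)] by (auto simp: path_image_join)
  then have "homotopic_loops Q ?l (linepath a a)"
    using convex_imp_simply_connected[OF Q(1)] Q(2) unfolding simply_connected_eq_contractible_loop_any by blast
  from homotopic_loops_continuous_image[OF this h, of "- {z}"] z
  have "homotopic_loops (- {z}) (h \<circ> ?l) (h \<circ> linepath a a)" by auto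
  then have "winding_number (h \<circ> ?l) z = winding_number (h \<circ> linepath a a) z"
    by (rule winding_number_homotopic_loops)
  also have "h \<circ> linepath a a = linepath (h a) (h a)" by (auto simp: linepath_def fun_eq_iff scaleR_add_left[symmetric])
  also have "winding_number (linepath (h a) (h a)) z = 0"
  proof -
    have "z \<noteq> h a" using z Q(2) by blast
    then show ?thesis by simp
  qed
  finally have 0: "winding_number (h \<circ> ?l) z = 0" .
  have paths: "path (h \<circ> linepath x y)" "z \<notin> path_image (h \<circ> linepath x y)" if "x \<in> Q" "y \<in> Q" for x y
    using sub[OF that] z continuous_on_subset[OF h] by (auto simp: path_image_compose intro!: path_continuous_image)
  show ?thesis
    using 0 paths Q
    by (simp add: add.assoc path_compose_join winding_number_join path_image_join pathfinish_compose pathstart_compose)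
qed

lemma winding_number_linepath_image_rev:
  assumes "continuous_on (closed_segment a b) h" "z \<notin> h ` closed_segment a b"
  shows "winding_number (h \<circ> linepath b a) z = - winding_number (h \<circ> linepath a b) z"
proof -
  have "h \<circ> linepath b a = reversepath (h \<circ> linepath a b)"
    by (simp flip: path_compose_reversepath)
  moreover have "path (h \<circ> linepath a b)" "z \<notin> path_image (h \<circ> linepath a b)"
    using assms by (auto simp: path_image_compose intro!: path_continuous_image)
  ultimately show ?thesis by (simp add: winding_number_reversepath)
qed

lemma winding_number_triangle:
  assumes "z \<notin> convex hull {a, b, c}"
  shows "winding_number (linepath a b) z + winding_number (linepath b c) z + winding_number (linepath c a) z = 0"
  using winding_number_triangle_image[of "convex hull {a, b, c}" "\<lambda>x. x" a b c z] assms
  by (auto simp: hull_inc comp_def)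

lemma winding_number_linepath_rev:
  "z \<notin> closed_segment a b \<Longrightarrow> winding_number (linepath b a) z = - winding_number (linepath a b) z"
  using winding_number_linepath_image_rev[of a b "\<lambda>x. x" z] by (auto simp: comp_def)

lemma in_segment_Complex:
  "z \<in> closed_segment (Complex a c) (Complex a' c') \<longleftrightarrow>
    (\<exists>u. 0 \<le> u \<and> u \<le> 1 \<and> Re z = (1 - u) * a + u * a' \<and> Im z = (1 - u) * c + u * c')"
  by (auto simp: closed_segment_def complex_eq_iff)

text \<open>
  The arc is closed up by a polygon outside the strip, through the far right (\<open>s = 1\<close>) or the far
  left (\<open>s = - 1\<close>). Both curves are simple, and their winding numbers differ by one.
\<close>

locale crossing_arc =
  fixes \<gamma> :: "real \<Rightarrow> complex" and b xb xt M :: real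
  assumes b: "0 < b" and \<gamma>: "arc \<gamma>" "pathstart \<gamma> = Complex xb 0" "pathfinish \<gamma> = Complex xt b"
    and \<gamma>_strip: "\<And>z. z \<in> path_image \<gamma> \<Longrightarrow> z = Complex xb 0 \<or> z = Complex xt b \<or> 0 < Im z \<and> Im z < b"
    and \<gamma>_bound: "\<And>z. z \<in> path_image \<gamma> \<Longrightarrow> \<bar>Re z\<bar> < M"
begin

definition closing :: "real \<Rightarrow> real \<Rightarrow> complex" where
  "closing s = linepath (Complex xt b) (Complex (s * M) (b + 1)) +++
     (linepath (Complex (s * M) (b + 1)) (Complex (s * M) (- 1)) +++
      linepath (Complex (s * M) (- 1)) (Complex xb 0))"

text \<open>As \<open>\<gamma>\<close> runs upwards, closing it on the right turns clockwise:
  \<open>N 1\<close> is to be \<open>0\<close> on the left of the arc and \<open>- 1\<close> on the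
  right, and \<open>N (- 1)\<close> is to be \<open>1\<close> and \<open>0\<close>.\<close>

definition N :: "real \<Rightarrow> complex \<Rightarrow> complex" where
  "N s z = winding_number (\<gamma> +++ closing s) z"

definition region :: "complex set" where
  "region = {z. 0 \<le> Im z \<and> Im z \<le> b \<and> \<bar>Re z\<bar> < M}"

lemma bounds: "\<bar>xb\<bar> < M" "\<bar>xt\<bar> < M"
  using \<gamma>_bound[of "Complex xb 0"] \<gamma>_bound[of "Complex xt b"] \<gamma>(2,3)
    pathstart_in_path_image[of \<gamma>] pathfinish_in_path_image[of \<gamma>] by auto

lemma closing_ends [simp]: "pathstart (closing s) = Complex xt b" "pathfinish (closing s) = Complex xb 0"
  by (simp_all add: closing_def)

lemma path_image_closing:
  "path_image (closing s) = closed_segment (Complex xt b) (Complex (s * M) (b + 1)) \<union>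
     closed_segment (Complex (s * M) (b + 1)) (Complex (s * M) (- 1)) \<union>
     closed_segment (Complex (s * M) (- 1)) (Complex xb 0)"
  by (auto simp: closing_def path_image_join)

lemma segments:
  "z \<in> closed_segment (Complex xt b) (Complex (s * M) (b + 1)) \<Longrightarrow>
     \<exists>u. 0 \<le> u \<and> u \<le> 1 \<and> Re z = xt + u * (s * M - xt) \<and> Im z = b + u"
  "z \<in> closed_segment (Complex (s * M) (b + 1)) (Complex (s * M) (- 1)) \<Longrightarrow> Re z = s * M"
  "z \<in> closed_segment (Complex (s * M) (- 1)) (Complex xb 0) \<Longrightarrow>
     \<exists>u. 0 \<le> u \<and> u \<le> 1 \<and> Re z = xb + u * (s * M - xb) \<and> Im z = - u"
proof -
  show "z \<in> closed_segment (Complex xt b) (Complex (s * M) (b + 1)) \<Longrightarrow>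
     \<exists>u. 0 \<le> u \<and> u \<le> 1 \<and> Re z = xt + u * (s * M - xt) \<and> Im z = b + u"
    unfolding in_segment_Complex by (auto simp: algebra_simps)
  show "z \<in> closed_segment (Complex (s * M) (b + 1)) (Complex (s * M) (- 1)) \<Longrightarrow> Re z = s * M"
    unfolding in_segment_Complex by (auto simp: algebra_simps)
  assume "z \<in> closed_segment (Complex (s * M) (- 1)) (Complex xb 0)"
  then obtain u where "0 \<le> u" "u \<le> 1" "Re z = (1 - u) * (s * M) + u * xb" "Im z = (1 - u) * - 1 + u * 0"
    unfolding in_segment_Complex by blast
  then show "\<exists>u. 0 \<le> u \<and> u \<le> 1 \<and> Re z = xb + u * (s * M - xb) \<and> Im z = - u"
    by (intro exI[of _ "1 - u"]) (auto simp: algebra_simps)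
qed

lemma closing_region:
  assumes "z \<in> path_image (closing s)" "z \<in> region" "s \<in> {1, - 1}"
  shows "z = Complex xt b \<or> z = Complex xb 0"
proof -
  from assms(1) consider "z \<in> closed_segment (Complex xt b) (Complex (s * M) (b + 1))"
    | "z \<in> closed_segment (Complex (s * M) (b + 1)) (Complex (s * M) (- 1))"
    | "z \<in> closed_segment (Complex (s * M) (- 1)) (Complex xb 0)"
    by (auto simp: path_image_closing)
  then show ?thesis
  proof cases
    case 1
    then obtain u where "0 \<le> u" "Re z = xt + u * (s * M - xt)" "Im z = b + u" using segments(1) by blast
    then show ?thesis using assms(2) by (auto simp: region_def complex_eq_iff)
  next
    case 2
    then show ?thesis using segments(2)[OF 2] assms(2,3) by (auto simp: region_def)
  next
    case 3
    then obtain u where "0 \<le> u" "Re z = xb + u * (s * M - xb)" "Im z = - u" using segments(3) by blast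
    then show ?thesis using assms(2) by (auto simp: region_def complex_eq_iff)
  qed
qed

lemma arc_closing: assumes s: "s \<in> {1, - 1}" shows "arc (closing s)"
  unfolding closing_def
proof (intro arc_join)
  have M: "s * M \<noteq> xb" "s * M \<noteq> xt" using s bounds by auto
  show "path_image (linepath (Complex (s * M) (b + 1)) (Complex (s * M) (- 1))) \<inter>
      path_image (linepath (Complex (s * M) (- 1)) (Complex xb 0)) \<subseteq>
      {pathstart (linepath (Complex (s * M) (- 1)) (Complex xb 0))}"
  proof
    fix z assume "z \<in> path_image (linepath (Complex (s * M) (b + 1)) (Complex (s * M) (- 1))) \<inter>
      path_image (linepath (Complex (s * M) (- 1)) (Complex xb 0))"
    then have "Re z = s * M" and "\<exists>u. 0 \<le> u \<and> u \<le> 1 \<and> Re z = xb + u * (s * M - xb) \<and> Im z = - u"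
      using segments(2,3) by auto
    then obtain u where "(1 - u) * (s * M - xb) = 0" "Im z = - u" "Re z = s * M" by (auto simp: algebra_simps)
    then show "z \<in> {pathstart (linepath (Complex (s * M) (- 1)) (Complex xb 0))}"
      using M by (auto simp: complex_eq_iff)
  qed
  show "path_image (linepath (Complex xt b) (Complex (s * M) (b + 1))) \<inter>
      path_image (linepath (Complex (s * M) (b + 1)) (Complex (s * M) (- 1)) +++
         linepath (Complex (s * M) (- 1)) (Complex xb 0)) \<subseteq>
      {pathstart (linepath (Complex (s * M) (b + 1)) (Complex (s * M) (- 1)) +++
         linepath (Complex (s * M) (- 1)) (Complex xb 0))}"
  proof
    fix z assume "z \<in> path_image (linepath (Complex xt b) (Complex (s * M) (b + 1))) \<inter>
      path_image (linepath (Complex (s * M) (b + 1)) (Complex (s * M) (- 1)) +++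
         linepath (Complex (s * M) (- 1)) (Complex xb 0))"
    then have z1: "z \<in> closed_segment (Complex xt b) (Complex (s * M) (b + 1))"
      and z2: "z \<in> closed_segment (Complex (s * M) (b + 1)) (Complex (s * M) (- 1)) \<or>
        z \<in> closed_segment (Complex (s * M) (- 1)) (Complex xb 0)"
      by (auto simp: path_image_join)
    obtain u where u: "0 \<le> u" "u \<le> 1" "Re z = xt + u * (s * M - xt)" "Im z = b + u" using segments(1)[OF z1] by blast
    have "Re z = s * M" using z2
    proof
      assume "z \<in> closed_segment (Complex (s * M) (- 1)) (Complex xb 0)"
      then have "Im z \<le> 0" using segments(3) by force
      then show ?thesis using u b by auto
    qed (rule segments(2))
    then have "(1 - u) * (s * M - xt) = 0" using u by (auto simp: algebra_simps)
    then have "u = 1" using M by auto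
    then show "z \<in> {pathstart (linepath (Complex (s * M) (b + 1)) (Complex (s * M) (- 1)) +++
         linepath (Complex (s * M) (- 1)) (Complex xb 0))}" using u by (simp add: complex_eq_iff)
  qed
qed (use b in auto)

lemma \<gamma>_region: "z \<in> path_image \<gamma> \<Longrightarrow> z \<in> region"
  using \<gamma>_strip[of z] \<gamma>_bound[of z] b by (auto simp: region_def)

lemma simple_loop: "s \<in> {1, - 1} \<Longrightarrow> simple_path (\<gamma> +++ closing s)"
  using closing_region \<gamma>_region arc_closing \<gamma> by (intro simple_path_join_loop) auto

lemma path_image_loop: "path_image (\<gamma> +++ closing s) = path_image \<gamma> \<union> path_image (closing s)"
  using \<gamma> by (simp add: path_image_join)

lemma loop: "path (\<gamma> +++ closing s)" "pathfinish (\<gamma> +++ closing s) = pathstart (\<gamma> +++ closing s)"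
  using \<gamma> arc_imp_path by (auto simp: closing_def)

lemma off_loop:
  assumes "z \<in> region" "z \<notin> path_image \<gamma>" "s \<in> {1, - 1}" shows "z \<notin> path_image (closing s)" "z \<notin> path_image (\<gamma> +++ closing s)"
proof -
  have "Complex xb 0 \<in> path_image \<gamma>" "Complex xt b \<in> path_image \<gamma>"
    using \<gamma>(2,3) pathstart_in_path_image[of \<gamma>] pathfinish_in_path_image[of \<gamma>] by auto
  then show "z \<notin> path_image (closing s)" using closing_region[OF _ assms(1,3)] assms(2) by auto
  then show "z \<notin> path_image (\<gamma> +++ closing s)" using assms(2) path_image_loop by auto
qed

lemma N_split:
  assumes "z \<in> region" "z \<notin> path_image \<gamma>" "s \<in> {1, - 1}"
  shows "N s z = winding_number \<gamma> z + winding_number (closing s) z"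
  unfolding N_def using off_loop[OF assms] assms(2) \<gamma> arc_imp_path arc_closing[OF assms(3)]
  by (intro winding_number_join) auto

lemma N_const:
  assumes "connected A" "A \<subseteq> region" "A \<inter> path_image \<gamma> = {}" "s \<in> {1, - 1}" "x \<in> A" "y \<in> A"
  shows "N s x = N s y"
  unfolding N_def
proof (rule winding_number_eq[OF loop assms(5,6,1)])
  show "A \<inter> path_image (\<gamma> +++ closing s) = {}" using off_loop(2) assms by blast
qed

text \<open>The two closing polygons differ by the boundary of a rectangle around \<open>z\<close>,
  run through counterclockwise, and by two triangles with vertices at the ends of the arc, which do
  not contain \<open>z\<close>.\<close>

lemma N_diff:
  assumes z: "z \<in> region" "z \<notin> path_image \<gamma>" shows "N (- 1) z = N 1 z + 1"
proof -
  define A B C D where "A = Complex M (b + 1)" and "B = Complex M (- 1)" and "C = Complex (- M) (- 1)"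
    and "D = Complex (- M) (b + 1)"
  define p q where "p = Complex xb 0" and "q = Complex xt b"
  have pq: "p \<in> path_image \<gamma>" "q \<in> path_image \<gamma>"
    using \<gamma>(2,3) pathstart_in_path_image[of \<gamma>] pathfinish_in_path_image[of \<gamma>] by (auto simp: p_def q_def)
  have "z \<notin> path_image (closing 1)" "z \<notin> path_image (closing (- 1))" using off_loop(1)[OF z] by auto
  then have no: "z \<notin> closed_segment q A" "z \<notin> closed_segment A B" "z \<notin> closed_segment B p"
      "z \<notin> closed_segment q D" "z \<notin> closed_segment D C" "z \<notin> closed_segment C p"
    unfolding path_image_closing by (auto simp: A_def B_def C_def D_def p_def q_def)
  have cl: "winding_number (closing 1) z = winding_number (linepath q A) z + winding_number (linepath A B) z + winding_number (linepath B p) z"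
    "winding_number (closing (- 1)) z = winding_number (linepath q D) z + winding_number (linepath D C) z + winding_number (linepath C p) z"
    using no by (simp_all add: closing_def winding_number_join path_image_join flip: A_def B_def C_def D_def p_def q_def)
  have z': "0 \<le> Im z" "Im z \<le> b" "\<bar>Re z\<bar> < M" using z by (auto simp: region_def)
  \<comment> \<open>The only point of this triangle at height at most \<open>b\<close> is its vertex
    \<open>q\<close>, which lies on the arc. The lower triangle is treated in the same way.\<close>
  have top: "z \<notin> convex hull {A, D, q}"
  proof
    assume "z \<in> convex hull {A, D, q}"
    then obtain u v w where uvw: "0 \<le> u" "0 \<le> v" "0 \<le> w" "u + v + w = 1" "z = u *\<^sub>R A + v *\<^sub>R D + w *\<^sub>R q"
      unfolding convex_hull_3 by blast
    have "Im z = (u + v + w) * b + (u + v)" unfolding uvw(5) by (simp add: A_def D_def q_def algebra_simps)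
    then have "u + v \<le> 0" using z'(2) uvw(4) by simp
    then have "u = 0" "v = 0" "w = 1" using uvw by auto
    then show False using uvw(5) z(2) pq by simp
  qed
  have bot: "z \<notin> convex hull {C, B, p}"
  proof
    assume "z \<in> convex hull {C, B, p}"
    then obtain u v w where uvw: "0 \<le> u" "0 \<le> v" "0 \<le> w" "u + v + w = 1" "z = u *\<^sub>R C + v *\<^sub>R B + w *\<^sub>R p"
      unfolding convex_hull_3 by blast
    have "Im z = - (u + v)" unfolding uvw(5) by (simp add: C_def B_def p_def algebra_simps)
    then have "u = 0" "v = 0" "w = 1" using uvw z'(1) by auto
    then show False using uvw(5) z(2) pq by simp
  qed
  have t1: "winding_number (linepath A D) z + winding_number (linepath D q) z + winding_number (linepath q A) z = 0"
    by (rule winding_number_triangle[OF top])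
  have t2: "winding_number (linepath C B) z + winding_number (linepath B p) z + winding_number (linepath p C) z = 0"
    by (rule winding_number_triangle[OF bot])
  have AD: "z \<notin> closed_segment A D" "z \<notin> closed_segment C B"
    using top bot closed_segment_subset_convex_hull[of A "{A, D, q}" D] closed_segment_subset_convex_hull[of C "{C, B, p}" B]
    by (auto simp: hull_inc)
  have "z \<in> box C A" using z' b by (auto simp: in_box_complex_iff A_def C_def)
  then have "winding_number (rectpath C A) z = 1" by (rule winding_number_rectpath)
  moreover have "rectpath C A = linepath C B +++ linepath B A +++ linepath A D +++ linepath D C"
    by (simp add: rectpath_def Let_def A_def B_def C_def D_def)
  ultimately have r: "winding_number (linepath C B) z + winding_number (linepath B A) z +
      winding_number (linepath A D) z + winding_number (linepath D C) z = 1"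
    using no AD by (simp add: winding_number_join path_image_join closed_segment_commute add.assoc)
  have rev: "winding_number (linepath D q) z = - winding_number (linepath q D) z"
    "winding_number (linepath p C) z = - winding_number (linepath C p) z"
    "winding_number (linepath B A) z = - winding_number (linepath A B) z"
    using no by (auto intro: winding_number_linepath_rev)
  have "winding_number (closing (- 1)) z = winding_number (closing 1) z + 1"
  proof -
    have e: "winding_number (linepath q D) z = winding_number (linepath A D) z + winding_number (linepath q A) z"
      "winding_number (linepath C p) z = winding_number (linepath C B) z + winding_number (linepath B p) z"
      using t1 t2 unfolding rev by (simp_all add: algebra_simps)
    have "winding_number (closing (- 1)) z = (winding_number (linepath C B) z - winding_number (linepath A B) z +
        winding_number (linepath A D) z + winding_number (linepath D C) z) + winding_number (closing 1) z"
      unfolding cl e by simp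
    also have "winding_number (linepath C B) z - winding_number (linepath A B) z +
        winding_number (linepath A D) z + winding_number (linepath D C) z = 1"
      using r unfolding rev by simp
    finally show ?thesis by simp
  qed
  then show ?thesis using N_split[OF z] by simp
qed

text \<open>Both closed curves are simple, so \<open>N 1 z\<close> and \<open>N 1 z + 1\<close> both
  lie in \<open>{- 1, 0, 1}\<close>; this excludes the value \<open>1\<close> for
  \<open>N 1 z\<close>.\<close>

lemma N_values:
  assumes z: "z \<in> region" "z \<notin> path_image \<gamma>" shows "N 1 z = 0 \<or> N 1 z = - 1"
proof -
  have "N s z \<in> {- 1, 0, 1}" if "s \<in> {1, - 1}" for s
    unfolding N_def
    by (rule simple_closed_path_winding_number_cases[OF simple_loop[OF that] loop(2) off_loop(2)[OF z that]])
  then have "N 1 z \<in> {- 1, 0, 1}" "N (- 1) z \<in> {- 1, 0, 1}" by simp_all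
  then show ?thesis using N_diff[OF z] by auto
qed

lemma N_zero_ray:
  assumes "A \<inter> path_image (\<gamma> +++ closing s) = {}" "connected A" "\<not> bounded A" "z \<in> A"
  shows "N s z = 0"
proof -
  obtain B where B: "\<And>z. B \<le> norm z \<Longrightarrow> winding_number (\<gamma> +++ closing s) z = 0"
    using winding_number_zero_at_infinity[OF loop] by blast
  obtain y where "y \<in> A" "\<not> norm y \<le> B" using assms(3) unfolding bounded_iff by blast
  then show ?thesis
    using winding_number_eq[OF loop assms(4) _ assms(2,1), of y] B unfolding N_def by simp
qed

lemma vertical_ray:
  "connected {z. Re z = x \<and> c \<le> Im z}" "\<not> bounded {z. Re z = x \<and> c \<le> Im z}"
  "connected {z. Re z = x \<and> Im z \<le> c}" "\<not> bounded {z. Re z = x \<and> Im z \<le> c}"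
proof -
  have "{z. Re z = x \<and> c \<le> Im z} = {z. Re z \<le> x} \<inter> {z. Re z \<ge> x} \<inter> {z. Im z \<ge> c}"
    "{z. Re z = x \<and> Im z \<le> c} = {z. Re z \<le> x} \<inter> {z. Re z \<ge> x} \<inter> {z. Im z \<le> c}"
    by auto
  then have "convex {z. Re z = x \<and> c \<le> Im z}" "convex {z. Re z = x \<and> Im z \<le> c}"
    by (simp_all only: convex_Int convex_halfspace_Im_ge convex_halfspace_Im_le
        convex_halfspace_Re_ge convex_halfspace_Re_le)
  then show "connected {z. Re z = x \<and> c \<le> Im z}" "connected {z. Re z = x \<and> Im z \<le> c}"
    by (auto intro: convex_connected)
  show "\<not> bounded {z. Re z = x \<and> c \<le> Im z}"
  proof
    assume "bounded {z. Re z = x \<and> c \<le> Im z}"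
    then obtain B where B: "\<And>z. Re z = x \<Longrightarrow> c \<le> Im z \<Longrightarrow> norm z \<le> B" unfolding bounded_iff by blast
    have "\<bar>Im (Complex x (max c (B + 1)))\<bar> \<le> B" using B[of "Complex x (max c (B + 1))"] abs_Im_le_cmod order_trans by fastforce
    then show False by auto
  qed
  show "\<not> bounded {z. Re z = x \<and> Im z \<le> c}"
  proof
    assume "bounded {z. Re z = x \<and> Im z \<le> c}"
    then obtain B where B: "\<And>z. Re z = x \<Longrightarrow> Im z \<le> c \<Longrightarrow> norm z \<le> B" unfolding bounded_iff by blast
    have "\<bar>Im (Complex x (min c (- B - 1)))\<bar> \<le> B" using B[of "Complex x (min c (- B - 1))"] abs_Im_le_cmod order_trans by fastforce
    then show False by auto
  qed
qed

text \<open>From a frame point on the side of the arc away from the closing polygon, a vertical ray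
  leaves the strip and escapes to infinity without meeting the loop.\<close>

lemma N_frame_zero:
  assumes s: "s \<in> {1, - 1}" and x: "\<bar>x\<bar> < M"
  shows "s * (xt - x) > 0 \<Longrightarrow> N s (Complex x b) = 0" "s * (xb - x) > 0 \<Longrightarrow> N s (Complex x 0) = 0"
proof -
  have M: "s * s = 1" "s * (s * M - x) > 0" using s x by auto
  have out: "z \<notin> path_image (\<gamma> +++ closing s)"
    if "Re z = x" and off: "z \<notin> path_image \<gamma>" "\<And>u. 0 \<le> u \<Longrightarrow> u \<le> 1 \<Longrightarrow> x = xt + u * (s * M - xt) \<Longrightarrow> Im z \<noteq> b + u"
      "\<And>u. 0 \<le> u \<Longrightarrow> u \<le> 1 \<Longrightarrow> x = xb + u * (s * M - xb) \<Longrightarrow> Im z \<noteq> - u" for z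
  proof -
    have "x \<noteq> s * M" using s x by auto
    then show ?thesis
      unfolding path_image_loop path_image_closing using that segments[of z s] by blast
  qed
  \<comment> \<open>A segment joining abscissae that lie on the same side of \<open>x\<close> does
    not reach \<open>x\<close>; multiplication by \<open>s\<close> treats both sides at
    once.\<close>
  have mid: "x \<noteq> y + u * (s * M - y)" if "s * (y - x) > 0" "0 \<le> u" "u \<le> 1" for u y
  proof
    assume "x = y + u * (s * M - y)"
    moreover have "(1 - u) * (s * (y - x)) + u * (s * (s * M - x)) = s * (y + u * (s * M - y) - x)"
      by (simp add: algebra_simps)
    ultimately have "(1 - u) * (s * (y - x)) + u * (s * (s * M - x)) = 0" by simp
    moreover have "(1 - u) * (s * (y - x)) \<ge> 0" "u * (s * (s * M - x)) \<ge> 0" using that M by simp_all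
    ultimately have "(1 - u) * (s * (y - x)) = 0" "u * (s * (s * M - x)) = 0" by linarith+
    then show False using that M by auto
  qed
  show "N s (Complex x b) = 0" if xt: "s * (xt - x) > 0"
  proof (rule N_zero_ray[OF _ vertical_ray(1,2)])
    show "{z. Re z = x \<and> b \<le> Im z} \<inter> path_image (\<gamma> +++ closing s) = {}"
    proof (rule ccontr)
      assume "\<not> ?thesis"
      then obtain z where z: "Re z = x" "b \<le> Im z" "z \<in> path_image (\<gamma> +++ closing s)" by blast
      have "z \<notin> path_image \<gamma>" using \<gamma>_strip[of z] z b xt by auto
      moreover have "Im z \<noteq> - u" if "0 \<le> u" for u using z b that by auto
      ultimately show False using out[OF z(1)] z(3) mid[OF xt] by blast
    qed
  qed simp
  show "N s (Complex x 0) = 0" if xb: "s * (xb - x) > 0"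
  proof (rule N_zero_ray[OF _ vertical_ray(3,4)])
    show "{z. Re z = x \<and> Im z \<le> 0} \<inter> path_image (\<gamma> +++ closing s) = {}"
    proof (rule ccontr)
      assume "\<not> ?thesis"
      then obtain z where z: "Re z = x" "Im z \<le> 0" "z \<in> path_image (\<gamma> +++ closing s)" by blast
      have "z \<notin> path_image \<gamma>" using \<gamma>_strip[of z] z b xb by auto
      moreover have "Im z \<noteq> b + u" if "0 \<le> u" for u using z b that by auto
      ultimately show False using out[OF z(1)] z(3) mid[OF xb] by blast
    qed
  qed simp
qed

lemma N_frame:
  assumes "\<bar>x\<bar> < M"
  shows "x < xt \<Longrightarrow> N 1 (Complex x b) = 0" "xb < x \<Longrightarrow> N 1 (Complex x 0) = - 1"
proof -
  show "x < xt \<Longrightarrow> N 1 (Complex x b) = 0" using N_frame_zero(1)[of 1 x] assms by simp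
  \<comment> \<open>To the right of the arc it is the loop closed on the left that is missed by the
    ray; \<open>N_diff\<close> converts the result.\<close>
  assume x: "xb < x"
  then have "N (- 1) (Complex x 0) = 0" using N_frame_zero(2)[of "- 1" x] assms by simp
  moreover have "Complex x 0 \<notin> path_image \<gamma>" using \<gamma>_strip[of "Complex x 0"] x b by auto
  moreover have "Complex x 0 \<in> region" using assms b by (simp add: region_def)
  ultimately have "N 1 (Complex x 0) + 1 = 0" using N_diff by metis
  then show "N 1 (Complex x 0) = - 1" by (simp add: add_eq_0_iff2)
qed

end

section \<open>An arc crossing a transistor\<close>

lemma unit_square_iff: "z \<in> unit_square \<longleftrightarrow> 0 \<le> Re z \<and> Re z \<le> 1 \<and> 0 \<le> Im z \<and> Im z \<le> 1"
  by (auto simp: in_cbox_complex_iff)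

text \<open>Seen from a point on its right, the straight crossing can be pushed to the left part
  \<open>lam\<close> of the boundary of the square; seen from the left, to the right part
  \<open>rho\<close>. Both points are then moved to one interior point, where \<open>rho\<close> and
  \<open>lam\<close> differ by the whole boundary, of winding number 1 by orientation.\<close>

lemma transistor_crossing:
  assumes h: "oriented_embedding h" and \<alpha>\<beta>: "0 < \<alpha>" "\<alpha> < 1" "0 < \<beta>" "\<beta> < 1"
    and rest: "path rest" "pathstart rest = h (Complex \<alpha> 1)" "pathfinish rest = h (Complex \<beta> 0)"
      "path_image rest \<inter> h ` unit_square \<subseteq> {h (Complex \<alpha> 1), h (Complex \<beta> 0)}"
    and zl: "zl \<in> unit_square" "Re zl < \<beta> + (\<alpha> - \<beta>) * Im zl"
    and zr: "zr \<in> unit_square" "Re zr > \<beta> + (\<alpha> - \<beta>) * Im zr"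
  shows "winding_number rest (h zl) + winding_number (h \<circ> linepath (Complex \<beta> 0) (Complex \<alpha> 1)) (h zl) =
    winding_number rest (h zr) + winding_number (h \<circ> linepath (Complex \<beta> 0) (Complex \<alpha> 1)) (h zr) + 1"
proof -
  let ?S = unit_square
  define pb pt where "pb = Complex \<beta> 0" and "pt = Complex \<alpha> 1"
  define c00 c10 c11 c01 where "c00 = Complex 0 0" and "c10 = Complex 1 0" and "c11 = Complex 1 1" and "c01 = Complex 0 1"
  note pts = pb_def pt_def c00_def c10_def c11_def c01_def
  have hc: "continuous_on ?S h" and hi: "inj_on h ?S"
    and hw: "winding_number (h \<circ> rectpath 0 (Complex 1 1)) (h (Complex (1/2) (1/2))) = 1"
    using h by (auto simp: oriented_embedding_def)
  have cS: "convex ?S" by (rule convex_box)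
  \<comment> \<open>The two closed and the two open parts into which the crossing divides the
    square. All are convex, hence their images are connected and loops in them contract.\<close>
  define QL where "QL = {z \<in> ?S. Re z \<le> \<beta> + (\<alpha> - \<beta>) * Im z}"
  define QR where "QR = {z \<in> ?S. Re z \<ge> \<beta> + (\<alpha> - \<beta>) * Im z}"
  define SL where "SL = {z \<in> ?S. Re z < \<beta> + (\<alpha> - \<beta>) * Im z}"
  define SR where "SR = {z \<in> ?S. Re z > \<beta> + (\<alpha> - \<beta>) * Im z}"
  have half: "QL = ?S \<inter> {z. Complex 1 (- (\<alpha> - \<beta>)) \<bullet> z \<le> \<beta>}" "QR = ?S \<inter> {z. Complex 1 (- (\<alpha> - \<beta>)) \<bullet> z \<ge> \<beta>}"
    "SL = ?S \<inter> {z. Complex 1 (- (\<alpha> - \<beta>)) \<bullet> z < \<beta>}" "SR = ?S \<inter> {z. Complex 1 (- (\<alpha> - \<beta>)) \<bullet> z > \<beta>}"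
    by (auto simp: QL_def QR_def SL_def SR_def inner_complex_def algebra_simps)
  have conv: "convex QL" "convex QR" "convex SL" "convex SR"
    unfolding half by (intro convex_Int cS convex_halfspace_le convex_halfspace_ge convex_halfspace_lt convex_halfspace_gt)+
  define W where "W a c z = winding_number (h \<circ> linepath a c) (h z)" for a c z
  have tri: "W a c z + W c d z + W d a z = 0"
    if "convex Q" "Q \<subseteq> ?S" "a \<in> Q" "c \<in> Q" "d \<in> Q" "z \<in> ?S" "z \<notin> Q" for Q a c d z
    unfolding W_def
  proof (rule winding_number_triangle_image[of Q])
    show "continuous_on Q h" using hc that continuous_on_subset by blast
    show "h z \<notin> h ` Q" using hi that by (auto simp: inj_on_def subset_iff)
  qed (use that in auto)
  have rev: "W c a z = - W a c z" if "a \<in> ?S" "c \<in> ?S" "z \<in> ?S" "z \<notin> closed_segment a c" for a c z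
    unfolding W_def
  proof (rule winding_number_linepath_image_rev)
    have sub: "closed_segment a c \<subseteq> ?S" using that cS closed_segment_subset by blast
    show "continuous_on (closed_segment a c) h" using hc sub continuous_on_subset by blast
    show "h z \<notin> h ` closed_segment a c" using hi sub that by (auto simp: inj_on_def subset_iff)
  qed
  have mem: "pb \<in> QL" "pb \<in> QR" "pt \<in> QL" "pt \<in> QR" "c00 \<in> QL" "c01 \<in> QL" "c10 \<in> QR" "c11 \<in> QR"
    "pb \<in> ?S" "pt \<in> ?S" "c00 \<in> ?S" "c01 \<in> ?S" "c10 \<in> ?S" "c11 \<in> ?S"
    using \<alpha>\<beta> by (auto simp: pts QL_def QR_def unit_square_iff)
  have segQ: "z \<notin> closed_segment a c" if "z \<notin> Q" "convex Q" "a \<in> Q" "c \<in> Q" for z a c Q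
    using that closed_segment_subset by blast
  have quad: "W pb pt z = W pb a z + W a c z + W c pt z"
    if Q: "convex Q" "Q \<subseteq> ?S" "pb \<in> Q" "pt \<in> Q" "a \<in> Q" "c \<in> Q" "z \<in> ?S" "z \<notin> Q" for Q a c z
  proof -
    have "W pb a z + W a c z + W c pb z = 0" "W pb c z + W c pt z + W pt pb z = 0"
      using tri[of Q] Q by auto
    moreover have "W c pb z = - W pb c z" "W pt pb z = - W pb pt z"
      using rev[of pb c z] rev[of pb pt z] segQ[OF Q(8,1)] Q by auto
    ultimately show ?thesis by (simp add: algebra_simps)
  qed
  define lam rho where "lam = h \<circ> (linepath pb c00 +++ linepath c00 c01 +++ linepath c01 pt)"
    and "rho = h \<circ> (linepath pb c10 +++ linepath c10 c11 +++ linepath c11 pt)"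
  have pth: "path (h \<circ> linepath a c)" if "a \<in> ?S" "c \<in> ?S" for a c
    using that closed_segment_subset[OF that cS] hc continuous_on_subset by (intro path_continuous_image) auto
  have pimg: "h z \<in> path_image (h \<circ> linepath a c) \<longleftrightarrow> z \<in> closed_segment a c" if "a \<in> ?S" "c \<in> ?S" "z \<in> ?S" for a c z
    using closed_segment_subset[OF that(1,2) cS] hi that(3) by (auto simp: path_image_compose inj_on_def subset_iff)
  have lam: "path lam" "pathstart lam = h pb" "pathfinish lam = h pt"
    "path_image lam = h ` (closed_segment pb c00 \<union> closed_segment c00 c01 \<union> closed_segment c01 pt)"
    using pth mem by (simp_all add: lam_def path_compose_join pathstart_compose pathfinish_compose path_image_join path_image_compose image_Un Un_assoc)
  have rho: "path rho" "pathstart rho = h pb" "pathfinish rho = h pt"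
    "path_image rho = h ` (closed_segment pb c10 \<union> closed_segment c10 c11 \<union> closed_segment c11 pt)"
    using pth mem by (simp_all add: rho_def path_compose_join pathstart_compose pathfinish_compose path_image_join path_image_compose image_Un Un_assoc)
  have wlam: "winding_number lam (h z) = W pb c00 z + W c00 c01 z + W c01 pt z"
    if "z \<in> ?S" "z \<notin> closed_segment pb c00" "z \<notin> closed_segment c00 c01" "z \<notin> closed_segment c01 pt" for z
    using that pth pimg mem
    by (simp add: lam_def path_compose_join winding_number_join pathstart_compose pathfinish_compose path_image_join W_def)
  have wrho: "winding_number rho (h z) = W pb c10 z + W c10 c11 z + W c11 pt z"
    if "z \<in> ?S" "z \<notin> closed_segment pb c10" "z \<notin> closed_segment c10 c11" "z \<notin> closed_segment c11 pt" for z
    using that pth pimg mem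
    by (simp add: rho_def path_compose_join winding_number_join pathstart_compose pathfinish_compose path_image_join W_def)
  have zlS: "zl \<in> SL" "zl \<notin> QR" and zrS: "zr \<in> SR" "zr \<notin> QL"
    using zl zr by (auto simp: SL_def SR_def QL_def QR_def)
  \<comment> \<open>The crossing and \<open>lam\<close> bound \<open>QL\<close>, which does not
    contain \<open>zr\<close>.\<close>
  have wr: "W pb pt zr = winding_number lam (h zr)"
    using quad[of QL c00 c01 zr] conv mem zr zrS segQ[of zr QL]
    by (subst wlam) (auto simp: QL_def)
  have wl: "W pb pt zl = winding_number rho (h zl)"
    using quad[of QR c10 c11 zl] conv mem zl zlS segQ[of zl QR]
    by (subst wrho) (auto simp: QR_def)
  define B where "B = box 0 (Complex 1 1)"
  have BS: "B \<subseteq> ?S" unfolding B_def by (rule box_subset_cbox)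
  have Bint: "0 < Re z \<and> Re z < 1 \<and> 0 < Im z \<and> Im z < 1" if "z \<in> B" for z
    using that by (auto simp: B_def in_box_complex_iff)
  have edges: "z \<notin> B" if "z \<in> closed_segment pb c00 \<union> closed_segment c00 c01 \<union> closed_segment c01 pt \<union>
      closed_segment pb c10 \<union> closed_segment c10 c11 \<union> closed_segment c11 pt" for z
  proof -
    have "Im z = 0 \<or> Re z = 0 \<or> Im z = 1 \<or> Re z = 1"
      using that unfolding Un_iff pts in_segment_Complex by (elim disjE exE conjE) auto
    then show ?thesis using Bint[of z] by auto
  qed
  have ends: "pathstart rest = h pt" "pathfinish rest = h pb" using rest(2,3) by (auto simp: pts)
  have restS: "h z \<notin> path_image rest" if "z \<in> ?S" "z \<noteq> pb" "z \<noteq> pt" for z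
    using rest(4) hi that mem by (auto simp: pts[symmetric] inj_on_def)
  have const: "winding_number (rest +++ c) (h x) = winding_number (rest +++ c) (h y)"
    if c: "path c" "pathstart c = h pb" "pathfinish c = h pt" "path_image c = h ` E" "E \<subseteq> ?S"
      and K: "convex K" "K \<subseteq> ?S" "K \<inter> E = {}" "pb \<notin> K" "pt \<notin> K" "x \<in> K" "y \<in> K" for c E K x y
  proof (rule winding_number_eq)
    show "path (rest +++ c)" "pathfinish (rest +++ c) = pathstart (rest +++ c)" using c ends rest(1) by auto
    show "connected (h ` K)"
      using K hc by (intro connected_continuous_image convex_connected) (auto intro: continuous_on_subset)
    have "h ` K \<inter> path_image c = {}" unfolding c(4) using inj_on_image_Int[OF hi K(2) c(5)] K(3) by simp
    moreover have "h ` K \<inter> path_image rest = {}" using restS K by blast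
    ultimately show "h ` K \<inter> path_image (rest +++ c) = {}" using c ends by (auto simp: path_image_join)
  qed (use K in auto)
  have split: "winding_number (rest +++ c) (h x) = winding_number rest (h x) + winding_number c (h x)"
    if "path c" "pathstart c = h pb" "h x \<notin> path_image c" "x \<in> ?S" "x \<noteq> pb" "x \<noteq> pt" for c x
    using that restS rest(1) ends by (intro winding_number_join) auto
  \<comment> \<open>At height 1/2 the crossing has abscissa \<open>(\<alpha> + \<beta>) / 2\<close>;
    these points lie midway between it and the left and right sides.\<close>
  define yl yr where "yl = Complex (\<beta> / 4 + \<alpha> / 4) (1/2)" and "yr = Complex (1/2 + \<beta> / 4 + \<alpha> / 4) (1/2)"
  have yl: "yl \<in> SL" "yl \<in> B" and yr: "yr \<in> SR" "yr \<in> B"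
    using \<alpha>\<beta> by (auto simp: yl_def yr_def SL_def SR_def B_def in_box_complex_iff unit_square_iff field_simps)
  let ?EL = "closed_segment pb c00 \<union> closed_segment c00 c01 \<union> closed_segment c01 pt"
  let ?ER = "closed_segment pb c10 \<union> closed_segment c10 c11 \<union> closed_segment c11 pt"
  have E: "?EL \<subseteq> QL" "?ER \<subseteq> QR" "?EL \<subseteq> ?S" "?ER \<subseteq> ?S"
    using closed_segment_subset conv mem cS by (meson Un_least)+
  have disj: "SR \<inter> QL = {}" "SL \<inter> QR = {}" by (auto simp: SR_def SL_def QL_def QR_def)
  have Bd: "B \<inter> ?EL = {}" "B \<inter> ?ER = {}" "pb \<notin> B" "pt \<notin> B" using edges Bint[of pb] Bint[of pt] by (auto simp: pts)
  have cB: "convex B" unfolding B_def by (rule convex_box)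
  have SS: "SR \<subseteq> ?S" "SL \<subseteq> ?S" by (auto simp: SR_def SL_def)
  have "winding_number (rest +++ lam) (h zr) = winding_number (rest +++ lam) (h yr)"
    by (rule const[OF lam E(3) conv(4) SS(1)]) (use E disj mem zrS yr in auto)
  \<comment> \<open>With the crossing replaced by \<open>lam\<close>, the loop no longer meets the
    interior of the transistor, which may be traversed from right to left.\<close>
  also have "\<dots> = winding_number (rest +++ lam) (h yl)"
    by (rule const[OF lam E(3) cB BS]) (use Bd yl yr in auto)
  finally have 1: "winding_number (rest +++ lam) (h zr) = winding_number (rest +++ lam) (h yl)" .
  have 2: "winding_number (rest +++ rho) (h zl) = winding_number (rest +++ rho) (h yl)"
    by (rule const[OF rho E(4) conv(3) SS(2)]) (use E disj mem zlS yl in auto)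
  have ylS: "yl \<in> ?S" "yl \<noteq> pb" "yl \<noteq> pt" using yl BS Bd by auto
  have yE: "yl \<notin> ?EL" "yl \<notin> ?ER" using yl Bd by blast+
  have hy: "h yl \<notin> path_image lam" "h yl \<notin> path_image rho"
    unfolding lam(4) rho(4)
    using yE by (simp_all only: inj_on_image_mem_iff[OF hi ylS(1) E(3)] inj_on_image_mem_iff[OF hi ylS(1) E(4)] not_False_eq_True)
  have hz: "h zr \<notin> path_image lam" "h zl \<notin> path_image rho"
  proof -
    have "zr \<notin> ?EL" "zl \<notin> ?ER" using zrS zlS E by blast+
    then show "h zr \<notin> path_image lam" "h zl \<notin> path_image rho"
      unfolding lam(4) rho(4)
      by (simp_all only: inj_on_image_mem_iff[OF hi zr(1) E(3)] inj_on_image_mem_iff[OF hi zl(1) E(4)] not_False_eq_True)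
  qed
  have zne: "zr \<noteq> pb" "zr \<noteq> pt" "zl \<noteq> pb" "zl \<noteq> pt" using zrS zlS mem by auto
  have rect: "winding_number (h \<circ> rectpath 0 (Complex 1 1)) (h yl) = 1"
  proof -
    let ?m = "Complex (1/2) (1/2)"
    have img: "path_image (rectpath 0 (Complex 1 1)) \<subseteq> ?S" using path_image_rectpath_subset_cbox[of 0 "Complex 1 1"] by simp
    have "B \<inter> path_image (rectpath 0 (Complex 1 1)) = {}"
      unfolding B_def using path_image_rectpath_inter_box[of 0 "Complex 1 1"] by auto
    then have "h ` B \<inter> path_image (h \<circ> rectpath 0 (Complex 1 1)) = {}"
      unfolding path_image_compose using inj_on_image_Int[OF hi BS img] by simp
    moreover have "path (h \<circ> rectpath 0 (Complex 1 1))"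
      using img hc continuous_on_subset by (intro path_continuous_image) auto
    moreover have "connected (h ` B)"
      using cB hc BS by (intro connected_continuous_image convex_connected) (auto intro: continuous_on_subset)
    moreover have "?m \<in> B" by (simp add: B_def in_box_complex_iff)
    ultimately have "winding_number (h \<circ> rectpath 0 (Complex 1 1)) (h yl) = winding_number (h \<circ> rectpath 0 (Complex 1 1)) (h ?m)"
      using yl by (intro winding_number_eq[where S = "h ` B"]) (auto simp: pathfinish_compose pathstart_compose)
    then show ?thesis using hw by simp
  qed
  have segB: "yl \<notin> closed_segment a c" if "a \<in> {z. Im z = 0} \<and> c \<in> {z. Im z = 0} \<or> a \<in> {z. Im z = 1} \<and> c \<in> {z. Im z = 1} \<or>
      a \<in> {z. Re z = 0} \<and> c \<in> {z. Re z = 0} \<or> a \<in> {z. Re z = 1} \<and> c \<in> {z. Re z = 1}" for a c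
  proof
    assume "yl \<in> closed_segment a c"
    then obtain u where "yl = (1 - u) *\<^sub>R a + u *\<^sub>R c" by (auto simp: closed_segment_def)
    then have "Re yl = (1 - u) * Re a + u * Re c" "Im yl = (1 - u) * Im a + u * Im c" by auto
    then show False using that Bint[OF yl(2)] by auto
  qed
  have "rectpath 0 (Complex 1 1) = linepath c00 c10 +++ linepath c10 c11 +++ linepath c11 c01 +++ linepath c01 c00"
    by (simp add: rectpath_def Let_def pts zero_complex.code)
  then have r: "W c00 c10 yl + W c10 c11 yl + W c11 c01 yl + W c01 c00 yl = 1"
    using rect pth pimg mem ylS(1) segB
    by (simp add: path_compose_join winding_number_join pathstart_compose pathfinish_compose path_image_join W_def pts add.assoc)
  have line: "W a d yl = W a c yl + W c d yl"
    if "a \<in> ?S" "c \<in> ?S" "d \<in> ?S" "c \<in> closed_segment a d" "yl \<notin> closed_segment a d" for a c d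
  proof -
    have "W a c yl + W c d yl + W d a yl = 0"
      using that ylS(1) closed_segment_subset[OF that(1,3) cS] by (intro tri[of "closed_segment a d"]) auto
    then show ?thesis using rev[of a d yl] that ylS(1) by (simp add: algebra_simps)
  qed
  have on: "pb \<in> closed_segment c00 c10" "pt \<in> closed_segment c11 c01"
    unfolding pts in_segment_Complex using \<alpha>\<beta>
    by (auto intro!: exI[of _ \<beta>] exI[of _ "1 - \<alpha>"])
  have e: "W c00 c10 yl = W c00 pb yl + W pb c10 yl" "W c11 c01 yl = W c11 pt yl + W pt c01 yl"
    using on mem segB by (auto intro!: line simp: pts)
  have f: "W c00 pb yl = - W pb c00 yl" "W pt c01 yl = - W c01 pt yl" "W c01 c00 yl = - W c00 c01 yl"
    using rev[of pb c00 yl] rev[of c01 pt yl] rev[of c00 c01 yl] mem ylS(1) yE by auto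
  \<comment> \<open>The points \<open>pb\<close> and \<open>pt\<close> cut the boundary into
    \<open>rho\<close> and the reverse of \<open>lam\<close>.\<close>
  have "winding_number rho (h yl) =
      (W c00 c10 yl + W c10 c11 yl + W c11 c01 yl + W c01 c00 yl) + winding_number lam (h yl)"
    unfolding e f using wlam[of yl] wrho[of yl] ylS(1) yE by simp
  then have 3: "winding_number rho (h yl) = winding_number lam (h yl) + 1" unfolding r by simp
  have "winding_number rest (h zl) + W pb pt zl = winding_number (rest +++ rho) (h zl)"
    using split[OF rho(1,2) hz(2) zl(1) zne(3,4)] wl by simp
  also have "\<dots> = winding_number rest (h yl) + winding_number rho (h yl)"
    using 2 split[OF rho(1,2) hy(2) ylS] by simp
  also have "\<dots> = winding_number (rest +++ lam) (h yl) + 1"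
    using 3 split[OF lam(1,2) hy(1) ylS] by simp
  also have "\<dots> = winding_number rest (h zr) + W pb pt zr + 1"
    using 1 split[OF lam(1,2) hz(1) zr(1) zne(1,2)] wr by simp
  finally show ?thesis by (simp add: W_def pts)
qed

section \<open>Chains of arcs\<close>

text \<open>Each stage is literally an initial part of the next, which allows winding numbers to be
  split at any given crossing.\<close>

primrec zigzag :: "(nat \<Rightarrow> real \<Rightarrow> 'b::real_normed_vector) \<Rightarrow> (nat \<Rightarrow> real \<Rightarrow> 'b) \<Rightarrow> nat \<Rightarrow> real \<Rightarrow> 'b" where
  "zigzag w \<sigma> 0 = w 0"
| "zigzag w \<sigma> (Suc i) = zigzag w \<sigma> i +++ (\<sigma> i +++ w (Suc i))"

context
  fixes w \<sigma> :: "nat \<Rightarrow> real \<Rightarrow> 'b::real_normed_vector" and m :: nat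
  assumes arcs: "\<And>i. i \<le> m \<Longrightarrow> arc (w i)" "\<And>i. i < m \<Longrightarrow> arc (\<sigma> i)"
    and ends: "\<And>i. i < m \<Longrightarrow> pathfinish (w i) = pathstart (\<sigma> i)" "\<And>i. i < m \<Longrightarrow> pathfinish (\<sigma> i) = pathstart (w (Suc i))"
begin

lemma zigzag_ends: "i \<le> m \<Longrightarrow> pathstart (zigzag w \<sigma> i) = pathstart (w 0)" "i \<le> m \<Longrightarrow> pathfinish (zigzag w \<sigma> i) = pathfinish (w i)"
  using ends by (induction i) auto

lemma zigzag_image: "i \<le> m \<Longrightarrow> path_image (zigzag w \<sigma> i) = (\<Union>j\<le>i. path_image (w j)) \<union> (\<Union>j<i. path_image (\<sigma> j))"
proof (induction i)
  case (Suc i)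
  then show ?case using ends[of i] zigzag_ends(2)[of i]
    by (auto simp: path_image_join atMost_Suc lessThan_Suc)
qed simp

lemma zigzag_arc:
  assumes disj: "\<And>i j. i \<le> m \<Longrightarrow> j \<le> m \<Longrightarrow> i \<noteq> j \<Longrightarrow> path_image (w i) \<inter> path_image (w j) = {}"
    "\<And>i j. i < m \<Longrightarrow> j < m \<Longrightarrow> i \<noteq> j \<Longrightarrow> path_image (\<sigma> i) \<inter> path_image (\<sigma> j) = {}"
    and meet: "\<And>i j z. i \<le> m \<Longrightarrow> j < m \<Longrightarrow> z \<in> path_image (w i) \<Longrightarrow> z \<in> path_image (\<sigma> j) \<Longrightarrow>
        i = j \<and> z = pathstart (\<sigma> j) \<or> i = Suc j \<and> z = pathfinish (\<sigma> j)"
  shows "i \<le> m \<Longrightarrow> arc (zigzag w \<sigma> i)"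
proof (induction i)
  case (Suc i)
  have "arc (\<sigma> i +++ w (Suc i))"
    using arcs ends Suc.prems meet[of "Suc i" i] by (intro arc_join) auto
  moreover have "path_image (zigzag w \<sigma> i) \<inter> path_image (\<sigma> i +++ w (Suc i)) \<subseteq> {pathstart (\<sigma> i +++ w (Suc i))}"
  proof
    fix z assume "z \<in> path_image (zigzag w \<sigma> i) \<inter> path_image (\<sigma> i +++ w (Suc i))"
    then have z1: "(\<exists>j\<le>i. z \<in> path_image (w j)) \<or> (\<exists>j<i. z \<in> path_image (\<sigma> j))"
      and z2: "z \<in> path_image (\<sigma> i) \<or> z \<in> path_image (w (Suc i))"
      using zigzag_image[of i] ends(2)[of i] Suc.prems by (auto simp: path_image_join)
    have im: "i < m" using Suc.prems by simp
    from z2 show "z \<in> {pathstart (\<sigma> i +++ w (Suc i))}"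
    proof
      assume z: "z \<in> path_image (\<sigma> i)"
      from z1 show ?thesis
      proof (elim disjE exE conjE)
        fix j assume "j \<le> i" "z \<in> path_image (w j)"
        then show ?thesis using meet[of j i z] z im by auto
      next
        fix j assume "j < i" "z \<in> path_image (\<sigma> j)"
        then show ?thesis using disj(2)[of j i] z im by auto
      qed
    next
      assume z: "z \<in> path_image (w (Suc i))"
      from z1 show ?thesis
      proof (elim disjE exE conjE)
        fix j assume "j \<le> i" "z \<in> path_image (w j)"
        then show ?thesis using disj(1)[of j "Suc i"] z im by auto
      next
        fix j assume "j < i" "z \<in> path_image (\<sigma> j)"
        then show ?thesis using meet[of "Suc i" j z] z im by auto
      qed
    qed
  qed
  ultimately show ?case using Suc ends zigzag_ends(2)[of i] by (auto intro!: arc_join)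
qed (use arcs in simp)

end

text \<open>Isolates the crossing \<open>\<sigma> i\<close> together with the part
  \<open>\<tau>\<close> after it, so that all the rest of the closed curve can be treated as a path
  returning to the transistor from outside.\<close>

lemma zigzag_sum:
  assumes arcs: "\<And>i. i \<le> m \<Longrightarrow> arc (w i)" "\<And>i. i < m \<Longrightarrow> arc (\<sigma> i)"
    and ends: "\<And>i. i < m \<Longrightarrow> pathfinish (w i) = pathstart (\<sigma> i)" "\<And>i. i < m \<Longrightarrow> pathfinish (\<sigma> i) = pathstart (w (Suc i))"
    and i: "i < m"
  shows "\<exists>\<tau>. path \<tau> \<and> pathstart \<tau> = pathstart (w (Suc i)) \<and> pathfinish \<tau> = pathfinish (w m) \<and>
    path_image \<tau> \<subseteq> (\<Union>j\<in>{Suc i..m}. path_image (w j)) \<union> (\<Union>j\<in>{Suc i..<m}. path_image (\<sigma> j)) \<and>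
    (\<forall>z. z \<notin> path_image (zigzag w \<sigma> m) \<longrightarrow> winding_number (zigzag w \<sigma> m) z =
       winding_number (zigzag w \<sigma> i) z + winding_number (\<sigma> i) z + winding_number \<tau> z)"
  using assms
proof (induction m)
  case (Suc l)
  have zp: "path (zigzag w \<sigma> k) \<and> pathfinish (zigzag w \<sigma> k) = pathfinish (w k)" if "k \<le> Suc l" for k
    using that
  proof (induction k)
    case (Suc k)
    then show ?case using Suc.prems \<open>\<And>i. i < Suc l \<Longrightarrow> arc (\<sigma> i)\<close> \<open>\<And>i. i \<le> Suc l \<Longrightarrow> arc (w i)\<close>
      \<open>\<And>i. i < Suc l \<Longrightarrow> pathfinish (w i) = pathstart (\<sigma> i)\<close> \<open>\<And>i. i < Suc l \<Longrightarrow> pathfinish (\<sigma> i) = pathstart (w (Suc i))\<close>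
      by (auto simp: arc_imp_path)
  qed (use Suc.prems in \<open>auto simp: arc_imp_path\<close>)
  have step: "winding_number (zigzag w \<sigma> (Suc l)) z =
      winding_number (zigzag w \<sigma> l) z + winding_number (\<sigma> l) z + winding_number (w (Suc l)) z \<and>
      z \<notin> path_image (zigzag w \<sigma> l) \<and> z \<notin> path_image (\<sigma> l) \<and> z \<notin> path_image (w (Suc l))"
    if "z \<notin> path_image (zigzag w \<sigma> (Suc l))" for z
    using that zp[of l] Suc.prems(1)[of "Suc l"] Suc.prems(2)[of l] Suc.prems(3)[of l] Suc.prems(4)[of l]
    by (simp add: path_image_join winding_number_join arc_imp_path)
  show ?case
  proof (cases "l = i")
    case True
    then show ?thesis using Suc.prems(1)[of "Suc i"] step
      by (intro exI[of _ "w (Suc i)"]) (auto simp: arc_imp_path)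
  next
    case False
    then obtain \<tau> where \<tau>: "path \<tau>" "pathstart \<tau> = pathstart (w (Suc i))" "pathfinish \<tau> = pathfinish (w l)"
      "path_image \<tau> \<subseteq> (\<Union>j\<in>{Suc i..l}. path_image (w j)) \<union> (\<Union>j\<in>{Suc i..<l}. path_image (\<sigma> j))"
      "\<And>z. z \<notin> path_image (zigzag w \<sigma> l) \<Longrightarrow> winding_number (zigzag w \<sigma> l) z =
         winding_number (zigzag w \<sigma> i) z + winding_number (\<sigma> i) z + winding_number \<tau> z"
      using Suc by auto
    have l: "l < Suc l" "i < l" using Suc.prems False by auto
    let ?\<tau> = "\<tau> +++ (\<sigma> l +++ w (Suc l))"
    have img: "path_image ?\<tau> = path_image \<tau> \<union> path_image (\<sigma> l) \<union> path_image (w (Suc l))"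
      using \<tau> Suc.prems(3,4)[of l] by (auto simp: path_image_join)
    have sub: "path_image ?\<tau> \<subseteq> (\<Union>j\<in>{Suc i..Suc l}. path_image (w j)) \<union> (\<Union>j\<in>{Suc i..<Suc l}. path_image (\<sigma> j))"
      unfolding img
    proof (intro Un_least)
      show "path_image \<tau> \<subseteq> (\<Union>j\<in>{Suc i..Suc l}. path_image (w j)) \<union> (\<Union>j\<in>{Suc i..<Suc l}. path_image (\<sigma> j))"
        by (rule subset_trans[OF \<tau>(4)]) (intro Un_mono UN_mono, auto)
      show "path_image (\<sigma> l) \<subseteq> (\<Union>j\<in>{Suc i..Suc l}. path_image (w j)) \<union> (\<Union>j\<in>{Suc i..<Suc l}. path_image (\<sigma> j))"
        using l by (intro le_supI2 UN_upper) auto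
      show "path_image (w (Suc l)) \<subseteq> (\<Union>j\<in>{Suc i..Suc l}. path_image (w j)) \<union> (\<Union>j\<in>{Suc i..<Suc l}. path_image (\<sigma> j))"
        using l by (intro le_supI1 UN_upper) auto
    qed
    have imgz: "path_image \<tau> \<subseteq> path_image (zigzag w \<sigma> l)"
    proof -
      have "path_image (zigzag w \<sigma> l) = (\<Union>j\<le>l. path_image (w j)) \<union> (\<Union>j<l. path_image (\<sigma> j))"
        by (rule zigzag_image[where m = "Suc l"]) (use Suc.prems in auto)
      then show ?thesis using \<tau>(4) by fastforce
    qed
    have "winding_number (zigzag w \<sigma> (Suc l)) z =
       winding_number (zigzag w \<sigma> i) z + winding_number (\<sigma> i) z + winding_number ?\<tau> z"
      if z: "z \<notin> path_image (zigzag w \<sigma> (Suc l))" for z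
    proof -
      have "z \<notin> path_image \<tau>" using step[OF z] imgz by blast
      then have "winding_number ?\<tau> z = winding_number \<tau> z + winding_number (\<sigma> l) z + winding_number (w (Suc l)) z"
        using step[OF z] \<tau> Suc.prems(1)[of "Suc l"] Suc.prems(2)[of l] Suc.prems(3)[of l] Suc.prems(4)[of l]
        by (simp add: path_image_join winding_number_join arc_imp_path)
      then show ?thesis using step[OF z] \<tau>(5)[of z] by simp
    qed
    then show ?thesis
      using \<tau> sub Suc.prems(1)[of "Suc l"] Suc.prems(2)[of l] Suc.prems(3)[of l] Suc.prems(4)[of l]
      by (intro exI[of _ ?\<tau>]) (auto simp: arc_imp_path)
  qed
qed simp

section \<open>Periodic drawings in a strip\<close>

lemma attach_pos_bounds: "k < n \<Longrightarrow> 0 < attach_pos n k \<and> attach_pos n k < 1"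
  by (simp add: attach_pos_def)

lemma attach_pos_less: "attach_pos n k < attach_pos n k' \<longleftrightarrow> k < k'"
  by (simp add: attach_pos_def divide_less_cancel)

lemma attach_pos_eq: "attach_pos n k = attach_pos n k' \<longleftrightarrow> k = k'"
  by (simp add: attach_pos_def)

lemma winding_number_translate: "winding_number (\<lambda>u. p u + c) (z + c) = winding_number p z"
  unfolding winding_number_offset[of "\<lambda>u. p u + c" "z + c"] winding_number_offset[of p z] by simp

lemma oriented_embedding_translate:
  assumes "oriented_embedding h" shows "oriented_embedding (\<lambda>p. h p + c)"
proof -
  have eq: "(\<lambda>p. h p + c) \<circ> rectpath 0 (Complex 1 1) = (\<lambda>u. (h \<circ> rectpath 0 (Complex 1 1)) u + c)" by auto
  have "inj_on (\<lambda>p. h p + c) unit_square" "continuous_on unit_square (\<lambda>p. h p + c)"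
    using assms by (auto simp: oriented_embedding_def inj_on_def intro!: continuous_intros)
  then show ?thesis
    using assms unfolding oriented_embedding_def eq winding_number_translate by blast
qed

text \<open>
  \<open>H t\<close> and \<open>G e\<close> are lifts of a transistor and of a wire of an annular diagram to a strip of
  height \<open>b\<close>, on which the covering transformations are the translations by multiples of \<open>P\<close>. The
  lift of a wire is the one whose top end is attached to the chosen lift of a transistor, or to the
  fundamental interval of the frame.
\<close>

locale strip_diag = diag \<A> \<R> \<Delta>
  for \<A> :: "'a set" and \<R> and \<Delta> +
  fixes P b :: real and H :: "nat \<Rightarrow> complex \<Rightarrow> complex" and G :: "nat \<Rightarrow> real \<Rightarrow> complex" and sh :: "nat \<Rightarrow> int"
  assumes P: "0 < P" and b: "0 < b"
    and H: "\<And>t. t \<in> T \<Longrightarrow> oriented_embedding (H t)"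
      "\<And>t p. t \<in> T \<Longrightarrow> p \<in> unit_square \<Longrightarrow> 0 < Im (H t p) \<and> Im (H t p) < b"
      "\<And>t t' p p' n. t \<in> T \<Longrightarrow> t' \<in> T \<Longrightarrow> p \<in> unit_square \<Longrightarrow> p' \<in> unit_square \<Longrightarrow>
         H t p = H t' p' + of_real (of_int n * P) \<Longrightarrow> t = t' \<and> n = 0"
    and G: "\<And>e. e \<in> W \<Longrightarrow> arc (G e)"
      "\<And>e u. e \<in> W \<Longrightarrow> u \<in> {0<..<1} \<Longrightarrow> 0 < Im (G e u) \<and> Im (G e u) < b"
      "\<And>e u t p n. e \<in> W \<Longrightarrow> u \<in> {0<..<1} \<Longrightarrow> t \<in> T \<Longrightarrow> p \<in> unit_square \<Longrightarrow>
         G e u \<noteq> H t p + of_real (of_int n * P)"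
      "\<And>e e' u u' n. e \<in> W \<Longrightarrow> e' \<in> W \<Longrightarrow> u \<in> {0..1} \<Longrightarrow> u' \<in> {0..1} \<Longrightarrow>
         G e u = G e' u' + of_real (of_int n * P) \<Longrightarrow> e = e' \<and> n = 0"
    and attach: "\<And>t k. t \<in> T \<Longrightarrow> k < length (tt t) \<Longrightarrow>
         pathstart (G (tt t ! k)) = H t (Complex (attach_pos (length (tt t)) k) 1) + of_real (of_int (sh (tt t ! k)) * P)"
      "\<And>t j. t \<in> T \<Longrightarrow> j < length (tb t) \<Longrightarrow>
         pathfinish (G (tb t ! j)) = H t (Complex (attach_pos (length (tb t)) j) 0)"
      "\<And>k. k < length ft \<Longrightarrow> pathfinish (G (ft ! k)) = Complex (P * attach_pos (length ft) k) b"
      "\<And>k. k < length fb \<Longrightarrow>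
         pathstart (G (fb ! k)) = Complex (P * attach_pos (length fb) k) 0 + of_real (of_int (sh (fb ! k)) * P)"
begin

definition lw :: "int \<Rightarrow> nat \<Rightarrow> real \<Rightarrow> complex" where
  "lw n e = (\<lambda>u. G e u + of_real (of_int n * P))"

definition lt :: "int \<Rightarrow> nat \<Rightarrow> complex \<Rightarrow> complex" where
  "lt n t = (\<lambda>p. H t p + of_real (of_int n * P))"

definition bpos :: "nat \<Rightarrow> nat \<Rightarrow> complex" where
  "bpos t j = Complex (attach_pos (length (tb t)) j) 0"

definition tpos :: "nat \<Rightarrow> nat \<Rightarrow> complex" where
  "tpos t k = Complex (attach_pos (length (tt t)) k) 1"

lemma pos_in: "j < length (tb t) \<Longrightarrow> bpos t j \<in> unit_square" "k < length (tt t) \<Longrightarrow> tpos t k \<in> unit_square"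
  using attach_pos_bounds[of j "length (tb t)"] attach_pos_bounds[of k "length (tt t)"]
  by (auto simp: bpos_def tpos_def unit_square_iff)

lemma lt_embedding: "t \<in> T \<Longrightarrow> oriented_embedding (lt n t)"
  unfolding lt_def by (intro oriented_embedding_translate H)

lemma lt_cont: "t \<in> T \<Longrightarrow> continuous_on unit_square (lt n t)" and lt_inj: "t \<in> T \<Longrightarrow> inj_on (lt n t) unit_square"
  using lt_embedding by (auto simp: oriented_embedding_def)

lemma lt_strip: "t \<in> T \<Longrightarrow> p \<in> unit_square \<Longrightarrow> 0 < Im (lt n t p) \<and> Im (lt n t p) < b"
  using H(2) by (simp add: lt_def)

lemma lt_eq:
  assumes "t \<in> T" "t' \<in> T" "p \<in> unit_square" "p' \<in> unit_square" "lt n t p = lt n' t' p'"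
  shows "n = n' \<and> t = t'"
proof -
  have "H t p = H t' p' + of_real (of_int (n' - n) * P)" using assms(5) by (simp add: lt_def algebra_simps)
  from H(3)[OF assms(1-4) this] show ?thesis by simp
qed

lemma lw_arc: "e \<in> W \<Longrightarrow> arc (lw n e)"
  using G(1)[of e] by (auto simp: lw_def arc_def path_def inj_on_def intro!: continuous_intros)

lemma lw_eq:
  assumes "e \<in> W" "e' \<in> W" "z \<in> path_image (lw n e)" "z \<in> path_image (lw n' e')"
  shows "n = n' \<and> e = e'"
proof -
  obtain u u' where u: "u \<in> {0..1}" "u' \<in> {0..1}" "lw n e u = lw n' e' u'" using assms(3,4) by (auto simp: path_image_def)
  then have "G e u = G e' u' + of_real (of_int (n' - n) * P)" by (simp add: lw_def algebra_simps)
  from G(4)[OF assms(1,2) u(1,2) this] show ?thesis by simp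
qed

lemma lw_top: "t \<in> T \<Longrightarrow> j < length (tb t) \<Longrightarrow> pathfinish (lw n (tb t ! j)) = lt n t (bpos t j)"
  using attach(2)[of t j] by (simp add: lw_def lt_def bpos_def pathfinish_def)

lemma lw_bottom: "t \<in> T \<Longrightarrow> k < length (tt t) \<Longrightarrow> pathstart (lw n (tt t ! k)) = lt (n + sh (tt t ! k)) t (tpos t k)"
  using attach(1)[of t k] by (simp add: lw_def lt_def tpos_def pathstart_def algebra_simps)

lemma lw_frame_top: "k < length ft \<Longrightarrow> pathfinish (lw n (ft ! k)) = Complex (P * (attach_pos (length ft) k + of_int n)) b"
  using attach(3)[of k] by (simp add: lw_def pathfinish_def complex_eq_iff algebra_simps)

lemma lw_frame_bottom: "k < length fb \<Longrightarrow>
    pathstart (lw n (fb ! k)) = Complex (P * (attach_pos (length fb) k + of_int (n + sh (fb ! k)))) 0"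
  using attach(4)[of k] by (simp add: lw_def pathstart_def complex_eq_iff algebra_simps)

lemma lw_cases:
  assumes "z \<in> path_image (lw n e)"
  obtains "z = pathstart (lw n e)" | "z = pathfinish (lw n e)" | u where "u \<in> {0<..<1}" "z = lw n e u"
proof -
  obtain u where "u \<in> {0..1}" "z = lw n e u" using assms by (auto simp: path_image_def)
  moreover from this have "u = 0 \<or> u = 1 \<or> u \<in> {0<..<1}" by auto
  ultimately show thesis using that by (auto simp: pathstart_def pathfinish_def)
qed

text \<open>The interior of a wire avoids all lifts of transistors, so contact is at an end. The
  sheets differ by 0 at the top end of the wire and by \<open>sh e\<close> at its bottom
  end.\<close>

lemma wire_meets:
  assumes e: "e \<in> W" and t: "t \<in> T" and z: "z \<in> path_image (lw n e)" "z = lt m t p" "p \<in> unit_square"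
  shows "m = n \<and> (\<exists>j<length (tb t). e = tb t ! j \<and> p = bpos t j \<and> z = pathfinish (lw n e)) \<or>
    m = n + sh e \<and> (\<exists>k<length (tt t). e = tt t ! k \<and> p = tpos t k \<and> z = pathstart (lw n e))"
  using z(1)
proof (cases rule: lw_cases)
  case 1
  from e show ?thesis
  proof (cases rule: bottom_cases)
    case (frame k)
    then show ?thesis using 1 lw_frame_bottom[of k n] lt_strip[OF t z(3), of m] z(2) by auto
  next
    case (trans t' k)
    then have "lt m t p = lt (n + sh e) t' (tpos t' k)" using 1 lw_bottom[of t' k n] z(2) by simp
    moreover from this have "m = n + sh e \<and> t = t'"
      using lt_eq[OF t trans(1) z(3) pos_in(2)[OF trans(2)]] by blast
    ultimately have "m = n + sh e" "t = t'" "p = tpos t k"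
      using lt_inj[OF t] z(3) pos_in(2)[OF trans(2)] by (auto dest: inj_onD)
    then show ?thesis using trans 1 by blast
  qed
next
  case 2
  from e show ?thesis
  proof (cases rule: top_cases)
    case (frame k)
    then show ?thesis using 2 lw_frame_top[of k n] lt_strip[OF t z(3), of m] z(2) by auto
  next
    case (trans t' j)
    then have "lt m t p = lt n t' (bpos t' j)" using 2 lw_top[of t' j n] z(2) by simp
    moreover from this have "m = n \<and> t = t'"
      using lt_eq[OF t trans(1) z(3) pos_in(1)[OF trans(2)]] by blast
    ultimately have "m = n" "t = t'" "p = bpos t j"
      using lt_inj[OF t] z(3) pos_in(1)[OF trans(2)] by (auto dest: inj_onD)
    then show ?thesis using trans 2 by blast
  qed
next
  case (3 u)
  then have "G e u = H t p + of_real (of_int (m - n) * P)" using z(2) by (simp add: lw_def lt_def algebra_simps)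
  then show ?thesis using G(3)[OF e 3(1) t z(3)] by blast
qed

lemma wire_strip:
  assumes e: "e \<in> W" and z: "z \<in> path_image (lw n e)"
  shows "0 < Im z \<and> Im z < b \<or> e \<in> set fb \<and> z = pathstart (lw n e) \<or> e \<in> set ft \<and> z = pathfinish (lw n e)"
  using z
proof (cases rule: lw_cases)
  case 1
  from e show ?thesis
  proof (cases rule: bottom_cases)
    case (trans t k)
    then show ?thesis using 1 lw_bottom[of t k n] lt_strip[OF trans(1) pos_in(2)[OF trans(2)]] by simp
  qed (use 1 in auto)
next
  case 2
  from e show ?thesis
  proof (cases rule: top_cases)
    case (trans t j)
    then show ?thesis using 2 lw_top[of t j n] lt_strip[OF trans(1) pos_in(1)[OF trans(2)]] by simp
  qed (use 2 in auto)
next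
  case (3 u)
  then show ?thesis using G(2)[OF e 3(1)] by (simp add: lw_def)
qed

lemma wire_region: "e \<in> W \<Longrightarrow> z \<in> path_image (lw n e) \<Longrightarrow> 0 \<le> Im z \<and> Im z \<le> b"
  using wire_strip[of e z n] lw_frame_bottom lw_frame_top b by (auto simp: in_set_conv_nth)

text \<open>Finitely many sheets form a compact set; the bound is the distance at which a trajectory
  is closed up.\<close>

lemma lifts_bounded: "\<exists>M. (\<forall>n e z. \<bar>n\<bar> \<le> K \<and> e \<in> W \<and> z \<in> path_image (lw n e) \<longrightarrow> \<bar>Re z\<bar> < M) \<and>
    (\<forall>n t p. \<bar>n\<bar> \<le> K \<and> t \<in> T \<and> p \<in> unit_square \<longrightarrow> \<bar>Re (lt n t p)\<bar> < M)"
proof -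
  define X where "X = (\<Union>n\<in>{-K..K}. \<Union>e\<in>W. path_image (lw n e)) \<union> (\<Union>n\<in>{-K..K}. \<Union>t\<in>T. lt n t ` unit_square)"
  have "compact (path_image (lw n e))" if "e \<in> W" for n e
    using lw_arc[OF that] arc_imp_path compact_path_image by blast
  moreover have "compact (lt n t ` unit_square)" if "t \<in> T" for n t
    using lt_cont[OF that] compact_cbox by (rule compact_continuous_image)
  ultimately have "compact X" unfolding X_def using fin by (intro compact_Un compact_UN) auto
  then obtain M where M: "\<And>z. z \<in> X \<Longrightarrow> norm z \<le> M" using compact_imp_bounded bounded_iff by metis
  have "\<bar>Re z\<bar> < M + 1" if "z \<in> X" for z using M[OF that] abs_Re_le_cmod[of z] by linarith
  moreover have "z \<in> X" if "\<bar>n\<bar> \<le> K" "e \<in> W" "z \<in> path_image (lw n e)" for n e z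
  proof -
    have "n \<in> {-K..K}" using that(1) by auto
    then show ?thesis using that(2,3) unfolding X_def by blast
  qed
  moreover have "lt n t p \<in> X" if "\<bar>n\<bar> \<le> K" "t \<in> T" "p \<in> unit_square" for n t p
  proof -
    have "n \<in> {-K..K}" using that(1) by auto
    then show ?thesis using that(2,3) unfolding X_def by blast
  qed
  ultimately show ?thesis by blast
qed

end

text \<open>\<open>K\<close> bounds the sheets visited and \<open>M\<close> the abscissae in these
  sheets. They are parameters so that they can be chosen large enough for a second trajectory as
  well.\<close>

locale trajectory = strip_diag +
  fixes m :: nat and n :: "nat \<Rightarrow> int" and e t j k :: "nat \<Rightarrow> nat" and x :: "nat \<Rightarrow> real"
    and kb kt :: nat and K :: int and M :: real
  assumes step: "\<And>i. i < m \<Longrightarrow> ustep_at \<Delta> sh (t i) (j i) (k i) (n i, e i, x i) (n (Suc i), e (Suc i), x (Suc i))"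
    and start: "kb < length fb" "e 0 = fb ! kb" and final: "kt < length ft" "e m = ft ! kt"
    and x: "x 0 \<in> unit_ivl"
    and K: "\<And>i. i \<le> m \<Longrightarrow> \<bar>n i\<bar> \<le> K"
    and Mw: "\<And>n e z. \<bar>n\<bar> \<le> K \<Longrightarrow> e \<in> W \<Longrightarrow> z \<in> path_image (lw n e) \<Longrightarrow> \<bar>Re z\<bar> < M"
    and Mt: "\<And>n t p. \<bar>n\<bar> \<le> K \<Longrightarrow> t \<in> T \<Longrightarrow> p \<in> unit_square \<Longrightarrow> \<bar>Re (lt n t p)\<bar> < M"
begin

lemma step_simps:
  assumes "i < m"
  shows "t i \<in> T" "j i < length (tb (t i))" "k i < length (tt (t i))" "e i = tb (t i) ! j i"
    "e (Suc i) = tt (t i) ! k i" "x i \<in> unit_ivl" "x (Suc i) \<in> unit_ivl" "n (Suc i) = n i - sh (e (Suc i))"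
    "emb (length (tb (t i))) (j i) (x i) = emb (length (tt (t i))) (k i) (x (Suc i))"
  using step[OF assms] by (auto simp: ustep_at_def)

lemma eW: "i \<le> m \<Longrightarrow> e i \<in> W"
  using step_simps in_W start by (cases i) auto

lemma x_in: "i \<le> m \<Longrightarrow> x i \<in> unit_ivl"
  using step_simps(7)[of "i - 1"] x by (cases i) auto

lemma e_up: "i < i' \<Longrightarrow> i' \<le> m \<Longrightarrow> (e i, e i') \<in> wire_up\<^sup>+"
proof (induction i')
  case (Suc i')
  have "(e i', e (Suc i')) \<in> wire_up"
    using step_simps[of i'] Suc.prems by (auto simp: wire_up_def intro!: bexI[of _ "t i'"])
  then show ?case using Suc by (cases "i = i'") (auto intro: trancl_into_trancl)
qed simp

text \<open>Acyclicity holds in the diagram itself, so a trajectory never returns to a wire, not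
  even in another sheet. This makes \<open>\<gamma>\<close> an arc.\<close>

lemma e_distinct: assumes "i \<le> m" "i' \<le> m" "e i = e i'" shows "i = i'"
proof (rule ccontr)
  assume "i \<noteq> i'"
  then have "(e i, e i') \<in> wire_up\<^sup>+ \<or> (e i', e i) \<in> wire_up\<^sup>+"
    using e_up[of i i'] e_up[of i' i] assms by (cases i i' rule: linorder_cases) auto
  then show False using assms wire_up_acyclic by (auto simp: acyclic_def)
qed

lemma t_distinct: assumes "i < m" "i' < m" "t i = t i'" shows "i = i'"
proof -
  have False if "i < i'" "i' < m" "t i = t i'" for i i'
  proof -
    have "(e i', e (Suc i)) \<in> wire_up"
      using step_simps(1-5)[of i] step_simps(1-5)[of i'] that by (auto simp: wire_up_def intro!: bexI[of _ "t i'"])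
    moreover have "(e (Suc i), e i') \<in> wire_up\<^sup>*"
      using e_up[of "Suc i" i'] that by (cases "Suc i = i'") auto
    ultimately have "(e i', e i') \<in> wire_up\<^sup>+" by (meson rtrancl_into_trancl2)
    then show False using wire_up_acyclic by (auto simp: acyclic_def)
  qed
  then show ?thesis using assms by (metis linorder_neqE_nat)
qed

definition w :: "nat \<Rightarrow> real \<Rightarrow> complex" where
  "w i = lw (n i) (e i)"

definition \<sigma> :: "nat \<Rightarrow> real \<Rightarrow> complex" where
  "\<sigma> i = lt (n i) (t i) \<circ> linepath (bpos (t i) (j i)) (tpos (t i) (k i))"

lemma seg_sub: "i < m \<Longrightarrow> closed_segment (bpos (t i) (j i)) (tpos (t i) (k i)) \<subseteq> unit_square"
  using step_simps pos_in by (intro closed_segment_subset convex_box) auto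

lemma \<sigma>_image: "path_image (\<sigma> i) = lt (n i) (t i) ` closed_segment (bpos (t i) (j i)) (tpos (t i) (k i))"
  by (simp add: \<sigma>_def path_image_compose)

lemma \<sigma>_ends: "pathstart (\<sigma> i) = lt (n i) (t i) (bpos (t i) (j i))" "pathfinish (\<sigma> i) = lt (n i) (t i) (tpos (t i) (k i))"
  by (simp_all add: \<sigma>_def pathstart_compose pathfinish_compose)

lemma seg_ends: "z \<in> closed_segment (bpos t' a) (tpos t' c) \<Longrightarrow> Im z = 0 \<Longrightarrow> z = bpos t' a"
  "z \<in> closed_segment (bpos t' a) (tpos t' c) \<Longrightarrow> Im z = 1 \<Longrightarrow> z = tpos t' c"
  by (auto simp: bpos_def tpos_def in_segment_Complex complex_eq_iff)

lemma seg_Re: "z \<in> closed_segment (bpos t' a) (tpos t' c) \<Longrightarrow>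
    Re z = attach_pos (length (tb t')) a + (attach_pos (length (tt t')) c - attach_pos (length (tb t')) a) * Im z"
  by (auto simp: bpos_def tpos_def in_segment_Complex algebra_simps)

lemma \<sigma>_arc: "i < m \<Longrightarrow> arc (\<sigma> i)"
proof -
  assume i: "i < m"
  have "bpos (t i) (j i) \<noteq> tpos (t i) (k i)" by (simp add: bpos_def tpos_def)
  then have l: "arc (linepath (bpos (t i) (j i)) (tpos (t i) (k i)))" by simp
  have "inj_on (lt (n i) (t i)) (path_image (linepath (bpos (t i) (j i)) (tpos (t i) (k i))))"
    using lt_inj[OF step_simps(1)[OF i]] seg_sub[OF i] by (auto intro: inj_on_subset)
  moreover have "continuous_on (path_image (linepath (bpos (t i) (j i)) (tpos (t i) (k i)))) (lt (n i) (t i))"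
    using lt_cont[OF step_simps(1)[OF i]] seg_sub[OF i] by (auto intro: continuous_on_subset)
  ultimately show ?thesis
    using l unfolding \<sigma>_def arc_def path_image_def by (auto intro: comp_inj_on path_continuous_image simp: path_image_def)
qed

lemma wire_\<sigma>:
  assumes "e' \<in> W" "z \<in> path_image (lw n' e')" "i < m" "z \<in> path_image (\<sigma> i)"
  shows "n' = n i \<and> e' = e i \<and> z = pathstart (\<sigma> i) \<or> n' = n (Suc i) \<and> e' = e (Suc i) \<and> z = pathfinish (\<sigma> i)"
proof -
  obtain p where p: "p \<in> closed_segment (bpos (t i) (j i)) (tpos (t i) (k i))" "z = lt (n i) (t i) p"
    using assms(4) by (auto simp: \<sigma>_image)
  note st = step_simps[OF assms(3)]
  consider a where "n i = n'" "a < length (tb (t i))" "e' = tb (t i) ! a" "p = bpos (t i) a"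
    | c where "n i = n' + sh e'" "c < length (tt (t i))" "e' = tt (t i) ! c" "p = tpos (t i) c"
    using wire_meets[OF assms(1) st(1) assms(2) p(2)] p(1) seg_sub[OF assms(3)] by blast
  then show ?thesis
  proof cases
    case 1
    \<comment> \<open>The crossing meets the bottom side of the square only where it starts, so the
      wire is the one by which the trajectory enters.\<close>
    then have "p = bpos (t i) (j i)" using seg_ends(1)[OF p(1)] by (simp add: bpos_def)
    then have "a = j i" using 1 by (simp add: bpos_def attach_pos_eq)
    then show ?thesis using 1 p(2) st(4) by (simp add: \<sigma>_ends)
  next
    case 2
    then have "p = tpos (t i) (k i)" using seg_ends(2)[OF p(1)] by (simp add: tpos_def)
    then have "c = k i" using 2 by (simp add: tpos_def attach_pos_eq)
    then show ?thesis using 2 p(2) st(5,8) by (simp add: \<sigma>_ends)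
  qed
qed

lemma w_arc: "i \<le> m \<Longrightarrow> arc (w i)"
  by (simp add: w_def lw_arc eW)

lemma w_\<sigma>_ends: "i < m \<Longrightarrow> pathfinish (w i) = pathstart (\<sigma> i)" "i < m \<Longrightarrow> pathfinish (\<sigma> i) = pathstart (w (Suc i))"
proof -
  assume i: "i < m"
  note st = step_simps[OF i]
  show "pathfinish (w i) = pathstart (\<sigma> i)" unfolding w_def \<sigma>_ends st(4) by (rule lw_top[OF st(1,2)])
  have "n (Suc i) + sh (tt (t i) ! k i) = n i" using st(5,8) by simp
  then show "pathfinish (\<sigma> i) = pathstart (w (Suc i))" unfolding w_def \<sigma>_ends st(5) lw_bottom[OF st(1,3)] by simp
qed

lemma w_disjoint: "i \<le> m \<Longrightarrow> i' \<le> m \<Longrightarrow> i \<noteq> i' \<Longrightarrow> path_image (w i) \<inter> path_image (w i') = {}"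
  using lw_eq[OF eW eW] e_distinct unfolding w_def by blast

lemma \<sigma>_in_transistor: "i < m \<Longrightarrow> path_image (\<sigma> i) \<subseteq> lt (n i) (t i) ` unit_square"
  using seg_sub by (auto simp: \<sigma>_image)

lemma \<sigma>_disjoint: "i < m \<Longrightarrow> i' < m \<Longrightarrow> i \<noteq> i' \<Longrightarrow> path_image (\<sigma> i) \<inter> path_image (\<sigma> i') = {}"
  using \<sigma>_in_transistor[of i] \<sigma>_in_transistor[of i'] lt_eq[OF step_simps(1) step_simps(1), of i i'] t_distinct[of i i'] by fastforce

lemma w_\<sigma>_meet:
  assumes "i \<le> m" "i' < m" "z \<in> path_image (w i)" "z \<in> path_image (\<sigma> i')"
  shows "i = i' \<and> z = pathstart (\<sigma> i') \<or> i = Suc i' \<and> z = pathfinish (\<sigma> i')"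
  using wire_\<sigma>[OF eW[OF assms(1)] assms(3)[unfolded w_def] assms(2,4)] e_distinct assms by auto

definition \<gamma> :: "real \<Rightarrow> complex" where
  "\<gamma> = zigzag w \<sigma> m"

lemmas zz = zigzag_ends[where w = w and \<sigma> = \<sigma> and m = m, OF w_arc \<sigma>_arc w_\<sigma>_ends] zigzag_image[where w = w and \<sigma> = \<sigma> and m = m, OF w_arc \<sigma>_arc w_\<sigma>_ends]
  zigzag_arc[where w = w and \<sigma> = \<sigma> and m = m, OF w_arc \<sigma>_arc w_\<sigma>_ends w_disjoint \<sigma>_disjoint w_\<sigma>_meet]

definition xb :: real where
  "xb = P * (attach_pos (length fb) kb + of_int (n 0 + sh (e 0)))"

definition xt :: real where
  "xt = P * (attach_pos (length ft) kt + of_int (n m))"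

lemma \<gamma>_ends: "pathstart \<gamma> = Complex xb 0" "pathfinish \<gamma> = Complex xt b"
proof -
  have "pathstart \<gamma> = pathstart (w 0)" "pathfinish \<gamma> = pathfinish (w m)"
    unfolding \<gamma>_def by (rule zz; simp)+
  then show "pathstart \<gamma> = Complex xb 0" "pathfinish \<gamma> = Complex xt b"
    using lw_frame_bottom[OF start(1), of "n 0"] lw_frame_top[OF final(1), of "n m"] start(2) final(2)
    by (simp_all add: w_def xb_def xt_def)
qed

lemma \<gamma>_image: "path_image \<gamma> = (\<Union>i\<le>m. path_image (w i)) \<union> (\<Union>i<m. path_image (\<sigma> i))"
  unfolding \<gamma>_def by (rule zz(3)) auto

lemma top_index: assumes "i \<le> m" "e i \<in> set ft" shows "i = m"
proof (rule ccontr)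
  assume "i \<noteq> m"
  then have "i < m" using assms by simp
  then have "t i \<in> T" "e i \<in> set (tb (t i))" using step_simps(1,2,4)[of i] by auto
  then show False using tops(3) assms(2) by blast
qed

lemma bottom_index: assumes "i \<le> m" "e i \<in> set fb" shows "i = 0"
proof (rule ccontr)
  assume "i \<noteq> 0"
  then obtain i' where i': "i = Suc i'" "i' < m" using assms by (cases i) auto
  then have "t i' \<in> T" "e i \<in> set (tt (t i'))" using step_simps(1,3,5)[of i'] by auto
  then show False using bottoms(3) assms(2) by blast
qed

sublocale C: crossing_arc \<gamma> b xb xt M
proof
  show "0 < b" by (rule b)
  show "arc \<gamma>" unfolding \<gamma>_def by (rule zz(4)) auto
  show "pathstart \<gamma> = Complex xb 0" "pathfinish \<gamma> = Complex xt b" by (rule \<gamma>_ends)+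
  fix z assume "z \<in> path_image \<gamma>"
  then consider i where "i \<le> m" "z \<in> path_image (w i)" | i where "i < m" "z \<in> path_image (\<sigma> i)"
    by (auto simp: \<gamma>_image)
  then have "(z = Complex xb 0 \<or> z = Complex xt b \<or> 0 < Im z \<and> Im z < b) \<and> \<bar>Re z\<bar> < M"
  proof cases
    case 1
    have "\<bar>Re z\<bar> < M" using Mw[OF K[OF 1(1)] eW[OF 1(1)]] 1(2) by (simp add: w_def)
    moreover have "pathstart (w 0) = Complex xb 0" "pathfinish (w m) = Complex xt b"
      using lw_frame_bottom[OF start(1), of "n 0"] lw_frame_top[OF final(1), of "n m"] start(2) final(2)
      by (simp_all add: w_def xb_def xt_def)
    ultimately show ?thesis
      using wire_strip[OF eW[OF 1(1)] 1(2)[unfolded w_def]] top_index[OF 1(1)] bottom_index[OF 1(1)]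
      by (auto simp: w_def)
  next
    case 2
    then obtain p where "p \<in> unit_square" "z = lt (n i) (t i) p" using \<sigma>_in_transistor by blast
    then show ?thesis using lt_strip[OF step_simps(1)[OF 2(1)]] Mt[OF K step_simps(1)[OF 2(1)]] 2(1) by auto
  qed
  then show "z = Complex xb 0 \<or> z = Complex xt b \<or> 0 < Im z \<and> Im z < b" "\<bar>Re z\<bar> < M" by blast+
qed

abbreviation "N z \<equiv> C.N 1 z"

definition on_wire :: "int \<Rightarrow> nat \<Rightarrow> bool" where
  "on_wire n' e' \<longleftrightarrow> (\<exists>i\<le>m. n' = n i \<and> e' = e i)"

lemma off_wire: "e' \<in> W \<Longrightarrow> \<not> on_wire n' e' \<Longrightarrow> path_image (lw n' e') \<inter> path_image \<gamma> = {}"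
proof (rule ccontr)
  assume e': "e' \<in> W" "\<not> on_wire n' e'" and "path_image (lw n' e') \<inter> path_image \<gamma> \<noteq> {}"
  then obtain z where z: "z \<in> path_image (lw n' e')" "z \<in> path_image \<gamma>" by blast
  then consider i where "i \<le> m" "z \<in> path_image (w i)" | i where "i < m" "z \<in> path_image (\<sigma> i)"
    by (auto simp: \<gamma>_image)
  then show False
  proof cases
    case 1
    then show False using lw_eq[OF e'(1) eW z(1)] e'(2) by (auto simp: w_def on_wire_def)
  next
    case 2
    then show False using wire_\<sigma>[OF e'(1) z(1) 2] e'(2) Suc_leI[OF 2(1)] by (auto simp: on_wire_def)
  qed
qed

lemma wire_const:
  assumes "e' \<in> W" "\<not> on_wire n' e'" "\<bar>n'\<bar> \<le> K" "z \<in> path_image (lw n' e')" "z' \<in> path_image (lw n' e')"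
  shows "N z = N z'"
proof (rule C.N_const[OF _ _ off_wire[OF assms(1,2)] _ assms(4,5)])
  show "connected (path_image (lw n' e'))"
    using lw_arc[OF assms(1)] by (simp add: connected_path_image arc_imp_path)
  show "path_image (lw n' e') \<subseteq> C.region"
    using wire_region[OF assms(1)] Mw[OF assms(3,1)] by (auto simp: C.region_def)
qed simp

lemma lt_region: assumes "t' \<in> T" "\<bar>n'\<bar> \<le> K" shows "lt n' t' ` unit_square \<subseteq> C.region"
proof
  fix z assume "z \<in> lt n' t' ` unit_square"
  then obtain p where "p \<in> unit_square" "z = lt n' t' p" by blast
  then show "z \<in> C.region" using lt_strip[OF assms(1), of p n'] Mt[OF assms(2,1), of p] by (auto simp: C.region_def)
qed

text \<open>A wire of the trajectory touching this lift of \<open>t'\<close> would have to be the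
  wire entering or leaving it, and the trajectory would cross the lift.\<close>

lemma off_transistor:
  assumes t': "t' \<in> T" and off: "\<And>i. i < m \<Longrightarrow> \<not> (n' = n i \<and> t' = t i)"
  shows "lt n' t' ` unit_square \<inter> path_image \<gamma> = {}"
proof (rule ccontr)
  assume "\<not> ?thesis"
  then obtain p where p: "p \<in> unit_square" "lt n' t' p \<in> path_image \<gamma>" by blast
  then consider i where "i \<le> m" "lt n' t' p \<in> path_image (w i)" | i where "i < m" "lt n' t' p \<in> path_image (\<sigma> i)"
    by (auto simp: \<gamma>_image)
  then show False
  proof cases
    case 1
    consider a where "n' = n i" "a < length (tb t')" "e i = tb t' ! a"
      | c where "n' = n i + sh (e i)" "c < length (tt t')" "e i = tt t' ! c"
      using wire_meets[OF eW[OF 1(1)] t' 1(2)[unfolded w_def] refl p(1)] by blast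
    then show False
    proof cases
      case 1
      have "i \<noteq> m" using 1 final tb_not_ft[OF t' 1(2) final(1)] by auto
      then have i: "i < m" using \<open>i \<le> m\<close> by simp
      then have "t i = t'" using tb_unique[OF step_simps(1)[OF i] t' step_simps(2)[OF i] 1(2)] step_simps(4)[OF i] 1(3) by simp
      then show False using off[OF i] 1(1) by simp
    next
      case 2
      have "i \<noteq> 0" using 2(3) start(2) tt_not_fb[OF t' 2(2) start(1)] by metis
      then obtain i' where i': "i = Suc i'" "i' < m" using \<open>i \<le> m\<close> by (cases i) auto
      then have "t i' = t'"
        using tt_unique[OF step_simps(1)[OF i'(2)] t' step_simps(3)[OF i'(2)] 2(2)] step_simps(5)[OF i'(2)] 2(3) by simp
      moreover have "n' = n i'" using step_simps(8)[OF i'(2)] 2(1) i'(1) by simp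
      ultimately show False using off[OF i'(2)] by simp
    qed
  next
    case 2
    then obtain q where "q \<in> unit_square" "lt n' t' p = lt (n i) (t i) q" using \<sigma>_in_transistor by blast
    then show False using lt_eq[OF t' step_simps(1)[OF 2(1)] p(1)] off[OF 2(1)] by blast
  qed
qed

lemma transistor_const:
  assumes "t' \<in> T" "\<And>i. i < m \<Longrightarrow> \<not> (n' = n i \<and> t' = t i)" "\<bar>n'\<bar> \<le> K" "p \<in> unit_square" "q \<in> unit_square"
  shows "N (lt n' t' p) = N (lt n' t' q)"
proof (rule C.N_const[OF _ lt_region[OF assms(1,3)] off_transistor[OF assms(1,2)]])
  show "connected (lt n' t' ` unit_square)"
    using lt_cont[OF assms(1)] by (intro connected_continuous_image convex_connected convex_box)
qed (use assms in auto)

text \<open>Each transistor is crossed only once, so the arc meets this lift in a single straight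
  crossing.\<close>

lemma \<gamma>_transistor: assumes i: "i < m" and p: "p \<in> unit_square" "lt (n i) (t i) p \<in> path_image \<gamma>"
  shows "p \<in> closed_segment (bpos (t i) (j i)) (tpos (t i) (k i))"
proof -
  have inS: "p \<in> closed_segment (bpos (t i) (j i)) (tpos (t i) (k i))" if "lt (n i) (t i) p \<in> path_image (\<sigma> i)"
    using that lt_inj[OF step_simps(1)[OF i]] seg_sub[OF i] p(1) inj_on_image_mem_iff unfolding \<sigma>_image by metis
  from p(2) consider i' where "i' \<le> m" "lt (n i) (t i) p \<in> path_image (w i')"
    | i' where "i' < m" "lt (n i) (t i) p \<in> path_image (\<sigma> i')"
    by (auto simp: \<gamma>_image)
  then show ?thesis
  proof cases
    case 1
    note st = step_simps[OF i]
    consider a where "a < length (tb (t i))" "e i' = tb (t i) ! a" "p = bpos (t i) a"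
      | c where "c < length (tt (t i))" "e i' = tt (t i) ! c" "p = tpos (t i) c"
      using wire_meets[OF eW[OF 1(1)] st(1) 1(2)[unfolded w_def] refl p(1)] by blast
    then show ?thesis
    proof cases
      case 1
      have "i' \<noteq> m" using 1 final tb_not_ft[OF st(1) 1(1) final(1)] by auto
      then have i': "i' < m" using \<open>i' \<le> m\<close> by simp
      note st' = step_simps[OF i']
      have "t i' = t i \<and> j i' = a" using tb_unique[OF st'(1) st(1) st'(2) 1(1)] st'(4) 1(2) by simp
      then have "a = j i" using t_distinct[OF i' i] by auto
      then show ?thesis using 1(3) by simp
    next
      case 2
      have "i' \<noteq> 0" using 2(2) start(2) tt_not_fb[OF st(1) 2(1) start(1)] by metis
      then obtain i1 where i1: "i' = Suc i1" "i1 < m" using \<open>i' \<le> m\<close> by (cases i') auto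
      note st' = step_simps[OF i1(2)]
      have "t i1 = t i \<and> k i1 = c" using tt_unique[OF st'(1) st(1) st'(3) 2(1)] st'(5) 2(2) i1 by simp
      then have "c = k i" using t_distinct[OF i1(2) i] by auto
      then show ?thesis using 2(3) by simp
    qed
  next
    case 2
    then obtain q where "q \<in> unit_square" "lt (n i) (t i) p = lt (n i') (t i') q" using \<sigma>_in_transistor by blast
    then have "t i = t i'" using lt_eq[OF step_simps(1)[OF i] step_simps(1)[OF 2(1)] p(1)] by blast
    then show ?thesis using t_distinct[OF i 2(1)] 2 inS by simp
  qed
qed

text \<open>\<open>transistor_crossing\<close> gives only a difference of 1. As \<open>N\<close>
  takes no values but \<open>0\<close> and \<open>- 1\<close>, the difference fixes both of them;
  this is how a local orientation decides a global side.\<close>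

lemma sides_differ:
  assumes i: "i < m" and l: "pl \<in> unit_square"
    "Re pl < attach_pos (length (tb (t i))) (j i) + (attach_pos (length (tt (t i))) (k i) - attach_pos (length (tb (t i))) (j i)) * Im pl"
    and r: "pr \<in> unit_square"
    "Re pr > attach_pos (length (tb (t i))) (j i) + (attach_pos (length (tt (t i))) (k i) - attach_pos (length (tb (t i))) (j i)) * Im pr"
  shows "N (lt (n i) (t i) pl) = 0 \<and> N (lt (n i) (t i) pr) = - 1"
proof -
  note st = step_simps[OF i]
  let ?h = "lt (n i) (t i)"
  obtain \<tau> where \<tau>: "path \<tau>" "pathstart \<tau> = pathstart (w (Suc i))" "pathfinish \<tau> = pathfinish (w m)"
    "path_image \<tau> \<subseteq> (\<Union>j\<in>{Suc i..m}. path_image (w j)) \<union> (\<Union>j\<in>{Suc i..<m}. path_image (\<sigma> j))"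
    "\<And>z. z \<notin> path_image \<gamma> \<Longrightarrow> winding_number \<gamma> z =
       winding_number (zigzag w \<sigma> i) z + winding_number (\<sigma> i) z + winding_number \<tau> z"
    using zigzag_sum[where w = w and \<sigma> = \<sigma> and m = m, OF w_arc \<sigma>_arc w_\<sigma>_ends i] unfolding \<gamma>_def by blast
  \<comment> \<open>From the exit of the transistor up to the frame, around by the closing polygon,
    and up again to the entrance.\<close>
  define rest where "rest = \<tau> +++ (C.closing 1 +++ zigzag w \<sigma> i)"
  have zi: "path (zigzag w \<sigma> i)" "pathstart (zigzag w \<sigma> i) = Complex xb 0" "pathfinish (zigzag w \<sigma> i) = pathfinish (w i)"
    "path_image (zigzag w \<sigma> i) = (\<Union>j\<le>i. path_image (w j)) \<union> (\<Union>j<i. path_image (\<sigma> j))"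
  proof -
    show "path (zigzag w \<sigma> i)" using zz(4)[of i] i by (simp add: arc_imp_path)
    show "pathstart (zigzag w \<sigma> i) = Complex xb 0" using zz(1)[of i] zz(1)[of m] i \<gamma>_ends by (simp add: \<gamma>_def)
    show "pathfinish (zigzag w \<sigma> i) = pathfinish (w i)" using zz(2)[of i] i by simp
    show "path_image (zigzag w \<sigma> i) = (\<Union>j\<le>i. path_image (w j)) \<union> (\<Union>j<i. path_image (\<sigma> j))" using zz(3)[of i] i by simp
  qed
  have ends: "pathfinish \<tau> = Complex xt b" using \<tau>(3) zz(2)[of m] \<gamma>_ends by (simp add: \<gamma>_def)
  have clo: "path (C.closing 1)" using C.arc_closing[of 1] arc_imp_path by simp
  have rest: "path rest" "pathstart rest = ?h (tpos (t i) (k i))" "pathfinish rest = ?h (bpos (t i) (j i))"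
    "path_image rest = path_image \<tau> \<union> path_image (C.closing 1) \<union> path_image (zigzag w \<sigma> i)"
    using \<tau> zi ends clo w_\<sigma>_ends[OF i] \<sigma>_ends[of i] by (auto simp: rest_def path_image_join)
  have pieces: "(\<exists>a\<le>m. z \<in> path_image (w a)) \<or> (\<exists>a<m. a \<noteq> i \<and> z \<in> path_image (\<sigma> a))"
    if "z \<in> path_image \<tau> \<or> z \<in> path_image (zigzag w \<sigma> i)" for z
  proof -
    from that consider a where "a \<in> {Suc i..m}" "z \<in> path_image (w a)" | a where "a \<in> {Suc i..<m}" "z \<in> path_image (\<sigma> a)"
      | a where "a \<le> i" "z \<in> path_image (w a)" | a where "a < i" "z \<in> path_image (\<sigma> a)"
      using \<tau>(4) unfolding zi(4) by blast
    then show ?thesis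
    proof cases
      case 1
      then have "a \<le> m" by simp
      then show ?thesis using 1 by blast
    next
      case 2
      then have "a < m" "a \<noteq> i" by auto
      then show ?thesis using 2 by blast
    next
      case 3
      then have "a \<le> m" using i by simp
      then show ?thesis using 3 by blast
    next
      case 4
      then have "a < m" "a \<noteq> i" using i by auto
      then show ?thesis using 4 by blast
    qed
  qed
  then have sub\<gamma>: "path_image \<tau> \<subseteq> path_image \<gamma>" "path_image (zigzag w \<sigma> i) \<subseteq> path_image \<gamma>"
    unfolding \<gamma>_image by blast+
  have meet: "path_image rest \<inter> ?h ` unit_square \<subseteq> {?h (tpos (t i) (k i)), ?h (bpos (t i) (j i))}"
  proof
    fix z assume "z \<in> path_image rest \<inter> ?h ` unit_square"
    then obtain p where p: "p \<in> unit_square" "z = ?h p" "z \<in> path_image rest" by blast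
    have strip: "0 < Im z" "Im z < b" using lt_strip[OF st(1) p(1)] p(2) by auto
    have "z \<in> C.region" using lt_region[OF st(1) K[of i]] p(1,2) i by auto
    then have "z \<notin> path_image (C.closing 1)" using C.closing_region[of z 1] strip by auto
    then have z: "z \<in> path_image \<tau> \<or> z \<in> path_image (zigzag w \<sigma> i)" using p(3) rest(4) by blast
    then have "z \<in> path_image \<gamma>" using sub\<gamma> by blast
    then have "p \<in> closed_segment (bpos (t i) (j i)) (tpos (t i) (k i))"
      using \<gamma>_transistor[OF i p(1)] p(2) by simp
    then have zs: "z \<in> path_image (\<sigma> i)" using p(2) by (auto simp: \<sigma>_image)
    from pieces[OF z] show "z \<in> {?h (tpos (t i) (k i)), ?h (bpos (t i) (j i))}"
    proof (elim disjE exE conjE)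
      fix a assume "a \<le> m" "z \<in> path_image (w a)"
      then show ?thesis using w_\<sigma>_meet[OF _ i _ zs, of a] by (auto simp: \<sigma>_ends)
    next
      fix a assume "a < m" "a \<noteq> i" "z \<in> path_image (\<sigma> a)"
      then show ?thesis using \<sigma>_disjoint[of a i] i zs by blast
    qed
  qed
  have ap: "0 < attach_pos (length (tt (t i))) (k i)" "attach_pos (length (tt (t i))) (k i) < 1"
    "0 < attach_pos (length (tb (t i))) (j i)" "attach_pos (length (tb (t i))) (j i) < 1"
    using attach_pos_bounds st by auto
  have off: "?h p \<notin> path_image \<gamma>" if "p \<in> unit_square"
    "Re p \<noteq> attach_pos (length (tb (t i))) (j i) + (attach_pos (length (tt (t i))) (k i) - attach_pos (length (tb (t i))) (j i)) * Im p" for p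
    using \<gamma>_transistor[OF i that(1)] seg_Re that(2) by blast
  have Nh: "N (?h p) = winding_number rest (?h p) + winding_number (\<sigma> i) (?h p)"
    if p: "p \<in> unit_square" and ne: "Re p \<noteq> attach_pos (length (tb (t i))) (j i) + (attach_pos (length (tt (t i))) (k i) - attach_pos (length (tb (t i))) (j i)) * Im p" for p
  proof -
    have no: "?h p \<notin> path_image \<gamma>" by (rule off[OF p ne])
    have reg: "?h p \<in> C.region" using lt_region[OF st(1) K[of i]] p i by auto
    have noc: "?h p \<notin> path_image (C.closing 1)" using C.off_loop(1)[OF reg no] by simp
    have no1: "?h p \<notin> path_image \<tau>" "?h p \<notin> path_image (zigzag w \<sigma> i)" using no sub\<gamma> by blast+
    have "winding_number rest (?h p) = winding_number \<tau> (?h p) + winding_number (C.closing 1) (?h p) + winding_number (zigzag w \<sigma> i) (?h p)"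
      unfolding rest_def using no1 noc \<tau>(1) zi(1,2) ends clo C.closing_ends
      by (simp add: winding_number_join path_image_join)
    then show ?thesis using C.N_split[OF reg no] \<tau>(5)[OF no] by simp
  qed
  have "winding_number rest (?h pl) + winding_number (\<sigma> i) (?h pl) = winding_number rest (?h pr) + winding_number (\<sigma> i) (?h pr) + 1"
    unfolding \<sigma>_def bpos_def tpos_def
    by (rule transistor_crossing[OF lt_embedding[OF st(1)] ap rest(1) _ _ _ l r])
      (use rest meet in \<open>simp_all add: bpos_def tpos_def\<close>)
  then have "N (?h pl) = N (?h pr) + 1" using Nh l r by simp
  moreover have "N (?h p) = 0 \<or> N (?h p) = - 1"
    if "p \<in> unit_square" "Re p \<noteq> attach_pos (length (tb (t i))) (j i) + (attach_pos (length (tt (t i))) (k i) - attach_pos (length (tb (t i))) (j i)) * Im p" for p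
  proof -
    have "?h p \<in> C.region" using lt_region[OF st(1) K[of i]] that(1) i by auto
    then show ?thesis by (rule C.N_values[OF _ off[OF that]])
  qed
  then have "N (?h pl) = 0 \<or> N (?h pl) = - 1" "N (?h pr) = 0 \<or> N (?h pr) = - 1" using l r by simp_all
  ultimately show ?thesis by (auto simp: add_eq_0_iff2)
qed

text \<open>
  \<open>N\<close> is \<open>0\<close> to the left and \<open>- 1\<close> to the right of the arc \<open>\<gamma>\<close> drawn by the trajectory. A point
  of a wire that the trajectory runs along is compared with it through the coordinate on the wire.
\<close>

definition right_of :: "state \<Rightarrow> bool" where
  "right_of s = (case s of (n', e', x') \<Rightarrow> (\<exists>i\<le>m. n' = n i \<and> e' = e i \<and> x i < x') \<or>
     \<not> on_wire n' e' \<and> (\<forall>z\<in>path_image (lw n' e'). N z = - 1))"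

lemma on_wire_transistor:
  assumes "t' \<in> T"
  shows "j' < length (tb t') \<Longrightarrow> on_wire n' (tb t' ! j') \<Longrightarrow> \<exists>i<m. n' = n i \<and> t' = t i \<and> j' = j i"
    "k' < length (tt t') \<Longrightarrow> on_wire n' (tt t' ! k') \<Longrightarrow> \<exists>i<m. n' + sh (tt t' ! k') = n i \<and> t' = t i \<and> k' = k i"
proof -
  assume j': "j' < length (tb t')" "on_wire n' (tb t' ! j')"
  then obtain i where i: "i \<le> m" "n' = n i" "tb t' ! j' = e i" by (auto simp: on_wire_def)
  have "i \<noteq> m" using i final tb_not_ft[OF assms j'(1) final(1)] by auto
  then have "i < m" using i by simp
  then show "\<exists>i<m. n' = n i \<and> t' = t i \<and> j' = j i"
    using tb_unique[OF step_simps(1)[OF \<open>i < m\<close>] assms step_simps(2)[OF \<open>i < m\<close>] j'(1)]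
      step_simps(4)[OF \<open>i < m\<close>] i by auto
next
  assume k': "k' < length (tt t')" "on_wire n' (tt t' ! k')"
  then obtain i where i: "i \<le> m" "n' = n i" "tt t' ! k' = e i" by (auto simp: on_wire_def)
  have "i \<noteq> 0" using i(3) start(2) tt_not_fb[OF assms k'(1) start(1)] by metis
  then obtain i1 where i1: "i = Suc i1" "i1 < m" using i(1) by (cases i) auto
  then show "\<exists>i<m. n' + sh (tt t' ! k') = n i \<and> t' = t i \<and> k' = k i"
    using tt_unique[OF step_simps(1)[OF i1(2)] assms step_simps(3)[OF i1(2)] k'(1)] step_simps(5,8)[OF i1(2)] i
    by (intro exI[of _ i1]) auto
qed

text \<open>At a lift of a transistor that the trajectory does not cross, \<open>N\<close> is
  constant. At one that it crosses, both points keep their coordinate in the transistor, and the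
  order of these coordinates is lexicographic in wire and position on either side.\<close>

lemma right_of_step:
  assumes st: "ustep_at \<Delta> sh t' j' k' (n1, e1, x1) (n2, e2, x2)" and K12: "\<bar>n1\<bar> \<le> K" "\<bar>n2\<bar> \<le> K"
    and R: "right_of (n1, e1, x1)"
  shows "right_of (n2, e2, x2)"
proof -
  have t': "t' \<in> T" "j' < length (tb t')" "k' < length (tt t')" "e1 = tb t' ! j'" "e2 = tt t' ! k'"
    "x1 \<in> unit_ivl" "x2 \<in> unit_ivl" "n2 = n1 - sh e2"
    "emb (length (tb t')) j' x1 = emb (length (tt t')) k' x2"
    using st by (auto simp: ustep_at_def)
  have e1: "e1 \<in> W" and e2: "e2 \<in> W" using in_W t' by auto
  have fin1: "pathfinish (lw n1 e1) = lt n1 t' (bpos t' j')" unfolding t'(4) by (rule lw_top[OF t'(1,2)])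
  have st2: "pathstart (lw n2 e2) = lt n1 t' (tpos t' k')" using lw_bottom[OF t'(1,3), of n2] t'(5,8) by simp
  have off2: "\<exists>i<m. n1 = n i \<and> t' = t i \<and> k' = k i" if "on_wire n2 e2"
  proof -
    have "n2 + sh (tt t' ! k') = n1" using t'(5,8) by simp
    then show ?thesis using on_wire_transistor(2)[OF t'(1,3), of n2] that unfolding t'(5) by simp
  qed
  have from2: "right_of (n2, e2, x2)" if "\<not> on_wire n2 e2" "N (lt n1 t' (tpos t' k')) = - 1"
  proof -
    have "N z = - 1" if "z \<in> path_image (lw n2 e2)" for z
      using wire_const[OF e2 \<open>\<not> on_wire n2 e2\<close> K12(2) that pathstart_in_path_image] st2 \<open>N _ = - 1\<close> by simp
    then show ?thesis using that by (simp add: right_of_def)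
  qed
  show ?thesis
  proof (cases "\<exists>i<m. n1 = n i \<and> t' = t i")
    case False
    then have "\<not> on_wire n1 e1" using on_wire_transistor(1)[OF t'(1,2)] t'(4) by auto
    then have "N (pathfinish (lw n1 e1)) = - 1"
      using R pathfinish_in_path_image by (auto simp: right_of_def on_wire_def)
    then have "N (lt n1 t' (tpos t' k')) = - 1"
      using transistor_const[OF t'(1) _ K12(1) pos_in(1)[OF t'(2)] pos_in(2)[OF t'(3)]] False fin1 by auto
    then show ?thesis using from2 off2 False by blast
  next
    case True
    then obtain i where i: "i < m" "n1 = n i" "t' = t i" by blast
    note si = step_simps[OF i(1)]
    have lt: "emb (length (tb t')) (j i) (x i) < emb (length (tb t')) j' x1"
    proof (cases "j' = j i")
      case True
      then have "e1 = e i" using t'(4) si(4) i by simp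
      then have "on_wire n1 e1" unfolding on_wire_def using i by (intro exI[of _ i]) simp
      then obtain i0 where "i0 \<le> m" "e1 = e i0" "x i0 < x1"
        using R unfolding right_of_def prod.case by blast
      moreover have "i0 = i"
        by (rule e_distinct) (use \<open>i0 \<le> m\<close> i(1) \<open>e1 = e i0\<close> \<open>e1 = e i\<close> in simp_all)
      ultimately have "x i < x1" by simp
      then show ?thesis using emb_less_iff[OF t'(2) t'(2) si(6) t'(6)] True by simp
    next
      case False
      have "\<not> on_wire n1 e1"
      proof
        assume "on_wire n1 e1"
        then obtain i0 where i0: "i0 < m" "t' = t i0" "j' = j i0"
          using on_wire_transistor(1)[OF t'(1,2)] unfolding t'(4) by blast
        then have "i0 = i" using t_distinct[OF i0(1) i(1)] i0(2) i(3) by metis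
        then show False using i0(3) False by simp
      qed
      then have "N (pathfinish (lw n1 e1)) = - 1"
        using R pathfinish_in_path_image by (auto simp: right_of_def on_wire_def)
      then have N: "N (lt (n i) (t i) (bpos t' j')) = - 1" using fin1 i by simp
      have "\<not> j' < j i"
      proof
        assume "j' < j i"
        then have "attach_pos (length (tb t')) j' < attach_pos (length (tb t')) (j i)" by (simp add: attach_pos_less)
        \<comment> \<open>The corner \<open>Complex 1 1\<close> serves as a point certainly to the
          right of the crossing. Attached left of the crossing, the wire would have \<open>N\<close>
          equal to \<open>0\<close>.\<close>
        then have "N (lt (n i) (t i) (bpos t' j')) = 0"
          using sides_differ[OF i(1) pos_in(1)[OF t'(2)], of "Complex 1 1"] i(3) attach_pos_bounds[OF si(3)]
          by (simp add: bpos_def unit_square_iff)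
        then show False using N by simp
      qed
      then have "j i < j'" using False by simp
      then show ?thesis using emb_less_iff[of "j i" "length (tb t')" j' "x i" x1] si(2,6) t'(2,6) i(3) by simp
    qed
    \<comment> \<open>Passing from the bottom to the top subdivision leaves both coordinates in the
      transistor unchanged.\<close>
    then have "emb (length (tt t')) (k i) (x (Suc i)) < emb (length (tt t')) k' x2" using si(9) t'(9) i(3) by simp
    then consider "k i = k'" "x (Suc i) < x2" | "k i < k'"
      using emb_less_iff[of "k i" "length (tt t')" k' "x (Suc i)" x2] si(3,7) t'(3,7) i(3) by auto
    then show ?thesis
    proof cases
      case 1
      then have "e2 = e (Suc i)" "n2 = n (Suc i)" using t'(5,8) si(5,8) i by auto
      then show ?thesis using 1 i(1) by (auto simp: right_of_def)
    next
      case 2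
      then have "attach_pos (length (tt t')) (k i) < attach_pos (length (tt t')) k'" by (simp add: attach_pos_less)
      then have "N (lt (n i) (t i) (tpos t' k')) = - 1"
        using sides_differ[OF i(1), of "Complex 0 0" "tpos t' k'"] pos_in(2)[OF t'(3)] i(3) attach_pos_bounds[OF si(2)]
        by (simp add: tpos_def unit_square_iff)
      moreover have "\<not> on_wire n2 e2"
      proof
        assume "on_wire n2 e2"
        then obtain i0 where i0: "i0 < m" "t' = t i0" "k' = k i0" using off2 by blast
        then have "i0 = i" using t_distinct[OF i0(1) i(1)] i0(2) i(3) by metis
        then show False using i0(3) 2 by simp
      qed
      ultimately show ?thesis using from2 i by simp
    qed
  qed
qed

lemma right_of_bottom_aux:
  assumes kb': "kb' < length fb" "\<bar>n'\<bar> \<le> K" "\<not> on_wire n' (fb ! kb')"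
    and less: "attach_pos (length fb) kb + of_int (n 0 + sh (e 0)) < attach_pos (length fb) kb' + of_int (n' + sh (fb ! kb'))"
  shows "right_of (n', fb ! kb', x')"
proof -
  define z where "z = P * (attach_pos (length fb) kb' + of_int (n' + sh (fb ! kb')))"
  have W: "fb ! kb' \<in> W" by (rule in_W(4)[OF kb'(1)])
  have z: "pathstart (lw n' (fb ! kb')) = Complex z 0" unfolding z_def by (rule lw_frame_bottom[OF kb'(1)])
  have "xb < z" using less P unfolding xb_def z_def by simp
  moreover have "\<bar>z\<bar> < M" using Mw[OF kb'(2) W pathstart_in_path_image] z by simp
  ultimately have "N (Complex z 0) = - 1" by (intro C.N_frame(2))
  then have "N y = - 1" if "y \<in> path_image (lw n' (fb ! kb'))" for y
    using wire_const[OF W kb'(3,2) that pathstart_in_path_image] z by simp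
  then show ?thesis using kb'(3) by (simp add: right_of_def)
qed

lemma right_of_bottom:
  assumes kb': "kb' < length fb" "x' \<in> unit_ivl" "\<bar>n'\<bar> \<le> K"
    and less: "of_int (n 0 + sh (e 0)) + emb (length fb) kb (x 0) < of_int (n' + sh (fb ! kb')) + emb (length fb) kb' x'"
  shows "right_of (n', fb ! kb', x')"
proof -
  let ?B = "n 0 + sh (e 0)" and ?B' = "n' + sh (fb ! kb')"
  have e: "emb (length fb) kb (x 0) \<in> unit_ivl" "emb (length fb) kb' x' \<in> unit_ivl" using emb_in x kb'(2) by blast+
  then have "?B \<le> ?B'" using less by (simp add: not_le)
  then consider "?B < ?B'" | "?B = ?B'" "kb < kb'" | "?B = ?B'" "kb = kb'" "x 0 < x'"
    using less emb_less_iff[OF start(1) kb'(1) x kb'(2)] by fastforce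
  then show ?thesis
  proof cases
    case 3
    have eq: "fb ! kb' = e 0" using 3(2) start(2) by simp
    then have "n' = n 0" using 3(1) by simp
    then show ?thesis unfolding right_of_def eq using 3(3) by (auto intro!: exI[of _ 0])
  next
    case 1
    have ap: "0 < attach_pos (length fb) kb'" "attach_pos (length fb) kb < 1"
      using attach_pos_bounds kb'(1) start(1) by auto
    \<comment> \<open>Attaching positions lie strictly between 0 and 1, so a higher sheet is always
      further to the right.\<close>
    have "of_int ?B + 1 \<le> (of_int ?B' :: real)" using 1 by linarith
    then have "attach_pos (length fb) kb + of_int ?B < attach_pos (length fb) kb' + of_int ?B'" using ap by linarith
    moreover have "\<not> on_wire n' (fb ! kb')"
    proof
      assume "on_wire n' (fb ! kb')"
      then obtain i where i: "i \<le> m" "n' = n i" "fb ! kb' = e i" by (auto simp: on_wire_def)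
      then have "e i \<in> set fb" using nth_mem[OF kb'(1)] by simp
      then show False using bottom_index[of i] 1 i by simp
    qed
    ultimately show ?thesis using right_of_bottom_aux[OF kb'(1,3)] by blast
  next
    case 2
    then have "attach_pos (length fb) kb + of_int ?B < attach_pos (length fb) kb' + of_int ?B'"
      by (simp add: attach_pos_less)
    moreover have "\<not> on_wire n' (fb ! kb')"
    proof
      assume "on_wire n' (fb ! kb')"
      then obtain i where i: "i \<le> m" "n' = n i" "fb ! kb' = e i" by (auto simp: on_wire_def)
      then have "e i \<in> set fb" using nth_mem[OF kb'(1)] by simp
      then have "fb ! kb' = fb ! kb" using bottom_index[of i] start(2) i by simp
      then show False using 2 bottoms(1) kb'(1) start(1) by (simp add: nth_eq_iff_index_eq)
    qed
    ultimately show ?thesis using right_of_bottom_aux[OF kb'(1,3)] by blast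
  qed
qed

lemma right_of_top:
  assumes R: "right_of (n', ft ! kt', x')" and kt': "kt' < length ft" "x' \<in> unit_ivl" "\<bar>n'\<bar> \<le> K"
  shows "of_int (n m) + emb (length ft) kt (x m) < of_int n' + emb (length ft) kt' x'"
proof (cases "on_wire n' (ft ! kt')")
  case True
  then obtain i where i: "i \<le> m" "n' = n i" "ft ! kt' = e i" "x i < x'" using R by (auto simp: right_of_def)
  then have "i = m" using top_index[of i] nth_mem[OF kt'(1)] by simp
  then have "kt' = kt" using i final kt'(1) tops(1) by (simp add: nth_eq_iff_index_eq)
  then show ?thesis using i \<open>i = m\<close> emb_less_iff[OF final(1) final(1) x_in kt'(2)] by simp
next
  case False
  let ?z = "pathfinish (lw n' (ft ! kt'))"
  define z where "z = P * (attach_pos (length ft) kt' + of_int n')"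
  have z: "?z = Complex z b" using lw_frame_top[OF kt'(1), of n'] by (simp add: z_def)
  have "N ?z = - 1" using R False pathfinish_in_path_image by (auto simp: right_of_def on_wire_def)
  moreover have "\<bar>z\<bar> < M" using Mw[OF kt'(3) in_W(3)[OF kt'(1)] pathfinish_in_path_image] z by simp
  ultimately have "\<not> z < xt" using C.N_frame(1)[of z] z by auto
  \<comment> \<open>The converse of the comparison at the bottom: \<open>N\<close> being
    \<open>- 1\<close> excludes a position left of the end of the arc, and equality is sorted out by
    sheet and index.\<close>
  then have le: "attach_pos (length ft) kt + of_int (n m) \<le> attach_pos (length ft) kt' + of_int n'"
    using P by (simp add: xt_def z_def)
  have ap: "0 < attach_pos (length ft) kt" "attach_pos (length ft) kt' < 1"
    using attach_pos_bounds kt'(1) final(1) by auto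
  then have "(of_int (n m) :: real) < of_int n' + 1" using le by linarith
  then have "n m \<le> n'" by linarith
  then consider "n m < n'" | "n m = n'" by linarith
  then show ?thesis
  proof cases
    case 1
    then have "of_int (n m) + 1 \<le> (of_int n' :: real)" by linarith
    moreover have "emb (length ft) kt (x m) < 1" "0 \<le> emb (length ft) kt' x'"
      using emb_in[OF x_in[OF order_refl]] emb_in[OF kt'(2)] by (auto simp: atLeastLessThan_iff)
    ultimately show ?thesis by linarith
  next
    case 2
    have "kt \<noteq> kt'" using False 2 final(2) by (auto simp: on_wire_def)
    moreover have "\<not> kt' < kt" using le 2 attach_pos_less[of "length ft" kt' kt] by auto
    ultimately have "kt < kt'" by simp
    then show ?thesis using 2 emb_less_iff[OF final(1) kt'(1) x_in kt'(2)] by simp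
  qed
qed

end

section \<open>Monotonicity of the flow in the strip\<close>

context diag
begin

lemma trace:
  assumes "e \<in> W" "x \<in> unit_ivl"
  obtains m ns es ts js ks xs k where
    "\<And>i. i < m \<Longrightarrow> ustep_at \<Delta> sh (ts i) (js i) (ks i) (ns i, es i, xs i) (ns (Suc i), es (Suc i), xs (Suc i))"
    "ns 0 = n" "es 0 = e" "xs 0 = x" "k < length ft" "es m = ft ! k" "xs m \<in> unit_ivl"
    "of_int n + waddr \<Delta> sh e x = of_int (ns m) + emb (length ft) k (xs m)"
proof -
  obtain n' k y where k: "k < length ft" "y \<in> unit_ivl" "((n, e, x), (n', ft ! k, y)) \<in> (ustep \<Delta> sh)\<^sup>*"
      "of_int n + waddr \<Delta> sh e x = of_int n' + emb (length ft) k y"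
    using reaches_waddr[OF assms, of sh n] unfolding reaches_def by blast
  obtain m where "((n, e, x), (n', ft ! k, y)) \<in> ustep \<Delta> sh ^^ m" using rtrancl_imp_relpow[OF k(3)] by blast
  then obtain f where f: "f 0 = (n, e, x)" "f m = (n', ft ! k, y)" "\<And>i. i < m \<Longrightarrow> (f i, f (Suc i)) \<in> ustep \<Delta> sh"
    unfolding relpow_fun_conv by blast
  then have "\<forall>i\<in>{..<m}. \<exists>t j k. ustep_at \<Delta> sh t j k (f i) (f (Suc i))" unfolding ustep_def by auto
  then obtain ts where "\<forall>i\<in>{..<m}. \<exists>j k. ustep_at \<Delta> sh (ts i) j k (f i) (f (Suc i))" using bchoice by meson
  then obtain js where "\<forall>i\<in>{..<m}. \<exists>k. ustep_at \<Delta> sh (ts i) (js i) k (f i) (f (Suc i))" using bchoice by meson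
  then obtain ks where ks: "\<forall>i\<in>{..<m}. ustep_at \<Delta> sh (ts i) (js i) (ks i) (f i) (f (Suc i))" using bchoice by meson
  show thesis
    by (rule that[of m ts js ks "\<lambda>i. fst (f i)" "\<lambda>i. fst (snd (f i))" "\<lambda>i. snd (snd (f i))" k])
      (use ks k f in simp_all)
qed

text \<open>The shifts change the sheet by integers and never the wire or the coordinate, so modulo
  1 they are invisible.\<close>

lemma waddr_mod_int:
  assumes "e \<in> W" "x \<in> unit_ivl" shows "waddr \<Delta> sh e x - waddr0 \<Delta> e x \<in> \<int>"
  using assms
proof (induction e arbitrary: x rule: wf_induct_rule[OF wf_wire_up(2)])
  case (1 e)
  from \<open>e \<in> W\<close> show ?case
  proof (cases rule: top_cases)
    case (frame k)
    then show ?thesis using addr_simps(1) 1 by simp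
  next
    case (trans t j)
    obtain k x' where k: "k < length (tt t)" "x' \<in> unit_ivl"
        "emb (length (tb t)) j x = emb (length (tt t)) k x'"
      using ustep_up[OF trans(1,2) 1(3)] by metis
    have "(tt t ! k, e) \<in> wire_up\<inverse>" using trans k by (auto simp: wire_up_def intro!: bexI[of _ t])
    then have "waddr \<Delta> sh (tt t ! k) x' - waddr0 \<Delta> (tt t ! k) x' \<in> \<int>" using 1(1) k trans in_W by blast
    then have "waddr \<Delta> sh (tt t ! k) x' - waddr0 \<Delta> (tt t ! k) x' - of_int (sh (tt t ! k)) \<in> \<int>" by simp
    moreover have eq: "waddr \<Delta> sh' e x = waddr \<Delta> sh' (tt t ! k) x' - of_int (sh' (tt t ! k))" for sh'
      unfolding trans(3) using addr_simps(2)[OF trans(1,2) 1(3), of sh'] addr_simps(3)[OF trans(1) k(1,2), of sh'] k(3) by simp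
    ultimately show ?thesis unfolding eq[of sh] eq[of "\<lambda>_. 0"] by (simp add: algebra_simps)
  qed
qed

lemma flow_mod_int:
  assumes "fb \<noteq> []" "y \<in> unit_ivl" shows "flow \<Delta> sh y - flow0 \<Delta> y \<in> \<int>"
proof -
  obtain k x where k: "k < length fb" "x \<in> unit_ivl" "y = emb (length fb) k x"
    using emb_surj[OF _ assms(2), of "length fb"] assms(1) by auto
  have "waddr \<Delta> sh (fb ! k) x - waddr0 \<Delta> (fb ! k) x - of_int (sh (fb ! k)) \<in> \<int>"
    using waddr_mod_int[OF in_W(4)[OF k(1)] k(2), of sh] by simp
  then show ?thesis using k by (simp add: flow_emb algebra_simps)
qed

end

context strip_diag
begin

text \<open>The first trajectory is turned into an arc. The second starts to its right, stays there
  step by step, and the top of the frame translates this back into an inequality of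
  addresses.\<close>

lemma waddr_mono:
  assumes k: "k < length fb" "x \<in> unit_ivl" and k': "k' < length fb" "x' \<in> unit_ivl"
    and less: "of_int (n + sh (fb ! k)) + emb (length fb) k x < of_int (n' + sh (fb ! k')) + emb (length fb) k' x'"
  shows "of_int n + waddr \<Delta> sh (fb ! k) x < of_int n' + waddr \<Delta> sh (fb ! k') x'"
proof -
  obtain m ns es ts js ks xs kt where tr:
    "\<And>i. i < m \<Longrightarrow> ustep_at \<Delta> sh (ts i) (js i) (ks i) (ns i, es i, xs i) (ns (Suc i), es (Suc i), xs (Suc i))"
    "ns 0 = n" "es 0 = fb ! k" "xs 0 = x" "kt < length ft" "es m = ft ! kt"
    and a: "of_int n + waddr \<Delta> sh (fb ! k) x = of_int (ns m) + emb (length ft) kt (xs m)"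
    by (rule trace[OF in_W(4)[OF k(1)] k(2), where sh = sh and n = n]) blast
  obtain m' ns' es' ts' js' ks' xs' kt' where tr':
    "\<And>i. i < m' \<Longrightarrow> ustep_at \<Delta> sh (ts' i) (js' i) (ks' i) (ns' i, es' i, xs' i) (ns' (Suc i), es' (Suc i), xs' (Suc i))"
    "ns' 0 = n'" "es' 0 = fb ! k'" "xs' 0 = x'" "kt' < length ft" "es' m' = ft ! kt'" "xs' m' \<in> unit_ivl"
    and a': "of_int n' + waddr \<Delta> sh (fb ! k') x' = of_int (ns' m') + emb (length ft) kt' (xs' m')"
    by (rule trace[OF in_W(4)[OF k'(1)] k'(2), where sh = sh and n = n']) blast
  \<comment> \<open>Large enough for the sheets of both trajectories.\<close>
  define K where "K = Max ((\<lambda>i. \<bar>ns i\<bar>) ` {..m} \<union> (\<lambda>i. \<bar>ns' i\<bar>) ` {..m'})"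
  have K: "i \<le> m \<Longrightarrow> \<bar>ns i\<bar> \<le> K" "i \<le> m' \<Longrightarrow> \<bar>ns' i\<bar> \<le> K" for i
    unfolding K_def by (auto intro: Max_ge)
  obtain M where M: "\<forall>n e z. \<bar>n\<bar> \<le> K \<and> e \<in> W \<and> z \<in> path_image (lw n e) \<longrightarrow> \<bar>Re z\<bar> < M"
      "\<forall>n t p. \<bar>n\<bar> \<le> K \<and> t \<in> T \<and> p \<in> unit_square \<longrightarrow> \<bar>Re (lt n t p)\<bar> < M"
    using lifts_bounded by blast
  note K' = K(2)
  interpret trajectory \<A> \<R> \<Delta> P b H G sh m ns es ts js ks xs k kt K M
    by unfold_locales (use tr k K(1) M in auto)
  have "right_of (ns' i, es' i, xs' i)" if "i \<le> m'" for i
    using that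
  proof (induction i)
    case 0
    then show ?case using right_of_bottom[OF k', of n'] less tr' K'[of 0] tr(2-4) by simp
  next
    case (Suc i)
    then show ?case using right_of_step[OF tr'(1)[of i] K'[of i] K'[of "Suc i"]] by simp
  qed
  then have "right_of (ns' m', ft ! kt', xs' m')" using tr'(6) by (metis order_refl)
  from right_of_top[OF this tr'(5,7) K'[OF order_refl]] show ?thesis using a a' by simp
qed

definition flow_lift :: "real \<Rightarrow> real" where
  "flow_lift t = flow \<Delta> sh (frac t) + of_int \<lfloor>t\<rfloor>"

lemma flow_lift_add_one: "flow_lift (t + 1) = flow_lift t + 1"
  by (simp add: flow_lift_def frac_def)

lemma strict_mono_flow_lift: assumes "fb \<noteq> []" shows "strict_mono flow_lift"
proof (rule strict_monoI)
  fix s t :: real assume "s < t"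
  obtain k x where k: "k < length fb" "x \<in> unit_ivl" "frac s = emb (length fb) k x"
    using emb_surj[of "length fb" "frac s"] assms frac_ge_0[of s] frac_lt_1[of s] by auto
  obtain k' x' where k': "k' < length fb" "x' \<in> unit_ivl" "frac t = emb (length fb) k' x'"
    using emb_surj[of "length fb" "frac t"] assms frac_ge_0[of t] frac_lt_1[of t] by auto
  \<comment> \<open>The lift is chosen such that its bottom end, shifted by \<open>sh\<close>, lies
    over the period of \<open>s\<close>.\<close>
  have "of_int (\<lfloor>s\<rfloor> - sh (fb ! k)) + waddr \<Delta> sh (fb ! k) x < of_int (\<lfloor>t\<rfloor> - sh (fb ! k')) + waddr \<Delta> sh (fb ! k') x'"
  proof (rule waddr_mono[OF k(1,2) k'(1,2)])
    have "of_int \<lfloor>s\<rfloor> + frac s < of_int \<lfloor>t\<rfloor> + frac t" using \<open>s < t\<close> by (simp add: frac_def)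
    then show "of_int (\<lfloor>s\<rfloor> - sh (fb ! k) + sh (fb ! k)) + emb (length fb) k x
      < of_int (\<lfloor>t\<rfloor> - sh (fb ! k') + sh (fb ! k')) + emb (length fb) k' x'" using k(3) k'(3) by simp
  qed
  then show "flow_lift s < flow_lift t"
    unfolding flow_lift_def k(3) k'(3) flow_emb[OF k(1,2)] flow_emb[OF k'(1,2)] by simp
qed

lemma circ_flow0_lift: assumes "fb \<noteq> []" shows "circ (flow0 \<Delta>) (circle_pt t) = circle_pt (flow_lift t)"
proof -
  have "frac t \<in> unit_ivl" using frac_ge_0[of t] frac_lt_1[of t] by simp
  then have "flow \<Delta> sh (frac t) - flow0 \<Delta> (frac t) \<in> \<int>" by (rule flow_mod_int[OF assms])
  then obtain i where i: "flow \<Delta> sh (frac t) - flow0 \<Delta> (frac t) = of_int i" by (rule Ints_cases)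
  have "flow_lift t = flow0 \<Delta> (frac t) + of_int (i + \<lfloor>t\<rfloor>)" using i by (simp add: flow_lift_def)
  then show ?thesis by (simp add: circ_circle_pt circle_pt_add_int del: of_int_add)
qed

end

section \<open>Planar and annular drawings\<close>

text \<open>
  The strip covers the annulus by \<open>annulus_cover\<close>; its line \<open>Im z = 0\<close> lies over the outer circle,
  which is the bottom of the frame, and its line \<open>Im z = ln 2\<close> over the inner one.
\<close>

definition annulus_cover :: "complex \<Rightarrow> complex" where
  "annulus_cover z = 2 * exp (\<i> * z)"

lemma annulus_cover_eq_iff: "annulus_cover z = annulus_cover z' \<longleftrightarrow> (\<exists>n::int. z = z' + of_real (of_int n * (2 * pi)))"
proof -
  have "\<i> * z = \<i> * z' + (of_int (2 * n) * pi) * \<i> \<longleftrightarrow> \<i> * z = \<i> * (z' + of_real (of_int n * (2 * pi)))" for n :: int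
    by (simp add: algebra_simps)
  then show ?thesis unfolding annulus_cover_def by (simp add: exp_eq)
qed

lemma norm_annulus_cover: "norm (annulus_cover z) = 2 * exp (- Im z)"
  by (simp add: annulus_cover_def norm_mult)

lemma annulus_cover_strip: "1 < norm (annulus_cover z) \<and> norm (annulus_cover z) < 2 \<longleftrightarrow> 0 < Im z \<and> Im z < ln 2"
proof -
  have "1 < 2 * exp (- Im z) \<longleftrightarrow> exp (Im z) < exp (ln 2)" by (simp add: exp_minus field_simps)
  then show ?thesis unfolding norm_annulus_cover exp_less_cancel_iff by auto
qed

lemma annulus_cover_frame:
  "annulus_cover (Complex (2 * pi * a) 0) = 2 * circle_pt a"
  "annulus_cover (Complex (2 * pi * a) (ln 2)) = circle_pt a"
proof -
  have "\<i> * Complex (2 * pi * a) (ln 2) = of_real (- ln 2) + \<i> * of_real (2 * pi * a)"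
    by (simp add: complex_eq_iff)
  then have "annulus_cover (Complex (2 * pi * a) (ln 2)) = 2 * (exp (of_real (- ln 2)) * circle_pt a)"
    unfolding annulus_cover_def circle_pt_def cis_conv_exp exp_add[symmetric] by simp
  also have "exp (of_real (- ln 2)) = (1 / 2 :: complex)" by (subst exp_of_real) (simp add: exp_minus)
  finally show "annulus_cover (Complex (2 * pi * a) (ln 2)) = circle_pt a" by simp
  have "\<i> * Complex (2 * pi * a) 0 = \<i> * of_real (2 * pi * a)" by (simp add: complex_eq_iff)
  then show "annulus_cover (Complex (2 * pi * a) 0) = 2 * circle_pt a"
    by (simp add: annulus_cover_def circle_pt_def cis_conv_exp)
qed

text \<open>A lift is a logarithm of \<open>f z / 2\<close>, rotated by \<open>- \<i>\<close>; it
  exists on a contractible domain since \<open>f\<close> has no zeros.\<close>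

lemma annulus_lift:
  fixes f :: "'b::real_normed_vector \<Rightarrow> complex"
  assumes "continuous_on S f" "contractible S" "\<And>z. z \<in> S \<Longrightarrow> f z \<noteq> 0"
  shows "\<exists>F. continuous_on S F \<and> (\<forall>z\<in>S. annulus_cover (F z) = f z)"
proof -
  have f2: "continuous_on S (\<lambda>z. f z / 2)" "\<And>z. z \<in> S \<Longrightarrow> f z / 2 \<noteq> 0" using assms by (auto intro!: continuous_intros)
  obtain l where l: "continuous_on S l" "\<And>z. z \<in> S \<Longrightarrow> f z / 2 = exp (l z)"
    using continuous_logarithm_on_contractible[OF f2(1) assms(2) f2(2)] by blast
  have "annulus_cover (- \<i> * l z) = f z" if "z \<in> S" for z
  proof -
    have "annulus_cover (- \<i> * l z) = 2 * exp (l z)" by (simp add: annulus_cover_def flip: mult.assoc)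
    also have "\<dots> = 2 * (f z / 2)" using l(2)[OF that] by metis
    finally show ?thesis by simp
  qed
  moreover have "continuous_on S (\<lambda>z. - \<i> * l z)" using l(1) by (intro continuous_intros)
  ultimately show ?thesis by blast
qed

text \<open>The removable singularity of the difference quotient is filled with the derivative at 0,
  so that the factor between the two loops is continuous at the centre as well.\<close>

lemma continuous_exp_quotient:
  "continuous_on UNIV (\<lambda>w. if w = 0 then \<i> else (exp (\<i> * w) - 1) / w)"
  unfolding continuous_on_eq_continuous_at[OF open_UNIV]
proof
  fix z :: complex
  show "isCont (\<lambda>w. if w = 0 then \<i> else (exp (\<i> * w) - 1) / w) z"
  proof (cases "z = 0")
    case True
    have "((\<lambda>w. exp (\<i> * w)) has_field_derivative \<i>) (at 0)" by (auto intro!: derivative_eq_intros)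
    then have "((\<lambda>w. (exp (\<i> * w) - 1) / w) \<longlongrightarrow> \<i>) (at 0)" by (simp add: has_field_derivative_iff)
    moreover have "\<forall>\<^sub>F w in at 0. (exp (\<i> * w) - 1) / w = (if w = 0 then \<i> else (exp (\<i> * w) - 1) / w)"
      by (simp add: eventually_at_filter)
    ultimately have "((\<lambda>w. if w = 0 then \<i> else (exp (\<i> * w) - 1) / w) \<longlongrightarrow> \<i>) (at 0)"
      by (rule Lim_transform_eventually)
    then show ?thesis using True by (simp add: isCont_def)
  next
    case False
    have "isCont (\<lambda>w. (exp (\<i> * w) - 1) / w) z" using False by (intro continuous_intros) auto
    have "\<forall>\<^sub>F w in nhds z. w \<noteq> 0" using False t1_space_nhds by blast
    then have "\<forall>\<^sub>F w in nhds z. (if w = 0 then \<i> else (exp (\<i> * w) - 1) / w) = (exp (\<i> * w) - 1) / w"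
      by (rule eventually_mono) simp
    from isCont_cong[OF this] show ?thesis using \<open>isCont _ z\<close> by blast
  qed
qed

text \<open>
  With \<open>\<phi> p\<close> the difference quotient of the covering map between \<open>H p\<close> and \<open>H z\<close>, the two loops
  around the origin differ by the factor \<open>\<phi>\<close>, which has a logarithm on \<open>S\<close>.
\<close>

lemma winding_number_annulus_lift:
  fixes S :: "complex set"
  assumes S: "contractible S" "z \<in> S" and H: "continuous_on S H" "inj_on (\<lambda>p. annulus_cover (H p)) S"
    and p: "path p" "pathfinish p = pathstart p" "path_image p \<subseteq> S - {z}"
  shows "winding_number (\<lambda>u. annulus_cover (H (p u))) (annulus_cover (H z)) = winding_number (H \<circ> p) (H z)"
proof -
  define q where "q = (\<lambda>w. if w = 0 then \<i> else (exp (\<i> * w) - 1) / w)"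
  define \<phi> where "\<phi> = (\<lambda>p. annulus_cover (H z) * q (H p - H z))"
  have Hne: "H y \<noteq> H z" if "y \<in> S" "y \<noteq> z" for y using H(2) that S(2) by (auto simp: inj_on_def)
  have \<phi>: "annulus_cover (H y) - annulus_cover (H z) = (H y - H z) * \<phi> y" if "y \<in> S" "y \<noteq> z" for y
  proof -
    have "annulus_cover (H y) = annulus_cover (H z) * exp (\<i> * (H y - H z))"
      by (simp add: annulus_cover_def algebra_simps flip: exp_add)
    moreover have "(H y - H z) * q (H y - H z) = exp (\<i> * (H y - H z)) - 1" using Hne[OF that] by (simp add: q_def)
    ultimately show ?thesis unfolding \<phi>_def by (metis mult.left_commute mult.right_neutral right_diff_distrib)
  qed
  have \<phi>_nz: "\<phi> y \<noteq> 0" if "y \<in> S" for y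
  proof (cases "y = z")
    case True
    then show ?thesis by (simp add: \<phi>_def q_def annulus_cover_def)
  next
    case False
    then have "annulus_cover (H y) \<noteq> annulus_cover (H z)" using H(2) that S(2) by (auto simp: inj_on_def)
    then show ?thesis using \<phi>[OF that False] by auto
  qed
  have \<phi>_cont: "continuous_on S \<phi>" unfolding \<phi>_def q_def
    by (intro continuous_intros continuous_on_compose2[OF continuous_exp_quotient] H(1)) auto
  obtain l where l: "continuous_on S l" "\<And>y. y \<in> S \<Longrightarrow> \<phi> y = exp (l y)"
    using continuous_logarithm_on_contractible[OF \<phi>_cont S(1) \<phi>_nz] by blast
  have pS: "p u \<in> S" "p u \<noteq> z" if "u \<in> {0..1}" for u
    using p(3) imageI[OF that, of p] unfolding path_image_def by blast+
  have cp: "continuous_on {0..1} p" using p(1) by (simp add: path_def)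
  \<comment> \<open>Multiplying by \<open>exp (s * l)\<close> interpolates between the factors 1 and
    \<open>\<phi>\<close> without ever vanishing.\<close>
  define F where "F = (\<lambda>(s::real, u). (H (p u) - H z) * exp (of_real s * l (p u)))"
  have cont: "continuous_on ({0..1} \<times> {0..1}) (\<lambda>x. f (p (snd x)))" if "continuous_on S f" for f :: "complex \<Rightarrow> complex"
  proof -
    have "continuous_on {0..1} (\<lambda>u. f (p u))" by (rule continuous_on_compose2[OF that cp]) (use pS in auto)
    then show ?thesis by (rule continuous_on_compose2) (auto intro!: continuous_intros)
  qed
  have "homotopic_loops (- {0}) (\<lambda>u. H (p u) - H z) (\<lambda>u. annulus_cover (H (p u)) - annulus_cover (H z))"
    unfolding homotopic_loops
  proof (intro exI[of _ F] conjI ballI)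
    show "continuous_on ({0..1} \<times> {0..1}) F" unfolding F_def case_prod_beta
      by (intro continuous_intros cont[OF H(1)] cont[OF l(1)])
    show "F \<in> {0..1} \<times> {0..1} \<rightarrow> - {0}" using Hne pS by (auto simp: F_def)
    show "F (0, u) = H (p u) - H z" for u by (simp add: F_def)
    show "F (1, u) = annulus_cover (H (p u)) - annulus_cover (H z)" if "u \<in> {0..1}" for u
      using \<phi> l(2) pS that by (simp add: F_def)
    show "pathfinish (F \<circ> Pair s) = pathstart (F \<circ> Pair s)" for s
      using p(2) by (simp add: F_def pathfinish_def pathstart_def)
  qed
  then have "winding_number (\<lambda>u. H (p u) - H z) 0 = winding_number (\<lambda>u. annulus_cover (H (p u)) - annulus_cover (H z)) 0"
    by (rule winding_number_homotopic_loops)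
  then show ?thesis
    unfolding winding_number_offset[of "\<lambda>u. annulus_cover (H (p u))" "annulus_cover (H z)"] winding_number_offset[of "H \<circ> p" "H z"]
    by simp
qed

text \<open>The covering map preserves winding numbers on a disc that it maps injectively, so the
  orientation of a transistor can be tested on its lift.\<close>

lemma oriented_embedding_annulus_lift:
  assumes h: "oriented_embedding h" and H: "continuous_on unit_square H" "\<And>p. p \<in> unit_square \<Longrightarrow> annulus_cover (H p) = h p"
  shows "oriented_embedding H"
proof -
  let ?z = "Complex (1/2) (1/2)" and ?r = "rectpath 0 (Complex 1 1)"
  have z: "?z \<in> box 0 (Complex 1 1)" by (simp add: in_box_complex_iff)
  then have zS: "?z \<in> unit_square" using box_subset_cbox by blast
  have inj: "inj_on (\<lambda>p. annulus_cover (H p)) unit_square"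
    using h H(2) by (auto simp: oriented_embedding_def inj_on_def)
  have r: "path_image ?r = unit_square - box 0 (Complex 1 1)" by (rule path_image_rectpath_cbox_minus_box) auto
  have "winding_number (H \<circ> ?r) (H ?z) = winding_number (\<lambda>u. annulus_cover (H (?r u))) (annulus_cover (H ?z))"
    by (rule winding_number_annulus_lift[symmetric, OF convex_imp_contractible zS H(1) inj])
      (use r z in \<open>auto simp: convex_box\<close>)
  also have "\<dots> = winding_number (h \<circ> ?r) (h ?z)"
    unfolding H(2)[OF zS]
  proof (rule winding_number_cong)
    show "annulus_cover (H (?r u)) = (h \<circ> ?r) u" if "0 \<le> u" "u \<le> 1" for u
    proof -
      have "?r u \<in> path_image ?r" unfolding path_image_def using that by simp
      then show ?thesis using H(2) unfolding r by simp
    qed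
  qed
  finally have "winding_number (H \<circ> ?r) (H ?z) = 1" using h by (simp add: oriented_embedding_def)
  moreover have "inj_on H unit_square" using inj by (auto simp: inj_on_def)
  ultimately show ?thesis using H(1) by (simp add: oriented_embedding_def)
qed

section \<open>Drawings as periodic families of discs and arcs in a strip\<close>

context diag
begin

context
  fixes U ptop pbot h g
  assumes dr: "drawing U ptop pbot \<Delta> h g"
begin

lemma drawing_transistor:
  "t \<in> T \<Longrightarrow> oriented_embedding (h t)" "t \<in> T \<Longrightarrow> p \<in> unit_square \<Longrightarrow> h t p \<in> U"
  "t \<in> T \<Longrightarrow> t' \<in> T \<Longrightarrow> p \<in> unit_square \<Longrightarrow> p' \<in> unit_square \<Longrightarrow> h t p = h t' p' \<Longrightarrow> t = t' \<and> p = p'"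
proof -
  note d = dr[unfolded drawing_def, THEN conjunct1] and d_disj = dr[unfolded drawing_def, THEN conjunct2, THEN conjunct1]
  show e: "t \<in> T \<Longrightarrow> oriented_embedding (h t)" for t
    using d by blast
  show "t \<in> T \<Longrightarrow> p \<in> unit_square \<Longrightarrow> h t p \<in> U" for t p
    using d by (simp add: image_subset_iff)
  assume tp: "t \<in> T" "t' \<in> T" "p \<in> unit_square" "p' \<in> unit_square" "h t p = h t' p'"
  have "h t p \<in> h t ` unit_square" "h t' p' \<in> h t' ` unit_square" using tp(3,4) by (simp_all only: imageI)
  then have "h t ` unit_square \<inter> h t' ` unit_square \<noteq> {}" using tp(5) by auto
  then have "t = t'" using d_disj tp(1,2) by blast
  then show "t = t' \<and> p = p'" using e[OF tp(1)] tp by (auto simp: oriented_embedding_def inj_on_def)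
qed

lemma drawing_wire:
  "e \<in> W \<Longrightarrow> arc (g e)" "e \<in> W \<Longrightarrow> u \<in> {0<..<1} \<Longrightarrow> g e u \<in> U"
  "e \<in> W \<Longrightarrow> u \<in> {0<..<1} \<Longrightarrow> t \<in> T \<Longrightarrow> p \<in> unit_square \<Longrightarrow> g e u \<noteq> h t p"
  "e \<in> W \<Longrightarrow> e' \<in> W \<Longrightarrow> u \<in> {0..1} \<Longrightarrow> u' \<in> {0..1} \<Longrightarrow> g e u = g e' u' \<Longrightarrow> e = e' \<and> u = u'"
proof -
  note d = dr[unfolded drawing_def, THEN conjunct2, THEN conjunct2, THEN conjunct1] and d_disj = dr[unfolded drawing_def, THEN conjunct2, THEN conjunct2, THEN conjunct2, THEN conjunct1]
  show a: "e \<in> W \<Longrightarrow> arc (g e)" for e using d by blast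
  have "g e u \<in> U - (\<Union>t\<in>T. h t ` unit_square)" if "e \<in> W" "u \<in> {0<..<1}" for e u
    using bspec[OF d that(1)] imageI[OF that(2), of "g e"] by blast
  then show "e \<in> W \<Longrightarrow> u \<in> {0<..<1} \<Longrightarrow> g e u \<in> U"
    "e \<in> W \<Longrightarrow> u \<in> {0<..<1} \<Longrightarrow> t \<in> T \<Longrightarrow> p \<in> unit_square \<Longrightarrow> g e u \<noteq> h t p" by blast+
  assume eu: "e \<in> W" "e' \<in> W" "u \<in> {0..1}" "u' \<in> {0..1}" "g e u = g e' u'"
  have "g e u \<in> path_image (g e)" "g e' u' \<in> path_image (g e')" using eu(3,4) unfolding path_image_def by blast+
  then have "path_image (g e) \<inter> path_image (g e') \<noteq> {}" using eu(5) by auto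
  then have "e = e'" using d_disj eu(1,2) by blast
  then show "e = e' \<and> u = u'" using a[OF eu(1)] eu by (auto simp: arc_def inj_on_def)
qed

lemma drawing_attach:
  "t \<in> T \<Longrightarrow> k < length (tt t) \<Longrightarrow> pathstart (g (tt t ! k)) = h t (Complex (attach_pos (length (tt t)) k) 1)"
  "t \<in> T \<Longrightarrow> j < length (tb t) \<Longrightarrow> pathfinish (g (tb t ! j)) = h t (Complex (attach_pos (length (tb t)) j) 0)"
  "k < length ft \<Longrightarrow> pathfinish (g (ft ! k)) = ptop (length ft) k"
  "k < length fb \<Longrightarrow> pathstart (g (fb ! k)) = pbot (length fb) k"
  using dr[unfolded drawing_def, THEN conjunct2, THEN conjunct2, THEN conjunct2, THEN conjunct2, THEN conjunct1]
    dr[unfolded drawing_def, THEN conjunct2, THEN conjunct2, THEN conjunct2, THEN conjunct2, THEN conjunct2, THEN conjunct1]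
    dr[unfolded drawing_def, THEN conjunct2, THEN conjunct2, THEN conjunct2, THEN conjunct2, THEN conjunct2, THEN conjunct2, THEN conjunct1]
    dr[unfolded drawing_def, THEN conjunct2, THEN conjunct2, THEN conjunct2, THEN conjunct2, THEN conjunct2, THEN conjunct2, THEN conjunct2] by blast+

end

lemma attach_in: "k < n \<Longrightarrow> Complex (attach_pos n k) 0 \<in> unit_square" "k < n \<Longrightarrow> Complex (attach_pos n k) 1 \<in> unit_square"
  using attach_pos_bounds[of k n] by (auto simp: in_cbox_complex_iff)

text \<open>A planar drawing is repeated in all integer translates of the unit square. The
  translates do not meet, so no shift occurs and the argument for annuli applies.\<close>

lemma planar_strip_diag:
  assumes "drawing (box 0 (Complex 1 1)) (\<lambda>n k. Complex (attach_pos n k) 1) (\<lambda>n k. Complex (attach_pos n k) 0) \<Delta> h g"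
  shows "strip_diag \<A> \<R> \<Delta> 1 1 h g (\<lambda>_. 0)"
proof -
  note tr = drawing_transistor[OF assms] and wi = drawing_wire[OF assms] and at = drawing_attach[OF assms]
  have trU: "0 < Re (h t p)" "Re (h t p) < 1" "0 < Im (h t p)" "Im (h t p) < 1" if "t \<in> T" "p \<in> unit_square" for t p
    using tr(2)[OF that] by (auto simp: in_box_complex_iff)
  have wiU: "0 < Re (g e u) \<and> Re (g e u) < 1" "u \<in> {0<..<1} \<Longrightarrow> 0 < Im (g e u) \<and> Im (g e u) < 1"
    if e: "e \<in> W" and u: "u \<in> {0..1}" for e u
  proof -
    show "0 < Im (g e u) \<and> Im (g e u) < 1" if "u \<in> {0<..<1}"
      using wi(2)[OF e that] by (auto simp: in_box_complex_iff)
    consider "u \<in> {0<..<1}" | "u = 0" | "u = 1" using u by fastforce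
    then show "0 < Re (g e u) \<and> Re (g e u) < 1"
    proof cases
      case 1
      then show ?thesis using wi(2)[OF e 1] by (auto simp: in_box_complex_iff)
    next
      case 2
      show ?thesis using e
      proof (cases rule: bottom_cases)
        case (frame k)
        then show ?thesis using at(4)[of k] attach_pos_bounds 2 by (simp add: pathstart_def)
      next
        case (trans t k)
        then show ?thesis using at(1)[of t k] trU[OF trans(1) attach_in(2)[OF trans(2)]] 2 by (simp add: pathstart_def)
      qed
    next
      case 3
      show ?thesis using e
      proof (cases rule: top_cases)
        case (frame k)
        then show ?thesis using at(3)[of k] attach_pos_bounds 3 by (simp add: pathfinish_def)
      next
        case (trans t k)
        then show ?thesis using at(2)[of t k] trU[OF trans(1) attach_in(1)[OF trans(2)]] 3 by (simp add: pathfinish_def)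
      qed
    qed
  qed
  \<comment> \<open>The whole drawing has abscissae strictly between 0 and 1; for the ends of wires
    on the frame this is a property of \<open>attach_pos\<close>.\<close>
  have n0: "n = 0 \<and> z = z'" if "z = z' + of_real (of_int n * 1)" "0 < Re z \<and> Re z < 1" "0 < Re z' \<and> Re z' < 1" for z z' and n :: int
  proof -
    have "Re z = Re z' + of_int n" using that(1) by simp
    then have "(of_int n :: real) < 1" "- 1 < (of_int n :: real)" using that(2,3) by linarith+
    then have "n = 0" by linarith
    then show ?thesis using that(1) by simp
  qed
  show ?thesis
  proof unfold_locales
    fix t t' p p' and n :: int
    assume tp: "t \<in> T" "t' \<in> T" "p \<in> unit_square" "p' \<in> unit_square" and "h t p = h t' p' + of_real (of_int n * 1)"
    from this(5) have "n = 0 \<and> h t p = h t' p'" by (rule n0) (use trU tp in auto)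
    then show "t = t' \<and> n = 0" using tr(3)[OF tp] by simp
  next
    fix e t p and u :: real and n :: int
    assume eu: "e \<in> W" "u \<in> {0<..<1}" "t \<in> T" "p \<in> unit_square"
    have "n = 0 \<and> g e u = h t p" if "g e u = h t p + of_real (of_int n * 1)"
      using that by (rule n0) (use trU[OF eu(3,4)] wiU(1)[OF eu(1), of u] eu(2) in auto)
    then show "g e u \<noteq> h t p + of_real (of_int n * 1)" using wi(3)[OF eu] by blast
  next
    fix e e' and u u' :: real and n :: int
    assume eu: "e \<in> W" "e' \<in> W" "u \<in> {0..1}" "u' \<in> {0..1}" and "g e u = g e' u' + of_real (of_int n * 1)"
    from this(5) have "n = 0 \<and> g e u = g e' u'" by (rule n0) (use wiU(1) eu in auto)
    then show "e = e' \<and> n = 0" using wi(4)[OF eu] by simp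
  qed (use tr(1) trU wi(1) wiU at in auto)
qed

text \<open>Transistors are lifted arbitrarily, wires are then lifted from their top ends, and the
  deviation at the bottom ends defines \<open>sh\<close>.\<close>

lemma annular_strip_diag:
  assumes "drawing {z. 1 < norm z \<and> norm z < 2} (\<lambda>n k. circle_pt (attach_pos n k)) (\<lambda>n k. 2 * circle_pt (attach_pos n k)) \<Delta> h g"
  obtains H G sh where "strip_diag \<A> \<R> \<Delta> (2 * pi) (ln 2) H G sh"
proof -
  note tr = drawing_transistor[OF assms] and wi = drawing_wire[OF assms] and at = drawing_attach[OF assms]
  have "\<exists>F. continuous_on unit_square F \<and> (\<forall>p\<in>unit_square. annulus_cover (F p) = h t p)" if t: "t \<in> T" for t
  proof -
    have "h t p \<noteq> 0" if "p \<in> unit_square" for p using tr(2)[OF t that] by auto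
    moreover have "continuous_on unit_square (h t)" using tr(1)[OF t] by (simp add: oriented_embedding_def)
    ultimately show ?thesis by (intro annulus_lift convex_imp_contractible convex_box)
  qed
  then obtain H where Hc: "\<And>t. t \<in> T \<Longrightarrow> continuous_on unit_square (H t)"
      and H: "\<And>t p. t \<in> T \<Longrightarrow> p \<in> unit_square \<Longrightarrow> annulus_cover (H t p) = h t p"
    using bchoice[of T "\<lambda>t F. continuous_on unit_square F \<and> (\<forall>p\<in>unit_square. annulus_cover (F p) = h t p)"] by blast
  \<comment> \<open>The prescribed top end of the lift is consistent because a wire is attached
    there at one place only.\<close>
  have top: "\<exists>z. annulus_cover z = pathfinish (g e) \<and>
      (\<forall>t\<in>T. \<forall>j<length (tb t). e = tb t ! j \<longrightarrow> z = H t (Complex (attach_pos (length (tb t)) j) 0)) \<and>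
      (\<forall>k<length ft. e = ft ! k \<longrightarrow> z = Complex (2 * pi * attach_pos (length ft) k) (ln 2))" if "e \<in> W" for e
    using that
  proof (cases rule: top_cases)
    case (frame k)
    have "k' = k" if "k' < length ft" "e = ft ! k'" for k'
      using frame that tops(1) by (simp add: nth_eq_iff_index_eq)
    moreover have "e \<noteq> tb t ! j" if "t \<in> T" "j < length (tb t)" for t j using tb_not_ft that frame by metis
    ultimately show ?thesis
      using frame at(3)[of k] by (intro exI[of _ "Complex (2 * pi * attach_pos (length ft) k) (ln 2)"])
        (auto simp: annulus_cover_frame)
  next
    case (trans t j)
    have "t' = t \<and> j' = j" if "t' \<in> T" "j' < length (tb t')" "e = tb t' ! j'" for t' j'
      using trans that tb_unique by metis
    moreover have "e \<noteq> ft ! k" if "k < length ft" for k using tb_not_ft that trans by metis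
    ultimately show ?thesis
      using trans at(2)[of t j] H[OF trans(1) attach_in(1)[OF trans(2)]]
      by (intro exI[of _ "H t (Complex (attach_pos (length (tb t)) j) 0)"]) auto
  qed
  define Q where "Q = (\<lambda>e F. continuous_on {0..1} F \<and> (\<forall>u\<in>{0..1}. annulus_cover (F u) = g e u) \<and>
      (\<forall>t\<in>T. \<forall>j<length (tb t). e = tb t ! j \<longrightarrow> F 1 = H t (Complex (attach_pos (length (tb t)) j) 0)) \<and>
      (\<forall>k<length ft. e = ft ! k \<longrightarrow> F 1 = Complex (2 * pi * attach_pos (length ft) k) (ln 2)))"
  have g0: "g e u \<noteq> 0" if e: "e \<in> W" and u: "u \<in> {0..1}" for e u
  proof -
    have hU: "h t p \<noteq> 0" if "t \<in> T" "p \<in> unit_square" for t p using tr(2)[OF that] by auto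
    consider "u \<in> {0<..<1}" | "u = 0" | "u = 1" using u by fastforce
    then show ?thesis
    proof cases
      case 1
      then show ?thesis using wi(2)[OF e 1] by auto
    next
      case 2
      show ?thesis using e
      proof (cases rule: bottom_cases)
        case (frame k)
        then show ?thesis using at(4)[of k] circle_pt_nz 2 by (simp add: pathstart_def)
      next
        case (trans t k)
        then show ?thesis using at(1)[of t k] hU[OF trans(1) attach_in(2)[OF trans(2)]] 2 by (simp add: pathstart_def)
      qed
    next
      case 3
      show ?thesis using e
      proof (cases rule: top_cases)
        case (frame k)
        then show ?thesis using at(3)[of k] circle_pt_nz 3 by (simp add: pathfinish_def)
      next
        case (trans t k)
        then show ?thesis using at(2)[of t k] hU[OF trans(1) attach_in(1)[OF trans(2)]] 3 by (simp add: pathfinish_def)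
      qed
    qed
  qed
  have "\<exists>F. Q e F" if e: "e \<in> W" for e
  proof -
    have "continuous_on {0..1} (g e)" using wi(1)[OF e] arc_imp_path by (simp add: path_def)
    then obtain F where F: "continuous_on {0..1} F" "\<And>u. u \<in> {0..1} \<Longrightarrow> annulus_cover (F u) = g e u"
      using annulus_lift[OF \<open>continuous_on {0..1} (g e)\<close> convex_imp_contractible[OF convex_real_interval(5)] g0[OF e]] by auto
    obtain z where z: "annulus_cover z = pathfinish (g e)"
      "\<forall>t\<in>T. \<forall>j<length (tb t). e = tb t ! j \<longrightarrow> z = H t (Complex (attach_pos (length (tb t)) j) 0)"
      "\<forall>k<length ft. e = ft ! k \<longrightarrow> z = Complex (2 * pi * attach_pos (length ft) k) (ln 2)"
      using top[OF e] by blast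
    have "annulus_cover z = annulus_cover (F 1)" using z(1) F(2)[of 1] by (simp add: pathfinish_def)
    \<comment> \<open>An arbitrary lift is translated so that its top end becomes the prescribed
      one.\<close>
    then obtain n :: int where n: "z = F 1 + of_real (of_int n * (2 * pi))" unfolding annulus_cover_eq_iff by blast
    have "annulus_cover (F u + of_real (of_int n * (2 * pi))) = g e u" if "u \<in> {0..1}" for u
      using F(2)[OF that] annulus_cover_eq_iff by metis
    then have "Q e (\<lambda>u. F u + of_real (of_int n * (2 * pi)))"
      unfolding Q_def n[symmetric] using F(1) z(2,3) by (intro conjI continuous_intros) auto
    then show ?thesis by blast
  qed
  then obtain G where G: "\<And>e. e \<in> W \<Longrightarrow> Q e (G e)" using bchoice[of W Q] by blast
  have Gc: "continuous_on {0..1} (G e)" and Gg: "u \<in> {0..1} \<Longrightarrow> annulus_cover (G e u) = g e u" if "e \<in> W" for e u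
    using G[OF that] by (auto simp: Q_def)
  \<comment> \<open>At the bottom there is no freedom left: both ends lie over the same point of the
    annulus, and the translation between them becomes \<open>sh e\<close>.\<close>
  have "\<exists>n::int. (\<forall>t\<in>T. \<forall>k<length (tt t). e = tt t ! k \<longrightarrow>
        G e 0 = H t (Complex (attach_pos (length (tt t)) k) 1) + of_real (of_int n * (2 * pi))) \<and>
      (\<forall>k<length fb. e = fb ! k \<longrightarrow> G e 0 = Complex (2 * pi * attach_pos (length fb) k) 0 + of_real (of_int n * (2 * pi)))"
    if e: "e \<in> W" for e
    using that
  proof (cases rule: bottom_cases)
    case (frame k)
    have "annulus_cover (G e 0) = annulus_cover (Complex (2 * pi * attach_pos (length fb) k) 0)"
      using Gg[OF e, of 0] at(4)[of k] frame by (simp add: annulus_cover_frame pathstart_def)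
    then obtain n :: int where "G e 0 = Complex (2 * pi * attach_pos (length fb) k) 0 + of_real (of_int n * (2 * pi))"
      unfolding annulus_cover_eq_iff by blast
    moreover have "k' = k" if "k' < length fb" "e = fb ! k'" for k'
      using frame that bottoms(1) by (simp add: nth_eq_iff_index_eq)
    moreover have "e \<noteq> tt t ! j" if "t \<in> T" "j < length (tt t)" for t j using tt_not_fb that frame by metis
    ultimately show ?thesis by (intro exI[of _ n]) auto
  next
    case (trans t k)
    have "annulus_cover (G e 0) = annulus_cover (H t (Complex (attach_pos (length (tt t)) k) 1))"
      using Gg[OF e, of 0] at(1)[of t k] H[OF trans(1) attach_in(2)[OF trans(2)]] trans by (simp add: pathstart_def)
    then obtain n :: int where "G e 0 = H t (Complex (attach_pos (length (tt t)) k) 1) + of_real (of_int n * (2 * pi))"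
      unfolding annulus_cover_eq_iff by blast
    moreover have "t' = t \<and> k' = k" if "t' \<in> T" "k' < length (tt t')" "e = tt t' ! k'" for t' k'
      using trans that tt_unique by metis
    moreover have "e \<noteq> fb ! k'" if "k' < length fb" for k' using tt_not_fb that trans by metis
    ultimately show ?thesis by (intro exI[of _ n]) auto
  qed
  then obtain sh :: "nat \<Rightarrow> int" where sh:
    "\<And>e t k. e \<in> W \<Longrightarrow> t \<in> T \<Longrightarrow> k < length (tt t) \<Longrightarrow> e = tt t ! k \<Longrightarrow>
        G e 0 = H t (Complex (attach_pos (length (tt t)) k) 1) + of_real (of_int (sh e) * (2 * pi))"
    "\<And>e k. e \<in> W \<Longrightarrow> k < length fb \<Longrightarrow> e = fb ! k \<Longrightarrow> G e 0 = Complex (2 * pi * attach_pos (length fb) k) 0 + of_real (of_int (sh e) * (2 * pi))"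
    using bchoice[of W "\<lambda>e n. (\<forall>t\<in>T. \<forall>k<length (tt t). e = tt t ! k \<longrightarrow>
        G e 0 = H t (Complex (attach_pos (length (tt t)) k) 1) + of_real (of_int n * (2 * pi))) \<and>
      (\<forall>k<length fb. e = fb ! k \<longrightarrow> G e 0 = Complex (2 * pi * attach_pos (length fb) k) 0 + of_real (of_int n * (2 * pi)))"]
    by blast
  have no_deck: "n = 0" if "z = z + of_real (of_int n * (2 * pi))" for z :: complex and n :: int
    using that pi_neq_zero by simp
  have "strip_diag \<A> \<R> \<Delta> (2 * pi) (ln 2) H G sh"
  proof unfold_locales
    show "0 < 2 * pi" "0 < ln (2::real)" by simp_all
    fix t assume t: "t \<in> T"
    show "oriented_embedding (H t)" by (rule oriented_embedding_annulus_lift[OF tr(1)[OF t] Hc[OF t] H[OF t]])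
    show "0 < Im (H t p) \<and> Im (H t p) < ln 2" if "p \<in> unit_square" for p
      using tr(2)[OF t that] H[OF t that] annulus_cover_strip[of "H t p"] by simp
    show "pathstart (G (tt t ! k)) = H t (Complex (attach_pos (length (tt t)) k) 1) + of_real (of_int (sh (tt t ! k)) * (2 * pi))"
      if "k < length (tt t)" for k using sh(1)[OF in_W(2)[OF t that] t that refl] by (simp add: pathstart_def)
    show "pathfinish (G (tb t ! j)) = H t (Complex (attach_pos (length (tb t)) j) 0)" if "j < length (tb t)" for j
      using G[OF in_W(1)[OF t that]] t that by (auto simp: Q_def pathfinish_def)
  next
    show "pathfinish (G (ft ! k)) = Complex (2 * pi * attach_pos (length ft) k) (ln 2)" if "k < length ft" for k
      using G[OF in_W(3)[OF that]] that by (auto simp: Q_def pathfinish_def)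
    show "pathstart (G (fb ! k)) = Complex (2 * pi * attach_pos (length fb) k) 0 + of_real (of_int (sh (fb ! k)) * (2 * pi))"
      if "k < length fb" for k using sh(2)[OF in_W(4)[OF that] that refl] by (simp add: pathstart_def)
  next
    fix t t' p p' and n :: int
    assume tp: "t \<in> T" "t' \<in> T" "p \<in> unit_square" "p' \<in> unit_square" and eq: "H t p = H t' p' + of_real (of_int n * (2 * pi))"
    then have "h t p = h t' p'" using H annulus_cover_eq_iff by metis
    then have "t = t' \<and> p = p'" by (rule tr(3)[OF tp])
    then show "t = t' \<and> n = 0" using no_deck eq by metis
  next
    fix e assume e: "e \<in> W"
    have "inj_on (G e) {0..1}" using wi(4)[OF e e] Gg[OF e] by (intro inj_onI) metis
    then show "arc (G e)" using Gc[OF e] by (simp add: arc_def path_def)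
    fix u :: real assume u: "u \<in> {0<..<1}"
    then have u': "u \<in> {0..1}" by simp
    show "0 < Im (G e u) \<and> Im (G e u) < ln 2"
      using wi(2)[OF e u] Gg[OF e u'] annulus_cover_strip[of "G e u"] by simp
    show "G e u \<noteq> H t p + of_real (of_int n * (2 * pi))" if "t \<in> T" "p \<in> unit_square" for t p and n :: int
      using wi(3)[OF e u that] Gg[OF e u'] H[OF that] annulus_cover_eq_iff by metis
  next
    fix e e' and u u' :: real and n :: int
    assume eu: "e \<in> W" "e' \<in> W" "u \<in> {0..1}" "u' \<in> {0..1}" and eq: "G e u = G e' u' + of_real (of_int n * (2 * pi))"
    then have "g e u = g e' u'" using Gg annulus_cover_eq_iff by metis
    then have "e = e' \<and> u = u'" by (rule wi(4)[OF eu])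
    then show "e = e' \<and> n = 0" using no_deck eq by metis
  qed
  then show thesis by (rule that)
qed

end

section \<open>Transfer to subgroups of Thompson's groups\<close>

lemma subgroup_of_carrier_update:
  assumes "group B" "subgroup K B" "K \<subseteq> M" "M \<subseteq> carrier B"
  shows "subgroup K (B\<lparr>carrier := M\<rparr>)"
proof -
  interpret B: group B by fact
  interpret K: subgroup K B by fact
  have "inv\<^bsub>B\<lparr>carrier := M\<rparr>\<^esub> x = inv\<^bsub>B\<^esub> x" if x: "x \<in> K" for x
  proof -
    have xB: "x \<in> carrier B" using K.subset x by blast
    have "inv\<^bsub>B\<lparr>carrier := M\<rparr>\<^esub> x = (THE y. y \<in> M \<and> x \<otimes>\<^bsub>B\<^esub> y = \<one>\<^bsub>B\<^esub> \<and> y \<otimes>\<^bsub>B\<^esub> x = \<one>\<^bsub>B\<^esub>)"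
      by (simp add: m_inv_def)
    \<comment> \<open>The inverse is a definite description over the new carrier \<open>M\<close>:
      existence comes from the subgroup \<open>K\<close>, which lies in \<open>M\<close>, and
      uniqueness from the surrounding group.\<close>
    also have "\<dots> = inv\<^bsub>B\<^esub> x"
    proof (rule the_equality)
      show "inv\<^bsub>B\<^esub> x \<in> M \<and> x \<otimes>\<^bsub>B\<^esub> inv\<^bsub>B\<^esub> x = \<one>\<^bsub>B\<^esub> \<and> inv\<^bsub>B\<^esub> x \<otimes>\<^bsub>B\<^esub> x = \<one>\<^bsub>B\<^esub>"
        using K.m_inv_closed[OF x] assms(3) xB by auto
      show "y = inv\<^bsub>B\<^esub> x" if "y \<in> M \<and> x \<otimes>\<^bsub>B\<^esub> y = \<one>\<^bsub>B\<^esub> \<and> y \<otimes>\<^bsub>B\<^esub> x = \<one>\<^bsub>B\<^esub>" for y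
        using B.inv_equality[of y x] that assms(4) xB by auto
    qed
    finally show ?thesis .
  qed
  then show ?thesis using assms(3) by unfold_locales auto
qed

lemma hom_subgroup_iso:
  assumes G: "group G" and \<phi>: "\<phi> \<in> hom G (BijGroup I)" "inj_on \<phi> (carrier G)"
    and \<Psi>: "\<And>x. x \<in> carrier G \<Longrightarrow> \<Psi> (\<phi> x) \<in> M" "M \<subseteq> Bij J" "inj_on \<Psi> (Bij I)"
      "\<And>f g. f \<in> Bij I \<Longrightarrow> g \<in> Bij I \<Longrightarrow> \<Psi> (compose I f g) = compose J (\<Psi> f) (\<Psi> g)"
  shows "\<exists>K. subgroup K ((BijGroup J)\<lparr>carrier := M\<rparr>) \<and> G \<cong> (BijGroup J)\<lparr>carrier := M, carrier := K\<rparr>"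
proof -
  define K where "K = (\<Psi> \<circ> \<phi>) ` carrier G"
  have BI: "carrier (BijGroup I) = Bij I" and BJ: "carrier (BijGroup J) = Bij J" by (simp_all add: BijGroup_def)
  have \<phi>B: "\<phi> x \<in> Bij I" if "x \<in> carrier G" for x using \<phi>(1) that BI by (auto simp: hom_def)
  have mult: "(\<Psi> \<circ> \<phi>) (x \<otimes>\<^bsub>G\<^esub> y) = (\<Psi> \<circ> \<phi>) x \<otimes>\<^bsub>BijGroup J\<^esub> (\<Psi> \<circ> \<phi>) y" if xy: "x \<in> carrier G" "y \<in> carrier G" for x y
  proof -
    have "\<phi> (x \<otimes>\<^bsub>G\<^esub> y) = compose I (\<phi> x) (\<phi> y)"
      using \<phi>(1) xy \<phi>B by (simp add: hom_def BijGroup_def)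
    moreover have "\<Psi> (\<phi> x) \<in> Bij J" "\<Psi> (\<phi> y) \<in> Bij J" using \<Psi>(1,2) xy by blast+
    ultimately show ?thesis using \<Psi>(4)[OF \<phi>B[OF xy(1)] \<phi>B[OF xy(2)]] by (simp add: BijGroup_def)
  qed
  have hom: "\<Psi> \<circ> \<phi> \<in> hom G (BijGroup J)" using \<Psi>(1,2) mult by (auto simp: hom_def BJ)
  interpret group_hom G "BijGroup J" "\<Psi> \<circ> \<phi>"
    by (rule group_hom.intro[OF G group_BijGroup group_hom_axioms.intro[OF hom]])
  have "subgroup K ((BijGroup J)\<lparr>carrier := M\<rparr>)"
    unfolding K_def by (rule subgroup_of_carrier_update[OF group_BijGroup img_is_subgroup]) (use \<Psi>(1,2) BJ in auto)
  moreover have "inj_on (\<Psi> \<circ> \<phi>) (carrier G)"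
    using \<phi>(2) \<Psi>(3) \<phi>B by (intro comp_inj_on) (auto intro: inj_on_subset)
  then have "\<Psi> \<circ> \<phi> \<in> iso G ((BijGroup J)\<lparr>carrier := M, carrier := K\<rparr>)"
    using mult by (auto simp: iso_def hom_def K_def bij_betw_def)
  ultimately show ?thesis using is_isoI by blast
qed

context diagram_group
begin

lemma simple_subgroup_iso:
  assumes S: "S \<subseteq> carrier DG" "is_simple (DG\<lparr>carrier := S\<rparr>)"
    and \<Psi>: "\<And>X. X \<in> S \<Longrightarrow> \<Psi> (act X) \<in> M" "M \<subseteq> Bij J" "inj_on \<Psi> (Bij unit_ivl)"
      "\<And>f g. f \<in> Bij unit_ivl \<Longrightarrow> g \<in> Bij unit_ivl \<Longrightarrow> \<Psi> (compose unit_ivl f g) = compose J (\<Psi> f) (\<Psi> g)"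
  shows "\<exists>K. subgroup K ((BijGroup J)\<lparr>carrier := M\<rparr>) \<and> DG\<lparr>carrier := S\<rparr> \<cong> (BijGroup J)\<lparr>carrier := M, carrier := K\<rparr>"
proof (rule hom_subgroup_iso[where \<phi> = act and \<Psi> = \<Psi> and I = unit_ivl])
  show "group (DG\<lparr>carrier := S\<rparr>)" using S(2) by (simp add: is_simple_def)
  show "act \<in> hom (DG\<lparr>carrier := S\<rparr>) (BijGroup unit_ivl)" "inj_on act (carrier (DG\<lparr>carrier := S\<rparr>))"
    using simple_act_hom_inj[OF S] by auto
qed (use \<Psi> in auto)

lemma act_bij_pl:
  assumes "X \<in> carrier DG" shows "bij_betw (act X) unit_ivl unit_ivl" "dyadic_pl (act X)"
proof -
  show "bij_betw (act X) unit_ivl unit_ivl" using act_Bij[OF assms] by (simp add: Bij_def)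
  have "dyadic_pl (flow0 (rep X))"
    using diag.flow0_pl[OF rep_diag[OF assms]] diagrams_fbot[OF rep_diagrams[OF assms]] by blast
  then show "dyadic_pl (act X)" by (subst dyadic_pl_cong[where g = "flow0 (rep X)"]) (auto simp: act_def)
qed

lemma planar_act:
  assumes X: "X \<in> carrier DG" and \<Delta>: "\<Delta> \<in> X" "planar \<Delta>" shows "closed_lift (act X) \<in> F_maps"
proof (rule closed_lift_in_F[OF act_bij_pl[OF X]])
  have d: "\<Delta> \<in> diagrams \<A> \<R> w w" by (rule class_diagrams[OF X \<Delta>(1)])
  interpret diag \<A> \<R> \<Delta> by (rule diagrams_diag[OF d])
  obtain h g where "strip_diag \<A> \<R> \<Delta> 1 1 h g (\<lambda>_. 0)" using \<Delta>(2) planar_strip_diag unfolding planar_def by blast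
  then interpret strip_diag \<A> \<R> \<Delta> 1 1 h g "\<lambda>_. 0" .
  have "act X t = flow_lift t" if "t \<in> unit_ivl" for t
  proof -
    have "frac t = t" "\<lfloor>t\<rfloor> = 0" using that by (auto simp: frac_eq floor_eq_iff)
    then show ?thesis using act_eq[OF X \<Delta>(1) that] by (simp add: flow_lift_def)
  qed
  then show "strict_mono_on unit_ivl (act X)"
    using strict_mono_flow_lift[OF diagrams_fbot[OF d]] by (auto simp: strict_mono_on_def strict_mono_def)
qed

lemma annular_act:
  assumes X: "X \<in> carrier DG" and \<Delta>: "\<Delta> \<in> X" "annular \<Delta>" shows "circ (act X) \<in> T_maps"
proof -
  have d: "\<Delta> \<in> diagrams \<A> \<R> w w" by (rule class_diagrams[OF X \<Delta>(1)])
  interpret diag \<A> \<R> \<Delta> by (rule diagrams_diag[OF d])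
  obtain H G sh where "strip_diag \<A> \<R> \<Delta> (2 * pi) (ln 2) H G sh"
    using \<Delta>(2) annular_strip_diag unfolding annular_def by blast
  then interpret strip_diag \<A> \<R> \<Delta> "2 * pi" "ln 2" H G sh .
  show ?thesis
  proof (rule circ_in_T[OF act_bij_pl[OF X] strict_mono_flow_lift[OF diagrams_fbot[OF d]] _ flow_lift_add_one])
    fix t :: real
    have "frac t \<in> unit_ivl" using frac_ge_0[of t] frac_lt_1[of t] by simp
    then have "circ (act X) (circle_pt t) = circ (flow0 \<Delta>) (circle_pt t)"
      using act_eq[OF X \<Delta>(1)] by (simp add: circ_circle_pt)
    then show "circ (act X) (circle_pt t) = circle_pt (flow_lift t)"
      using circ_flow0_lift[OF diagrams_fbot[OF d]] by simp
  qed
qed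

end

lemma Bij_image: "f \<in> Bij I \<Longrightarrow> f ` I \<subseteq> I"
  by (auto simp: Bij_def bij_betw_def)

theorem proposition1p2:
  fixes \<A> :: "'a set" and \<R> :: "('a list \<times> 'a list) set" and w :: "'a list"
  assumes "semigroup_presentation \<A> \<R>"
    and "w \<in> lists \<A>" and "w \<noteq> []"
  shows "(\<forall>S. subgroup S (braided_diagram_group \<A> \<R> w) \<and>
              is_simple ((braided_diagram_group \<A> \<R> w)\<lparr>carrier := S\<rparr>) \<longrightarrow>
           (\<exists>K. subgroup K thompson_V \<and>
              (braided_diagram_group \<A> \<R> w)\<lparr>carrier := S\<rparr> \<cong> thompson_V\<lparr>carrier := K\<rparr>)) \<and>
         (\<forall>S. subgroup S (planar_diagram_group \<A> \<R> w) \<and>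
              is_simple ((planar_diagram_group \<A> \<R> w)\<lparr>carrier := S\<rparr>) \<longrightarrow>
           (\<exists>K. subgroup K thompson_F \<and>
              (planar_diagram_group \<A> \<R> w)\<lparr>carrier := S\<rparr> \<cong> thompson_F\<lparr>carrier := K\<rparr>)) \<and>
         (\<forall>S. subgroup S (annular_diagram_group \<A> \<R> w) \<and>
              is_simple ((annular_diagram_group \<A> \<R> w)\<lparr>carrier := S\<rparr>) \<longrightarrow>
           (\<exists>K. subgroup K thompson_T \<and>
              (annular_diagram_group \<A> \<R> w)\<lparr>carrier := S\<rparr> \<cong> thompson_T\<lparr>carrier := K\<rparr>))"
proof (intro conjI allI impI; elim conjE)
  interpret diagram_group \<A> \<R> w by unfold_locales fact+
  note circ = circ_inj circ_compose[OF Bij_image] and lift = closed_lift_inj closed_lift_compose[OF Bij_image]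
  fix S
  {
    assume S: "subgroup S DG" "is_simple (DG\<lparr>carrier := S\<rparr>)"
    have SD: "S \<subseteq> carrier DG" by (rule subgroup.subset[OF S(1)])
    show "\<exists>K. subgroup K thompson_V \<and> DG\<lparr>carrier := S\<rparr> \<cong> thompson_V\<lparr>carrier := K\<rparr>"
      unfolding thompson_V_def
    proof (rule simple_subgroup_iso[OF SD S(2) _ _ circ])
      show "circ (act X) \<in> V_maps" if "X \<in> S" for X using circ_in_V[OF act_bij_pl] that SD by blast
    qed (auto simp: V_maps_def)
  next
    assume S: "subgroup S (planar_diagram_group \<A> \<R> w)" "is_simple ((planar_diagram_group \<A> \<R> w)\<lparr>carrier := S\<rparr>)"
    \<comment> \<open>The planar group differs from the braided one in its carrier alone. Thus
      \<open>S\<close> is the same structure inside \<open>DG\<close>, where simple groups act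
      faithfully; planarity of representatives only decides where the action takes its
      values.\<close>
    have eq: "(planar_diagram_group \<A> \<R> w)\<lparr>carrier := S\<rparr> = DG\<lparr>carrier := S\<rparr>" by (simp add: planar_diagram_group_def)
    have SP: "X \<in> carrier DG \<and> (\<exists>\<Delta>\<in>X. planar \<Delta>)" if "X \<in> S" for X
      using subgroup.subset[OF S(1)] that by (auto simp: planar_diagram_group_def)
    show "\<exists>K. subgroup K thompson_F \<and> (planar_diagram_group \<A> \<R> w)\<lparr>carrier := S\<rparr> \<cong> thompson_F\<lparr>carrier := K\<rparr>"
      unfolding thompson_F_def eq
    proof (rule simple_subgroup_iso[OF _ S(2)[unfolded eq] _ _ lift])
      show "closed_lift (act X) \<in> F_maps" if "X \<in> S" for X using planar_act SP[OF that] by blast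
    qed (use SP in \<open>auto simp: F_maps_def\<close>)
  next
    assume S: "subgroup S (annular_diagram_group \<A> \<R> w)" "is_simple ((annular_diagram_group \<A> \<R> w)\<lparr>carrier := S\<rparr>)"
    have eq: "(annular_diagram_group \<A> \<R> w)\<lparr>carrier := S\<rparr> = DG\<lparr>carrier := S\<rparr>" by (simp add: annular_diagram_group_def)
    have SA: "X \<in> carrier DG \<and> (\<exists>\<Delta>\<in>X. annular \<Delta>)" if "X \<in> S" for X
      using subgroup.subset[OF S(1)] that by (auto simp: annular_diagram_group_def)
    show "\<exists>K. subgroup K thompson_T \<and> (annular_diagram_group \<A> \<R> w)\<lparr>carrier := S\<rparr> \<cong> thompson_T\<lparr>carrier := K\<rparr>"
      unfolding thompson_T_def eq
    proof (rule simple_subgroup_iso[OF _ S(2)[unfolded eq] _ _ circ])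
      show "circ (act X) \<in> T_maps" if "X \<in> S" for X using annular_act SA[OF that] by blast
    qed (use SA in \<open>auto simp: T_maps_def V_maps_def\<close>)
  }
qed

end
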